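(* Let $R=\bigoplus_{n\ge0}R_n$ be a finitely generated standard graded algebra over a Noetherian local ring $(R_0,\mathfrak n)$, let $\mathfrak m=\mathfrak n\oplus R_+$ be the maximal graded ideal of $R$, and let $M$ be a finitely generated graded $R$-module. Then $$\max\{a(H^i_{\mathfrak m}(M))\mid i\ge0\}=a^*(M).$$
   Context: Standard graded means $R$ is generated over $R_0$ by $R_1$; $R_+=\bigoplus_{n\ge1}R_n$. $H^i_{\mathfrak m}(M)$ and $H^i_{R_+}(M)$ are the graded local cohomology modules of $M$ with respect to $\mathfrak m$ and $R_+$. For a graded module $H$, $a(H)=\sup\{t\mid H_t\neq0\}$ with $a(0)=-\infty$. $a^*(M)=\max\{a(H^i_{R_+}(M))\mid i\ge0\}$. *)

theory Defs
  imports
    "HOL-Algebra.Ring_Divisibility"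
    "HOL-Algebra.Generated_Rings"
    "HOL-Algebra.Ideal_Product"
    "HOL-Algebra.Module"
    "HOL-Library.Extended_Real"
begin

section \<open>Graded rings and graded modules\<close>

record 'a gring = "'a ring" +
  ring_part :: "nat \<Rightarrow> 'a set"

record ('a, 'b) gmodule = "('a, 'b) module" +
  mod_part :: "int \<Rightarrow> 'b set"

definition direct_sum_of :: "('b, 'x) ring_scheme \<Rightarrow> ('i \<Rightarrow> 'b set) \<Rightarrow> bool" where
  "direct_sum_of G D \<longleftrightarrow>
     (\<forall>i. additive_subgroup (D i) G) \<and>
     (\<forall>x \<in> carrier G. \<exists>!f. (\<forall>i. f i \<in> D i) \<and> finite {i. f i \<noteq> \<zero>\<^bsub>G\<^esub>} \<and>
        x = finsum G f {i. f i \<noteq> \<zero>\<^bsub>G\<^esub>})"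

definition graded_ring :: "'a gring \<Rightarrow> bool" where
  "graded_ring R \<longleftrightarrow>
     cring R \<and> direct_sum_of R (ring_part R) \<and>
     (\<forall>m n. \<forall>a \<in> ring_part R m. \<forall>b \<in> ring_part R n. a \<otimes>\<^bsub>R\<^esub> b \<in> ring_part R (m + n))"

definition graded_module :: "'a gring \<Rightarrow> ('a, 'b) gmodule \<Rightarrow> bool" where
  "graded_module R M \<longleftrightarrow>
     module R M \<and> direct_sum_of M (mod_part M) \<and>
     (\<forall>n t. \<forall>a \<in> ring_part R n. \<forall>x \<in> mod_part M t.
        a \<odot>\<^bsub>M\<^esub> x \<in> mod_part M (int n + t))"

definition degree_zero_ring :: "'a gring \<Rightarrow> 'a gring" where
  "degree_zero_ring R = R\<lparr>carrier := ring_part R 0\<rparr>"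

definition noetherian_local_ring :: "('a, 'x) ring_scheme \<Rightarrow> 'a set \<Rightarrow> bool" where
  "noetherian_local_ring A \<nn> \<longleftrightarrow>
     cring A \<and> noetherian_ring A \<and> maximalideal \<nn> A \<and> (\<forall>J. maximalideal J A \<longrightarrow> J = \<nn>)"

definition fg_standard_graded :: "'a gring \<Rightarrow> bool" where
  "fg_standard_graded R \<longleftrightarrow>
     graded_ring R \<and>
     (\<exists>X. finite X \<and> X \<subseteq> carrier R \<and> generate_ring R (ring_part R 0 \<union> X) = carrier R) \<and>
     generate_ring R (ring_part R 0 \<union> ring_part R 1) = carrier R"

definition irrelevant_ideal :: "'a gring \<Rightarrow> 'a set" where
  "irrelevant_ideal R =
     {finsum R f F | f F. finite F \<and> F \<subseteq> {1..} \<and> (\<forall>n \<in> F. f n \<in> ring_part R n)}"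

definition fg_module :: "('a, 'x) ring_scheme \<Rightarrow> ('a, 'b, 'y) module_scheme \<Rightarrow> bool" where
  "fg_module R M \<longleftrightarrow>
     (\<exists>X. finite X \<and> X \<subseteq> carrier M \<and> (\<forall>N. submodule N R M \<and> X \<subseteq> N \<longrightarrow> N = carrier M))"

text \<open>Homogeneous homomorphisms of degree zero.\<close>

definition graded_hom ::
    "'a gring \<Rightarrow> ('a, 'b) gmodule \<Rightarrow> ('a, 'c) gmodule \<Rightarrow> ('b \<Rightarrow> 'c) \<Rightarrow> bool" where
  "graded_hom R M N f \<longleftrightarrow>
     f \<in> carrier M \<rightarrow> carrier N \<and>
     (\<forall>x \<in> carrier M. \<forall>y \<in> carrier M. f (x \<oplus>\<^bsub>M\<^esub> y) = f x \<oplus>\<^bsub>N\<^esub> f y) \<and>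
     (\<forall>a \<in> carrier R. \<forall>x \<in> carrier M. f (a \<odot>\<^bsub>M\<^esub> x) = a \<odot>\<^bsub>N\<^esub> f x) \<and>
     (\<forall>t. f ` mod_part M t \<subseteq> mod_part N t)"


section \<open>Graded local cohomology\<close>

text \<open>
  Injective objects of the category of graded modules and degree-zero homomorphisms.
  HOL definitions cannot quantify over types, so the test modules \<open>A\<close>, \<open>B\<close> are the graded modules
  whose elements lie in the type of the ring.  All shifts of \<open>R\<close> and all their graded submodules
  are among them, so by the graded form of Baer's criterion this is injectivity with respect to
  graded modules of arbitrary type.
\<close>

definition graded_injective :: "'a gring \<Rightarrow> ('a, 'c) gmodule \<Rightarrow> bool" where
  "graded_injective R E \<longleftrightarrow>
     graded_module R E \<and>
     (\<forall>(A :: ('a, 'a) gmodule) (B :: ('a, 'a) gmodule) \<iota> f.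
        graded_module R A \<and> graded_module R B \<and>
        graded_hom R A B \<iota> \<and> inj_on \<iota> (carrier A) \<and> graded_hom R A E f \<longrightarrow>
        (\<exists>g. graded_hom R B E g \<and> (\<forall>x \<in> carrier A. g (\<iota> x) = f x)))"

definition graded_injective_resolution ::
    "'a gring \<Rightarrow> ('a, 'b) gmodule \<Rightarrow> ('b \<Rightarrow> 'c) \<Rightarrow> (nat \<Rightarrow> ('a, 'c) gmodule) \<Rightarrow>
     (nat \<Rightarrow> 'c \<Rightarrow> 'c) \<Rightarrow> bool" where
  "graded_injective_resolution R M \<epsilon> E d \<longleftrightarrow>
     (\<forall>i. graded_injective R (E i)) \<and>
     graded_hom R M (E 0) \<epsilon> \<and> (\<forall>i. graded_hom R (E i) (E (Suc i)) (d i)) \<and>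
     inj_on \<epsilon> (carrier M) \<and>
     \<epsilon> ` carrier M = {x \<in> carrier (E 0). d 0 x = \<zero>\<^bsub>E 1\<^esub>} \<and>
     (\<forall>i. d i ` carrier (E i) =
          {x \<in> carrier (E (Suc i)). d (Suc i) x = \<zero>\<^bsub>E (Suc (Suc i))\<^esub>})"

text \<open>The functor \<open>\<Gamma>\<^sub>I\<close>; powers of ideals are taken in the monoid \<^term>\<open>ideals_set R\<close>.\<close>

definition torsion_part :: "'a gring \<Rightarrow> 'a set \<Rightarrow> ('a, 'b) gmodule \<Rightarrow> ('a, 'b) gmodule" where
  "torsion_part R I M =
     (let T = {x \<in> carrier M. \<exists>k :: nat. \<forall>a \<in> I [^]\<^bsub>ideals_set R\<^esub> k. a \<odot>\<^bsub>M\<^esub> x = \<zero>\<^bsub>M\<^esub>}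
      in M\<lparr>carrier := T, mod_part := (\<lambda>t. T \<inter> mod_part M t)\<rparr>)"

text \<open>
  The quotient of a graded module by a graded submodule, with cosets as elements.  The fields
  \<^const>\<open>mult\<close> and \<^const>\<open>one\<close>, inherited from the record type of rings, play no role in a module.
\<close>

definition quotient_gmodule :: "('a, 'b) gmodule \<Rightarrow> 'b set \<Rightarrow> ('a, 'b set) gmodule" where
  "quotient_gmodule M N =
     \<lparr>carrier = a_rcosets\<^bsub>M\<^esub> N, mult = undefined, one = undefined,
      zero = N, add = set_add M,
      smult = (\<lambda>a X. \<Union>x \<in> X. N +>\<^bsub>M\<^esub> (a \<odot>\<^bsub>M\<^esub> x)),
      mod_part = (\<lambda>t. (\<lambda>x. N +>\<^bsub>M\<^esub> x) ` mod_part M t)\<rparr>"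

definition cocycles ::
    "(nat \<Rightarrow> ('a, 'c) gmodule) \<Rightarrow> (nat \<Rightarrow> 'c \<Rightarrow> 'c) \<Rightarrow> nat \<Rightarrow> ('a, 'c) gmodule" where
  "cocycles C d i =
     (let Z = {x \<in> carrier (C i). d i x = \<zero>\<^bsub>C (Suc i)\<^esub>}
      in (C i)\<lparr>carrier := Z, mod_part := (\<lambda>t. Z \<inter> mod_part (C i) t)\<rparr>)"

definition coboundaries ::
    "(nat \<Rightarrow> ('a, 'c) gmodule) \<Rightarrow> (nat \<Rightarrow> 'c \<Rightarrow> 'c) \<Rightarrow> nat \<Rightarrow> 'c set" where
  "coboundaries C d i =
     (case i of 0 \<Rightarrow> {\<zero>\<^bsub>C 0\<^esub>} | Suc j \<Rightarrow> d j ` carrier (C j))"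

definition cohomology ::
    "(nat \<Rightarrow> ('a, 'c) gmodule) \<Rightarrow> (nat \<Rightarrow> 'c \<Rightarrow> 'c) \<Rightarrow> nat \<Rightarrow> ('a, 'c set) gmodule" where
  "cohomology C d i = quotient_gmodule (cocycles C d i) (coboundaries C d i)"

text \<open>
  The right derived functors of \<open>\<Gamma>\<^sub>I\<close> on graded modules: \<open>H\<^sup>i\<^sub>I(M)\<close> is computed from a graded
  injective resolution \<open>(E, d)\<close> of \<open>M\<close>.
\<close>

definition local_cohomology ::
    "'a gring \<Rightarrow> 'a set \<Rightarrow> (nat \<Rightarrow> ('a, 'c) gmodule) \<Rightarrow> (nat \<Rightarrow> 'c \<Rightarrow> 'c) \<Rightarrow> nat \<Rightarrow>
     ('a, 'c set) gmodule" where
  "local_cohomology R I E d i = cohomology (\<lambda>j. torsion_part R I (E j)) d i"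

text \<open>In \<^typ>\<open>ereal\<close> the supremum of the empty set is \<open>-\<infinity>\<close>, which gives \<open>a(0) = -\<infinity>\<close>.\<close>

definition a_invariant :: "('a, 'b) gmodule \<Rightarrow> ereal" where
  "a_invariant H = Sup {ereal (real_of_int t) | t. mod_part H t \<noteq> {\<zero>\<^bsub>H\<^esub>}}"

text \<open>\<open>a\<^sup>*(M)\<close>, for a graded module \<open>M\<close> with graded injective resolution \<open>(E, d)\<close>.\<close>

definition a_star ::
    "'a gring \<Rightarrow> (nat \<Rightarrow> ('a, 'c) gmodule) \<Rightarrow> (nat \<Rightarrow> 'c \<Rightarrow> 'c) \<Rightarrow> ereal" where
  "a_star R E d =
     (GREATEST v. v \<in> range (\<lambda>i. a_invariant (local_cohomology R (irrelevant_ideal R) E d i)))"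

end

theory Submission
  imports Defs
begin

text \<open>
  Let \<open>xs\<close> generate \<open>R\<^sub>1\<close> over \<open>R\<^sub>0\<close>, let \<open>ys\<close> generate \<open>\<nn>\<close>, and write \<open>K(zs; C)\<close> for the
  Koszul complex of \<open>zs\<close> on a complex \<open>C\<close>, built by iterated mapping cones.
  If every element of \<open>C\<close> is killed by a power of \<open>x\<close>, the long exact sequence of the cone of
  multiplication by \<open>x\<close> shows that \<open>C\<close> is acyclic in all degrees \<open>\<ge> t\<close> iff the cone is acyclic in
  all degrees \<open>\<ge> t + deg x\<close>.  If \<open>E\<close> is graded injective, \<open>x\<close> acts bijectively on \<open>E / \<Gamma>\<^sub>x E\<close> and
  \<open>\<Gamma>\<^sub>x E\<close> is again graded injective, so \<open>K(zs; \<Gamma>\<^sub>I E)\<close>, \<open>K(zs; E)\<close> and \<open>K(zs; M)\<close> are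
  quasi-isomorphic as long as \<open>zs\<close> contains generators of \<open>I\<close>.  Hence the largest degree in which
  some \<open>H\<^sup>i\<^sub>\<mm>(M)\<close>, respectively some \<open>H\<^sup>i\<close> of \<open>\<Gamma>\<close> at \<open>R\<^sub>+\<close>, is nonzero can be read off from
  \<open>K(xs, ys; M)\<close>, respectively \<open>K(xs; M)\<close>, with the same shift.  Since \<open>K(xs; M)\<close> has finitely
  generated cohomology over the local ring \<open>R\<^sub>0\<close>, Nakayama's lemma says that coning off \<open>ys \<subseteq> \<nn>\<close>
  does not change the degrees in which the cohomology vanishes.  Finally \<open>xs\<close> acts nilpotently on the
  cohomology of \<open>K(xs; M)\<close>, which is therefore zero in high degrees.
  The cohomological index plays no role, so complexes are treated as modules with a differential
  \<open>D\<close>, \<open>D\<^sup>2 = 0\<close>; and all finiteness enters through ascending chains of graded subfamilies.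
\<close>

section \<open>Graded families of subgroups and the ascending chain condition\<close>

text \<open>The obstacle is finiteness: local cohomology modules are in general not finitely
  generated, so Nakayama's lemma cannot be applied to them. Koszul complexes of \<open>M\<close> are
  finitely generated, but they lose the individual degrees: torsion lets vanishing pass between a
  complex and a cone only for all degrees above a threshold at once. That is why every transfer is
  an equivalence about rays \<open>t \<ge> t0\<close>, and why the result concerns the largest
  nonvanishing degree over all \<open>i\<close> and not single modules. Elements of degree 0 do not
  move the threshold, so adjoining generators of \<open>\<nn>\<close> leaves the shift equal to the
  length of \<open>xs\<close>. The torsion complexes, \<open>E\<close> and \<open>M\<close> are all
  realised as families of subsets of one ambient module with one differential; a quasi-isomorphism
  is then an inclusion with acyclic quotient, expressed by representatives. Injectivity is used only
  in Baer's form, written with graphs of partial homomorphisms, because this form passes to torsion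
  parts.\<close>

text \<open>
  A graded submodule is represented by its homogeneous parts \<open>S t\<close>; the ring enters only through
  its generators, \<open>A\<close> acting in degree 0 and \<open>X\<close> in degree 1.
\<close>

definition graded_family ::
    "'a set \<Rightarrow> 'a set \<Rightarrow> ('a, 'b, 'x) module_scheme \<Rightarrow> (int \<Rightarrow> 'b set) \<Rightarrow> bool" where
  "graded_family A X G S \<longleftrightarrow>
     (\<forall>t. S t \<subseteq> carrier G \<and> \<zero>\<^bsub>G\<^esub> \<in> S t \<and> (\<forall>a \<in> S t. \<forall>b \<in> S t. a \<oplus>\<^bsub>G\<^esub> b \<in> S t) \<and>
        (\<forall>r \<in> A. \<forall>a \<in> S t. r \<odot>\<^bsub>G\<^esub> a \<in> S t) \<and> (\<forall>x \<in> X. \<forall>a \<in> S t. x \<odot>\<^bsub>G\<^esub> a \<in> S (t + 1)))"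

lemma graded_familyI:
  assumes "\<And>t a. a \<in> S t \<Longrightarrow> a \<in> carrier G" "\<And>t. \<zero>\<^bsub>G\<^esub> \<in> S t"
    "\<And>t a b. a \<in> S t \<Longrightarrow> b \<in> S t \<Longrightarrow> a \<oplus>\<^bsub>G\<^esub> b \<in> S t"
    "\<And>t r a. r \<in> A \<Longrightarrow> a \<in> S t \<Longrightarrow> r \<odot>\<^bsub>G\<^esub> a \<in> S t"
    "\<And>t x a. x \<in> X \<Longrightarrow> a \<in> S t \<Longrightarrow> x \<odot>\<^bsub>G\<^esub> a \<in> S (t + 1)"
  shows "graded_family A X G S"
  using assms unfolding graded_family_def by blast

lemma graded_familyD:
  assumes "graded_family A X G S"
  shows "\<And>t a. a \<in> S t \<Longrightarrow> a \<in> carrier G" "\<And>t. \<zero>\<^bsub>G\<^esub> \<in> S t"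
    "\<And>t a b. a \<in> S t \<Longrightarrow> b \<in> S t \<Longrightarrow> a \<oplus>\<^bsub>G\<^esub> b \<in> S t"
    "\<And>t r a. r \<in> A \<Longrightarrow> a \<in> S t \<Longrightarrow> r \<odot>\<^bsub>G\<^esub> a \<in> S t"
    "\<And>t x a. x \<in> X \<Longrightarrow> a \<in> S t \<Longrightarrow> x \<odot>\<^bsub>G\<^esub> a \<in> S (t + 1)"
  using assms unfolding graded_family_def by blast+

definition acc ::
    "'a set \<Rightarrow> 'a set \<Rightarrow> ('a, 'b, 'x) module_scheme \<Rightarrow> (int \<Rightarrow> 'b set) \<Rightarrow> bool" where
  "acc A X G S \<longleftrightarrow>
     (\<forall>Z :: nat \<Rightarrow> int \<Rightarrow> 'b set. (\<forall>n. graded_family A X G (Z n) \<and> Z n \<le> S) \<and> mono Z \<longrightarrow>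
        (\<exists>N. \<forall>n \<ge> N. Z n = Z N))"

lemma accD:
  assumes "acc A X G S" "\<And>n. graded_family A X G (Z n)" "\<And>n. Z n \<le> S" "\<And>n. Z n \<le> Z (Suc n)"
  obtains N where "\<And>n. n \<ge> N \<Longrightarrow> Z n = Z N"
proof -
  have "mono Z" using assms(4) by (simp add: mono_iff_le_Suc)
  with assms show thesis using that unfolding acc_def by blast
qed

lemma acc_subset: "acc A X G S \<Longrightarrow> S' \<le> S \<Longrightarrow> acc A X G S'"
  unfolding acc_def by (meson order_trans)

text \<open>The pattern is that a module is noetherian as soon as a submodule and the quotient by it
  are: \<open>f1\<close> plays the intersection with the submodule, \<open>f2\<close> the image in
  the quotient. Injectivity is asked only for nested pairs, which is all a chain provides, and the
  targets have their own types so that one of them may be the ring acting on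
  \<open>G\<close>.\<close>

lemma acc_joint:
  fixes G :: "('a, 'b, 'x) module_scheme"
    and G1 :: "('a, 'b1, 'x1) module_scheme" and G2 :: "('a, 'b2, 'x2) module_scheme"
  assumes acc1: "acc A X1 G1 S1" and acc2: "acc A X2 G2 S2"
    and f1: "\<And>Z. graded_family A X G Z \<Longrightarrow> Z \<le> S \<Longrightarrow> graded_family A X1 G1 (f1 Z) \<and> f1 Z \<le> S1"
    and f2: "\<And>Z. graded_family A X G Z \<Longrightarrow> Z \<le> S \<Longrightarrow> graded_family A X2 G2 (f2 Z) \<and> f2 Z \<le> S2"
    and m1: "\<And>Z Z'. Z \<le> Z' \<Longrightarrow> f1 Z \<le> f1 Z'" and m2: "\<And>Z Z'. Z \<le> Z' \<Longrightarrow> f2 Z \<le> f2 Z'"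
    and inj: "\<And>Z Z'. graded_family A X G Z \<Longrightarrow> graded_family A X G Z' \<Longrightarrow> Z \<le> Z' \<Longrightarrow> Z' \<le> S \<Longrightarrow>
       f1 Z = f1 Z' \<Longrightarrow> f2 Z = f2 Z' \<Longrightarrow> Z' \<le> Z"
  shows "acc A X G S"
  unfolding acc_def
proof (intro allI impI)
  fix Z :: "nat \<Rightarrow> int \<Rightarrow> 'b set"
  assume Z: "(\<forall>n. graded_family A X G (Z n) \<and> Z n \<le> S) \<and> mono Z"
  then have le: "Z m \<le> Z n" if "m \<le> n" for m n using that by (simp add: monoD)
  obtain N1 where N1: "\<And>n. n \<ge> N1 \<Longrightarrow> f1 (Z n) = f1 (Z N1)"
    using accD[OF acc1, of "\<lambda>n. f1 (Z n)"] f1 m1 le Z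
    by (metis Suc_n_not_le_n nat_le_linear)
  obtain N2 where N2: "\<And>n. n \<ge> N2 \<Longrightarrow> f2 (Z n) = f2 (Z N2)"
    using accD[OF acc2, of "\<lambda>n. f2 (Z n)"] f2 m2 le Z
    by (metis Suc_n_not_le_n nat_le_linear)
  have "Z n = Z (max N1 N2)" if n: "n \<ge> max N1 N2" for n
  proof (rule antisym)
    show "Z n \<le> Z (max N1 N2)"
      using inj[of "Z (max N1 N2)" "Z n"] Z le[OF n] N1[of n] N1[of "max N1 N2"]
        N2[of n] N2[of "max N1 N2"] n by auto
  qed (use le n in auto)
  then show "\<exists>N. \<forall>n \<ge> N. Z n = Z N" by blast
qed

locale operators = cring R for R (structure) +
  fixes A :: "'a set"
  assumes A_subring: "subring A R"
begin

lemma A_carrier: "r \<in> A \<Longrightarrow> r \<in> carrier R"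
  using subringE(1)[OF A_subring] by blast

lemma one_A: "\<one> \<in> A" and zero_A: "\<zero> \<in> A" and minus_A: "r \<in> A \<Longrightarrow> \<ominus> r \<in> A"
  using subringE[OF A_subring] by auto

text \<open>The inverse is multiplication by \<open>\<ominus> \<one>\<close>, an element of
  \<open>A\<close>; this is why the closure conditions of \<open>graded_family\<close> do not list
  inverses.\<close>

lemma family_minus:
  assumes "module R G" "graded_family A X G S" "a \<in> S t"
  shows "\<ominus>\<^bsub>G\<^esub> a \<in> S t"
proof -
  interpret G: module R G by fact
  have "a \<in> carrier G" using graded_familyD(1)[OF assms(2,3)] .
  then have "\<ominus>\<^bsub>G\<^esub> a = (\<ominus> \<one>) \<odot>\<^bsub>G\<^esub> a" by (simp add: G.smult_l_minus)
  then show ?thesis using graded_familyD(4)[OF assms(2) minus_A[OF one_A] assms(3)] by simp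
qed

lemma family_diff:
  assumes "module R G" "graded_family A X G S" "a \<in> S t" "b \<in> S t"
  shows "a \<ominus>\<^bsub>G\<^esub> b \<in> S t"
  unfolding a_minus_def using graded_familyD(3)[OF assms(2,3) family_minus[OF assms(1,2,4)]] .

lemma family_diff_cancel:
  assumes "module R G" "graded_family A X G S" "a \<ominus>\<^bsub>G\<^esub> b \<in> S t" "b \<in> S t" "a \<in> carrier G"
  shows "a \<in> S t"
proof -
  interpret G: module R G by fact
  have b: "b \<in> carrier G" using graded_familyD(1)[OF assms(2,4)] .
  have "(a \<ominus>\<^bsub>G\<^esub> b) \<oplus>\<^bsub>G\<^esub> b = a"
    using b assms(5) by (simp add: a_minus_def G.M.a_assoc G.M.l_neg)
  then show ?thesis using graded_familyD(3)[OF assms(2,3,4)] by simp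
qed

end

section \<open>Hilbert's basis theorem for graded families\<close>

primrec polys_below ::
    "('a, 'x) ring_scheme \<Rightarrow> ('a, 'b, 'y) module_scheme \<Rightarrow> 'a \<Rightarrow> (int \<Rightarrow> 'b set) \<Rightarrow> nat \<Rightarrow> int \<Rightarrow> 'b set" where
  "polys_below R G x S 0 t = {\<zero>\<^bsub>G\<^esub>}"
| "polys_below R G x S (Suc j) t =
     {u \<oplus>\<^bsub>G\<^esub> (x [^]\<^bsub>R\<^esub> j) \<odot>\<^bsub>G\<^esub> s | u s. u \<in> polys_below R G x S j t \<and> s \<in> S (t - int j)}"

text \<open>Elements of \<open>polys_below\<close> are values of polynomials in \<open>x\<close>
  with coefficients in \<open>S\<close>, not formal polynomials, so the value does not determine the
  coefficients. A leading coefficient is therefore any \<open>s\<close> for which some choice of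
  lower terms completes \<open>x\<^sup>j s\<close> to an element of \<open>Z\<close>; its degree
  \<open>t\<close> lies \<open>j\<close> below that of the polynomial.\<close>

definition leading_coefficients ::
    "('a, 'x) ring_scheme \<Rightarrow> ('a, 'b, 'y) module_scheme \<Rightarrow> 'a \<Rightarrow> (int \<Rightarrow> 'b set) \<Rightarrow> nat \<Rightarrow>
      (int \<Rightarrow> 'b set) \<Rightarrow> int \<Rightarrow> 'b set" where
  "leading_coefficients R G x S j Z t =
     {s \<in> S t. \<exists>u \<in> polys_below R G x S j (t + int j).
        u \<oplus>\<^bsub>G\<^esub> (x [^]\<^bsub>R\<^esub> j) \<odot>\<^bsub>G\<^esub> s \<in> Z (t + int j)}"

context operators
begin

context
  fixes G :: "('a, 'c, 'y) module_scheme" and X :: "'a set" and x :: 'a and S :: "int \<Rightarrow> 'c set"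
  assumes G: "module R G" and X: "X \<subseteq> carrier R" and x: "x \<in> carrier R"
    and S: "graded_family A X G S"
begin

interpretation G: module R G by (rule G)

lemma S_carrier: "s \<in> S t \<Longrightarrow> s \<in> carrier G" using graded_familyD(1)[OF S] .

lemma family_polys_below: "graded_family A X G (polys_below R G x S j)"
proof (induction j)
  case 0
  then show ?case using X A_carrier by (intro graded_familyI) auto
next
  case (Suc j)
  note QD = graded_familyD[OF Suc] and S' = graded_familyD[OF S]
  show ?case
  proof (intro graded_familyI)
    fix t a assume "a \<in> polys_below R G x S (Suc j) t"
    then show "a \<in> carrier G" using QD(1) S'(1) x by fastforce
  next
    fix t show "\<zero>\<^bsub>G\<^esub> \<in> polys_below R G x S (Suc j) t"
      using QD(2)[of t] S'(2)[of "t - int j"] x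
      by (auto intro!: exI[of _ "\<zero>\<^bsub>G\<^esub>"])
  next
    fix t a b assume "a \<in> polys_below R G x S (Suc j) t" "b \<in> polys_below R G x S (Suc j) t"
    then obtain u s u' s' where a: "a = u \<oplus>\<^bsub>G\<^esub> (x [^] j) \<odot>\<^bsub>G\<^esub> s" "u \<in> polys_below R G x S j t" "s \<in> S (t - int j)"
      and b: "b = u' \<oplus>\<^bsub>G\<^esub> (x [^] j) \<odot>\<^bsub>G\<^esub> s'" "u' \<in> polys_below R G x S j t" "s' \<in> S (t - int j)" by auto
    have "a \<oplus>\<^bsub>G\<^esub> b = (u \<oplus>\<^bsub>G\<^esub> u') \<oplus>\<^bsub>G\<^esub> (x [^] j) \<odot>\<^bsub>G\<^esub> (s \<oplus>\<^bsub>G\<^esub> s')"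
      using a b QD(1) S'(1) x by (simp add: G.smult_r_distr G.M.a_ac)
    moreover have "u \<oplus>\<^bsub>G\<^esub> u' \<in> polys_below R G x S j t" "s \<oplus>\<^bsub>G\<^esub> s' \<in> S (t - int j)" using a b QD(3) S'(3) by auto
    ultimately show "a \<oplus>\<^bsub>G\<^esub> b \<in> polys_below R G x S (Suc j) t" unfolding polys_below.simps by blast
  next
    fix t r a assume r: "r \<in> A" and "a \<in> polys_below R G x S (Suc j) t"
    then obtain u s where a: "a = u \<oplus>\<^bsub>G\<^esub> (x [^] j) \<odot>\<^bsub>G\<^esub> s" "u \<in> polys_below R G x S j t" "s \<in> S (t - int j)" by auto
    have "r \<odot>\<^bsub>G\<^esub> a = r \<odot>\<^bsub>G\<^esub> u \<oplus>\<^bsub>G\<^esub> (x [^] j) \<odot>\<^bsub>G\<^esub> (r \<odot>\<^bsub>G\<^esub> s)"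
      using a QD(1) S'(1) x A_carrier[OF r]
      by (simp add: G.smult_r_distr G.smult_assoc1[symmetric] m_comm)
    with QD(4)[OF r a(2)] S'(4)[OF r a(3)] show "r \<odot>\<^bsub>G\<^esub> a \<in> polys_below R G x S (Suc j) t"
      unfolding polys_below.simps by blast
  next
    fix t r a assume r: "r \<in> X" and "a \<in> polys_below R G x S (Suc j) t"
    then obtain u s where a: "a = u \<oplus>\<^bsub>G\<^esub> (x [^] j) \<odot>\<^bsub>G\<^esub> s" "u \<in> polys_below R G x S j t" "s \<in> S (t - int j)" by auto
    have "r \<odot>\<^bsub>G\<^esub> a = r \<odot>\<^bsub>G\<^esub> u \<oplus>\<^bsub>G\<^esub> (x [^] j) \<odot>\<^bsub>G\<^esub> (r \<odot>\<^bsub>G\<^esub> s)"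
      using a QD(1) S'(1) x r X
      by (simp add: G.smult_r_distr G.smult_assoc1[symmetric] m_comm subset_eq)
    moreover have "r \<odot>\<^bsub>G\<^esub> s \<in> S (t + 1 - int j)"
      using S'(5)[OF r a(3)] by (simp add: algebra_simps)
    ultimately show "r \<odot>\<^bsub>G\<^esub> a \<in> polys_below R G x S (Suc j) (t + 1)"
      using QD(5)[OF r a(2)] unfolding polys_below.simps by blast
  qed
qed

lemmas polys_belowD = graded_familyD[OF family_polys_below]

lemma polys_below_Suc: "polys_below R G x S j t \<subseteq> polys_below R G x S (Suc j) t"
proof
  fix u assume u: "u \<in> polys_below R G x S j t"
  moreover have "u = u \<oplus>\<^bsub>G\<^esub> (x [^] j) \<odot>\<^bsub>G\<^esub> \<zero>\<^bsub>G\<^esub>" using x polys_belowD(1)[OF u] by simp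
  ultimately show "u \<in> polys_below R G x S (Suc j) t" using graded_familyD(2)[OF S] by fastforce
qed

lemma polys_below_mono: "i \<le> j \<Longrightarrow> polys_below R G x S i t \<subseteq> polys_below R G x S j t"
  by (rule lift_Suc_mono_le[of "\<lambda>j. polys_below R G x S j t"]) (use polys_below_Suc in auto)

lemma smult_polys_below: "u \<in> polys_below R G x S j t \<Longrightarrow> x \<odot>\<^bsub>G\<^esub> u \<in> polys_below R G x S (Suc j) (t + 1)"
proof (induction j arbitrary: u)
  case 0
  then show ?case using x polys_belowD(2)[of "Suc 0" "t + 1"] by simp
next
  case (Suc j)
  then obtain v s where u: "u = v \<oplus>\<^bsub>G\<^esub> (x [^] j) \<odot>\<^bsub>G\<^esub> s" "v \<in> polys_below R G x S j t" "s \<in> S (t - int j)" by auto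
  have "x \<odot>\<^bsub>G\<^esub> u = x \<odot>\<^bsub>G\<^esub> v \<oplus>\<^bsub>G\<^esub> (x [^] Suc j) \<odot>\<^bsub>G\<^esub> s"
    using u polys_belowD(1) S_carrier x
    by (simp add: G.smult_r_distr G.smult_assoc1[symmetric] m_comm)
  moreover have "s \<in> S (t + 1 - int (Suc j))" using u(3) by simp
  ultimately show ?case using Suc.IH[OF u(2)] unfolding polys_below.simps(2)[of _ _ _ _ "Suc j"] by blast
qed

lemma family_polynomials: "graded_family A (insert x X) G (\<lambda>t. \<Union>j. polys_below R G x S j t)"
proof (intro graded_familyI)
  fix t a b assume "a \<in> (\<Union>j. polys_below R G x S j t)" "b \<in> (\<Union>j. polys_below R G x S j t)"
  then obtain i j where ij: "a \<in> polys_below R G x S i t" "b \<in> polys_below R G x S j t" by auto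
  then have "a \<in> polys_below R G x S (max i j) t" "b \<in> polys_below R G x S (max i j) t"
    using polys_below_mono[of i "max i j" t] polys_below_mono[of j "max i j" t] by auto
  then show "a \<oplus>\<^bsub>G\<^esub> b \<in> (\<Union>j. polys_below R G x S j t)" using polys_belowD(3)[of a _ t b] by blast
next
  fix t r a assume "r \<in> insert x X" "a \<in> (\<Union>j. polys_below R G x S j t)"
  then show "r \<odot>\<^bsub>G\<^esub> a \<in> (\<Union>j. polys_below R G x S j (t + 1))"
    using polys_belowD(5)[of r a _ t] smult_polys_below[of a _ t] by blast
next
  fix t a assume "a \<in> (\<Union>j. polys_below R G x S j t)"
  then show "a \<in> carrier G" using polys_belowD(1)[of a _ t] by blast
next
  fix t show "\<zero>\<^bsub>G\<^esub> \<in> (\<Union>j. polys_below R G x S j t)" using polys_belowD(2)[of 0 t] by blast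
next
  fix t r a assume "r \<in> A" "a \<in> (\<Union>j. polys_below R G x S j t)"
  then show "r \<odot>\<^bsub>G\<^esub> a \<in> (\<Union>j. polys_below R G x S j t)" using polys_belowD(4)[of r a _ t] by blast
qed

lemma family_leading_coefficients:
  assumes Z: "graded_family A (insert x X) G Z"
  shows "graded_family A X G (leading_coefficients R G x S j Z)"
proof -
  note ZD = graded_familyD[OF Z] and SD = graded_familyD[OF S]
  show ?thesis
  proof (intro graded_familyI)
    fix t a assume "a \<in> leading_coefficients R G x S j Z t"
    then show "a \<in> carrier G" using S_carrier by (auto simp: leading_coefficients_def)
  next
    fix t show "\<zero>\<^bsub>G\<^esub> \<in> leading_coefficients R G x S j Z t"
      using SD(2) polys_belowD(2) ZD(2) x
      by (auto simp: leading_coefficients_def intro!: bexI[of _ "\<zero>\<^bsub>G\<^esub>"])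
  next
    fix t a b assume "a \<in> leading_coefficients R G x S j Z t" "b \<in> leading_coefficients R G x S j Z t"
    then obtain u v where a: "a \<in> S t" "u \<in> polys_below R G x S j (t + int j)" "u \<oplus>\<^bsub>G\<^esub> (x [^] j) \<odot>\<^bsub>G\<^esub> a \<in> Z (t + int j)"
      and b: "b \<in> S t" "v \<in> polys_below R G x S j (t + int j)" "v \<oplus>\<^bsub>G\<^esub> (x [^] j) \<odot>\<^bsub>G\<^esub> b \<in> Z (t + int j)"
      by (auto simp: leading_coefficients_def)
    have "(u \<oplus>\<^bsub>G\<^esub> v) \<oplus>\<^bsub>G\<^esub> (x [^] j) \<odot>\<^bsub>G\<^esub> (a \<oplus>\<^bsub>G\<^esub> b)
        = (u \<oplus>\<^bsub>G\<^esub> (x [^] j) \<odot>\<^bsub>G\<^esub> a) \<oplus>\<^bsub>G\<^esub> (v \<oplus>\<^bsub>G\<^esub> (x [^] j) \<odot>\<^bsub>G\<^esub> b)"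
      using a b polys_belowD(1) S_carrier x by (simp add: G.smult_r_distr G.M.a_ac)
    then show "a \<oplus>\<^bsub>G\<^esub> b \<in> leading_coefficients R G x S j Z t"
      using ZD(3)[OF a(3) b(3)] SD(3)[OF a(1) b(1)] polys_belowD(3)[OF a(2) b(2)]
      by (auto simp: leading_coefficients_def intro!: bexI[of _ "u \<oplus>\<^bsub>G\<^esub> v"])
  next
    fix t r a assume r: "r \<in> A" and "a \<in> leading_coefficients R G x S j Z t"
    then obtain u where a: "a \<in> S t" "u \<in> polys_below R G x S j (t + int j)" "u \<oplus>\<^bsub>G\<^esub> (x [^] j) \<odot>\<^bsub>G\<^esub> a \<in> Z (t + int j)"
      by (auto simp: leading_coefficients_def)
    have "r \<odot>\<^bsub>G\<^esub> (u \<oplus>\<^bsub>G\<^esub> (x [^] j) \<odot>\<^bsub>G\<^esub> a) = r \<odot>\<^bsub>G\<^esub> u \<oplus>\<^bsub>G\<^esub> (x [^] j) \<odot>\<^bsub>G\<^esub> (r \<odot>\<^bsub>G\<^esub> a)"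
      using a polys_belowD(1) S_carrier x A_carrier[OF r]
      by (simp add: G.smult_r_distr G.smult_assoc1[symmetric] m_comm)
    then show "r \<odot>\<^bsub>G\<^esub> a \<in> leading_coefficients R G x S j Z t"
      using ZD(4)[OF r a(3)] SD(4)[OF r a(1)] polys_belowD(4)[OF r a(2)]
      by (auto simp: leading_coefficients_def intro!: bexI[of _ "r \<odot>\<^bsub>G\<^esub> u"])
  next
    fix t r a assume r: "r \<in> X" and "a \<in> leading_coefficients R G x S j Z t"
    then obtain u where a: "a \<in> S t" "u \<in> polys_below R G x S j (t + int j)" "u \<oplus>\<^bsub>G\<^esub> (x [^] j) \<odot>\<^bsub>G\<^esub> a \<in> Z (t + int j)"
      by (auto simp: leading_coefficients_def)
    have "r \<odot>\<^bsub>G\<^esub> (u \<oplus>\<^bsub>G\<^esub> (x [^] j) \<odot>\<^bsub>G\<^esub> a) = r \<odot>\<^bsub>G\<^esub> u \<oplus>\<^bsub>G\<^esub> (x [^] j) \<odot>\<^bsub>G\<^esub> (r \<odot>\<^bsub>G\<^esub> a)"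
      using a polys_belowD(1) S_carrier x r X
      by (simp add: G.smult_r_distr G.smult_assoc1[symmetric] m_comm subset_eq)
    moreover have e: "t + int j + 1 = t + 1 + int j" by simp
    moreover note ZD(5)[OF _ a(3), of r, unfolded e] SD(5)[OF r a(1)] polys_belowD(5)[OF r a(2), unfolded e]
    ultimately show "r \<odot>\<^bsub>G\<^esub> a \<in> leading_coefficients R G x S j Z (t + 1)"
      using r by (auto simp: leading_coefficients_def intro!: bexI[of _ "r \<odot>\<^bsub>G\<^esub> u"])
  qed
qed

text \<open>Multiplying by \<open>x\<close> keeps the leading coefficient and raises its exponent;
  closure of the larger family under the new operator \<open>x\<close> enters here.\<close>

lemma leading_coefficients_mono:
  assumes Z: "graded_family A (insert x X) G Z'" and ij: "i \<le> j" and ZZ: "Z \<le> Z'"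
  shows "leading_coefficients R G x S i Z \<le> leading_coefficients R G x S j Z'"
proof -
  have *: "leading_coefficients R G x S j Z' \<le> leading_coefficients R G x S (Suc j) Z'" for j
  proof (rule le_funI, rule subsetI)
    fix t a assume "a \<in> leading_coefficients R G x S j Z' t"
    then obtain u where a: "a \<in> S t" "u \<in> polys_below R G x S j (t + int j)" "u \<oplus>\<^bsub>G\<^esub> (x [^] j) \<odot>\<^bsub>G\<^esub> a \<in> Z' (t + int j)"
      by (auto simp: leading_coefficients_def)
    have "x \<odot>\<^bsub>G\<^esub> (u \<oplus>\<^bsub>G\<^esub> (x [^] j) \<odot>\<^bsub>G\<^esub> a) = x \<odot>\<^bsub>G\<^esub> u \<oplus>\<^bsub>G\<^esub> (x [^] Suc j) \<odot>\<^bsub>G\<^esub> a"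
      using a polys_belowD(1) S_carrier x
      by (simp add: G.smult_r_distr G.smult_assoc1[symmetric] m_comm)
    moreover have "x \<odot>\<^bsub>G\<^esub> (u \<oplus>\<^bsub>G\<^esub> (x [^] j) \<odot>\<^bsub>G\<^esub> a) \<in> Z' (t + int (Suc j))"
      using graded_familyD(5)[OF Z _ a(3), of x] by (simp add: algebra_simps)
    moreover have "x \<odot>\<^bsub>G\<^esub> u \<in> polys_below R G x S (Suc j) (t + int (Suc j))"
      using smult_polys_below[OF a(2)] by (simp add: algebra_simps)
    ultimately show "a \<in> leading_coefficients R G x S (Suc j) Z' t"
      using a(1) unfolding leading_coefficients_def by auto
  qed
  have "leading_coefficients R G x S i Z \<le> leading_coefficients R G x S i Z'"
    using ZZ by (auto simp: le_fun_def leading_coefficients_def)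
  also have "\<dots> \<le> leading_coefficients R G x S j Z'"
    by (rule lift_Suc_mono_le[of "\<lambda>j. leading_coefficients R G x S j Z'"]) (use * ij in auto)
  finally show ?thesis .
qed

text \<open>An element of \<open>Z'\<close> and an element of \<open>Z\<close> with the same leading
  coefficient differ by a shorter polynomial, which again lies in \<open>Z'\<close>; induction on
  the length puts the difference into \<open>Z\<close>.\<close>

lemma leading_coefficients_determine:
  assumes Z: "graded_family A (insert x X) G Z" and Z': "graded_family A (insert x X) G Z'"
    and ZZ: "Z \<le> Z'" and Zsub: "Z' \<le> (\<lambda>t. \<Union>j. polys_below R G x S j t)"
    and eq: "\<And>j. leading_coefficients R G x S j Z = leading_coefficients R G x S j Z'"
  shows "Z' = Z"
proof -
  have *: "z \<in> Z' t \<Longrightarrow> z \<in> polys_below R G x S j t \<Longrightarrow> z \<in> Z t" for j z t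
  proof (induction j arbitrary: z)
    case 0
    then show ?case using graded_familyD(2)[OF Z] by simp
  next
    case (Suc j)
    then obtain u s where z: "z = u \<oplus>\<^bsub>G\<^esub> (x [^] j) \<odot>\<^bsub>G\<^esub> s" "u \<in> polys_below R G x S j t" "s \<in> S (t - int j)" by auto
    then have "s \<in> leading_coefficients R G x S j Z' (t - int j)"
      using Suc.prems(1) by (auto simp: leading_coefficients_def)
    then have "s \<in> leading_coefficients R G x S j Z (t - int j)" using eq by simp
    then obtain v where v: "v \<in> polys_below R G x S j t" "v \<oplus>\<^bsub>G\<^esub> (x [^] j) \<odot>\<^bsub>G\<^esub> s \<in> Z t"
      by (auto simp: leading_coefficients_def)
    have c: "u \<in> carrier G" "v \<in> carrier G" "(x [^] j) \<odot>\<^bsub>G\<^esub> s \<in> carrier G"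
      using z(2) v(1) polys_belowD(1) S_carrier[OF z(3)] x by auto
    have "z \<ominus>\<^bsub>G\<^esub> (v \<oplus>\<^bsub>G\<^esub> (x [^] j) \<odot>\<^bsub>G\<^esub> s)
        = (u \<ominus>\<^bsub>G\<^esub> v) \<oplus>\<^bsub>G\<^esub> ((x [^] j) \<odot>\<^bsub>G\<^esub> s \<oplus>\<^bsub>G\<^esub> \<ominus>\<^bsub>G\<^esub> ((x [^] j) \<odot>\<^bsub>G\<^esub> s))"
      using c unfolding z(1) by (simp add: a_minus_def G.M.minus_add G.M.a_ac G.M.r_neg)
    also have "\<dots> = u \<ominus>\<^bsub>G\<^esub> v" using c by (simp add: G.M.r_neg)
    finally have e: "z \<ominus>\<^bsub>G\<^esub> (v \<oplus>\<^bsub>G\<^esub> (x [^] j) \<odot>\<^bsub>G\<^esub> s) = u \<ominus>\<^bsub>G\<^esub> v" .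
    have "z \<ominus>\<^bsub>G\<^esub> (v \<oplus>\<^bsub>G\<^esub> (x [^] j) \<odot>\<^bsub>G\<^esub> s) \<in> Z' t"
      using family_diff[OF G Z' Suc.prems(1)] v(2) ZZ by (auto simp: le_fun_def)
    then have "u \<ominus>\<^bsub>G\<^esub> v \<in> Z t"
      using Suc.IH[of "u \<ominus>\<^bsub>G\<^esub> v"] family_diff[OF G family_polys_below z(2) v(1)] e by simp
    then have "z \<ominus>\<^bsub>G\<^esub> (v \<oplus>\<^bsub>G\<^esub> (x [^] j) \<odot>\<^bsub>G\<^esub> s) \<in> Z t" using e by simp
    then show ?case using family_diff_cancel[OF G Z _ v(2)] c z(1) by auto
  qed
  have "Z' \<le> Z"
  proof (rule le_funI, rule subsetI)
    fix t z assume z: "z \<in> Z' t"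
    then obtain j where "z \<in> polys_below R G x S j t" using Zsub unfolding le_fun_def by blast
    with z show "z \<in> Z t" by (rule *)
  qed
  from order.antisym[OF this ZZ] show ?thesis .
qed

text \<open>The coefficient families grow both with the chain index \<open>n\<close> and with the
  exponent \<open>j\<close>. The diagonal settles all exponents beyond some \<open>N\<close>, and
  the finitely many remaining ones settle one by one.\<close>

theorem acc_polynomials:
  assumes acc: "acc A X G S"
  shows "acc A (insert x X) G (\<lambda>t. \<Union>j. polys_below R G x S j t)"
  unfolding acc_def
proof (intro allI impI)
  fix Z :: "nat \<Rightarrow> int \<Rightarrow> 'c set"
  assume Z: "(\<forall>n. graded_family A (insert x X) G (Z n) \<and> Z n \<le> (\<lambda>t. \<Union>j. polys_below R G x S j t)) \<and> mono Z"
  define L where "L n j = leading_coefficients R G x S j (Z n)" for n j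
  have fam: "graded_family A X G (L n j)" and le: "L n j \<le> S" for n j
    using Z family_leading_coefficients by (auto simp: L_def le_fun_def leading_coefficients_def)
  have mono: "L m i \<le> L n j" if "m \<le> n" "i \<le> j" for m n i j
    unfolding L_def using leading_coefficients_mono[of "Z n" i j "Z m"] Z that by (simp add: monoD)
  obtain N where N: "\<And>n. n \<ge> N \<Longrightarrow> L n n = L N N"
    using accD[OF acc, of "\<lambda>n. L n n"] fam le mono by (metis Suc_n_not_le_n nat_le_linear)
  \<comment> \<open>The entry lies between \<open>L N N\<close> and the diagonal entry at
    \<open>max n j\<close>, and these two are equal.\<close>
  have diag: "L n j = L N N" if "n \<ge> N" "j \<ge> N" for n j
    using N[of "max n j"] mono[of n "max n j" j "max n j"] mono[of N n N j] that by force
  have "\<exists>M. \<forall>n \<ge> M. L n j = L M j" for j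
    using accD[OF acc, of "\<lambda>n. L n j"] fam le mono by (metis Suc_n_not_le_n nat_le_linear)
  then obtain M where M: "\<And>j n. n \<ge> M j \<Longrightarrow> L n j = L (M j) j" by metis
  \<comment> \<open>A common bound for the exponents below \<open>N\<close>; inserting
    \<open>N\<close> keeps the set nonempty and brings the diagonal range under the same
    bound.\<close>
  define K where "K = Max (insert N (M ` {..<N}))"
  have "L n j = L K j" if "n \<ge> K" for n j
  proof (cases "j < N")
    case True
    then have "M j \<le> K" unfolding K_def by (intro Max_ge) auto
    then show ?thesis using M[of j n] M[of j K] that by auto
  next
    case False
    have "N \<le> K" unfolding K_def by (intro Max_ge) auto
    then show ?thesis using diag[of n j] diag[of K j] that False by auto
  qed
  then have LK: "leading_coefficients R G x S j (Z K) = leading_coefficients R G x S j (Z n)"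
    if "n \<ge> K" for n j
    using that unfolding L_def by metis
  have "Z n = Z K" if n: "n \<ge> K" for n
  proof (rule leading_coefficients_determine)
    show "Z K \<le> Z n" using Z n monoD by blast
    show "graded_family A (insert x X) G (Z K)" "graded_family A (insert x X) G (Z n)"
      "Z n \<le> (\<lambda>t. \<Union>j. polys_below R G x S j t)"
      using Z by blast+
    show "leading_coefficients R G x S j (Z K) = leading_coefficients R G x S j (Z n)" for j
      using LK[OF n] .
  qed
  then show "\<exists>N. \<forall>n \<ge> N. Z n = Z N" by blast
qed

lemma subset_polynomials: "S \<le> (\<lambda>t. \<Union>j. polys_below R G x S j t)"
proof (rule le_funI, rule subsetI)
  fix t s assume s: "s \<in> S t"
  then have "s = \<zero>\<^bsub>G\<^esub> \<oplus>\<^bsub>G\<^esub> (x [^] (0::nat)) \<odot>\<^bsub>G\<^esub> s" using S_carrier by simp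
  then have "s \<in> polys_below R G x S (Suc 0) t" using s by auto
  then show "s \<in> (\<Union>j. polys_below R G x S j t)" by blast
qed

end

text \<open>Operators are adjoined one at a time: each enlarges the family to its polynomials in the
  new operator, and the basis theorem preserves the chain condition for the enlarged set of
  operators.\<close>

theorem acc_extend_operators:
  assumes G: "module R G" and "finite X" "X \<subseteq> carrier R"
    and S: "graded_family A {} G S" and acc: "acc A {} G S"
  shows "\<exists>T. graded_family A X G T \<and> S \<le> T \<and> acc A X G T"
  using assms(2,3)
proof (induction X rule: finite_induct)
  case empty
  then show ?case using S acc by blast
next
  case (insert x X)
  then obtain T where T: "graded_family A X G T" "S \<le> T" "acc A X G T" by auto
  have X: "X \<subseteq> carrier R" "x \<in> carrier R" using insert by auto
  show ?case
    using family_polynomials[OF G X T(1)] acc_polynomials[OF G X T(1,3)]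
      order_trans[OF T(2) subset_polynomials[OF G X T(1)]] by blast
qed

end

section \<open>Chain condition for finitely generated modules over a noetherian ring\<close>

definition self_module :: "('a, 'x) ring_scheme \<Rightarrow> ('a, 'a) module" where
  "self_module R = \<lparr>carrier = carrier R, mult = mult R, one = \<one>\<^bsub>R\<^esub>, zero = \<zero>\<^bsub>R\<^esub>, add = add R, smult = mult R\<rparr>"

lemma self_module_simps [simp]:
  "carrier (self_module R) = carrier R" "zero (self_module R) = zero R"
  "add (self_module R) = add R" "smult (self_module R) = mult R"
  by (simp_all add: self_module_def)

lemma self_module_a_inv [simp]: "\<ominus>\<^bsub>self_module R\<^esub> a = \<ominus>\<^bsub>R\<^esub> a"
  by (simp add: a_inv_def m_inv_def)

lemma (in cring) module_self_module: "module R (self_module R)"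
proof (rule moduleI)
  show "cring R" by (rule is_cring)
  show "abelian_group (self_module R)"
    by (rule abelian_groupI) (auto simp: a_ac intro: l_neg)
qed (auto simp: l_distr r_distr m_assoc)

context operators
begin

lemma acc_base_ring:
  assumes "noetherian_ring (R\<lparr>carrier := A\<rparr>)"
  shows "acc A {} (self_module R) (\<lambda>t. if t = 0 then A else {\<zero>})"
  unfolding acc_def
proof (intro allI impI)
  interpret N: noetherian_ring "R\<lparr>carrier := A\<rparr>" by fact
  fix Z :: "nat \<Rightarrow> int \<Rightarrow> 'a set"
  assume Z: "(\<forall>n. graded_family A {} (self_module R) (Z n) \<and> Z n \<le> (\<lambda>t. if t = 0 then A else {\<zero>})) \<and> mono Z"
  then have fam: "graded_family A {} (self_module R) (Z n)" for n by blast
  note ZD = graded_familyD[OF fam, simplified]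
  have sub: "Z n t \<subseteq> (if t = 0 then A else {\<zero>})" for n t
    using Z unfolding le_fun_def by blast
  have "ideal (Z n 0) (R\<lparr>carrier := A\<rparr>)" for n
  proof (rule idealI)
    show "subgroup (Z n 0) (add_monoid (R\<lparr>carrier := A\<rparr>))"
    proof
      show "Z n 0 \<subseteq> carrier (add_monoid (R\<lparr>carrier := A\<rparr>))" using sub[of n 0] by simp
      fix a assume a: "a \<in> Z n 0"
      \<comment> \<open>The additive inverse is chosen within the carrier, so the one of the
        restricted ring has to be identified with the one of \<open>R\<close>.\<close>
      have *: "\<ominus>\<^bsub>R\<lparr>carrier := A\<rparr>\<^esub> a = \<ominus> a"
      proof (rule N.minus_equality)
        show "\<ominus> a \<oplus>\<^bsub>R\<lparr>carrier := A\<rparr>\<^esub> a = \<zero>\<^bsub>R\<lparr>carrier := A\<rparr>\<^esub>"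
          using a sub[of n 0] A_carrier by (auto simp: l_neg)
      qed (use a sub[of n 0] minus_A in auto)
      have "\<ominus> a \<in> Z n 0"
        using family_minus[OF module_self_module fam a] a sub[of n 0]
        by simp
      then show "inv\<^bsub>add_monoid (R\<lparr>carrier := A\<rparr>)\<^esub> a \<in> Z n 0"
        using * unfolding a_inv_def by simp
    qed (use ZD in auto)
  next
    fix a x assume "a \<in> Z n 0" "x \<in> carrier (R\<lparr>carrier := A\<rparr>)"
    then show "x \<otimes>\<^bsub>R\<lparr>carrier := A\<rparr>\<^esub> a \<in> Z n 0" "a \<otimes>\<^bsub>R\<lparr>carrier := A\<rparr>\<^esub> x \<in> Z n 0"
      using ZD(4)[of x a n] ZD(1)[of a n] A_carrier[of x] by (auto simp: m_comm)
  qed (rule N.ring_axioms)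
  moreover have "Z m 0 \<subseteq> Z n 0 \<or> Z n 0 \<subseteq> Z m 0" for m n
    using Z by (metis le_fun_def monoD nat_le_linear)
  ultimately have "subset.chain {I. ideal I (R\<lparr>carrier := A\<rparr>)} (range (\<lambda>n. Z n 0))"
    unfolding subset.chain_def by blast
  then have "\<Union> (range (\<lambda>n. Z n 0)) \<in> range (\<lambda>n. Z n 0)"
    by (intro N.ideal_chain_is_trivial) auto
  then obtain N where N: "\<Union> (range (\<lambda>n. Z n 0)) = Z N 0" by blast
  have "Z n t = Z N t" if "n \<ge> N" for n t
  proof (cases "t = 0")
    case True
    have "Z N 0 \<subseteq> Z n 0" using Z that by (metis le_fun_def monoD)
    then show ?thesis using N True by blast
  next
    case False
    then show ?thesis using sub[of n t] sub[of N t] ZD(2)[of n t] ZD(2)[of N t] by auto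
  qed
  then show "\<exists>N. \<forall>n\<ge>N. Z n = Z N" by blast
qed

text \<open>Generators are adjoined one at a time. Enlarging \<open>S\<close> by \<open>m\<close>
  changes only the degree \<open>\<tau>\<close>, and the quotient there is cyclic over
  \<open>A\<close>; so among nested subfamilies each is determined by its part in \<open>S\<close>
  and by the ideal of coefficients of \<open>m\<close> that it allows.\<close>

theorem acc_finitely_generated:
  fixes G :: "('a, 'd, 'y) module_scheme"
  assumes noeth: "noetherian_ring (R\<lparr>carrier := A\<rparr>)" and G: "module R G"
    and "finite Y" "Y \<subseteq> UNIV \<times> carrier G"
  shows "\<exists>S. graded_family A {} G S \<and> acc A {} G S \<and> (\<forall>(t, m) \<in> Y. m \<in> S t)"
  using assms(3,4)
proof (induction Y rule: finite_induct)
  case empty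
  interpret G: module R G by (rule G)
  have fam: "graded_family A {} G (\<lambda>t. {\<zero>\<^bsub>G\<^esub>})" using A_carrier by (intro graded_familyI) auto
  have "Z = (\<lambda>t. {\<zero>\<^bsub>G\<^esub>})" if "graded_family A {} G Z" "Z \<le> (\<lambda>t. {\<zero>\<^bsub>G\<^esub>})" for Z
    using that graded_familyD(2)[OF that(1)] by (auto simp: le_fun_def fun_eq_iff)
  then have "acc A {} G (\<lambda>t. {\<zero>\<^bsub>G\<^esub>})" unfolding acc_def by metis
  with fam show ?case by blast
next
  case (insert y Y)
  interpret G: module R G by (rule G)
  obtain S where S: "graded_family A {} G S" and accS: "acc A {} G S"
    and YS: "\<forall>(t, m) \<in> Y. m \<in> S t" using insert by auto
  obtain \<tau> m where y: "y = (\<tau>, m)" by (cases y)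
  have m: "m \<in> carrier G" using insert.prems y by auto
  note SD = graded_familyD[OF S]
  define S' where "S' t = (if t = \<tau> then {s \<oplus>\<^bsub>G\<^esub> a \<odot>\<^bsub>G\<^esub> m | s a. s \<in> S \<tau> \<and> a \<in> A} else S t)" for t
  have mem: "s \<oplus>\<^bsub>G\<^esub> a \<odot>\<^bsub>G\<^esub> m \<in> S' \<tau>" if "s \<in> S \<tau>" "a \<in> A" for s a
    using that unfolding S'_def by auto
  have memE: "\<exists>s a. z = s \<oplus>\<^bsub>G\<^esub> a \<odot>\<^bsub>G\<^esub> m \<and> s \<in> S \<tau> \<and> a \<in> A" if "z \<in> S' \<tau>" for z
    using that unfolding S'_def by auto
  have fam: "graded_family A {} G S'"
  proof (intro graded_familyI)
    fix t a assume "a \<in> S' t"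
    then show "a \<in> carrier G" using SD(1) m A_carrier by (auto simp: S'_def split: if_splits)
  next
    fix t show "\<zero>\<^bsub>G\<^esub> \<in> S' t"
      using SD(2)[of t] mem[OF SD(2) zero_A] m by (cases "t = \<tau>") (auto simp: S'_def)
  next
    fix t a b assume ab: "a \<in> S' t" "b \<in> S' t"
    show "a \<oplus>\<^bsub>G\<^esub> b \<in> S' t"
    proof (cases "t = \<tau>")
      case True
      obtain s r s' r' where a: "a = s \<oplus>\<^bsub>G\<^esub> r \<odot>\<^bsub>G\<^esub> m" "s \<in> S \<tau>" "r \<in> A"
        and b: "b = s' \<oplus>\<^bsub>G\<^esub> r' \<odot>\<^bsub>G\<^esub> m" "s' \<in> S \<tau>" "r' \<in> A"
        using memE ab True by meson
      have "a \<oplus>\<^bsub>G\<^esub> b = (s \<oplus>\<^bsub>G\<^esub> s') \<oplus>\<^bsub>G\<^esub> (r \<oplus> r') \<odot>\<^bsub>G\<^esub> m"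
        using a b SD(1) m A_carrier by (simp add: G.smult_l_distr G.M.a_ac)
      then show ?thesis
        using mem[OF SD(3)[OF a(2) b(2)] subringE(7)[OF A_subring a(3) b(3)]] True by simp
    qed (use ab SD(3) in \<open>auto simp: S'_def\<close>)
  next
    fix t r a assume r: "r \<in> A" and a: "a \<in> S' t"
    show "r \<odot>\<^bsub>G\<^esub> a \<in> S' t"
    proof (cases "t = \<tau>")
      case True
      obtain s r' where a: "a = s \<oplus>\<^bsub>G\<^esub> r' \<odot>\<^bsub>G\<^esub> m" "s \<in> S \<tau>" "r' \<in> A"
        using memE a True by meson
      have "r \<odot>\<^bsub>G\<^esub> a = (r \<odot>\<^bsub>G\<^esub> s) \<oplus>\<^bsub>G\<^esub> (r \<otimes> r') \<odot>\<^bsub>G\<^esub> m"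
        using a SD(1) m A_carrier r by (simp add: G.smult_r_distr G.smult_assoc1)
      then show ?thesis
        using mem[OF SD(4)[OF r a(2)] subringE(6)[OF A_subring r a(3)]] True by simp
    qed (use a r SD(4) in \<open>auto simp: S'_def\<close>)
  qed auto
  define f1 where "f1 Z t = Z t \<inter> S t" for Z :: "int \<Rightarrow> 'd set" and t
  \<comment> \<open>The ideal of coefficients of \<open>m\<close> occurring in \<open>Z\<close>,
    placed in degree 0 whatever \<open>\<tau>\<close> is, to meet the form of
    \<open>acc_base_ring\<close>.\<close>
  define f2 where "f2 Z t = (if t = (0::int) then {a \<in> A. \<exists>s \<in> S \<tau>. s \<oplus>\<^bsub>G\<^esub> a \<odot>\<^bsub>G\<^esub> m \<in> Z \<tau>} else {\<zero>})"
    for Z :: "int \<Rightarrow> 'd set" and t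
  have "acc A {} G S'"
  proof (rule acc_joint[OF accS acc_base_ring[OF noeth], where ?f1.0 = f1 and ?f2.0 = f2])
    fix Z assume Z: "graded_family A {} G Z" "Z \<le> S'"
    show "graded_family A {} G (f1 Z) \<and> f1 Z \<le> S"
      using Z(1) S unfolding graded_family_def f1_def le_fun_def by auto
    note ZD = graded_familyD[OF Z(1)]
    have mem2: "a \<in> f2 Z 0" if "a \<in> A" "s \<in> S \<tau>" "s \<oplus>\<^bsub>G\<^esub> a \<odot>\<^bsub>G\<^esub> m \<in> Z \<tau>" for a s
      using that unfolding f2_def by auto
    have "graded_family A {} (self_module R) (f2 Z)"
    proof (intro graded_familyI)
      fix t a assume "a \<in> f2 Z t"
      then show "a \<in> carrier (self_module R)" using A_carrier by (auto simp: f2_def split: if_splits)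
    next
      fix t show "\<zero>\<^bsub>self_module R\<^esub> \<in> f2 Z t"
        using mem2[OF zero_A SD(2)] ZD(2) m by (cases "t = 0") (auto simp: f2_def)
    next
      fix t a b assume ab: "a \<in> f2 Z t" "b \<in> f2 Z t"
      show "a \<oplus>\<^bsub>self_module R\<^esub> b \<in> f2 Z t"
      proof (cases "t = 0")
        case True
        obtain s s' where a: "a \<in> A" "s \<in> S \<tau>" "s \<oplus>\<^bsub>G\<^esub> a \<odot>\<^bsub>G\<^esub> m \<in> Z \<tau>"
          and b: "b \<in> A" "s' \<in> S \<tau>" "s' \<oplus>\<^bsub>G\<^esub> b \<odot>\<^bsub>G\<^esub> m \<in> Z \<tau>"
          using ab True unfolding f2_def by auto
        have "(s \<oplus>\<^bsub>G\<^esub> s') \<oplus>\<^bsub>G\<^esub> (a \<oplus> b) \<odot>\<^bsub>G\<^esub> m = (s \<oplus>\<^bsub>G\<^esub> a \<odot>\<^bsub>G\<^esub> m) \<oplus>\<^bsub>G\<^esub> (s' \<oplus>\<^bsub>G\<^esub> b \<odot>\<^bsub>G\<^esub> m)"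
          using a b SD(1) m A_carrier by (simp add: G.smult_l_distr G.M.a_ac)
        then show ?thesis
          using mem2[OF subringE(7)[OF A_subring a(1) b(1)] SD(3)[OF a(2) b(2)]] ZD(3)[OF a(3) b(3)] True
          by simp
      qed (use ab in \<open>auto simp: f2_def\<close>)
    next
      fix t r a assume r: "r \<in> A" and a: "a \<in> f2 Z t"
      show "r \<odot>\<^bsub>self_module R\<^esub> a \<in> f2 Z t"
      proof (cases "t = 0")
        case True
        obtain s where a: "a \<in> A" "s \<in> S \<tau>" "s \<oplus>\<^bsub>G\<^esub> a \<odot>\<^bsub>G\<^esub> m \<in> Z \<tau>"
          using a True unfolding f2_def by auto
        have "r \<odot>\<^bsub>G\<^esub> s \<oplus>\<^bsub>G\<^esub> (r \<otimes> a) \<odot>\<^bsub>G\<^esub> m = r \<odot>\<^bsub>G\<^esub> (s \<oplus>\<^bsub>G\<^esub> a \<odot>\<^bsub>G\<^esub> m)"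
          using a SD(1) m A_carrier r by (simp add: G.smult_r_distr G.smult_assoc1)
        then show ?thesis
          using mem2[OF subringE(6)[OF A_subring r a(1)] SD(4)[OF r a(2)]] ZD(4)[OF r a(3)] True
          by simp
      qed (use a r A_carrier in \<open>auto simp: f2_def\<close>)
    qed auto
    then show "graded_family A {} (self_module R) (f2 Z) \<and> f2 Z \<le> (\<lambda>t. if t = 0 then A else {\<zero>})"
      by (auto simp: f2_def le_fun_def)
  next
    fix Z Z' :: "int \<Rightarrow> 'd set"
    assume "Z \<le> Z'"
    then have "Z t \<subseteq> Z' t" for t by (simp add: le_fun_def)
    then show "f1 Z \<le> f1 Z'" "f2 Z \<le> f2 Z'" by (auto simp: f1_def f2_def le_fun_def)
  next
    fix Z Z' assume Z: "graded_family A {} G Z" and Z': "graded_family A {} G Z'" and ZZ: "Z \<le> Z'"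
      and ZS: "Z' \<le> S'" and e1: "f1 Z = f1 Z'" and e2: "f2 Z = f2 Z'"
    have old: "z \<in> Z t" if "z \<in> Z' t" "z \<in> S t" for z t
      using that fun_cong[OF e1, of t] unfolding f1_def by blast
    show "Z' \<le> Z"
    proof (rule le_funI, rule subsetI)
      fix t z assume z: "z \<in> Z' t"
      then have zS: "z \<in> S' t" using ZS unfolding le_fun_def by blast
      show "z \<in> Z t"
      proof (cases "t = \<tau>")
        case True
        obtain s a where za: "z = s \<oplus>\<^bsub>G\<^esub> a \<odot>\<^bsub>G\<^esub> m" "s \<in> S \<tau>" "a \<in> A"
          using memE zS True by meson
        have "a \<in> f2 Z' 0" using za z True unfolding f2_def by auto
        then obtain s' where s': "s' \<in> S \<tau>" "s' \<oplus>\<^bsub>G\<^esub> a \<odot>\<^bsub>G\<^esub> m \<in> Z \<tau>"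
          using fun_cong[OF e2, of 0] unfolding f2_def by auto
        have c: "s \<in> carrier G" "s' \<in> carrier G" "a \<odot>\<^bsub>G\<^esub> m \<in> carrier G"
          using SD(1) za s' m A_carrier by auto
        have "z \<ominus>\<^bsub>G\<^esub> (s' \<oplus>\<^bsub>G\<^esub> a \<odot>\<^bsub>G\<^esub> m)
            = (s \<ominus>\<^bsub>G\<^esub> s') \<oplus>\<^bsub>G\<^esub> (a \<odot>\<^bsub>G\<^esub> m \<oplus>\<^bsub>G\<^esub> \<ominus>\<^bsub>G\<^esub> (a \<odot>\<^bsub>G\<^esub> m))"
          using c unfolding za(1) by (simp add: a_minus_def G.M.minus_add G.M.a_ac G.M.r_neg)
        also have "\<dots> = s \<ominus>\<^bsub>G\<^esub> s'" using c by (simp add: G.M.r_neg)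
        finally have e: "z \<ominus>\<^bsub>G\<^esub> (s' \<oplus>\<^bsub>G\<^esub> a \<odot>\<^bsub>G\<^esub> m) = s \<ominus>\<^bsub>G\<^esub> s'" .
        have "s' \<oplus>\<^bsub>G\<^esub> a \<odot>\<^bsub>G\<^esub> m \<in> Z' \<tau>" using s'(2) ZZ unfolding le_fun_def by blast
        then have "z \<ominus>\<^bsub>G\<^esub> (s' \<oplus>\<^bsub>G\<^esub> a \<odot>\<^bsub>G\<^esub> m) \<in> Z' \<tau>"
          using family_diff[OF G Z'] z True by blast
        moreover have "s \<ominus>\<^bsub>G\<^esub> s' \<in> S \<tau>" using family_diff[OF G S za(2) s'(1)] .
        ultimately have "z \<ominus>\<^bsub>G\<^esub> (s' \<oplus>\<^bsub>G\<^esub> a \<odot>\<^bsub>G\<^esub> m) \<in> Z \<tau>" using old e by simp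
        then show ?thesis
          using family_diff_cancel[OF G Z _ s'(2)] graded_familyD(1)[OF Z' z] True by blast
      next
        case False
        then show ?thesis using old[OF z] zS unfolding S'_def by simp
      qed
    qed
  qed
  moreover have sub: "S t \<subseteq> S' t" for t
  proof
    fix s assume s: "s \<in> S t"
    have "t = \<tau> \<Longrightarrow> s = s \<oplus>\<^bsub>G\<^esub> \<zero> \<odot>\<^bsub>G\<^esub> m" using SD(1)[OF s] m by simp
    then show "s \<in> S' t" using s mem[of s \<zero>] zero_A unfolding S'_def by (cases "t = \<tau>") auto
  qed
  moreover have "m \<in> S' \<tau>" using mem[OF SD(2) one_A] m by simp
  then have "\<forall>(t, m) \<in> insert y Y. m \<in> S' t" using YS sub y by blast
  ultimately show ?case using fam by blast
qed

end

section \<open>Differential families and iterated mapping cones\<close>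

text \<open>
  The elements of a cone are pairs.  They are interleaved into one sequence, so that cones can be
  iterated without leaving the type.
\<close>

definition left_half :: "(nat \<Rightarrow> 'c) \<Rightarrow> nat \<Rightarrow> 'c" where "left_half h n = h (2 * n)"

definition right_half :: "(nat \<Rightarrow> 'c) \<Rightarrow> nat \<Rightarrow> 'c" where "right_half h n = h (2 * n + 1)"

definition interleave :: "(nat \<Rightarrow> 'c) \<Rightarrow> (nat \<Rightarrow> 'c) \<Rightarrow> nat \<Rightarrow> 'c" where
  "interleave a b n = (if even n then a (n div 2) else b (n div 2))"

lemma halves_interleave [simp]:
  "left_half (interleave a b) = a" "right_half (interleave a b) = b"
  by (auto simp: left_half_def right_half_def interleave_def)

lemma interleave_halves [simp]: "interleave (left_half h) (right_half h) = h"
proof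
  fix n show "interleave (left_half h) (right_half h) n = h n"
    by (cases "even n") (auto simp: left_half_def right_half_def interleave_def)
qed

lemma interleave_eq_iff [simp]: "interleave a b = interleave a' b' \<longleftrightarrow> a = a' \<and> b = b'"
  by (metis halves_interleave)

lemma interleave_eqI: "left_half h = a \<Longrightarrow> right_half h = b \<Longrightarrow> h = interleave a b"
  using interleave_halves[of h] by simp

definition cone_module ::
    "('a, nat \<Rightarrow> 'c) module \<Rightarrow> ('a, nat \<Rightarrow> 'c) module" where
  "cone_module G =
     \<lparr>carrier = {h. left_half h \<in> carrier G \<and> right_half h \<in> carrier G},
      mult = undefined, one = undefined, zero = interleave \<zero>\<^bsub>G\<^esub> \<zero>\<^bsub>G\<^esub>,
      add = (\<lambda>h k. interleave (left_half h \<oplus>\<^bsub>G\<^esub> left_half k) (right_half h \<oplus>\<^bsub>G\<^esub> right_half k)),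
      smult = (\<lambda>r h. interleave (r \<odot>\<^bsub>G\<^esub> left_half h) (r \<odot>\<^bsub>G\<^esub> right_half h))\<rparr>"

lemma cone_module_simps [simp]:
  "h \<in> carrier (cone_module G) \<longleftrightarrow> left_half h \<in> carrier G \<and> right_half h \<in> carrier G"
  "zero (cone_module G) = interleave \<zero>\<^bsub>G\<^esub> \<zero>\<^bsub>G\<^esub>"
  "h \<oplus>\<^bsub>cone_module G\<^esub> k =
     interleave (left_half h \<oplus>\<^bsub>G\<^esub> left_half k) (right_half h \<oplus>\<^bsub>G\<^esub> right_half k)"
  "r \<odot>\<^bsub>cone_module G\<^esub> h = interleave (r \<odot>\<^bsub>G\<^esub> left_half h) (r \<odot>\<^bsub>G\<^esub> right_half h)"
  by (simp_all add: cone_module_def)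

text \<open>The sign of the second term makes the square vanish:
  \<open>x D a - D (x a - D b)\<close> equals \<open>D (D b)\<close>, which is zero.\<close>

definition cone_diff ::
    "('a, nat \<Rightarrow> 'c) module \<Rightarrow> 'a \<Rightarrow> ((nat \<Rightarrow> 'c) \<Rightarrow> nat \<Rightarrow> 'c) \<Rightarrow> (nat \<Rightarrow> 'c) \<Rightarrow> nat \<Rightarrow> 'c" where
  "cone_diff G x D h =
     interleave (D (left_half h)) (x \<odot>\<^bsub>G\<^esub> left_half h \<ominus>\<^bsub>G\<^esub> D (right_half h))"

text \<open>Multiplication by \<open>x\<close> raises degrees by \<open>\<delta>\<close>; starting
  the left half \<open>\<delta>\<close> lower makes the differential of the cone preserve the
  degree.\<close>

definition cone_family :: "nat \<Rightarrow> (int \<Rightarrow> (nat \<Rightarrow> 'c) set) \<Rightarrow> int \<Rightarrow> (nat \<Rightarrow> 'c) set" where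
  "cone_family \<delta> S t = {h. left_half h \<in> S (t - int \<delta>) \<and> right_half h \<in> S t}"

lemma cone_family_iff [simp]:
  "h \<in> cone_family \<delta> S t \<longleftrightarrow> left_half h \<in> S (t - int \<delta>) \<and> right_half h \<in> S t"
  by (simp add: cone_family_def)

lemma module_cone_module:
  assumes "module R G" shows "module R (cone_module G)"
proof -
  interpret G: module R G by fact
  show ?thesis
  proof (rule moduleI)
    show "cring R" by (rule G.is_cring)
    show "abelian_group (cone_module G)"
    proof (rule abelian_groupI)
      fix h assume h: "h \<in> carrier (cone_module G)"
      show "\<exists>k \<in> carrier (cone_module G). k \<oplus>\<^bsub>cone_module G\<^esub> h = \<zero>\<^bsub>cone_module G\<^esub>"
        using h by (intro bexI[of _ "interleave (\<ominus>\<^bsub>G\<^esub> left_half h) (\<ominus>\<^bsub>G\<^esub> right_half h)"])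
          (auto simp: G.M.l_neg)
    qed (auto simp: G.M.a_ac)
  qed (auto simp: G.smult_l_distr G.smult_r_distr G.smult_assoc1)
qed

lemma cone_module_a_inv:
  assumes "module R G" "h \<in> carrier (cone_module G)"
  shows "\<ominus>\<^bsub>cone_module G\<^esub> h = interleave (\<ominus>\<^bsub>G\<^esub> left_half h) (\<ominus>\<^bsub>G\<^esub> right_half h)"
proof -
  interpret G: module R G by fact
  interpret C: module R "cone_module G" by (rule module_cone_module) fact
  show ?thesis using assms(2) by (intro C.M.minus_equality) (auto simp: G.M.l_neg)
qed

lemma cone_module_minus:
  assumes "module R G" "h \<in> carrier (cone_module G)" "k \<in> carrier (cone_module G)"
  shows "h \<ominus>\<^bsub>cone_module G\<^esub> k =
    interleave (left_half h \<ominus>\<^bsub>G\<^esub> left_half k) (right_half h \<ominus>\<^bsub>G\<^esub> right_half k)"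
  using cone_module_a_inv[OF assms(1,3)] by (simp add: a_minus_def)

lemma (in module) minus_minus_cancel:
  "a \<in> carrier M \<Longrightarrow> b \<in> carrier M \<Longrightarrow> a \<ominus>\<^bsub>M\<^esub> (a \<ominus>\<^bsub>M\<^esub> b) = b"
  by (simp add: a_minus_def M.minus_add M.r_neg M.a_assoc[symmetric])

lemma (in module) smult_diff:
  "r \<in> carrier R \<Longrightarrow> a \<in> carrier M \<Longrightarrow> b \<in> carrier M \<Longrightarrow>
    r \<odot>\<^bsub>M\<^esub> (a \<ominus>\<^bsub>M\<^esub> b) = r \<odot>\<^bsub>M\<^esub> a \<ominus>\<^bsub>M\<^esub> r \<odot>\<^bsub>M\<^esub> b"
  by (simp add: a_minus_def smult_r_distr smult_r_minus)

lemma (in abelian_group) add_diff_add: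
  "a \<in> carrier G \<Longrightarrow> b \<in> carrier G \<Longrightarrow> c \<in> carrier G \<Longrightarrow> d \<in> carrier G \<Longrightarrow>
    (a \<oplus> b) \<ominus> (c \<oplus> d) = (a \<ominus> c) \<oplus> (b \<ominus> d)"
  by (simp add: a_minus_def minus_add a_ac)

lemma (in abelian_group) diff_eq_zero_iff:
  "a \<in> carrier G \<Longrightarrow> b \<in> carrier G \<Longrightarrow> a \<ominus> b = \<zero> \<longleftrightarrow> a = b"
  by (metis a_minus_def add.inv_closed minus_equality minus_minus r_neg)

lemma (in abelian_group) diff_add_cancel:
  "a \<in> carrier G \<Longrightarrow> b \<in> carrier G \<Longrightarrow> (a \<ominus> b) \<oplus> b = a"
  by (simp add: a_minus_def a_assoc l_neg)

lemma (in abelian_group) add_diff_cancel: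
  "a \<in> carrier G \<Longrightarrow> b \<in> carrier G \<Longrightarrow> (a \<oplus> b) \<ominus> b = a"
  by (simp add: a_minus_def a_assoc r_neg)

text \<open>The ambient module and \<open>D\<close> are ungraded and stay fixed while the family
  \<open>S\<close> varies. Torsion parts, the whole resolution and the embedded copy of
  \<open>M\<close> thus become comparable as families in one place.\<close>

locale differential_family = operators R A + module R G
  for R :: "('a, 'x) ring_scheme" (structure) and A and G :: "('a, 'b) module" (structure) +
  fixes X :: "'a set" and D :: "'b \<Rightarrow> 'b" and S :: "int \<Rightarrow> 'b set"
  assumes X_carrier: "X \<subseteq> carrier R"
    and family: "graded_family A X G S"
    and D_closed: "a \<in> carrier G \<Longrightarrow> D a \<in> carrier G"
    and D_add: "a \<in> carrier G \<Longrightarrow> b \<in> carrier G \<Longrightarrow> D (a \<oplus>\<^bsub>G\<^esub> b) = D a \<oplus>\<^bsub>G\<^esub> D b"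
    and D_smult: "r \<in> carrier R \<Longrightarrow> a \<in> carrier G \<Longrightarrow> D (r \<odot>\<^bsub>G\<^esub> a) = r \<odot>\<^bsub>G\<^esub> D a"
    and D_D: "a \<in> carrier G \<Longrightarrow> D (D a) = \<zero>\<^bsub>G\<^esub>"
    and D_S: "a \<in> S t \<Longrightarrow> D a \<in> S t"
begin

lemma module_G: "module R G" ..

lemma D_zero: "D \<zero>\<^bsub>G\<^esub> = \<zero>\<^bsub>G\<^esub>"
  using D_smult[of \<zero> "\<zero>\<^bsub>G\<^esub>"] D_closed[of "\<zero>\<^bsub>G\<^esub>"] by simp

lemma D_minus: "a \<in> carrier G \<Longrightarrow> D (\<ominus>\<^bsub>G\<^esub> a) = \<ominus>\<^bsub>G\<^esub> D a"
  using D_smult[of "\<ominus> \<one>" a] D_closed[of a] by (simp add: smult_l_minus)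

lemma D_diff: "a \<in> carrier G \<Longrightarrow> b \<in> carrier G \<Longrightarrow> D (a \<ominus>\<^bsub>G\<^esub> b) = D a \<ominus>\<^bsub>G\<^esub> D b"
  by (simp add: a_minus_def D_add D_minus)

lemmas S_carrier = graded_familyD(1)[OF family]
  and S_zero = graded_familyD(2)[OF family]
  and S_add = graded_familyD(3)[OF family]
  and S_smult = graded_familyD(4)[OF family]
  and S_shift = graded_familyD(5)[OF family]
  and S_minus = family_minus[OF module_G family]
  and S_diff = family_diff[OF module_G family]

end

definition is_generator :: "'a set \<Rightarrow> 'a set \<Rightarrow> 'a \<times> nat \<Rightarrow> bool" where
  "is_generator A X g \<longleftrightarrow> (case g of (x, \<delta>) \<Rightarrow> \<delta> = 0 \<and> x \<in> A \<or> \<delta> = 1 \<and> x \<in> X)"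

definition acyclic_at :: "('a, 'b) module \<Rightarrow> ('b \<Rightarrow> 'b) \<Rightarrow> (int \<Rightarrow> 'b set) \<Rightarrow> int \<Rightarrow> bool" where
  "acyclic_at G D S t \<longleftrightarrow> (\<forall>z \<in> S t. D z = \<zero>\<^bsub>G\<^esub> \<longrightarrow> (\<exists>w \<in> S t. z = D w))"

definition torsion_family :: "('a, 'x) ring_scheme \<Rightarrow> ('a, 'b) module \<Rightarrow> (int \<Rightarrow> 'b set) \<Rightarrow> 'a \<Rightarrow> bool" where
  "torsion_family R G S x \<longleftrightarrow> (\<forall>t. \<forall>z \<in> S t. \<exists>k :: nat. (x [^]\<^bsub>R\<^esub> k) \<odot>\<^bsub>G\<^esub> z = \<zero>\<^bsub>G\<^esub>)"

context differential_family
begin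

lemma generator_carrier: "is_generator A X (x, \<delta>) \<Longrightarrow> x \<in> carrier R"
  using X_carrier A_carrier by (auto simp: is_generator_def)

lemma generator_shift:
  "is_generator A X (x, \<delta>) \<Longrightarrow> graded_family A X H U \<Longrightarrow> a \<in> U t \<Longrightarrow> x \<odot>\<^bsub>H\<^esub> a \<in> U (t + int \<delta>)"
  using graded_familyD(4,5)[of A X H U] by (auto simp: is_generator_def)

end

section \<open>Cohomology of a cone\<close>

lemma differential_family_cone:
  fixes G :: "('a, nat \<Rightarrow> 'c) module"
  assumes "differential_family R A G X D S" and g: "is_generator A X (x, \<delta>)"
  shows "differential_family R A (cone_module G) X (cone_diff G x D) (cone_family \<delta> S)"
proof -
  interpret differential_family R A G X D S by fact
  have x: "x \<in> carrier R" by (rule generator_carrier[OF g])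
  have C: "module R (cone_module G)" by (rule module_cone_module[OF module_G])
  have shift: "x \<odot>\<^bsub>G\<^esub> a \<in> S t" if "a \<in> S (t - int \<delta>)" for a t
    using generator_shift[OF g family that] by simp
  show ?thesis
  proof (intro differential_family.intro C differential_family_axioms.intro X_carrier)
    show "operators R A" ..
    show "graded_family A X (cone_module G) (cone_family \<delta> S)"
    proof (intro graded_familyI)
      fix t y a assume "y \<in> X" "a \<in> cone_family \<delta> S t"
      then show "y \<odot>\<^bsub>cone_module G\<^esub> a \<in> cone_family \<delta> S (t + 1)"
        using S_shift[of y "left_half a" "t - int \<delta>"] S_shift[of y "right_half a" t]
        by (simp add: algebra_simps)
    qed (auto intro: S_carrier S_zero S_add S_smult)
  next
    fix a assume "a \<in> carrier (cone_module G)"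
    then show "cone_diff G x D a \<in> carrier (cone_module G)"
      using x D_closed by (simp add: cone_diff_def)
  next
    fix a b assume "a \<in> carrier (cone_module G)" "b \<in> carrier (cone_module G)"
    then show "cone_diff G x D (a \<oplus>\<^bsub>cone_module G\<^esub> b) = cone_diff G x D a \<oplus>\<^bsub>cone_module G\<^esub> cone_diff G x D b"
      using x D_closed by (simp add: cone_diff_def D_add smult_r_distr M.add_diff_add)
  next
    fix r a assume "r \<in> carrier R" "a \<in> carrier (cone_module G)"
    then show "cone_diff G x D (r \<odot>\<^bsub>cone_module G\<^esub> a) = r \<odot>\<^bsub>cone_module G\<^esub> cone_diff G x D a"
      using x D_closed by (simp add: cone_diff_def D_smult smult_diff smult_assoc1[symmetric] m_comm)
  next
    fix a assume "a \<in> carrier (cone_module G)"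
    then show "cone_diff G x D (cone_diff G x D a) = \<zero>\<^bsub>cone_module G\<^esub>"
      using x D_closed by (simp add: cone_diff_def D_diff D_smult D_D minus_minus_cancel)
  next
    fix a t assume "a \<in> cone_family \<delta> S t"
    then show "cone_diff G x D a \<in> cone_family \<delta> S t"
      using D_S shift S_diff by (simp add: cone_diff_def)
  qed
qed

text \<open>Induction on the power of \<open>x\<close> that kills the cocycle \<open>z\<close>. The
  product \<open>x z\<close> is killed by a smaller power, so it is some \<open>D b\<close>; then
  \<open>(z, b)\<close> is a cocycle of the cone and the left half of a primitive bounds
  \<open>z\<close>. Since \<open>x z\<close> lives in degree \<open>t + \<delta>\<close>, the
  induction climbs, and the cone has to be acyclic along the whole ray.\<close>

lemma acyclic_if_cone_acyclic:
  fixes G :: "('a, nat \<Rightarrow> 'c) module"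
  assumes "differential_family R A G X D S" and g: "is_generator A X (x, \<delta>)"
    and tors: "torsion_family R G S x"
    and cone: "\<And>t. t \<ge> t0 + int \<delta> \<Longrightarrow> acyclic_at (cone_module G) (cone_diff G x D) (cone_family \<delta> S) t"
    and t: "t \<ge> t0"
  shows "acyclic_at G D S t"
proof -
  interpret differential_family R A G X D S by fact
  have x: "x \<in> carrier R" by (rule generator_carrier[OF g])
  have "\<exists>w \<in> S t. z = D w"
    if "(x [^]\<^bsub>R\<^esub> k) \<odot>\<^bsub>G\<^esub> z = \<zero>\<^bsub>G\<^esub>" "z \<in> S t" "D z = \<zero>\<^bsub>G\<^esub>" "t \<ge> t0" for k :: nat and z t
    using that
  proof (induction k arbitrary: z t)
    case 0
    then have "z = \<zero>\<^bsub>G\<^esub>" using S_carrier by simp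
    then show ?case using S_zero D_zero by metis
  next
    case (Suc k)
    note z = S_carrier[OF Suc.prems(2)]
    have xz: "x \<odot>\<^bsub>G\<^esub> z \<in> S (t + int \<delta>)" using generator_shift[OF g family Suc.prems(2)] .
    have "(x [^]\<^bsub>R\<^esub> k) \<odot>\<^bsub>G\<^esub> (x \<odot>\<^bsub>G\<^esub> z) = \<zero>\<^bsub>G\<^esub>"
      using Suc.prems(1) x z by (simp add: smult_assoc1)
    moreover have "D (x \<odot>\<^bsub>G\<^esub> z) = \<zero>\<^bsub>G\<^esub>" using D_smult[OF x z] Suc.prems(3) x by simp
    ultimately obtain b where b: "b \<in> S (t + int \<delta>)" "x \<odot>\<^bsub>G\<^esub> z = D b"
      using Suc.IH[OF _ xz] Suc.prems(4) by auto
    have "interleave z b \<in> cone_family \<delta> S (t + int \<delta>)" using b Suc.prems(2) by simp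
    moreover have "cone_diff G x D (interleave z b) = \<zero>\<^bsub>cone_module G\<^esub>"
      using b Suc.prems(3) D_closed[OF S_carrier[OF b(1)]]
      by (simp add: cone_diff_def M.diff_eq_zero_iff)
    ultimately obtain w where w: "w \<in> cone_family \<delta> S (t + int \<delta>)" "interleave z b = cone_diff G x D w"
      using cone[of "t + int \<delta>"] Suc.prems(4) unfolding acyclic_at_def by auto
    then have "left_half w \<in> S t" "z = D (left_half w)" by (simp_all add: cone_diff_def)
    then show ?case by blast
  qed
  then show ?thesis using tors t unfolding acyclic_at_def torsion_family_def by blast
qed

text \<open>A chase in the long exact sequence: if \<open>a = D a'\<close>, then
  \<open>x a' - b\<close> is a cocycle, and for a primitive \<open>b'\<close> of it the pair
  \<open>(a', b')\<close> has differential \<open>(a, b)\<close>.\<close>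

lemma cone_acyclic_if_acyclic:
  fixes G :: "('a, nat \<Rightarrow> 'c) module"
  assumes "differential_family R A G X D S" and g: "is_generator A X (x, \<delta>)"
    and left: "acyclic_at G D S (t - int \<delta>)" and right: "acyclic_at G D S t"
  shows "acyclic_at (cone_module G) (cone_diff G x D) (cone_family \<delta> S) t"
  unfolding acyclic_at_def
proof (intro ballI impI)
  interpret differential_family R A G X D S by fact
  have x: "x \<in> carrier R" by (rule generator_carrier[OF g])
  fix h assume h: "h \<in> cone_family \<delta> S t" "cone_diff G x D h = \<zero>\<^bsub>cone_module G\<^esub>"
  define a b where "a = left_half h" and "b = right_half h"
  have ab: "a \<in> S (t - int \<delta>)" "b \<in> S t" "D a = \<zero>\<^bsub>G\<^esub>" "x \<odot>\<^bsub>G\<^esub> a \<ominus>\<^bsub>G\<^esub> D b = \<zero>\<^bsub>G\<^esub>"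
    using h by (auto simp: a_def b_def cone_diff_def)
  obtain a' where a': "a' \<in> S (t - int \<delta>)" "a = D a'"
    using left ab unfolding acyclic_at_def by blast
  have xa': "x \<odot>\<^bsub>G\<^esub> a' \<in> S t" using generator_shift[OF g family a'(1)] by simp
  note c = S_carrier[OF xa'] S_carrier[OF ab(2)] S_carrier[OF a'(1)]
  have "D (x \<odot>\<^bsub>G\<^esub> a' \<ominus>\<^bsub>G\<^esub> b) = \<zero>\<^bsub>G\<^esub>" using c x ab a' by (simp add: D_diff D_smult)
  then obtain b' where b': "b' \<in> S t" "x \<odot>\<^bsub>G\<^esub> a' \<ominus>\<^bsub>G\<^esub> b = D b'"
    using right S_diff[OF xa' ab(2)] unfolding acyclic_at_def by blast
  have "b = x \<odot>\<^bsub>G\<^esub> a' \<ominus>\<^bsub>G\<^esub> D b'" using c unfolding b'(2)[symmetric] by (simp add: minus_minus_cancel)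
  then have "h = cone_diff G x D (interleave a' b')"
    unfolding cone_diff_def using a'(2) by (intro interleave_eqI) (auto simp: a_def b_def)
  then show "\<exists>w \<in> cone_family \<delta> S t. h = cone_diff G x D w" using a' b' by (intro bexI) auto
qed

section \<open>Comparison of a complex with a subcomplex\<close>

definition quotient_acyclic ::
    "('a, 'b) module \<Rightarrow> ('b \<Rightarrow> 'b) \<Rightarrow> (int \<Rightarrow> 'b set) \<Rightarrow> (int \<Rightarrow> 'b set) \<Rightarrow> bool" where
  "quotient_acyclic G D S' S \<longleftrightarrow>
     (\<forall>t. \<forall>k \<in> S t. D k \<in> S' t \<longrightarrow> (\<exists>l \<in> S t. k \<ominus>\<^bsub>G\<^esub> D l \<in> S' t))"

text \<open>Like \<open>quotient_acyclic\<close>, this speaks about the quotient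
  \<open>S / S'\<close> through representatives: acyclicity there, bijectivity of multiplication by
  \<open>x\<close> here. No module of cosets has to be built and coned.\<close>

definition quotient_bijective ::
    "('a, 'b) module \<Rightarrow> 'a \<times> nat \<Rightarrow> (int \<Rightarrow> 'b set) \<Rightarrow> (int \<Rightarrow> 'b set) \<Rightarrow> bool" where
  "quotient_bijective G g S' S \<longleftrightarrow> (case g of (x, \<delta>) \<Rightarrow>
     (\<forall>t. \<forall>z \<in> S t. x \<odot>\<^bsub>G\<^esub> z \<in> S' (t + int \<delta>) \<longrightarrow> z \<in> S' t) \<and>
     (\<forall>t. \<forall>z \<in> S t. \<exists>w \<in> S (t - int \<delta>). z \<ominus>\<^bsub>G\<^esub> x \<odot>\<^bsub>G\<^esub> w \<in> S' t))"

text \<open>The inclusion is a quasi-isomorphism. A cocycle of \<open>S\<close> is moved into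
  \<open>S'\<close> by a boundary; conversely a primitive in \<open>S\<close> of an element of
  \<open>S'\<close> is a cocycle modulo \<open>S'\<close>, so a boundary corrects it to a primitive
  in \<open>S'\<close>.\<close>

lemma acyclic_at_quotient_acyclic:
  assumes "differential_family R A G X D S" "differential_family R A G X D S'"
    and sub: "S' \<le> S" and q: "quotient_acyclic G D S' S"
  shows "acyclic_at G D S' t \<longleftrightarrow> acyclic_at G D S t"
proof -
  interpret differential_family R A G X D S by fact
  interpret S': differential_family R A G X D S' by fact
  have sub: "a \<in> S' t \<Longrightarrow> a \<in> S t" for a using sub by (auto simp: le_fun_def)
  show ?thesis
  proof
    assume L: "acyclic_at G D S' t"
    show "acyclic_at G D S t"
      unfolding acyclic_at_def
    proof (intro ballI impI)
      fix z assume z: "z \<in> S t" "D z = \<zero>\<^bsub>G\<^esub>"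
      obtain l where l: "l \<in> S t" "z \<ominus>\<^bsub>G\<^esub> D l \<in> S' t"
        using q z S'.S_zero unfolding quotient_acyclic_def by metis
      note c = S_carrier[OF z(1)] S_carrier[OF l(1)] D_closed[OF S_carrier[OF l(1)]]
      have "D (z \<ominus>\<^bsub>G\<^esub> D l) = \<zero>\<^bsub>G\<^esub>" using c z by (simp add: a_minus_def D_add D_minus D_D)
      then obtain w where w: "w \<in> S' t" "z \<ominus>\<^bsub>G\<^esub> D l = D w"
        using L l unfolding acyclic_at_def by blast
      have "D (w \<oplus>\<^bsub>G\<^esub> l) = D w \<oplus>\<^bsub>G\<^esub> D l" using c S'.S_carrier[OF w(1)] by (simp add: D_add)
      also have "\<dots> = z" using c unfolding w(2)[symmetric] by (simp add: M.diff_add_cancel)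
      finally show "\<exists>w \<in> S t. z = D w" using S_add[OF sub[OF w(1)] l(1)] by metis
    qed
  next
    assume L: "acyclic_at G D S t"
    show "acyclic_at G D S' t"
      unfolding acyclic_at_def
    proof (intro ballI impI)
      fix z assume z: "z \<in> S' t" "D z = \<zero>\<^bsub>G\<^esub>"
      then obtain k where k: "k \<in> S t" "z = D k" using L sub unfolding acyclic_at_def by blast
      then obtain l where l: "l \<in> S t" "k \<ominus>\<^bsub>G\<^esub> D l \<in> S' t"
        using q z unfolding quotient_acyclic_def by blast
      note c = S_carrier[OF k(1)] S_carrier[OF l(1)] D_closed[OF S_carrier[OF l(1)]]
        D_closed[OF S_carrier[OF k(1)]]
      have "D (k \<ominus>\<^bsub>G\<^esub> D l) = z" using c k by (simp add: a_minus_def D_add D_minus D_D)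
      then show "\<exists>w \<in> S' t. z = D w" using l by metis
    qed
  qed
qed

lemma cone_family_mono: "S' \<le> S \<Longrightarrow> cone_family \<delta> S' \<le> cone_family \<delta> S"
  by (auto simp: le_fun_def subset_iff)

text \<open>The quotient of the cones is the cone of the quotient, so this is the argument of
  \<open>cone_acyclic_if_acyclic\<close> read modulo \<open>S'\<close>.\<close>

lemma quotient_acyclic_cone:
  fixes G :: "('a, nat \<Rightarrow> 'c) module"
  assumes "differential_family R A G X D S" "differential_family R A G X D S'"
    and sub: "S' \<le> S" and q: "quotient_acyclic G D S' S" and g: "is_generator A X (x, \<delta>)"
  shows "quotient_acyclic (cone_module G) (cone_diff G x D) (cone_family \<delta> S') (cone_family \<delta> S)"
  unfolding quotient_acyclic_def
proof (intro allI ballI impI)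
  interpret differential_family R A G X D S by fact
  interpret S': differential_family R A G X D S' by fact
  have x: "x \<in> carrier R" by (rule generator_carrier[OF g])
  fix t k assume k: "k \<in> cone_family \<delta> S t" "cone_diff G x D k \<in> cone_family \<delta> S' t"
  define a b where "a = left_half k" and "b = right_half k"
  have ab: "a \<in> S (t - int \<delta>)" "b \<in> S t" "D a \<in> S' (t - int \<delta>)" "x \<odot>\<^bsub>G\<^esub> a \<ominus>\<^bsub>G\<^esub> D b \<in> S' t"
    using k by (auto simp: a_def b_def cone_diff_def)
  obtain l where l: "l \<in> S (t - int \<delta>)" "a \<ominus>\<^bsub>G\<^esub> D l \<in> S' (t - int \<delta>)"
    using q ab unfolding quotient_acyclic_def by blast
  have xl: "x \<odot>\<^bsub>G\<^esub> l \<in> S t" using generator_shift[OF g family l(1)] by simp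
  have xs: "x \<odot>\<^bsub>G\<^esub> (a \<ominus>\<^bsub>G\<^esub> D l) \<in> S' t" using generator_shift[OF g S'.family l(2)] by simp
  note c = S_carrier[OF ab(1)] S_carrier[OF ab(2)] S_carrier[OF l(1)] S_carrier[OF xl]
    D_closed[OF S_carrier[OF l(1)]] D_closed[OF S_carrier[OF ab(2)]]
  have xa: "x \<odot>\<^bsub>G\<^esub> a \<in> carrier G" "x \<odot>\<^bsub>G\<^esub> D l \<in> carrier G" using x c by auto
  \<comment> \<open>The computation shows that \<open>b - x l\<close> is a cocycle modulo
    \<open>S'\<close>.\<close>
  have "x \<odot>\<^bsub>G\<^esub> (a \<ominus>\<^bsub>G\<^esub> D l) \<ominus>\<^bsub>G\<^esub> (x \<odot>\<^bsub>G\<^esub> a \<ominus>\<^bsub>G\<^esub> D b)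
      = (x \<odot>\<^bsub>G\<^esub> a \<ominus>\<^bsub>G\<^esub> x \<odot>\<^bsub>G\<^esub> D l) \<ominus>\<^bsub>G\<^esub> (x \<odot>\<^bsub>G\<^esub> a \<ominus>\<^bsub>G\<^esub> D b)"
    using c x by (simp add: smult_diff)
  also have "\<dots> = (x \<odot>\<^bsub>G\<^esub> a \<ominus>\<^bsub>G\<^esub> x \<odot>\<^bsub>G\<^esub> a) \<oplus>\<^bsub>G\<^esub> (D b \<ominus>\<^bsub>G\<^esub> x \<odot>\<^bsub>G\<^esub> D l)"
    using c(6) xa by (simp add: a_minus_def M.minus_add M.a_ac)
  also have "\<dots> = D b \<ominus>\<^bsub>G\<^esub> x \<odot>\<^bsub>G\<^esub> D l" using c(6) xa by (simp add: a_minus_def M.r_neg)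
  also have "\<dots> = D (b \<ominus>\<^bsub>G\<^esub> x \<odot>\<^bsub>G\<^esub> l)" using c x by (simp add: D_diff D_smult)
  finally have "D (b \<ominus>\<^bsub>G\<^esub> x \<odot>\<^bsub>G\<^esub> l) \<in> S' t" using S'.S_diff[OF xs ab(4)] by simp
  then obtain m where m: "m \<in> S t" "(b \<ominus>\<^bsub>G\<^esub> x \<odot>\<^bsub>G\<^esub> l) \<ominus>\<^bsub>G\<^esub> D m \<in> S' t"
    using q S_diff[OF ab(2) xl] unfolding quotient_acyclic_def by blast
  note c' = S_carrier[OF m(1)] D_closed[OF S_carrier[OF m(1)]]
  \<comment> \<open>The cone differential subtracts \<open>D\<close> of the right half; with
    \<open>- m\<close> there, the right half of the difference becomes
    \<open>b - x l - D m\<close>.\<close>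
  define w where "w = interleave l (\<ominus>\<^bsub>G\<^esub> m)"
  have w: "w \<in> cone_family \<delta> S t" using l m S_minus by (simp add: w_def)
  have wc: "w \<in> carrier (cone_module G)" using c c' by (simp add: w_def)
  have dw: "cone_diff G x D w \<in> carrier (cone_module G)"
    using c c' x D_closed by (simp add: cone_diff_def w_def)
  have "k \<ominus>\<^bsub>cone_module G\<^esub> cone_diff G x D w \<in> cone_family \<delta> S' t"
  proof -
    have kc: "k \<in> carrier (cone_module G)" using c by (simp add: a_def b_def)
    have r: "b \<ominus>\<^bsub>G\<^esub> (x \<odot>\<^bsub>G\<^esub> l \<ominus>\<^bsub>G\<^esub> D (\<ominus>\<^bsub>G\<^esub> m)) = (b \<ominus>\<^bsub>G\<^esub> x \<odot>\<^bsub>G\<^esub> l) \<ominus>\<^bsub>G\<^esub> D m"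
      using c c' by (simp add: a_minus_def D_minus M.minus_add M.a_assoc)
    show ?thesis
      using m(2) l(2) r[symmetric]
      unfolding cone_module_minus[OF module_G kc dw] by (simp add: cone_diff_def w_def a_def b_def)
  qed
  then show "\<exists>l \<in> cone_family \<delta> S t. k \<ominus>\<^bsub>cone_module G\<^esub> cone_diff G x D l \<in> cone_family \<delta> S' t"
    using w by blast
qed

text \<open>The cone of an isomorphism is acyclic. Surjectivity modulo \<open>S'\<close> gives
  \<open>w\<close> with \<open>x w\<close> congruent to \<open>b\<close>, and the primitive is
  \<open>(w, 0)\<close>: injectivity applies to \<open>a - D w\<close> because
  \<open>x (a - D w)\<close> equals \<open>(x a - D b) + D (b - x w)\<close>.\<close>

lemma quotient_acyclic_cone_bijective:
  fixes G :: "('a, nat \<Rightarrow> 'c) module"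
  assumes "differential_family R A G X D S" "differential_family R A G X D S'"
    and sub: "S' \<le> S" and bij: "quotient_bijective G (x, \<delta>) S' S" and g: "is_generator A X (x, \<delta>)"
  shows "quotient_acyclic (cone_module G) (cone_diff G x D) (cone_family \<delta> S') (cone_family \<delta> S)"
  unfolding quotient_acyclic_def
proof (intro allI ballI impI)
  interpret differential_family R A G X D S by fact
  interpret S': differential_family R A G X D S' by fact
  have x: "x \<in> carrier R" by (rule generator_carrier[OF g])
  fix t k assume k: "k \<in> cone_family \<delta> S t" "cone_diff G x D k \<in> cone_family \<delta> S' t"
  define a b where "a = left_half k" and "b = right_half k"
  have ab: "a \<in> S (t - int \<delta>)" "b \<in> S t" "D a \<in> S' (t - int \<delta>)" "x \<odot>\<^bsub>G\<^esub> a \<ominus>\<^bsub>G\<^esub> D b \<in> S' t"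
    using k by (auto simp: a_def b_def cone_diff_def)
  obtain w where w: "w \<in> S (t - int \<delta>)" "b \<ominus>\<^bsub>G\<^esub> x \<odot>\<^bsub>G\<^esub> w \<in> S' t"
    using bij ab(2) unfolding quotient_bijective_def by blast
  have Dw: "D w \<in> S (t - int \<delta>)" using D_S[OF w(1)] .
  have aDw: "a \<ominus>\<^bsub>G\<^esub> D w \<in> S (t - int \<delta>)" using S_diff[OF ab(1) Dw] .
  note c = S_carrier[OF ab(1)] S_carrier[OF ab(2)] S_carrier[OF w(1)] S_carrier[OF Dw]
    D_closed[OF S_carrier[OF ab(2)]]
  have xc: "x \<odot>\<^bsub>G\<^esub> a \<in> carrier G" "x \<odot>\<^bsub>G\<^esub> w \<in> carrier G" "x \<odot>\<^bsub>G\<^esub> D w \<in> carrier G" using x c by auto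
  have "(x \<odot>\<^bsub>G\<^esub> a \<ominus>\<^bsub>G\<^esub> D b) \<oplus>\<^bsub>G\<^esub> D (b \<ominus>\<^bsub>G\<^esub> x \<odot>\<^bsub>G\<^esub> w)
      = ((x \<odot>\<^bsub>G\<^esub> a \<ominus>\<^bsub>G\<^esub> D b) \<oplus>\<^bsub>G\<^esub> D b) \<ominus>\<^bsub>G\<^esub> x \<odot>\<^bsub>G\<^esub> D w"
    using c x xc by (simp add: a_minus_def D_add D_minus D_smult M.a_assoc)
  also have "\<dots> = x \<odot>\<^bsub>G\<^esub> (a \<ominus>\<^bsub>G\<^esub> D w)"
    using c x xc by (simp add: M.diff_add_cancel smult_diff)
  finally have "x \<odot>\<^bsub>G\<^esub> (a \<ominus>\<^bsub>G\<^esub> D w) \<in> S' (t - int \<delta> + int \<delta>)"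
    using S'.S_add[OF ab(4) S'.D_S[OF w(2)]] by simp
  then have "a \<ominus>\<^bsub>G\<^esub> D w \<in> S' (t - int \<delta>)"
    using bij aDw unfolding quotient_bijective_def by blast
  moreover have "k \<ominus>\<^bsub>cone_module G\<^esub> cone_diff G x D (interleave w \<zero>\<^bsub>G\<^esub>)
      = interleave (a \<ominus>\<^bsub>G\<^esub> D w) (b \<ominus>\<^bsub>G\<^esub> x \<odot>\<^bsub>G\<^esub> w)"
  proof -
    have e: "cone_diff G x D (interleave w \<zero>\<^bsub>G\<^esub>) = interleave (D w) (x \<odot>\<^bsub>G\<^esub> w)"
      using xc by (simp add: cone_diff_def D_zero a_minus_def)
    show ?thesis
      unfolding e using c xc by (subst cone_module_minus[OF module_G]) (auto simp: a_def b_def)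
  qed
  ultimately show "\<exists>l \<in> cone_family \<delta> S t. k \<ominus>\<^bsub>cone_module G\<^esub> cone_diff G x D l \<in> cone_family \<delta> S' t"
    using w S_zero by (intro bexI[of _ "interleave w \<zero>\<^bsub>G\<^esub>"]) auto
qed

text \<open>Multiplication by \<open>y\<close> acts separately on the two halves. The fact carries
  bijectivity past the generators that precede \<open>y\<close> in a Koszul list.\<close>

lemma quotient_bijective_cone:
  fixes G :: "('a, nat \<Rightarrow> 'c) module"
  assumes "differential_family R A G X D S" and bij: "quotient_bijective G (y, \<epsilon>) S' S"
    and y: "y \<in> carrier R"
  shows "quotient_bijective (cone_module G) (y, \<epsilon>) (cone_family \<delta> S') (cone_family \<delta> S)"
  unfolding quotient_bijective_def split
proof (intro conjI allI ballI impI)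
  interpret differential_family R A G X D S by fact
  have inj: "w \<in> S' t" if "w \<in> S t" "y \<odot>\<^bsub>G\<^esub> w \<in> S' (t + int \<epsilon>)" for t w
    using bij that unfolding quotient_bijective_def split by blast
  have surj: "\<exists>w \<in> S (t - int \<epsilon>). u \<ominus>\<^bsub>G\<^esub> y \<odot>\<^bsub>G\<^esub> w \<in> S' t" if "u \<in> S t" for t u
    using bij that unfolding quotient_bijective_def split by blast
  fix t z assume z: "z \<in> cone_family \<delta> S t"
  {
    assume "y \<odot>\<^bsub>cone_module G\<^esub> z \<in> cone_family \<delta> S' (t + int \<epsilon>)"
    then have "y \<odot>\<^bsub>G\<^esub> left_half z \<in> S' (t - int \<delta> + int \<epsilon>)" "y \<odot>\<^bsub>G\<^esub> right_half z \<in> S' (t + int \<epsilon>)"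
      by (simp_all add: algebra_simps)
    then show "z \<in> cone_family \<delta> S' t" using inj z by simp
  }
  obtain u where u: "u \<in> S (t - int \<delta> - int \<epsilon>)" "left_half z \<ominus>\<^bsub>G\<^esub> y \<odot>\<^bsub>G\<^esub> u \<in> S' (t - int \<delta>)"
    using surj[of "left_half z" "t - int \<delta>"] z by auto
  obtain v where v: "v \<in> S (t - int \<epsilon>)" "right_half z \<ominus>\<^bsub>G\<^esub> y \<odot>\<^bsub>G\<^esub> v \<in> S' t"
    using surj[of "right_half z" t] z by auto
  have "z \<ominus>\<^bsub>cone_module G\<^esub> y \<odot>\<^bsub>cone_module G\<^esub> interleave u v
      = interleave (left_half z \<ominus>\<^bsub>G\<^esub> y \<odot>\<^bsub>G\<^esub> u) (right_half z \<ominus>\<^bsub>G\<^esub> y \<odot>\<^bsub>G\<^esub> v)"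
    using z S_carrier S_carrier[OF u(1)] S_carrier[OF v(1)] y
    by (subst cone_module_minus[OF module_G]) auto
  then show "\<exists>w \<in> cone_family \<delta> S (t - int \<epsilon>). z \<ominus>\<^bsub>cone_module G\<^esub> y \<odot>\<^bsub>cone_module G\<^esub> w \<in> cone_family \<delta> S' t"
    using u v by (intro bexI[of _ "interleave u v"]) (auto simp: algebra_simps)
qed

lemma torsion_family_cone:
  fixes G :: "('a, nat \<Rightarrow> 'c) module"
  assumes "differential_family R A G X D S" and tors: "torsion_family R G S y" and y: "y \<in> carrier R"
  shows "torsion_family R (cone_module G) (cone_family \<delta> S) y"
  unfolding torsion_family_def
proof (intro allI ballI)
  interpret differential_family R A G X D S by fact
  fix t z assume z: "z \<in> cone_family \<delta> S t"
  have c: "left_half z \<in> carrier G" "right_half z \<in> carrier G" using z S_carrier by auto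
  obtain i j :: nat where ij: "(y [^]\<^bsub>R\<^esub> i) \<odot>\<^bsub>G\<^esub> left_half z = \<zero>\<^bsub>G\<^esub>" "(y [^]\<^bsub>R\<^esub> j) \<odot>\<^bsub>G\<^esub> right_half z = \<zero>\<^bsub>G\<^esub>"
    using tors z unfolding torsion_family_def by (metis cone_family_iff)
  have "(y [^]\<^bsub>R\<^esub> (i + j)) \<odot>\<^bsub>G\<^esub> left_half z = (y [^]\<^bsub>R\<^esub> j) \<odot>\<^bsub>G\<^esub> ((y [^]\<^bsub>R\<^esub> i) \<odot>\<^bsub>G\<^esub> left_half z)"
    using y c by (simp add: smult_assoc1[symmetric] nat_pow_mult add.commute)
  moreover have "(y [^]\<^bsub>R\<^esub> (i + j)) \<odot>\<^bsub>G\<^esub> right_half z = (y [^]\<^bsub>R\<^esub> i) \<odot>\<^bsub>G\<^esub> ((y [^]\<^bsub>R\<^esub> j) \<odot>\<^bsub>G\<^esub> right_half z)"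
    using y c by (simp add: smult_assoc1[symmetric] nat_pow_mult)
  ultimately have "(y [^]\<^bsub>R\<^esub> (i + j)) \<odot>\<^bsub>cone_module G\<^esub> z = \<zero>\<^bsub>cone_module G\<^esub>"
    using ij y by simp
  then show "\<exists>k :: nat. (y [^]\<^bsub>R\<^esub> k) \<odot>\<^bsub>cone_module G\<^esub> z = \<zero>\<^bsub>cone_module G\<^esub>" by blast
qed

text \<open>The Koszul complex is not built as an object: the head of the list is coned off first,
  and the remaining entries act on that cone, which has the same type. Only acyclicity on the ray
  from \<open>t0\<close> is recorded.\<close>

fun koszul_acyclic ::
    "('a \<times> nat) list \<Rightarrow> ('a, nat \<Rightarrow> 'c) module \<Rightarrow> ((nat \<Rightarrow> 'c) \<Rightarrow> nat \<Rightarrow> 'c) \<Rightarrow>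
      (int \<Rightarrow> (nat \<Rightarrow> 'c) set) \<Rightarrow> int \<Rightarrow> bool" where
  "koszul_acyclic [] G D S t0 \<longleftrightarrow> (\<forall>t \<ge> t0. acyclic_at G D S t)"
| "koszul_acyclic ((x, \<delta>) # gs) G D S t0 \<longleftrightarrow>
     koszul_acyclic gs (cone_module G) (cone_diff G x D) (cone_family \<delta> S) t0"

text \<open>Each cone moves the threshold up by the degree of its generator, which accumulates to
  the sum of the degrees. Torsion supplies the way back from the cone to the complex and is itself
  inherited by cones.\<close>

theorem koszul_acyclic_torsion:
  fixes G :: "('a, nat \<Rightarrow> 'c) module"
  assumes "differential_family R A G X D S"
    and "\<forall>g \<in> set gs. is_generator A X g \<and> torsion_family R G S (fst g)"
  shows "koszul_acyclic gs G D S (t0 + int (sum_list (map snd gs))) \<longleftrightarrow> (\<forall>t \<ge> t0. acyclic_at G D S t)"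
  using assms
proof (induction gs arbitrary: G D S t0)
  case Nil
  then show ?case by simp
next
  case (Cons g gs)
  obtain x \<delta> where g: "g = (x, \<delta>)" by (cases g)
  note DF = Cons.prems(1)
  interpret differential_family R A G X D S by (rule DF)
  have gen: "is_generator A X (x, \<delta>)" using Cons.prems(2) g by auto
  note IH = Cons.IH[OF differential_family_cone[OF DF gen], of "t0 + int \<delta>"]
  have tors: "\<forall>g \<in> set gs. is_generator A X g \<and>
      torsion_family R (cone_module G) (cone_family \<delta> S) (fst g)"
  proof
    fix h assume h: "h \<in> set gs"
    then have "is_generator A X (fst h, snd h)" "torsion_family R G S (fst h)" using Cons.prems(2) by auto
    then show "is_generator A X h \<and> torsion_family R (cone_module G) (cone_family \<delta> S) (fst h)"
      using torsion_family_cone[OF DF] generator_carrier[of "fst h" "snd h"] by auto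
  qed
  have "koszul_acyclic (g # gs) G D S (t0 + int (sum_list (map snd (g # gs)))) \<longleftrightarrow>
      (\<forall>t \<ge> t0 + int \<delta>. acyclic_at (cone_module G) (cone_diff G x D) (cone_family \<delta> S) t)"
    using IH[OF tors] g by (simp add: add.assoc)
  also have "\<dots> \<longleftrightarrow> (\<forall>t \<ge> t0. acyclic_at G D S t)" (is "?L \<longleftrightarrow> ?R")
  proof
    assume ?L
    moreover have "torsion_family R G S x" using Cons.prems(2) g by auto
    ultimately show ?R using acyclic_if_cone_acyclic[OF DF gen] by blast
  next
    assume R: ?R
    show ?L
    proof (intro allI impI)
      fix t assume "t0 + int \<delta> \<le> t"
      then show "acyclic_at (cone_module G) (cone_diff G x D) (cone_family \<delta> S) t"
        using R by (intro cone_acyclic_if_acyclic[OF DF gen]) auto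
    qed
  qed
  finally show ?case .
qed

theorem koszul_acyclic_quotient_acyclic:
  fixes G :: "('a, nat \<Rightarrow> 'c) module"
  assumes "differential_family R A G X D S" "differential_family R A G X D S'" "S' \<le> S"
    and "\<forall>g \<in> set gs. is_generator A X g" and "quotient_acyclic G D S' S"
  shows "koszul_acyclic gs G D S' t0 \<longleftrightarrow> koszul_acyclic gs G D S t0"
  using assms
proof (induction gs arbitrary: G D S S')
  case Nil
  then show ?case using acyclic_at_quotient_acyclic by (metis koszul_acyclic.simps(1))
next
  case (Cons g gs)
  obtain x \<delta> where g: "g = (x, \<delta>)" by (cases g)
  have gen: "is_generator A X (x, \<delta>)" using Cons.prems(4) g by auto
  show ?case
    using Cons.IH[OF differential_family_cone[OF Cons.prems(1) gen] differential_family_cone[OF Cons.prems(2) gen]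
        cone_family_mono[OF Cons.prems(3)] _ quotient_acyclic_cone[OF Cons.prems(1,2,3,5) gen]]
      Cons.prems(4) g by simp
qed

text \<open>Bijectivity of \<open>h\<close> survives the cones that precede it in the list; at
  \<open>h\<close> the quotient of the cones becomes acyclic, and the later cones preserve
  that.\<close>

theorem koszul_acyclic_quotient_bijective:
  fixes G :: "('a, nat \<Rightarrow> 'c) module"
  assumes "differential_family R A G X D S" "differential_family R A G X D S'" "S' \<le> S"
    and "\<forall>g \<in> set gs. is_generator A X g" and "h \<in> set gs" and "quotient_bijective G h S' S"
  shows "koszul_acyclic gs G D S' t0 \<longleftrightarrow> koszul_acyclic gs G D S t0"
  using assms
proof (induction gs arbitrary: G D S S')
  case Nil
  then show ?case by simp
next
  case (Cons g gs)
  obtain x \<delta> where g: "g = (x, \<delta>)" by (cases g)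
  have gen: "is_generator A X (x, \<delta>)" using Cons.prems(4) g by auto
  note DF = Cons.prems(1,2)
  note cone = differential_family_cone[OF DF(1) gen] differential_family_cone[OF DF(2) gen]
    cone_family_mono[OF Cons.prems(3), of \<delta>]
  interpret differential_family R A G X D S by (rule DF(1))
  show ?case
  proof (cases "h = g")
    case True
    then have "quotient_bijective G (x, \<delta>) S' S" using Cons.prems(6) g by simp
    from koszul_acyclic_quotient_acyclic[OF cone _ quotient_acyclic_cone_bijective[OF DF Cons.prems(3) this gen]]
    show ?thesis using Cons.prems(4) g by simp
  next
    case False
    then have h: "h \<in> set gs" using Cons.prems(5) by simp
    then have "is_generator A X (fst h, snd h)" using Cons.prems(4) by simp
    then have "fst h \<in> carrier R" by (rule generator_carrier)
    then have "quotient_bijective (cone_module G) h (cone_family \<delta> S') (cone_family \<delta> S)"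
      using quotient_bijective_cone[OF DF(1), of "fst h" "snd h" S'] Cons.prems(6) by simp
    from Cons.IH[OF cone _ h this] show ?thesis using Cons.prems(4) g by simp
  qed
qed

text \<open>A cone is an extension: the elements with left half zero form the subobject, the left
  halves the quotient. The index of \<open>f2\<close> is moved by \<open>\<delta>\<close> to undo
  the shift of the left half.\<close>

lemma acc_cone:
  fixes G :: "('a, nat \<Rightarrow> 'c) module"
  assumes "differential_family R A G X D S" and acc: "acc A X G S"
  shows "acc A X (cone_module G) (cone_family \<delta> S)"
proof -
  interpret differential_family R A G X D S by fact
  have C: "module R (cone_module G)" by (rule module_cone_module[OF module_G])
  define f1 where "f1 Z t = {b. interleave \<zero>\<^bsub>G\<^esub> b \<in> Z t}" for Z :: "int \<Rightarrow> (nat \<Rightarrow> 'c) set" and t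
  define f2 where "f2 Z t = {a. \<exists>b. interleave a b \<in> Z (t + int \<delta>)}"
    for Z :: "int \<Rightarrow> (nat \<Rightarrow> 'c) set" and t
  show ?thesis
  proof (rule acc_joint[OF acc acc, where ?f1.0 = f1 and ?f2.0 = f2])
    fix Z assume Z: "graded_family A X (cone_module G) Z" "Z \<le> cone_family \<delta> S"
    note ZD = graded_familyD[OF Z(1)]
    have sub: "h \<in> cone_family \<delta> S t" if "h \<in> Z t" for h t using Z(2) that unfolding le_fun_def by blast
    have "graded_family A X G (f1 Z)"
    proof (intro graded_familyI)
      fix t a assume "a \<in> f1 Z t"
      then show "a \<in> carrier G" using ZD(1) by (fastforce simp: f1_def)
    next
      fix t show "\<zero>\<^bsub>G\<^esub> \<in> f1 Z t" using ZD(2)[of t] by (simp add: f1_def)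
    next
      fix t a b assume "a \<in> f1 Z t" "b \<in> f1 Z t"
      then show "a \<oplus>\<^bsub>G\<^esub> b \<in> f1 Z t" using ZD(3)[of "interleave \<zero>\<^bsub>G\<^esub> a" t "interleave \<zero>\<^bsub>G\<^esub> b"]
        by (simp add: f1_def)
    next
      fix t r a assume "r \<in> A" "a \<in> f1 Z t"
      then show "r \<odot>\<^bsub>G\<^esub> a \<in> f1 Z t"
        using ZD(4)[of r "interleave \<zero>\<^bsub>G\<^esub> a" t] A_carrier[of r] by (simp add: f1_def)
    next
      fix t r a assume "r \<in> X" "a \<in> f1 Z t"
      then show "r \<odot>\<^bsub>G\<^esub> a \<in> f1 Z (t + 1)"
        using ZD(5)[of r "interleave \<zero>\<^bsub>G\<^esub> a" t] X_carrier by (simp add: f1_def subset_iff)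
    qed
    moreover have "f1 Z \<le> S" using sub by (fastforce simp: f1_def le_fun_def)
    ultimately show "graded_family A X G (f1 Z) \<and> f1 Z \<le> S" ..
    have "graded_family A X G (f2 Z)"
    proof (intro graded_familyI)
      fix t a assume "a \<in> f2 Z t"
      then show "a \<in> carrier G" using ZD(1) by (fastforce simp: f2_def)
    next
      fix t show "\<zero>\<^bsub>G\<^esub> \<in> f2 Z t" using ZD(2)[of "t + int \<delta>"] by (auto simp: f2_def)
    next
      fix t a b assume "a \<in> f2 Z t" "b \<in> f2 Z t"
      then obtain a' b' where "interleave a a' \<in> Z (t + int \<delta>)" "interleave b b' \<in> Z (t + int \<delta>)"
        by (auto simp: f2_def)
      then show "a \<oplus>\<^bsub>G\<^esub> b \<in> f2 Z t"
        using ZD(3)[of "interleave a a'" "t + int \<delta>" "interleave b b'"] by (auto simp: f2_def)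
    next
      fix t r a assume r: "r \<in> A" and "a \<in> f2 Z t"
      then obtain a' where "interleave a a' \<in> Z (t + int \<delta>)" by (auto simp: f2_def)
      then show "r \<odot>\<^bsub>G\<^esub> a \<in> f2 Z t"
        using ZD(4)[of r "interleave a a'" "t + int \<delta>"] r by (auto simp: f2_def)
    next
      fix t r a assume r: "r \<in> X" and "a \<in> f2 Z t"
      then obtain a' where "interleave a a' \<in> Z (t + int \<delta>)" by (auto simp: f2_def)
      then have "interleave (r \<odot>\<^bsub>G\<^esub> a) (r \<odot>\<^bsub>G\<^esub> a') \<in> Z (t + 1 + int \<delta>)"
        using ZD(5)[of r "interleave a a'" "t + int \<delta>"] r by (simp add: algebra_simps)
      then show "r \<odot>\<^bsub>G\<^esub> a \<in> f2 Z (t + 1)" by (auto simp: f2_def)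
    qed
    moreover have "f2 Z \<le> S" using sub by (fastforce simp: f2_def le_fun_def)
    ultimately show "graded_family A X G (f2 Z) \<and> f2 Z \<le> S" ..
  next
    fix Z Z' :: "int \<Rightarrow> (nat \<Rightarrow> 'c) set"
    assume "Z \<le> Z'"
    then have "Z t \<subseteq> Z' t" for t by (simp add: le_fun_def)
    then show "f1 Z \<le> f1 Z'" "f2 Z \<le> f2 Z'" unfolding f1_def f2_def le_fun_def by blast+
  next
    fix Z Z' assume Z: "graded_family A X (cone_module G) Z" and Z': "graded_family A X (cone_module G) Z'"
      and ZZ: "Z \<le> Z'" and sub: "Z' \<le> cone_family \<delta> S" and e1: "f1 Z = f1 Z'" and e2: "f2 Z = f2 Z'"
    show "Z' \<le> Z"
    proof (rule le_funI, rule subsetI)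
      fix t z assume z: "z \<in> Z' t"
      have zc: "z \<in> carrier (cone_module G)" using graded_familyD(1)[OF Z' z] .
      have "left_half z \<in> f2 Z' (t - int \<delta>)" using z by (auto simp: f2_def intro: exI[of _ "right_half z"])
      then have "left_half z \<in> f2 Z (t - int \<delta>)" using e2 by simp
      then obtain b where b: "interleave (left_half z) b \<in> Z t" by (auto simp: f2_def)
      then have bZ': "interleave (left_half z) b \<in> Z' t" using ZZ unfolding le_fun_def by blast
      note bc = graded_familyD(1)[OF Z' bZ']
      have e: "z \<ominus>\<^bsub>cone_module G\<^esub> interleave (left_half z) b = interleave \<zero>\<^bsub>G\<^esub> (right_half z \<ominus>\<^bsub>G\<^esub> b)"
        unfolding cone_module_minus[OF module_G zc bc] using zc by (simp add: a_minus_def M.r_neg)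
      have "right_half z \<ominus>\<^bsub>G\<^esub> b \<in> f1 Z' t"
        using family_diff[OF C Z' z bZ'] unfolding e f1_def by simp
      then have "z \<ominus>\<^bsub>cone_module G\<^esub> interleave (left_half z) b \<in> Z t"
        unfolding e using e1 by (simp add: f1_def fun_eq_iff set_eq_iff)
      then show "z \<in> Z t" using family_diff_cancel[OF C Z _ b zc] by blast
    qed
  qed
qed

section \<open>Nakayama's lemma for the cone of a degree-zero element\<close>

lemma acc_maximal:
  assumes acc: "acc A X G S"
    and P: "\<And>Z. P Z \<Longrightarrow> graded_family A X G Z \<and> Z \<le> S" and Z0: "P Z0"
  shows "\<exists>Z. P Z \<and> (\<forall>Z'. P Z' \<and> Z \<le> Z' \<longrightarrow> Z' = Z)"
proof (rule ccontr)
  assume "\<not> ?thesis"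
  then have "\<forall>Z. \<exists>Z'. P Z \<longrightarrow> P Z' \<and> Z \<le> Z' \<and> Z' \<noteq> Z" by blast
  then obtain f where f: "\<And>Z. P Z \<Longrightarrow> P (f Z) \<and> Z \<le> f Z \<and> f Z \<noteq> Z" by metis
  define c where "c n = (f ^^ n) Z0" for n :: nat
  have c: "P (c n)" for n by (induction n) (auto simp: c_def Z0 f)
  have cS: "c (Suc n) = f (c n)" for n by (simp add: c_def)
  obtain N where N: "\<And>n. n \<ge> N \<Longrightarrow> c n = c N"
    using accD[OF acc, of c] P[OF c] f[OF c] cS by metis
  have "f (c N) = c N" using N[of "Suc N"] cS by simp
  with f[OF c] show False by blast
qed

text \<open>
  Nakayama's lemma: acyclicity of the cone makes every cocycle a multiple of \<open>y\<close> modulo boundaries,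
  which is impossible on the simple quotient by a maximal submodule \<open>W\<close> between the boundaries \<open>B\<close>
  and the cocycles \<open>Z\<close>.
\<close>

lemma acyclic_if_cone_acyclic_local:
  fixes G :: "('a, nat \<Rightarrow> 'c) module"
  assumes "differential_family R A G X D S" and acc: "acc A X G S"
    and y: "y \<in> A" and unit: "\<And>r. r \<in> A \<Longrightarrow> \<exists>u \<in> A. u \<otimes>\<^bsub>R\<^esub> (\<one>\<^bsub>R\<^esub> \<ominus>\<^bsub>R\<^esub> r \<otimes>\<^bsub>R\<^esub> y) = \<one>\<^bsub>R\<^esub>"
    and cone: "acyclic_at (cone_module G) (cone_diff G y D) (cone_family 0 S) t"
  shows "acyclic_at G D S t"
proof -
  interpret differential_family R A G X D S by fact
  have yR: "y \<in> carrier R" using A_carrier[OF y] .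
  define Z where "Z = {z \<in> S t. D z = \<zero>\<^bsub>G\<^esub>}"
  define B where "B = D ` S t"
  have Zc: "z \<in> Z \<Longrightarrow> z \<in> carrier G" for z using S_carrier by (auto simp: Z_def)
  have Z_add: "a \<oplus>\<^bsub>G\<^esub> b \<in> Z" if "a \<in> Z" "b \<in> Z" for a b
    using that S_add S_carrier by (auto simp: Z_def D_add)
  have Z_smult: "r \<odot>\<^bsub>G\<^esub> a \<in> Z" if "a \<in> Z" "r \<in> A" for a r
    using that S_smult S_carrier A_carrier by (auto simp: Z_def D_smult)
  \<comment> \<open>The pair \<open>(0, z)\<close> is a cocycle of the cone. The left half of a
    primitive is a cocycle \<open>a\<close>, and the right half gives
    \<open>z = y a - D b\<close>.\<close>
  have Zdecomp: "\<exists>a \<in> Z. \<exists>b \<in> S t. z = y \<odot>\<^bsub>G\<^esub> a \<ominus>\<^bsub>G\<^esub> D b" if z: "z \<in> Z" for z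
  proof -
    have "cone_diff G y D (interleave \<zero>\<^bsub>G\<^esub> z) = \<zero>\<^bsub>cone_module G\<^esub>"
      using z yR by (simp add: cone_diff_def Z_def D_zero a_minus_def)
    moreover have "interleave \<zero>\<^bsub>G\<^esub> z \<in> cone_family 0 S t" using z S_zero by (simp add: Z_def)
    ultimately obtain w where w: "w \<in> cone_family 0 S t" "interleave \<zero>\<^bsub>G\<^esub> z = cone_diff G y D w"
      using cone unfolding acyclic_at_def by blast
    then show ?thesis by (auto simp: cone_diff_def Z_def)
  qed
  \<comment> \<open>The chain condition concerns graded families, the argument only degree
    \<open>t\<close>. An \<open>A\<close>-submodule \<open>W\<close> in degree \<open>t\<close> is
    completed by zero below and by all of \<open>S\<close> above, which makes closure under
    \<open>X\<close> automatic.\<close>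
  define F where "F W s = (if s < t then {\<zero>\<^bsub>G\<^esub>} else if s = t then W else S s)" for W s
  have F_t [simp]: "F W t = W" for W by (simp add: F_def)
  define good where "good W \<longleftrightarrow> B \<subseteq> W \<and> W \<subseteq> Z \<and>
      (\<forall>a \<in> W. \<forall>b \<in> W. a \<oplus>\<^bsub>G\<^esub> b \<in> W) \<and> (\<forall>r \<in> A. \<forall>a \<in> W. r \<odot>\<^bsub>G\<^esub> a \<in> W)" for W
  have zeroB: "\<zero>\<^bsub>G\<^esub> \<in> B" using S_zero D_zero unfolding B_def by (metis imageI)
  have good_F: "graded_family A X G (F W) \<and> F W \<le> S" if W: "good W" for W
  proof
    have WS: "W \<subseteq> S t" using W by (auto simp: good_def Z_def)
    show "F W \<le> S" using WS S_zero by (auto simp: F_def le_fun_def)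
    show "graded_family A X G (F W)"
    proof (intro graded_familyI)
      fix s a assume "a \<in> F W s"
      then show "a \<in> carrier G" using S_carrier WS by (auto simp: F_def split: if_splits)
    next
      fix s show "\<zero>\<^bsub>G\<^esub> \<in> F W s" using zeroB W S_zero by (auto simp: F_def good_def)
    next
      fix s a b assume "a \<in> F W s" "b \<in> F W s"
      then show "a \<oplus>\<^bsub>G\<^esub> b \<in> F W s" using W S_add by (auto simp: F_def good_def split: if_splits)
    next
      fix s r a assume "r \<in> A" "a \<in> F W s"
      then show "r \<odot>\<^bsub>G\<^esub> a \<in> F W s"
        using W S_smult A_carrier by (auto simp: F_def good_def split: if_splits)
    next
      fix s x a assume x: "x \<in> X" and a: "a \<in> F W s"
      then have xc: "x \<in> carrier R" using X_carrier by blast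
      consider "s < t" | "s \<ge> t" by linarith
      then show "x \<odot>\<^bsub>G\<^esub> a \<in> F W (s + 1)"
      proof cases
        case 1
        then have "x \<odot>\<^bsub>G\<^esub> a = \<zero>\<^bsub>G\<^esub>" using a xc by (simp add: F_def)
        then show ?thesis using zeroB W S_zero by (auto simp: F_def good_def)
      next
        case 2
        then have "a \<in> S s" using a WS by (auto simp: F_def split: if_splits)
        then show ?thesis using S_shift[OF x] 2 by (auto simp: F_def)
      qed
    qed
  qed
  have good_B: "good B"
    unfolding good_def
  proof (intro conjI ballI)
    show "B \<subseteq> Z" using D_S D_D S_carrier by (auto simp: B_def Z_def)
  next
    fix a b assume "a \<in> B" "b \<in> B"
    then obtain u v where "u \<in> S t" "v \<in> S t" "a = D u" "b = D v" by (auto simp: B_def)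
    then have "a \<oplus>\<^bsub>G\<^esub> b = D (u \<oplus>\<^bsub>G\<^esub> v)" "u \<oplus>\<^bsub>G\<^esub> v \<in> S t" using S_carrier S_add by (auto simp: D_add)
    then show "a \<oplus>\<^bsub>G\<^esub> b \<in> B" by (simp add: B_def)
  next
    fix r a assume r: "r \<in> A" and "a \<in> B"
    then obtain u where "u \<in> S t" "a = D u" by (auto simp: B_def)
    then have "r \<odot>\<^bsub>G\<^esub> a = D (r \<odot>\<^bsub>G\<^esub> u)" "r \<odot>\<^bsub>G\<^esub> u \<in> S t"
      using S_carrier S_smult r A_carrier by (auto simp: D_smult)
    then show "r \<odot>\<^bsub>G\<^esub> a \<in> B" by (simp add: B_def)
  qed auto
  have "Z \<subseteq> B"
  proof (rule ccontr)
    assume "\<not> Z \<subseteq> B"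
    then have BZ: "B \<noteq> Z" by blast
    define P where "P F' \<longleftrightarrow> (\<exists>W. F' = F W \<and> good W \<and> W \<noteq> Z)" for F'
    have PF: "P (F W)" if "good W" "W \<noteq> Z" for W using that unfolding P_def by blast
    have "\<exists>F0. P F0 \<and> (\<forall>F'. P F' \<and> F0 \<le> F' \<longrightarrow> F' = F0)"
    proof (rule acc_maximal[OF acc, where P = P])
      show "P (F B)" using PF[OF good_B BZ] .
      fix F' assume "P F'"
      then show "graded_family A X G F' \<and> F' \<le> S" unfolding P_def using good_F by metis
    qed
    then obtain F0 where F0: "P F0" and max: "\<And>F'. P F' \<Longrightarrow> F0 \<le> F' \<Longrightarrow> F' = F0" by metis
    from F0 obtain W where W: "F0 = F W" "good W" "W \<noteq> Z" unfolding P_def by metis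
    have maxW: "W' = Z \<or> W' = W" if "good W'" "W \<subseteq> W'" for W'
    proof (rule ccontr)
      assume n: "\<not> ?thesis"
      have "F W \<le> F W'"
      proof (rule le_funI)
        fix s show "F W s \<subseteq> F W' s" using that(2) unfolding F_def by simp
      qed
      moreover have "P (F W')" using PF that(1) n by blast
      ultimately have "F W' = F W" using max[of "F W'"] W(1) by simp
      from fun_cong[OF this, of t] have "W' = W" unfolding F_t .
      then show False using n by blast
    qed
    have W_add: "a \<oplus>\<^bsub>G\<^esub> b \<in> W" if "a \<in> W" "b \<in> W" for a b using W(2) that by (simp add: good_def)
    have W_smult: "r \<odot>\<^bsub>G\<^esub> a \<in> W" if "r \<in> A" "a \<in> W" for r a using W(2) that by (simp add: good_def)
    have WZ: "W \<subseteq> Z" and BW: "B \<subseteq> W" using W(2) by (auto simp: good_def)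
    have Wc: "w \<in> W \<Longrightarrow> w \<in> carrier G" for w using WZ Zc by blast
    \<comment> \<open>This represents the kernel of \<open>y\<close> on \<open>Z / W\<close>. By
      maximality of \<open>W\<close> either it is everything, and then \<open>Z = y Z + B\<close>
      lies in \<open>W\<close>, or it is trivial, and then \<open>y\<close> is injective on
      \<open>Z / W\<close>.\<close>
    define W1 where "W1 = {w \<in> Z. y \<odot>\<^bsub>G\<^esub> w \<in> W}"
    have WW1: "W \<subseteq> W1" using WZ W_smult[OF y] by (auto simp: W1_def)
    have "good W1"
      unfolding good_def
    proof (intro conjI ballI)
      show "B \<subseteq> W1" using BW WW1 by blast
      show "W1 \<subseteq> Z" by (auto simp: W1_def)
    next
      fix a b assume "a \<in> W1" "b \<in> W1"
      then show "a \<oplus>\<^bsub>G\<^esub> b \<in> W1" using Z_add W_add Zc yR by (auto simp: W1_def smult_r_distr)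
    next
      fix r a assume r: "r \<in> A" and a: "a \<in> W1"
      have "y \<odot>\<^bsub>G\<^esub> (r \<odot>\<^bsub>G\<^esub> a) = r \<odot>\<^bsub>G\<^esub> (y \<odot>\<^bsub>G\<^esub> a)"
        using a Zc yR A_carrier[OF r] by (simp add: W1_def smult_assoc1[symmetric] m_comm)
      then show "r \<odot>\<^bsub>G\<^esub> a \<in> W1" using Z_smult W_smult r a by (auto simp: W1_def)
    qed
    then consider "W1 = Z" | "W1 = W" using maxW WW1 by blast
    then show False
    proof cases
      case 1
      have "z \<in> W" if z: "z \<in> Z" for z
      proof -
        obtain a b where ab: "a \<in> Z" "b \<in> S t" "z = y \<odot>\<^bsub>G\<^esub> a \<ominus>\<^bsub>G\<^esub> D b" using Zdecomp[OF z] by blast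
        have "z = y \<odot>\<^bsub>G\<^esub> a \<oplus>\<^bsub>G\<^esub> D (\<ominus>\<^bsub>G\<^esub> b)"
          using ab S_carrier D_minus by (simp add: a_minus_def)
        moreover have "D (\<ominus>\<^bsub>G\<^esub> b) \<in> W" using BW S_minus[OF ab(2)] by (auto simp: B_def)
        moreover have "y \<odot>\<^bsub>G\<^esub> a \<in> W" using 1 ab(1) by (auto simp: W1_def)
        ultimately show ?thesis using W_add by simp
      qed
      then show False using WZ W(3) by blast
    next
      case 2
      obtain z where z: "z \<in> Z" "z \<notin> W" using WZ W(3) by blast
      have yz: "y \<odot>\<^bsub>G\<^esub> z \<notin> W" using 2 z by (auto simp: W1_def)
      have zc: "z \<in> carrier G" "y \<odot>\<^bsub>G\<^esub> z \<in> carrier G" using Zc z yR by auto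
      \<comment> \<open>Since \<open>y z\<close> is outside \<open>W\<close>, maximality makes
        \<open>W\<close> and \<open>y z\<close> span \<open>Z\<close>. So
        \<open>z = w + r y z\<close>, that is, \<open>(1 - r y) z\<close> lies in \<open>W\<close>,
        and the unit hypothesis brings \<open>z\<close> itself into \<open>W\<close>.\<close>
      define W2 where "W2 = {w \<oplus>\<^bsub>G\<^esub> r \<odot>\<^bsub>G\<^esub> (y \<odot>\<^bsub>G\<^esub> z) | w r. w \<in> W \<and> r \<in> A}"
      have mem2: "w \<oplus>\<^bsub>G\<^esub> r \<odot>\<^bsub>G\<^esub> (y \<odot>\<^bsub>G\<^esub> z) \<in> W2" if "w \<in> W" "r \<in> A" for w r
        using that unfolding W2_def by blast
      have WW2: "W \<subseteq> W2"
      proof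
        fix w assume w: "w \<in> W"
        then have "w \<oplus>\<^bsub>G\<^esub> \<zero>\<^bsub>R\<^esub> \<odot>\<^bsub>G\<^esub> (y \<odot>\<^bsub>G\<^esub> z) = w" using Wc zc by simp
        then show "w \<in> W2" using mem2[OF w zero_A] by simp
      qed
      have "good W2"
        unfolding good_def
      proof (intro conjI ballI)
        show "B \<subseteq> W2" using BW WW2 by blast
        show "W2 \<subseteq> Z"
        proof
          fix v assume "v \<in> W2"
          then obtain w r where v: "v = w \<oplus>\<^bsub>G\<^esub> r \<odot>\<^bsub>G\<^esub> (y \<odot>\<^bsub>G\<^esub> z)" "w \<in> W" "r \<in> A"
            unfolding W2_def by blast
          then show "v \<in> Z" using Z_add[of w] Z_smult[OF Z_smult[OF z(1) y]] WZ by auto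
        qed
      next
        fix a b assume "a \<in> W2" "b \<in> W2"
        then obtain w r w' r' where a: "a = w \<oplus>\<^bsub>G\<^esub> r \<odot>\<^bsub>G\<^esub> (y \<odot>\<^bsub>G\<^esub> z)" "w \<in> W" "r \<in> A"
          and b: "b = w' \<oplus>\<^bsub>G\<^esub> r' \<odot>\<^bsub>G\<^esub> (y \<odot>\<^bsub>G\<^esub> z)" "w' \<in> W" "r' \<in> A" unfolding W2_def by blast
        have "a \<oplus>\<^bsub>G\<^esub> b = (w \<oplus>\<^bsub>G\<^esub> w') \<oplus>\<^bsub>G\<^esub> (r \<oplus>\<^bsub>R\<^esub> r') \<odot>\<^bsub>G\<^esub> (y \<odot>\<^bsub>G\<^esub> z)"
          using a b Wc zc A_carrier by (simp add: smult_l_distr M.a_ac)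
        then show "a \<oplus>\<^bsub>G\<^esub> b \<in> W2"
          using mem2[OF W_add[OF a(2) b(2)] subringE(7)[OF A_subring a(3) b(3)]] by simp
      next
        fix s a assume s: "s \<in> A" and "a \<in> W2"
        then obtain w r where a: "a = w \<oplus>\<^bsub>G\<^esub> r \<odot>\<^bsub>G\<^esub> (y \<odot>\<^bsub>G\<^esub> z)" "w \<in> W" "r \<in> A"
          unfolding W2_def by blast
        have "s \<odot>\<^bsub>G\<^esub> a = s \<odot>\<^bsub>G\<^esub> w \<oplus>\<^bsub>G\<^esub> (s \<otimes>\<^bsub>R\<^esub> r) \<odot>\<^bsub>G\<^esub> (y \<odot>\<^bsub>G\<^esub> z)"
          using a Wc zc A_carrier s by (simp add: smult_r_distr smult_assoc1)
        then show "s \<odot>\<^bsub>G\<^esub> a \<in> W2"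
          using mem2[OF W_smult[OF s a(2)] subringE(6)[OF A_subring s a(3)]] by simp
      qed
      moreover have "y \<odot>\<^bsub>G\<^esub> z \<in> W2"
        using mem2[of "\<zero>\<^bsub>G\<^esub>" "\<one>\<^bsub>R\<^esub>"] zeroB BW one_A zc by auto
      ultimately have "W2 = Z" using maxW WW2 yz by blast
      then obtain w r where w: "z = w \<oplus>\<^bsub>G\<^esub> r \<odot>\<^bsub>G\<^esub> (y \<odot>\<^bsub>G\<^esub> z)" "w \<in> W" "r \<in> A"
        using z(1) unfolding W2_def by blast
      obtain u where u: "u \<in> A" "u \<otimes>\<^bsub>R\<^esub> (\<one>\<^bsub>R\<^esub> \<ominus>\<^bsub>R\<^esub> r \<otimes>\<^bsub>R\<^esub> y) = \<one>\<^bsub>R\<^esub>" using unit[OF w(3)] by blast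
      have rR: "r \<in> carrier R" "u \<in> carrier R" using A_carrier w(3) u(1) by auto
      have "(\<one>\<^bsub>R\<^esub> \<ominus>\<^bsub>R\<^esub> r \<otimes>\<^bsub>R\<^esub> y) \<odot>\<^bsub>G\<^esub> z = z \<ominus>\<^bsub>G\<^esub> r \<odot>\<^bsub>G\<^esub> (y \<odot>\<^bsub>G\<^esub> z)"
        using zc rR yR by (simp add: smult_l_distr smult_l_minus smult_assoc1 a_minus_def)
      also have "\<dots> = (w \<oplus>\<^bsub>G\<^esub> r \<odot>\<^bsub>G\<^esub> (y \<odot>\<^bsub>G\<^esub> z)) \<ominus>\<^bsub>G\<^esub> r \<odot>\<^bsub>G\<^esub> (y \<odot>\<^bsub>G\<^esub> z)"
        by (simp only: w(1)[symmetric])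
      also have "\<dots> = w" using zc rR Wc[OF w(2)] by (simp add: M.add_diff_cancel)
      finally have "u \<odot>\<^bsub>G\<^esub> w = (u \<otimes>\<^bsub>R\<^esub> (\<one>\<^bsub>R\<^esub> \<ominus>\<^bsub>R\<^esub> r \<otimes>\<^bsub>R\<^esub> y)) \<odot>\<^bsub>G\<^esub> z"
        using zc rR yR by (simp add: smult_assoc1)
      then have "u \<odot>\<^bsub>G\<^esub> w = z" using u zc by simp
      then show False using W_smult[OF u(1) w(2)] z(2) by simp
    qed
  qed
  then show ?thesis unfolding acyclic_at_def Z_def B_def by blast
qed

text \<open>The elements \<open>ys\<close> are coned off last, after the chain condition has been
  carried through the cones of \<open>gs\<close>, so that Nakayama's lemma applies at each of them.
  Having degree 0, they leave \<open>t0\<close> in place.\<close>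

theorem koszul_acyclic_append_local:
  fixes G :: "('a, nat \<Rightarrow> 'c) module"
  assumes "differential_family R A G X D S" and "acc A X G S"
    and "\<forall>g \<in> set gs. is_generator A X g"
    and "\<And>y. y \<in> set ys \<Longrightarrow> y \<in> A"
    and "\<And>y r. y \<in> set ys \<Longrightarrow> r \<in> A \<Longrightarrow> \<exists>u \<in> A. u \<otimes>\<^bsub>R\<^esub> (\<one>\<^bsub>R\<^esub> \<ominus>\<^bsub>R\<^esub> r \<otimes>\<^bsub>R\<^esub> y) = \<one>\<^bsub>R\<^esub>"
  shows "koszul_acyclic (gs @ map (\<lambda>y. (y, 0)) ys) G D S t0 \<longleftrightarrow> koszul_acyclic gs G D S t0"
  using assms
proof (induction gs arbitrary: G D S)
  case Nil
  then show ?case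
  proof (induction ys arbitrary: G D S)
    case Nil
    then show ?case by simp
  next
    case (Cons y ys)
    have gen: "is_generator A X (y, 0)" using Cons.prems(4) by (simp add: is_generator_def)
    have y: "y \<in> A" "\<And>r. r \<in> A \<Longrightarrow> \<exists>u \<in> A. u \<otimes>\<^bsub>R\<^esub> (\<one>\<^bsub>R\<^esub> \<ominus>\<^bsub>R\<^esub> r \<otimes>\<^bsub>R\<^esub> y) = \<one>\<^bsub>R\<^esub>"
      using Cons.prems(4,5) by auto
    have "koszul_acyclic ([] @ map (\<lambda>y. (y, 0)) (y # ys)) G D S t0 \<longleftrightarrow>
        (\<forall>t \<ge> t0. acyclic_at (cone_module G) (cone_diff G y D) (cone_family 0 S) t)"
      using Cons.IH[OF differential_family_cone[OF Cons.prems(1) gen] acc_cone[OF Cons.prems(1,2)]] Cons.prems(4,5)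
      by simp
    also have "\<dots> \<longleftrightarrow> (\<forall>t \<ge> t0. acyclic_at G D S t)"
      using acyclic_if_cone_acyclic_local[OF Cons.prems(1,2) y]
        cone_acyclic_if_acyclic[OF Cons.prems(1) gen] by auto
    finally show ?case by simp
  qed
next
  case (Cons g gs)
  obtain x \<delta> where g: "g = (x, \<delta>)" by (cases g)
  have gen: "is_generator A X (x, \<delta>)" using Cons.prems(3) g by auto
  show ?case
    using Cons.IH[OF differential_family_cone[OF Cons.prems(1) gen] acc_cone[OF Cons.prems(1,2)]] Cons.prems(3-5) g
    by simp
qed

text \<open>Here \<open>V j\<close> is the iterated colon of \<open>V 0\<close> by \<open>j\<close>
  factors from \<open>X\<close>. Applying \<open>x\<close> lowers the exponent still required of
  \<open>x\<close>, because the operators commute, so the induction runs on the sum of the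
  exponents. The \<open>Suc\<close> serves the base case: with \<open>X\<close> empty nothing places
  \<open>q\<close> in \<open>V 0\<close>, whereas \<open>V 1\<close> is then all of
  \<open>U\<close>. Bare operators are used because the lemma serves both the action on cocycles
  modulo boundaries and torsion under powers of an ideal.\<close>

lemma iterated_colon_exponents:
  fixes op :: "'x \<Rightarrow> 'q \<Rightarrow> 'q" and V :: "nat \<Rightarrow> 'q set" and k :: "'x \<Rightarrow> nat"
  assumes fin: "finite X"
    and U: "\<And>x q. x \<in> X \<Longrightarrow> q \<in> U \<Longrightarrow> op x q \<in> U"
    and comm: "\<And>x y q. x \<in> X \<Longrightarrow> y \<in> X \<Longrightarrow> q \<in> U \<Longrightarrow> op x (op y q) = op y (op x q)"
    and V0: "\<And>x q. x \<in> X \<Longrightarrow> q \<in> V 0 \<Longrightarrow> op x q \<in> V 0" "V 0 \<subseteq> U"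
    and VSuc: "\<And>j. V (Suc j) = {q \<in> U. \<forall>x \<in> X. op x q \<in> V j}"
    and q: "q \<in> U" and pow: "\<And>x. x \<in> X \<Longrightarrow> (op x ^^ k x) q \<in> V 0"
  shows "q \<in> V (Suc (sum k X))"
proof -
  have V0_V: "V 0 \<subseteq> V n" for n
  proof (induction n)
    case (Suc n)
    then show ?case using V0 VSuc by blast
  qed simp
  have "q \<in> V (Suc n)" if "sum k X = n" "q \<in> U" "\<And>x. x \<in> X \<Longrightarrow> (op x ^^ k x) q \<in> V 0" for n k q
    using that
  proof (induction n arbitrary: k q)
    case 0
    then have "k x = 0" if "x \<in> X" for x using that fin by simp
    then have "q \<in> V 0" if "x \<in> X" for x using 0(3)[OF that] that by simp
    then show ?case using VSuc[of 0] 0(2) V0(1) by blast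
  next
    case (Suc n)
    have "op x q \<in> V (Suc n)" if x: "x \<in> X" for x
    proof (cases "k x")
      case 0
      then have "q \<in> V 0" using Suc.prems(3)[OF x] by simp
      then show ?thesis using V0(1)[OF x] V0_V by blast
    next
      case (Suc m)
      define k' where "k' = k(x := m)"
      have iter: "(op y ^^ i) (op x q) = op x ((op y ^^ i) q) \<and> (op y ^^ i) q \<in> U" if y: "y \<in> X" for y i
        using x y Suc.prems(2) by (induction i) (auto simp: U comm)
      have e: "sum k X = k x + sum k (X - {x})" using fin x by (simp add: sum.remove)
      have "sum k' X = k' x + sum k' (X - {x})" using fin x by (simp add: sum.remove)
      also have "sum k' (X - {x}) = sum k (X - {x})" by (intro sum.cong) (auto simp: k'_def)
      finally have s: "sum k' X = n" using Suc e \<open>sum k X = Suc n\<close> by (simp add: k'_def)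
      have "(op y ^^ k' y) (op x q) \<in> V 0" if y: "y \<in> X" for y
      proof (cases "y = x")
        case True
        then show ?thesis using Suc.prems(3)[OF x] Suc by (simp add: k'_def funpow_swap1)
      next
        case False
        then show ?thesis using Suc.prems(3)[OF y] iter[OF y, of "k y"] V0(1)[OF x] by (simp add: k'_def)
      qed
      then show ?thesis using Suc.IH[OF s U[OF x Suc.prems(2)]] by blast
    qed
    then show ?case using VSuc[of "Suc n"] Suc.prems(2) by blast
  qed
  then show ?thesis using q pow by blast
qed

text \<open>The exponent is uniform over all degrees and cocycles; a pointwise one would not bound
  the length of the colon chain in \<open>acyclic_in_high_degrees\<close>.\<close>

definition nilpotent_on_cohomology ::
    "('a, 'x) ring_scheme \<Rightarrow> ('a, 'b) module \<Rightarrow> ('b \<Rightarrow> 'b) \<Rightarrow> (int \<Rightarrow> 'b set) \<Rightarrow> 'a \<Rightarrow> bool" where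
  "nilpotent_on_cohomology R G D S x \<longleftrightarrow>
     (\<exists>j :: nat. \<forall>t. \<forall>z \<in> S t. D z = \<zero>\<^bsub>G\<^esub> \<longrightarrow> (\<exists>w \<in> S (t + int j). (x [^]\<^bsub>R\<^esub> j) \<odot>\<^bsub>G\<^esub> z = D w))"

text \<open>Nilpotency makes the chain of colons \<open>V j\<close>, which starts at the boundaries
  \<open>B\<close>, reach the cocycles \<open>Z\<close> after finitely many steps. Each layer
  \<open>V (Suc j) / V j\<close> is killed by \<open>X\<close>, so it is a module over
  \<open>A\<close> alone, and the chain condition confines it to degrees bounded above.\<close>

lemma acyclic_in_high_degrees:
  fixes G :: "('a, 'b) module"
  assumes "differential_family R A G X D S" and acc: "acc A X G S" and fin: "finite X"
    and nil: "\<And>x. x \<in> X \<Longrightarrow> nilpotent_on_cohomology R G D S x"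
  shows "\<exists>t0. \<forall>t \<ge> t0. acyclic_at G D S t"
proof -
  interpret differential_family R A G X D S by fact
  define Z where "Z t = {z \<in> S t. D z = \<zero>\<^bsub>G\<^esub>}" for t
  define B where "B t = D ` S t" for t
  define V where "V j = rec_nat B (\<lambda>_ V t. {z \<in> Z t. \<forall>x \<in> X. x \<odot>\<^bsub>G\<^esub> z \<in> V (t + 1)}) j" for j
  have V0: "V 0 = B" by (simp add: V_def)
  have VSuc: "V (Suc j) t = {z \<in> Z t. \<forall>x \<in> X. x \<odot>\<^bsub>G\<^esub> z \<in> V j (t + 1)}" for j t by (simp add: V_def)
  have ZS: "z \<in> Z t \<Longrightarrow> z \<in> S t" for z t by (simp add: Z_def)
  have Zc: "z \<in> Z t \<Longrightarrow> z \<in> carrier G" for z t using S_carrier ZS by blast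
  have Xc: "x \<in> X \<Longrightarrow> x \<in> carrier R" for x using X_carrier by blast
  have BZ: "B t \<subseteq> Z t" for t using D_S D_D S_carrier by (auto simp: B_def Z_def)
  have Z_fam: "graded_family A X G Z"
  proof (intro graded_familyI)
    fix t show "\<zero>\<^bsub>G\<^esub> \<in> Z t" using S_zero D_zero by (simp add: Z_def)
  next
    fix t a b assume "a \<in> Z t" "b \<in> Z t"
    then show "a \<oplus>\<^bsub>G\<^esub> b \<in> Z t" using S_add S_carrier by (auto simp: Z_def D_add)
  next
    fix t r a assume "r \<in> A" "a \<in> Z t"
    then show "r \<odot>\<^bsub>G\<^esub> a \<in> Z t" using S_smult S_carrier A_carrier by (auto simp: Z_def D_smult)
  next
    fix t r a assume "r \<in> X" "a \<in> Z t"
    then show "r \<odot>\<^bsub>G\<^esub> a \<in> Z (t + 1)" using S_shift S_carrier Xc by (auto simp: Z_def D_smult)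
  qed (rule Zc)
  note ZD = graded_familyD[OF Z_fam]
  have B_fam: "graded_family A X G B"
  proof (intro graded_familyI)
    fix t a assume "a \<in> B t" then show "a \<in> carrier G" using BZ Zc by blast
  next
    fix t show "\<zero>\<^bsub>G\<^esub> \<in> B t" using S_zero[of t] D_zero unfolding B_def by (metis imageI)
  next
    fix t a b assume "a \<in> B t" "b \<in> B t"
    then obtain u v where "u \<in> S t" "v \<in> S t" "a = D u" "b = D v" by (auto simp: B_def)
    then have "a \<oplus>\<^bsub>G\<^esub> b = D (u \<oplus>\<^bsub>G\<^esub> v)" "u \<oplus>\<^bsub>G\<^esub> v \<in> S t" using S_carrier S_add by (auto simp: D_add)
    then show "a \<oplus>\<^bsub>G\<^esub> b \<in> B t" by (simp add: B_def)
  next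
    fix t r a assume r: "r \<in> A" and "a \<in> B t"
    then obtain u where "u \<in> S t" "a = D u" by (auto simp: B_def)
    then have "r \<odot>\<^bsub>G\<^esub> a = D (r \<odot>\<^bsub>G\<^esub> u)" "r \<odot>\<^bsub>G\<^esub> u \<in> S t"
      using S_carrier S_smult r A_carrier by (auto simp: D_smult)
    then show "r \<odot>\<^bsub>G\<^esub> a \<in> B t" by (simp add: B_def)
  next
    fix t r a assume r: "r \<in> X" and "a \<in> B t"
    then obtain u where "u \<in> S t" "a = D u" by (auto simp: B_def)
    then have "r \<odot>\<^bsub>G\<^esub> a = D (r \<odot>\<^bsub>G\<^esub> u)" "r \<odot>\<^bsub>G\<^esub> u \<in> S (t + 1)"
      using S_carrier S_shift r Xc by (auto simp: D_smult)
    then show "r \<odot>\<^bsub>G\<^esub> a \<in> B (t + 1)" by (simp add: B_def)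
  qed
  have V_step: "V j t \<subseteq> V (Suc j) t \<and> V j t \<subseteq> Z t \<and> graded_family A X G (V j)" for j t
  proof (induction j arbitrary: t)
    case 0
    have "B t \<subseteq> V (Suc 0) t" using BZ graded_familyD(5)[OF B_fam] unfolding VSuc V0 by blast
    then show ?case using BZ B_fam unfolding V0 by blast
  next
    case (Suc j)
    note VD = graded_familyD[OF conjunct2[OF conjunct2[OF Suc]]]
    have 1: "V (Suc j) t \<subseteq> V (Suc (Suc j)) t" for t
    proof
      fix z assume z: "z \<in> V (Suc j) t"
      have "x \<odot>\<^bsub>G\<^esub> z \<in> V (Suc j) (t + 1)" if "x \<in> X" for x
        using z that Suc.IH[of "t + 1"] unfolding VSuc[of j t] by blast
      then show "z \<in> V (Suc (Suc j)) t" using z unfolding VSuc[of "Suc j" t] VSuc[of j t] by blast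
    qed
    have "graded_family A X G (V (Suc j))"
    proof (intro graded_familyI)
      fix t a assume "a \<in> V (Suc j) t" then show "a \<in> carrier G" using Zc by (auto simp: VSuc)
    next
      fix t show "\<zero>\<^bsub>G\<^esub> \<in> V (Suc j) t" using ZD(2) VD(2) Xc by (auto simp: VSuc)
    next
      fix t a b assume "a \<in> V (Suc j) t" "b \<in> V (Suc j) t"
      then show "a \<oplus>\<^bsub>G\<^esub> b \<in> V (Suc j) t" using ZD(3) VD(3) Xc Zc by (auto simp: VSuc smult_r_distr)
    next
      fix t r a assume r: "r \<in> A" and a: "a \<in> V (Suc j) t"
      have ac: "a \<in> carrier G" using a Zc unfolding VSuc by blast
      have "x \<odot>\<^bsub>G\<^esub> (r \<odot>\<^bsub>G\<^esub> a) = r \<odot>\<^bsub>G\<^esub> (x \<odot>\<^bsub>G\<^esub> a)" if "x \<in> X" for x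
        using ac Xc[OF that] A_carrier[OF r] by (simp add: smult_assoc1[symmetric] m_comm)
      then show "r \<odot>\<^bsub>G\<^esub> a \<in> V (Suc j) t" using ZD(4)[OF r] VD(4)[OF r] a by (auto simp: VSuc)
    next
      fix t r a assume r: "r \<in> X" and a: "a \<in> V (Suc j) t"
      have "r \<odot>\<^bsub>G\<^esub> a \<in> V j (t + 1)" using a r by (auto simp: VSuc)
      then show "r \<odot>\<^bsub>G\<^esub> a \<in> V (Suc j) (t + 1)" using Suc.IH by blast
    qed
    moreover have "V (Suc j) t \<subseteq> Z t" unfolding VSuc by blast
    ultimately show ?case using 1 by blast
  qed
  have V_fam: "graded_family A X G (V j)" and VZ: "V j t \<subseteq> Z t" and V_mono: "V j t \<subseteq> V (Suc j) t" for j t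
    using V_step by blast+
  have step: "\<exists>t0. \<forall>t \<ge> t0. V (Suc j) t \<subseteq> V j t" for j
  proof -
    \<comment> \<open>Because \<open>X\<close> kills the layer, switching from
      \<open>V (Suc j)\<close> to \<open>V j\<close> above any degree \<open>n\<close> still gives a
      graded family. These families ascend with \<open>n\<close>, and once they stop growing the
      layer is zero in all higher degrees.\<close>
    define W where "W n t = (if t \<le> int n then V (Suc j) t else V j t)" for n :: nat and t
    have XV: "x \<odot>\<^bsub>G\<^esub> a \<in> V j (t + 1)" if "x \<in> X" "a \<in> V (Suc j) t" for x a t
      using that by (auto simp: VSuc)
    have "graded_family A X G (W n)" for n
    proof (intro graded_familyI)
      fix t x a assume x: "x \<in> X" and a: "a \<in> W n t"
      have "a \<in> V (Suc j) t" using a V_mono by (auto simp: W_def split: if_splits)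
      then have "x \<odot>\<^bsub>G\<^esub> a \<in> V j (t + 1)" using XV x by blast
      then show "x \<odot>\<^bsub>G\<^esub> a \<in> W n (t + 1)" using V_mono[of j "t + 1"] by (auto simp: W_def)
    qed (use graded_familyD(1-4)[OF V_fam] in \<open>auto simp: W_def split: if_splits\<close>)
    moreover have "W n \<le> S" for n
    proof (rule le_funI)
      fix t show "W n t \<subseteq> S t" using VZ[of j t] VZ[of "Suc j" t] ZS[of _ t] unfolding W_def by auto
    qed
    moreover have "W n \<le> W (Suc n)" for n
    proof (rule le_funI)
      fix t show "W n t \<subseteq> W (Suc n) t" using V_mono[of j t] unfolding W_def by auto
    qed
    ultimately obtain N where N: "\<And>n. n \<ge> N \<Longrightarrow> W n = W N" using accD[OF acc] by metis
    have "V (Suc j) t \<subseteq> V j t" if t: "t \<ge> int N + 1" for t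
    proof -
      have "V (Suc j) t = W (nat t) t" using t by (simp add: W_def)
      also have "\<dots> = W N t" using N[of "nat t"] t by simp
      also have "\<dots> = V j t" using t by (simp add: W_def)
      finally show ?thesis by simp
    qed
    then show ?thesis by blast
  qed
  have VB: "\<exists>t0. \<forall>t \<ge> t0. V j t \<subseteq> B t" for j
  proof (induction j)
    case 0 then show ?case by (simp add: V0)
  next
    case (Suc j)
    then obtain t1 t2 where "\<forall>t \<ge> t1. V j t \<subseteq> B t" "\<forall>t \<ge> t2. V (Suc j) t \<subseteq> V j t" using step by metis
    then have "\<forall>t \<ge> max t1 t2. V (Suc j) t \<subseteq> B t" by (meson max.bounded_iff order_trans)
    then show ?case by blast
  qed
  have "\<forall>x \<in> X. \<exists>j :: nat. \<forall>t. \<forall>z \<in> Z t. (x [^]\<^bsub>R\<^esub> j) \<odot>\<^bsub>G\<^esub> z \<in> B (t + int j)"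
    using nil unfolding nilpotent_on_cohomology_def Z_def B_def by (metis (mono_tags, lifting) imageI mem_Collect_eq)
  then obtain k where k: "\<And>x t z. x \<in> X \<Longrightarrow> z \<in> Z t \<Longrightarrow> (x [^]\<^bsub>R\<^esub> (k x :: nat)) \<odot>\<^bsub>G\<^esub> z \<in> B (t + int (k x))"
    by metis
  \<comment> \<open>The operators shift the degree, so each element is paired with its degree and
    \<open>iterated_colon_exponents\<close> is applied to pairs.\<close>
  define act where "act x q = (fst q + 1 :: int, x \<odot>\<^bsub>G\<^esub> snd q)" for x and q :: "int \<times> 'b"
  define pairs where "pairs V = {q. snd q \<in> V (fst q)}" for V :: "int \<Rightarrow> 'b set"
  have act_pow: "(act x ^^ n) (t, z) = (t + int n, (x [^]\<^bsub>R\<^esub> n) \<odot>\<^bsub>G\<^esub> z)"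
    if "x \<in> X" "z \<in> Z t" for x n t z
    using Xc[OF that(1)] Zc[OF that(2)]
    by (induction n) (auto simp: act_def smult_assoc1[symmetric] m_comm)
  have "Z t \<subseteq> V (Suc (sum k X)) t" for t
  proof
    fix z assume z: "z \<in> Z t"
    have "(t, z) \<in> pairs (V (Suc (sum k X)))"
    proof (rule iterated_colon_exponents[OF fin, where U = "pairs Z" and op = act and V = "\<lambda>j. pairs (V j)"])
      fix x q assume "x \<in> X" "q \<in> pairs Z"
      then show "act x q \<in> pairs Z" using ZD(5) by (simp add: pairs_def act_def)
    next
      fix x y q assume "x \<in> X" "y \<in> X" "q \<in> pairs Z"
      then show "act x (act y q) = act y (act x q)"
        using Xc Zc by (simp add: act_def pairs_def smult_assoc1[symmetric] m_comm)
    next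
      fix x q assume "x \<in> X" "q \<in> pairs (V 0)"
      then show "act x q \<in> pairs (V 0)" using graded_familyD(5)[OF B_fam] by (simp add: pairs_def act_def V0)
    next
      show "pairs (V 0) \<subseteq> pairs Z" using VZ by (auto simp: pairs_def)
    next
      fix j show "pairs (V (Suc j)) = {q \<in> pairs Z. \<forall>x\<in>X. act x q \<in> pairs (V j)}"
        by (auto simp: pairs_def act_def VSuc)
    next
      show "(t, z) \<in> pairs Z" using z by (simp add: pairs_def)
    next
      fix x assume "x \<in> X"
      then show "(act x ^^ k x) (t, z) \<in> pairs (V 0)" using act_pow z k by (simp add: pairs_def V0)
    qed
    then show "z \<in> V (Suc (sum k X)) t" by (simp add: pairs_def)
  qed
  then obtain t0 where "\<forall>t \<ge> t0. Z t \<subseteq> B t" using VB by (meson order_trans)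
  then have "\<forall>t \<ge> t0. acyclic_at G D S t" unfolding acyclic_at_def Z_def B_def by blast
  then show ?thesis by blast
qed

text \<open>Multiplication by \<open>x\<close> on its own cone is null-homotopic: for a cocycle
  \<open>(a, b)\<close> one has \<open>x a = D b\<close>, so \<open>x (a, b)\<close> is the
  differential of \<open>(b, 0)\<close>.\<close>

lemma nilpotent_on_cone:
  fixes G :: "('a, nat \<Rightarrow> 'c) module"
  assumes "differential_family R A G X D S" and x: "x \<in> X"
  shows "nilpotent_on_cohomology R (cone_module G) (cone_diff G x D) (cone_family 1 S) x"
proof -
  interpret differential_family R A G X D S by fact
  have xc: "x \<in> carrier R" using x X_carrier by blast
  have "\<exists>w \<in> cone_family 1 S (t + int 1). (x [^]\<^bsub>R\<^esub> (1::nat)) \<odot>\<^bsub>cone_module G\<^esub> z = cone_diff G x D w"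
    if z: "z \<in> cone_family 1 S t" "cone_diff G x D z = \<zero>\<^bsub>cone_module G\<^esub>" for t z
  proof
    have c: "left_half z \<in> carrier G" "right_half z \<in> carrier G" using z S_carrier by auto
    have "x \<odot>\<^bsub>G\<^esub> left_half z \<ominus>\<^bsub>G\<^esub> D (right_half z) = \<zero>\<^bsub>G\<^esub>" using z by (simp add: cone_diff_def)
    then have "x \<odot>\<^bsub>G\<^esub> left_half z = D (right_half z)"
      using c xc D_closed by (simp add: M.diff_eq_zero_iff)
    then show "(x [^]\<^bsub>R\<^esub> (1::nat)) \<odot>\<^bsub>cone_module G\<^esub> z = cone_diff G x D (interleave (right_half z) \<zero>\<^bsub>G\<^esub>)"
      using xc c by (simp add: cone_diff_def D_zero a_minus_def)
    show "interleave (right_half z) \<zero>\<^bsub>G\<^esub> \<in> cone_family 1 S (t + int 1)" using z S_zero by simp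
  qed
  then show ?thesis unfolding nilpotent_on_cohomology_def by blast
qed

text \<open>The cohomology of the cone is squeezed between two pieces of that of \<open>S\<close>,
  which doubles the exponent. With \<open>s = y\<^sup>j\<close>, the first factor gives
  \<open>s a = D a'\<close> and makes \<open>s b - x a'\<close> a cocycle; the second turns
  \<open>s\<close> times that cocycle into a boundary \<open>D e\<close>. The primitive is
  \<open>(s a', - e)\<close>.\<close>

lemma nilpotent_on_cohomology_cone:
  fixes G :: "('a, nat \<Rightarrow> 'c) module"
  assumes "differential_family R A G X D S" and x: "x \<in> X" and y: "y \<in> X"
    and nil: "nilpotent_on_cohomology R G D S y"
  shows "nilpotent_on_cohomology R (cone_module G) (cone_diff G x D) (cone_family 1 S) y"
proof -
  interpret differential_family R A G X D S by fact
  have xc: "x \<in> carrier R" and yc: "y \<in> carrier R" using x y X_carrier by auto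
  obtain j :: nat where j: "\<And>t z. z \<in> S t \<Longrightarrow> D z = \<zero>\<^bsub>G\<^esub> \<Longrightarrow> \<exists>w \<in> S (t + int j). (y [^]\<^bsub>R\<^esub> j) \<odot>\<^bsub>G\<^esub> z = D w"
    using nil unfolding nilpotent_on_cohomology_def by blast
  define s where "s = y [^]\<^bsub>R\<^esub> j"
  have sc: "s \<in> carrier R" using yc by (simp add: s_def)
  have s_shift: "s \<odot>\<^bsub>G\<^esub> a \<in> S (t + int j)" if "a \<in> S t" for a t
  proof -
    have "(y [^]\<^bsub>R\<^esub> i) \<odot>\<^bsub>G\<^esub> a \<in> S (t + int i)" for i :: nat
    proof (induction i)
      case 0 then show ?case using that S_carrier by simp
    next
      case (Suc i)
      have "(y [^]\<^bsub>R\<^esub> Suc i) \<odot>\<^bsub>G\<^esub> a = y \<odot>\<^bsub>G\<^esub> ((y [^]\<^bsub>R\<^esub> i) \<odot>\<^bsub>G\<^esub> a)"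
        using yc S_carrier[OF that] by (simp add: smult_assoc1[symmetric] m_comm)
      then show ?case using S_shift[OF y Suc] by (simp add: algebra_simps)
    qed
    then show ?thesis by (simp add: s_def)
  qed
  have "\<exists>w \<in> cone_family 1 S (t + int (j + j)). (y [^]\<^bsub>R\<^esub> (j + j)) \<odot>\<^bsub>cone_module G\<^esub> z = cone_diff G x D w"
    if z: "z \<in> cone_family 1 S t" "cone_diff G x D z = \<zero>\<^bsub>cone_module G\<^esub>" for t z
  proof -
    define a b where "a = left_half z" and "b = right_half z"
    have ab: "a \<in> S (t - 1)" "b \<in> S t" "D a = \<zero>\<^bsub>G\<^esub>" using z by (auto simp: a_def b_def cone_diff_def)
    note c = S_carrier[OF ab(1)] S_carrier[OF ab(2)] D_closed[OF S_carrier[OF ab(2)]]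
    have "x \<odot>\<^bsub>G\<^esub> a \<ominus>\<^bsub>G\<^esub> D b = \<zero>\<^bsub>G\<^esub>" using z by (simp add: cone_diff_def a_def b_def)
    then have xa: "x \<odot>\<^bsub>G\<^esub> a = D b" using c xc by (simp add: M.diff_eq_zero_iff)
    obtain a' where a': "a' \<in> S (t - 1 + int j)" "s \<odot>\<^bsub>G\<^esub> a = D a'" using j[OF ab(1,3)] by (auto simp: s_def)
    have xa': "x \<odot>\<^bsub>G\<^esub> a' \<in> S (t + int j)" using S_shift[OF x a'(1)] by (simp add: algebra_simps)
    note c' = S_carrier[OF a'(1)] S_carrier[OF xa'] D_closed[OF S_carrier[OF a'(1)]]
    have "D (s \<odot>\<^bsub>G\<^esub> b) = s \<odot>\<^bsub>G\<^esub> (x \<odot>\<^bsub>G\<^esub> a)" using c sc xa by (simp add: D_smult)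
    also have "\<dots> = x \<odot>\<^bsub>G\<^esub> (s \<odot>\<^bsub>G\<^esub> a)" using c sc xc by (simp add: smult_assoc1[symmetric] m_comm)
    also have "\<dots> = D (x \<odot>\<^bsub>G\<^esub> a')" using a' c' xc by (simp add: D_smult)
    finally have Dsb: "D (s \<odot>\<^bsub>G\<^esub> b) = D (x \<odot>\<^bsub>G\<^esub> a')" .
    have "D (s \<odot>\<^bsub>G\<^esub> b \<ominus>\<^bsub>G\<^esub> x \<odot>\<^bsub>G\<^esub> a') = D (s \<odot>\<^bsub>G\<^esub> b) \<ominus>\<^bsub>G\<^esub> D (x \<odot>\<^bsub>G\<^esub> a')"
      using c sc c' by (intro D_diff) auto
    also have "\<dots> = \<zero>\<^bsub>G\<^esub>" unfolding Dsb using D_closed c' by (simp add: a_minus_def M.r_neg)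
    finally have "D (s \<odot>\<^bsub>G\<^esub> b \<ominus>\<^bsub>G\<^esub> x \<odot>\<^bsub>G\<^esub> a') = \<zero>\<^bsub>G\<^esub>" .
    from j[OF S_diff[OF s_shift[OF ab(2)] xa'] this]
    obtain e where e: "e \<in> S (t + int j + int j)" "s \<odot>\<^bsub>G\<^esub> (s \<odot>\<^bsub>G\<^esub> b \<ominus>\<^bsub>G\<^esub> x \<odot>\<^bsub>G\<^esub> a') = D e"
      by (auto simp: s_def)
    have ss: "(y [^]\<^bsub>R\<^esub> (j + j)) \<odot>\<^bsub>G\<^esub> u = s \<odot>\<^bsub>G\<^esub> (s \<odot>\<^bsub>G\<^esub> u)" if "u \<in> carrier G" for u
      using that yc by (simp add: s_def smult_assoc1[symmetric] nat_pow_mult)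
    define w where "w = interleave (s \<odot>\<^bsub>G\<^esub> a') (\<ominus>\<^bsub>G\<^esub> e)"
    have sxa': "x \<odot>\<^bsub>G\<^esub> (s \<odot>\<^bsub>G\<^esub> a') = s \<odot>\<^bsub>G\<^esub> (x \<odot>\<^bsub>G\<^esub> a')"
      using c' sc xc by (simp add: smult_assoc1[symmetric] m_comm)
    have "D e = s \<odot>\<^bsub>G\<^esub> (s \<odot>\<^bsub>G\<^esub> b) \<ominus>\<^bsub>G\<^esub> x \<odot>\<^bsub>G\<^esub> (s \<odot>\<^bsub>G\<^esub> a')"
      unfolding e(2)[symmetric] sxa' using c sc c' by (simp add: smult_diff)
    moreover have "D (\<ominus>\<^bsub>G\<^esub> e) = \<ominus>\<^bsub>G\<^esub> D e" using S_carrier[OF e(1)] by (rule D_minus)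
    ultimately have "x \<odot>\<^bsub>G\<^esub> (s \<odot>\<^bsub>G\<^esub> a') \<ominus>\<^bsub>G\<^esub> D (\<ominus>\<^bsub>G\<^esub> e)
        = x \<odot>\<^bsub>G\<^esub> (s \<odot>\<^bsub>G\<^esub> a') \<oplus>\<^bsub>G\<^esub> (s \<odot>\<^bsub>G\<^esub> (s \<odot>\<^bsub>G\<^esub> b) \<ominus>\<^bsub>G\<^esub> x \<odot>\<^bsub>G\<^esub> (s \<odot>\<^bsub>G\<^esub> a'))"
      using c c' sc xc by (simp add: a_minus_def)
    also have "\<dots> = s \<odot>\<^bsub>G\<^esub> (s \<odot>\<^bsub>G\<^esub> b)"
      using c c' sc xc by (simp add: M.a_comm[of "x \<odot>\<^bsub>G\<^esub> (s \<odot>\<^bsub>G\<^esub> a')"] M.diff_add_cancel)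
    finally have "cone_diff G x D w = interleave (s \<odot>\<^bsub>G\<^esub> (s \<odot>\<^bsub>G\<^esub> a)) (s \<odot>\<^bsub>G\<^esub> (s \<odot>\<^bsub>G\<^esub> b))"
      using a'(2) c' sc by (simp add: cone_diff_def w_def D_smult)
    then have "(y [^]\<^bsub>R\<^esub> (j + j)) \<odot>\<^bsub>cone_module G\<^esub> z = cone_diff G x D w"
      using ss c by (simp add: a_def b_def)
    moreover have "w \<in> cone_family 1 S (t + int (j + j))"
      using s_shift[OF a'(1)] S_minus[OF e(1)] by (simp add: w_def algebra_simps)
    ultimately show ?thesis by blast
  qed
  then show ?thesis unfolding nilpotent_on_cohomology_def by blast
qed

text \<open>The condition on \<open>X - set xs\<close> makes the induction go: coning off
  \<open>x\<close> adds \<open>x\<close> to the elements acting nilpotently. For a list that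
  exhausts \<open>X\<close> it starts out vacuous and ends, after all cones, covering every element
  of \<open>X\<close>.\<close>

theorem koszul_acyclic_in_high_degrees:
  fixes G :: "('a, nat \<Rightarrow> 'c) module"
  assumes "differential_family R A G X D S" and "acc A X G S" and fin: "finite X"
    and "set xs \<subseteq> X" and "\<forall>x \<in> X - set xs. nilpotent_on_cohomology R G D S x"
  shows "\<exists>t0. koszul_acyclic (map (\<lambda>x. (x, 1)) xs) G D S t0"
  using assms(1,2,4,5)
proof (induction xs arbitrary: G D S)
  case Nil
  then show ?case using acyclic_in_high_degrees[OF Nil.prems(1,2) fin] by simp
next
  case (Cons x xs)
  have x: "x \<in> X" using Cons.prems(3) by simp
  have gen: "is_generator A X (x, 1)" using x by (simp add: is_generator_def)
  have "\<forall>y \<in> X - set xs. nilpotent_on_cohomology R (cone_module G) (cone_diff G x D) (cone_family 1 S) y"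
    using nilpotent_on_cone[OF Cons.prems(1) x] nilpotent_on_cohomology_cone[OF Cons.prems(1) x] Cons.prems(4)
    by auto
  then show ?case
    using Cons.IH[OF differential_family_cone[OF Cons.prems(1) gen] acc_cone[OF Cons.prems(1,2)]] Cons.prems(3)
    by simp
qed

section \<open>Direct sum decompositions\<close>

definition decomposition :: "('b, 'x) ring_scheme \<Rightarrow> ('i \<Rightarrow> 'b set) \<Rightarrow> 'b \<Rightarrow> ('i \<Rightarrow> 'b) \<Rightarrow> bool" where
  "decomposition G D x f \<longleftrightarrow>
     (\<forall>i. f i \<in> D i) \<and> finite {i. f i \<noteq> \<zero>\<^bsub>G\<^esub>} \<and> x = finsum G f {i. f i \<noteq> \<zero>\<^bsub>G\<^esub>}"

definition component :: "('b, 'x) ring_scheme \<Rightarrow> ('i \<Rightarrow> 'b set) \<Rightarrow> 'b \<Rightarrow> 'i \<Rightarrow> 'b" where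
  "component G D x = (THE f. decomposition G D x f)"

text \<open>Finite sums are defined through the carrier, so sums in a record with a smaller carrier
  have to be compared explicitly with those of the ambient group.\<close>

lemma finsum_same_operations:
  assumes "abelian_group G" "abelian_group H" and "zero H = zero G" "add H = add G"
    and "carrier H \<subseteq> carrier G" and "f \<in> S \<rightarrow> carrier H"
  shows "finsum H f S = finsum G f S"
proof -
  interpret G: abelian_group G by fact
  interpret H: abelian_group H by fact
  show ?thesis
  proof (cases "finite S")
    case True
    then show ?thesis using assms(6)
    proof (induction S rule: finite_induct)
      case (insert i S)
      then have "f \<in> S \<rightarrow> carrier G" "f i \<in> carrier G" "f \<in> S \<rightarrow> carrier H" "f i \<in> carrier H"
        using assms(5) by auto
      then show ?case using insert assms(4) by simp
    qed (simp add: assms(3))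
  qed (simp add: G.finsum_infinite H.finsum_infinite assms(3))
qed

locale graded_group = abelian_group G for G (structure) +
  fixes D :: "'i \<Rightarrow> 'a set"
  assumes direct_sum: "direct_sum_of G D"
begin

lemma part_subgroup: "additive_subgroup (D i) G"
  using direct_sum by (simp add: direct_sum_of_def)

lemma part_carrier: "a \<in> D i \<Longrightarrow> a \<in> carrier G"
  using additive_subgroup.a_subset[OF part_subgroup] by blast

lemma part_zero: "\<zero> \<in> D i" using additive_subgroup.zero_closed[OF part_subgroup] .

lemma part_add: "a \<in> D i \<Longrightarrow> b \<in> D i \<Longrightarrow> a \<oplus> b \<in> D i"
  using additive_subgroup.a_closed[OF part_subgroup] .

lemma part_inv: "a \<in> D i \<Longrightarrow> \<ominus> a \<in> D i"
  using additive_subgroup.a_inv_closed[OF part_subgroup] abelian_group_axioms by blast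

lemma ex1_decomposition: "x \<in> carrier G \<Longrightarrow> \<exists>!f. decomposition G D x f"
  using direct_sum unfolding direct_sum_of_def decomposition_def by blast

lemma decomposition_component: "x \<in> carrier G \<Longrightarrow> decomposition G D x (component G D x)"
  unfolding component_def using theI'[OF ex1_decomposition] by blast

lemma component_unique: "x \<in> carrier G \<Longrightarrow> decomposition G D x f \<Longrightarrow> component G D x = f"
  using ex1_decomposition decomposition_component by blast

lemma component_part: "x \<in> carrier G \<Longrightarrow> component G D x i \<in> D i"
  using decomposition_component by (simp add: decomposition_def)

lemma component_closed: "x \<in> carrier G \<Longrightarrow> component G D x i \<in> carrier G"
  using component_part part_carrier by blast

lemma finite_support: "x \<in> carrier G \<Longrightarrow> finite {i. component G D x i \<noteq> \<zero>}"
  using decomposition_component by (simp add: decomposition_def)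

lemma component_sum:
  "x \<in> carrier G \<Longrightarrow> x = finsum G (component G D x) {i. component G D x i \<noteq> \<zero>}"
  using decomposition_component by (simp add: decomposition_def)

lemma finsum_superset:
  assumes "finite F" "{i. f i \<noteq> \<zero>} \<subseteq> F" "\<And>i. f i \<in> carrier G"
  shows "finsum G f F = finsum G f {i. f i \<noteq> \<zero>}"
proof (rule add.finprod_mono_neutral_cong_right)
qed (use assms in auto)

lemma component_eqI:
  assumes "\<And>i. f i \<in> D i" "finite F" "{i. f i \<noteq> \<zero>} \<subseteq> F" "x = finsum G f F"
  shows "component G D x = f"
proof -
  have f: "f i \<in> carrier G" for i using assms(1) part_carrier by blast
  have "x \<in> carrier G" unfolding assms(4) using f by (intro finsum_closed) auto
  moreover have "decomposition G D x f"
    unfolding decomposition_def using assms finsum_superset[OF assms(2,3) f] finite_subset[OF assms(3,2)] by auto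
  ultimately show ?thesis by (rule component_unique)
qed

lemma component_homogeneous: "x \<in> D i \<Longrightarrow> component G D x = (\<lambda>j. if j = i then x else \<zero>)"
proof (rule component_eqI[where F = "{i}"])
  assume x: "x \<in> D i"
  show "x = (\<Oplus>j\<in>{i}. if j = i then x else \<zero>)" using part_carrier[OF x] by simp
qed (use part_zero in auto)

lemma component_zero: "component G D \<zero> = (\<lambda>j. \<zero>)"
proof (rule component_eqI[where F = "{}"])
qed (use part_zero in auto)

lemma component_add:
  assumes x: "x \<in> carrier G" and y: "y \<in> carrier G"
  shows "component G D (x \<oplus> y) = (\<lambda>i. component G D x i \<oplus> component G D y i)"
proof -
  let ?f = "component G D x" and ?g = "component G D y"
  let ?F = "{i. ?f i \<noteq> \<zero>} \<union> {i. ?g i \<noteq> \<zero>}"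
  have F: "finite ?F" using finite_support x y by simp
  have c: "?f \<in> ?F \<rightarrow> carrier G" "?g \<in> ?F \<rightarrow> carrier G" using component_closed x y by auto
  show ?thesis
  proof (rule component_eqI[where F = ?F])
    show "x \<oplus> y = (\<Oplus>i\<in>?F. ?f i \<oplus> ?g i)"
      using finsum_addf[OF c] finsum_superset[OF F, of ?f] finsum_superset[OF F, of ?g]
        component_sum[OF x] component_sum[OF y] component_closed x y by simp
  qed (use F part_add component_part x y in auto)
qed

text \<open>The sets \<open>T\<close> carry knowledge about the individual components of
  \<open>x\<close> into the homogeneous case; \<open>homogeneous_induct\<close> is the instance
  where \<open>T\<close> is the grading itself.\<close>

lemma component_induct [consumes 2, case_names zero homogeneous add]:
  assumes x: "x \<in> carrier G" and T: "\<And>i. component G D x i \<in> T i"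
    and zero: "P \<zero>" and hom: "\<And>i a. a \<in> T i \<Longrightarrow> a \<in> D i \<Longrightarrow> P a"
    and add: "\<And>a b. a \<in> carrier G \<Longrightarrow> b \<in> carrier G \<Longrightarrow> P a \<Longrightarrow> P b \<Longrightarrow> P (a \<oplus> b)"
  shows "P x"
proof -
  have "P (finsum G (component G D x) F)" if "finite F" for F
    using that
  proof (induction F rule: finite_induct)
    case (insert i F)
    have "finsum G (component G D x) (insert i F) = component G D x i \<oplus> finsum G (component G D x) F"
      using insert component_closed[OF x] by simp
    moreover have "P (component G D x i)" using hom T component_part[OF x] by blast
    moreover have "finsum G (component G D x) F \<in> carrier G"
      using component_closed[OF x] by (intro finsum_closed) auto
    ultimately show ?case using add insert.IH component_closed[OF x] by simp
  qed (simp add: zero)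
  then show ?thesis using finite_support[OF x] component_sum[OF x] by metis
qed

lemma homogeneous_induct [consumes 1, case_names homogeneous add]:
  assumes x: "x \<in> carrier G" and hom: "\<And>i a. a \<in> D i \<Longrightarrow> P a"
    and add: "\<And>a b. a \<in> carrier G \<Longrightarrow> b \<in> carrier G \<Longrightarrow> P a \<Longrightarrow> P b \<Longrightarrow> P (a \<oplus> b)"
  shows "P x"
  using x component_part[OF x]
proof (induction rule: component_induct)
  case zero then show ?case using hom part_zero by blast
qed (use hom add in auto)

lemma component_all_zero: "x \<in> carrier G \<Longrightarrow> (\<And>i. component G D x i = \<zero>) \<Longrightarrow> x = \<zero>"
  using component_sum[of x] by simp

lemma component_inv:
  assumes x: "x \<in> carrier G" shows "component G D (\<ominus> x) i = \<ominus> component G D x i"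
proof -
  have "component G D (\<ominus> x) i \<oplus> component G D x i = \<zero>"
    using component_add[of "\<ominus> x" x] x component_zero by (simp add: l_neg fun_eq_iff)
  then show ?thesis using component_closed x by (metis minus_equality a_inv_closed)
qed

text \<open>Extension by zero along an injection of index sets turns a grading by naturals into one
  by integers, and along a translation it produces shifted modules.\<close>

lemma direct_sum_reindex:
  assumes inj: "inj \<sigma>" and D': "\<And>i. D' (\<sigma> i) = D i" "\<And>j. j \<notin> range \<sigma> \<Longrightarrow> D' j = {\<zero>}"
  shows "direct_sum_of G D'"
  unfolding direct_sum_of_def
proof (intro conjI allI ballI)
  fix j show "additive_subgroup (D' j) G"
  proof (cases "j \<in> range \<sigma>")
    case True then show ?thesis using part_subgroup D'(1) by auto
  next
    case False
    then show ?thesis using D'(2) by (simp add: additive_subgroup_def add.triv_subgroup)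
  qed
next
  fix x assume x: "x \<in> carrier G"
  have D'_zero: "f j = \<zero>" if "\<forall>j. f j \<in> D' j" "j \<notin> range \<sigma>" for f j using that D'(2) by blast
  have support: "{j. f j \<noteq> \<zero>} = \<sigma> ` {i. f (\<sigma> i) \<noteq> \<zero>}" if f: "\<forall>j. f j \<in> D' j" for f
  proof (rule subset_antisym; rule subsetI)
    fix j assume j: "j \<in> {j. f j \<noteq> \<zero>}"
    then have "j \<in> range \<sigma>" using D'_zero[OF f, of j] by blast
    then obtain i where "j = \<sigma> i" by (rule rangeE)
    then show "j \<in> \<sigma> ` {i. f (\<sigma> i) \<noteq> \<zero>}" using j by simp
  qed auto
  have sum: "finsum G f {j. f j \<noteq> \<zero>} = finsum G (\<lambda>i. f (\<sigma> i)) {i. f (\<sigma> i) \<noteq> \<zero>}" if "\<forall>j. f j \<in> D' j" for f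
    unfolding support[OF that]
  proof (rule finsum_reindex)
    show "f \<in> \<sigma> ` {i. f (\<sigma> i) \<noteq> \<zero>} \<rightarrow> carrier G" using that D'(1) part_carrier by fastforce
    show "inj_on \<sigma> {i. f (\<sigma> i) \<noteq> \<zero>}" using inj by (rule inj_on_subset) simp
  qed
  have fin: "finite {j. f j \<noteq> \<zero>} \<longleftrightarrow> finite {i. f (\<sigma> i) \<noteq> \<zero>}" if "\<forall>j. f j \<in> D' j" for f
    unfolding support[OF that] using inj by (simp add: finite_image_iff inj_on_subset)
  define g where "g j = (if j \<in> range \<sigma> then component G D x (inv_into UNIV \<sigma> j) else \<zero>)" for j
  have g\<sigma>: "g (\<sigma> i) = component G D x i" for i using inj by (simp add: g_def)
  have g: "\<forall>j. g j \<in> D' j"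
  proof
    fix j show "g j \<in> D' j"
    proof (cases "j \<in> range \<sigma>")
      case True
      then show ?thesis using g\<sigma> D'(1) component_part[OF x] by auto
    next
      case False
      then show ?thesis using D'(2)[OF False] by (simp add: g_def)
    qed
  qed
  show "\<exists>!f. (\<forall>j. f j \<in> D' j) \<and> finite {j. f j \<noteq> \<zero>} \<and> x = finsum G f {j. f j \<noteq> \<zero>}"
  proof (rule ex1I)
    show "(\<forall>j. g j \<in> D' j) \<and> finite {j. g j \<noteq> \<zero>} \<and> x = finsum G g {j. g j \<noteq> \<zero>}"
      using g fin[OF g] sum[OF g] finite_support[OF x] component_sum[OF x] by (simp add: g\<sigma>)
  next
    fix f assume f: "(\<forall>j. f j \<in> D' j) \<and> finite {j. f j \<noteq> \<zero>} \<and> x = finsum G f {j. f j \<noteq> \<zero>}"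
    then have "decomposition G D x (\<lambda>i. f (\<sigma> i))"
      using D'(1) fin[of f] sum[of f] unfolding decomposition_def by auto
    then have "component G D x = (\<lambda>i. f (\<sigma> i))" using component_unique[OF x] by blast
    then have e: "f (\<sigma> i) = g (\<sigma> i)" for i using g\<sigma> by simp
    show "f = g"
    proof
      fix j show "f j = g j"
        using e D'_zero[of f j] D'_zero[OF g, of j] f by (cases "j \<in> range \<sigma>") auto
    qed
  qed
qed

end

text \<open>Homogeneous additive maps commute with taking components. The injection
  \<open>\<sigma>\<close> is the identity for differentials and a translation for multiplication by
  a homogeneous ring element.\<close>

lemma component_hom:
  assumes "graded_group G D" "graded_group H D'" and \<sigma>: "inj \<sigma>"
    and h: "\<And>x. x \<in> carrier G \<Longrightarrow> h x \<in> carrier H"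
    and h_add: "\<And>x y. x \<in> carrier G \<Longrightarrow> y \<in> carrier G \<Longrightarrow> h (x \<oplus>\<^bsub>G\<^esub> y) = h x \<oplus>\<^bsub>H\<^esub> h y"
    and h_part: "\<And>i x. x \<in> D i \<Longrightarrow> h x \<in> D' (\<sigma> i)"
    and x: "x \<in> carrier G"
  shows "component H D' (h x) (\<sigma> i) = h (component G D x i)"
proof -
  interpret G: graded_group G D by fact
  interpret H: graded_group H D' by fact
  have "h \<zero>\<^bsub>G\<^esub> \<oplus>\<^bsub>H\<^esub> h \<zero>\<^bsub>G\<^esub> = h \<zero>\<^bsub>G\<^esub>" using h_add[of "\<zero>\<^bsub>G\<^esub>" "\<zero>\<^bsub>G\<^esub>"] by simp
  then have h0: "h \<zero>\<^bsub>G\<^esub> = \<zero>\<^bsub>H\<^esub>" using h[of "\<zero>\<^bsub>G\<^esub>"] by simp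
  show ?thesis using x
  proof (induction rule: G.homogeneous_induct)
    case (homogeneous j a)
    have "(\<sigma> i = \<sigma> j) = (i = j)" using \<sigma> by (simp add: inj_eq)
    then show ?case
      using G.component_homogeneous[OF homogeneous] H.component_homogeneous[OF h_part[OF homogeneous]] h0
      by simp
  next
    case (add a b)
    then show ?case
      using h h_add G.component_closed by (simp add: G.component_add H.component_add)
  qed
qed

text \<open>A subgroup cut out by conditions on components contains the components of its elements,
  so the ambient decomposition is also the one inside.\<close>

lemma direct_sum_of_subgroup:
  assumes "graded_group G D" and "abelian_group H" and ops: "zero H = zero G" "add H = add G"
    and carr: "carrier H = {x \<in> carrier G. \<forall>i. component G D x i \<in> D' i}"
    and D': "\<And>i. D' i \<subseteq> D i" "\<And>i. \<zero>\<^bsub>G\<^esub> \<in> D' i" "\<And>i a b. a \<in> D' i \<Longrightarrow> b \<in> D' i \<Longrightarrow> a \<oplus>\<^bsub>G\<^esub> b \<in> D' i"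
      "\<And>i a. a \<in> D' i \<Longrightarrow> \<ominus>\<^bsub>G\<^esub> a \<in> D' i"
  shows "direct_sum_of H D'"
proof -
  interpret G: graded_group G D by fact
  interpret H: abelian_group H by fact
  have sub: "carrier H \<subseteq> carrier G" using carr by blast
  have D'H: "a \<in> carrier H" if a: "a \<in> D' i" for a i
  proof -
    have "a \<in> D i" using a D'(1) by blast
    then show ?thesis using a D'(2) G.component_homogeneous G.part_carrier unfolding carr by simp
  qed
  have inv: "\<ominus>\<^bsub>H\<^esub> a = \<ominus>\<^bsub>G\<^esub> a" if "a \<in> D' i" for a i
  proof (rule H.minus_equality)
    show "\<ominus>\<^bsub>G\<^esub> a \<oplus>\<^bsub>H\<^esub> a = \<zero>\<^bsub>H\<^esub>" using D'H[OF that] sub unfolding ops by (auto intro: G.l_neg)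
  qed (use that D'H D'(4) in auto)
  show ?thesis
    unfolding direct_sum_of_def
  proof (intro conjI allI ballI)
    fix i show "additive_subgroup (D' i) H"
    proof (intro additive_subgroup.intro subgroup.intro)
      show "D' i \<subseteq> carrier (add_monoid H)" using D'H by auto
      fix a assume "a \<in> D' i"
      then show "inv\<^bsub>add_monoid H\<^esub> a \<in> D' i" using inv D'(4) unfolding a_inv_def by metis
    qed (use D' ops in auto)
  next
    fix x assume x: "x \<in> carrier H"
    then have xG: "x \<in> carrier G" using sub by blast
    have eq: "decomposition H D' x f \<longleftrightarrow> decomposition G D x f \<and> (\<forall>i. f i \<in> D' i)" for f
    proof -
      have "finsum H f {i. f i \<noteq> \<zero>\<^bsub>G\<^esub>} = finsum G f {i. f i \<noteq> \<zero>\<^bsub>G\<^esub>}" if "\<forall>i. f i \<in> D' i"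
        using that D'H sub ops
        by (intro finsum_same_operations G.abelian_group_axioms H.abelian_group_axioms) auto
      then show ?thesis using D'(1) ops unfolding decomposition_def by auto
    qed
    have "\<exists>!f. decomposition H D' x f"
    proof (rule ex1I)
      show "decomposition H D' x (component G D x)"
        using eq G.decomposition_component[OF xG] x carr by auto
    next
      fix f assume "decomposition H D' x f"
      then show "f = component G D x" using eq G.component_unique[OF xG] by blast
    qed
    then show "\<exists>!f. (\<forall>i. f i \<in> D' i) \<and> finite {i. f i \<noteq> \<zero>\<^bsub>H\<^esub>} \<and> x = finsum H f {i. f i \<noteq> \<zero>\<^bsub>H\<^esub>}"
      unfolding decomposition_def .
  qed
qed

section \<open>Standard graded rings\<close>

text \<open>In a noetherian ring a nonempty chain of ideals contains its own union, which provides
  the upper bound for Zorn's lemma.\<close>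

lemma (in noetherian_ring) exists_maximalideal_containing:
  assumes J: "ideal J R" and "\<one> \<notin> J"
  shows "\<exists>I. maximalideal I R \<and> J \<subseteq> I"
proof -
  define P where "P = {I. ideal I R \<and> J \<subseteq> I \<and> \<one> \<notin> I}"
  have "\<exists>U \<in> P. \<forall>I \<in> C. I \<subseteq> U" if C: "subset.chain P C" for C
  proof (cases "C = {}")
    case True
    then show ?thesis using assms by (auto simp: P_def)
  next
    case False
    have "C \<subseteq> P" using C by (simp add: subset.chain_def)
    moreover have "subset.chain {I. ideal I R} C"
      using C unfolding subset.chain_def P_def by blast
    then have "\<Union> C \<in> C" by (rule ideal_chain_is_trivial[OF False])
    ultimately show ?thesis by (intro bexI[of _ "\<Union> C"]) auto
  qed
  from subset_Zorn[OF this] obtain I where I: "I \<in> P" and max: "\<And>K. K \<in> P \<Longrightarrow> I \<subseteq> K \<Longrightarrow> K = I"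
    by metis
  interpret I: ideal I R using I by (simp add: P_def)
  have "maximalideal I R"
  proof (intro maximalidealI)
    show "ideal I R" by (rule I.is_ideal)
    show "carrier R \<noteq> I" using I by (auto simp: P_def)
  next
    fix K assume K: "ideal K R" "I \<subseteq> K" "K \<subseteq> carrier R"
    show "K = I \<or> K = carrier R"
    proof (cases "\<one> \<in> K")
      case True
      then show ?thesis using ideal.one_imp_carrier[OF K(1)] by simp
    next
      case False
      then have "K \<in> P" using K I by (auto simp: P_def)
      then show ?thesis using max K(2) by simp
    qed
  qed
  then show ?thesis using I by (auto simp: P_def)
qed

lemma noetherian_local_unit:
  assumes "noetherian_local_ring N \<nn>" and a: "a \<in> carrier N" "a \<notin> \<nn>"
  shows "\<exists>u \<in> carrier N. u \<otimes>\<^bsub>N\<^esub> a = \<one>\<^bsub>N\<^esub>"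
proof -
  interpret cring N using assms(1) by (simp add: noetherian_local_ring_def)
  interpret noetherian_ring N using assms(1) by (simp add: noetherian_local_ring_def)
  have id: "ideal (PIdl\<^bsub>N\<^esub> a) N" using a(1) by (rule cgenideal_ideal)
  have "\<one>\<^bsub>N\<^esub> \<in> PIdl\<^bsub>N\<^esub> a"
  proof (rule ccontr)
    assume "\<one>\<^bsub>N\<^esub> \<notin> PIdl\<^bsub>N\<^esub> a"
    from exists_maximalideal_containing[OF id this]
    obtain I where "maximalideal I N" "PIdl\<^bsub>N\<^esub> a \<subseteq> I" by blast
    then have "a \<in> \<nn>"
      using cgenideal_self[OF a(1)] assms(1) unfolding noetherian_local_ring_def by blast
    with a(2) show False by simp
  qed
  then show ?thesis unfolding cgenideal_def by force
qed

text \<open>With the integers as index set, shifts such as \<open>t - \<delta>\<close> never leave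
  the grading.\<close>

definition int_part :: "'a gring \<Rightarrow> int \<Rightarrow> 'a set" where
  "int_part R t = (if t < 0 then {\<zero>\<^bsub>R\<^esub>} else ring_part R (nat t))"

lemma int_part_nat [simp]: "int_part R (int n) = ring_part R n" by (simp add: int_part_def)

lemma int_part_0 [simp]: "int_part R 0 = ring_part R 0"
  and int_part_1 [simp]: "int_part R 1 = ring_part R 1"
  by (simp_all add: int_part_def)

locale standard_graded =
  fixes R :: "'a gring" (structure) and \<nn> :: "'a set"
  assumes standard: "fg_standard_graded R"
    and local: "noetherian_local_ring (degree_zero_ring R) \<nn>"
begin

lemma graded_R: "graded_ring R" using standard by (simp add: fg_standard_graded_def)

sublocale cring R using graded_R by (simp add: graded_ring_def)

lemma direct_sum_int_part: "direct_sum_of R (int_part R)"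
proof -
  interpret graded_group R "ring_part R"
    using graded_R by unfold_locales (simp add: graded_ring_def)
  show ?thesis
  proof (rule direct_sum_reindex[where \<sigma> = int])
    show "inj int" by simp
    fix j :: int assume "j \<notin> range int"
    then have "j < 0" by (metis nonneg_int_cases not_less rangeI)
    then show "int_part R j = {\<zero>}" by (simp add: int_part_def)
  qed simp
qed

sublocale gr: graded_group R "int_part R"
  by unfold_locales (rule direct_sum_int_part)

lemma part_mult:
  assumes "r \<in> int_part R m" "s \<in> int_part R n" shows "r \<otimes> s \<in> int_part R (m + n)"
proof (cases "m < 0 \<or> n < 0")
  case True
  then have "r = \<zero> \<or> s = \<zero>" using assms by (auto simp: int_part_def)
  then have "r \<otimes> s = \<zero>" using assms gr.part_carrier by auto
  then show ?thesis using gr.part_zero by simp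
next
  case False
  then have "r \<otimes> s \<in> ring_part R (nat m + nat n)"
    using assms graded_R by (simp add: int_part_def graded_ring_def)
  then show ?thesis using False by (simp add: int_part_def nat_add_distrib)
qed

lemma degree_zero_cring: "cring (R\<lparr>carrier := ring_part R 0\<rparr>)"
  and degree_zero_noetherian: "noetherian_ring (R\<lparr>carrier := ring_part R 0\<rparr>)"
  using local by (simp_all add: noetherian_local_ring_def degree_zero_ring_def)

lemma one_part: "\<one> \<in> ring_part R 0"
proof -
  interpret Z: cring "R\<lparr>carrier := ring_part R 0\<rparr>" by (rule degree_zero_cring)
  show ?thesis using Z.one_closed by simp
qed

sublocale operators R "ring_part R 0"
proof (intro operators.intro operators_axioms.intro is_cring)
  show "subring (ring_part R 0) R"
  proof (rule subringI)
    show "ring_part R 0 \<subseteq> carrier R" using gr.part_carrier[of _ 0] by auto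
    show "\<one> \<in> ring_part R 0" by (rule one_part)
  next
    fix h k assume "h \<in> ring_part R 0" "k \<in> ring_part R 0"
    then show "h \<otimes> k \<in> ring_part R 0" "h \<oplus> k \<in> ring_part R 0"
      using part_mult[of h 0 k 0] gr.part_add[of h 0 k] by auto
  next
    fix h assume "h \<in> ring_part R 0"
    then show "\<ominus> h \<in> ring_part R 0" using gr.part_inv[of h 0] by simp
  qed
qed

lemma component_mult_part:
  assumes r: "r \<in> int_part R m" and s: "s \<in> carrier R"
  shows "component R (int_part R) (r \<otimes> s) (n + m) = r \<otimes> component R (int_part R) s n"
proof (rule component_hom[OF gr.graded_group_axioms gr.graded_group_axioms, where \<sigma> = "\<lambda>n. n + m"])
  show "inj (\<lambda>n. n + m)" by (simp add: inj_on_def)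
  have rc: "r \<in> carrier R" using gr.part_carrier[OF r] .
  show "x \<in> carrier R \<Longrightarrow> r \<otimes> x \<in> carrier R" for x using rc by simp
  show "x \<in> carrier R \<Longrightarrow> y \<in> carrier R \<Longrightarrow> r \<otimes> (x \<oplus> y) = r \<otimes> x \<oplus> r \<otimes> y" for x y
    using rc by (simp add: r_distr)
  show "x \<in> int_part R i \<Longrightarrow> r \<otimes> x \<in> int_part R (i + m)" for x i
    using part_mult[OF r, of x i] by (simp add: add.commute)
qed (rule s)

text \<open>Induction over \<open>generate_ring\<close>, following components. For a product the
  first factor is split into homogeneous pieces, and multiplying by such a piece only translates the
  components of the second.\<close>

lemma multiplicative_family_full:
  assumes gen: "generate_ring R H = carrier R" and H: "H \<subseteq> carrier R"
    and HT: "\<And>h n. h \<in> H \<Longrightarrow> component R (int_part R) h n \<in> T n"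
    and T: "\<And>n. T n \<subseteq> int_part R n" "\<And>n. \<zero> \<in> T n" "\<one> \<in> T 0"
    and T_add: "\<And>n a b. a \<in> T n \<Longrightarrow> b \<in> T n \<Longrightarrow> a \<oplus> b \<in> T n"
    and T_inv: "\<And>n a. a \<in> T n \<Longrightarrow> \<ominus> a \<in> T n"
    and T_mult: "\<And>m n a b. a \<in> T m \<Longrightarrow> b \<in> T n \<Longrightarrow> a \<otimes> b \<in> T (m + n)"
  shows "int_part R n \<subseteq> T n"
proof -
  have full: "r \<in> carrier R \<Longrightarrow> component R (int_part R) r n \<in> T n" for r n
    unfolding gen[symmetric]
  proof (induction r arbitrary: n rule: generate_ring.induct)
    case one
    then show ?case using gr.component_homogeneous[of \<one> 0] one_part T by simp
  next
    case (incl h)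
    then show ?case by (rule HT)
  next
    case (a_inv h)
    then show ?case using T_inv gen gr.component_inv by auto
  next
    case (eng_add h k)
    then show ?case using T_add gen gr.component_add by auto
  next
    case (eng_mult h k)
    then have c: "h \<in> carrier R" "k \<in> carrier R" using gen by auto
    have "\<forall>n. component R (int_part R) (h \<otimes> k) n \<in> T n"
      using c(1) eng_mult.IH(1)
    proof (induction rule: gr.component_induct)
      case zero
      then show ?case using c T(2) gr.component_zero by simp
    next
      case (homogeneous m a)
      show ?case
      proof
        fix n
        have "component R (int_part R) (a \<otimes> k) (n - m + m) = a \<otimes> component R (int_part R) k (n - m)"
          by (rule component_mult_part[OF homogeneous(2) c(2)])
        moreover have "a \<otimes> component R (int_part R) k (n - m) \<in> T (m + (n - m))"
          using T_mult homogeneous(1) eng_mult.IH(2) by blast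
        ultimately show "component R (int_part R) (a \<otimes> k) n \<in> T n" by simp
      qed
    next
      case (add a b)
      then show ?case using c T_add gr.component_add[of "a \<otimes> k" "b \<otimes> k"] by (simp add: l_distr)
    qed
    then show ?case by blast
  qed
  show ?thesis
  proof
    fix r assume r: "r \<in> int_part R n"
    then show "r \<in> T n" using full[OF gr.part_carrier[OF r], of n] gr.component_homogeneous[OF r] by simp
  qed
qed

text \<open>The witnesses are the degree-one components of the algebra generators. Replacing the
  degree-one part of \<open>R\<close> by a submodule \<open>N\<close> that contains them leaves a
  multiplicative family, since a product of total degree one has a factor of degree 0 beside one of
  degree 1, or else a vanishing factor of negative degree. By
  \<open>multiplicative_family_full\<close> the replacement changed nothing.\<close>

lemma exists_degree_one_generators:
  "\<exists>X. finite X \<and> X \<subseteq> ring_part R 1 \<and>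
     (\<forall>N. N \<subseteq> ring_part R 1 \<and> X \<subseteq> N \<and> \<zero> \<in> N \<and> (\<forall>a \<in> N. \<forall>b \<in> N. a \<oplus> b \<in> N) \<and>
        (\<forall>r \<in> ring_part R 0. \<forall>a \<in> N. r \<otimes> a \<in> N) \<longrightarrow> ring_part R 1 \<subseteq> N)"
proof -
  obtain X0 where X0: "finite X0" "X0 \<subseteq> carrier R" "generate_ring R (ring_part R 0 \<union> X0) = carrier R"
    using standard by (auto simp: fg_standard_graded_def)
  define X where "X = (\<lambda>x. component R (int_part R) x 1) ` X0"
  have X1: "X \<subseteq> ring_part R 1" using gr.component_part[of _ 1] X0(2) by (auto simp: X_def)
  have "ring_part R 1 \<subseteq> N"
    if N: "N \<subseteq> ring_part R 1" "X \<subseteq> N" "\<zero> \<in> N" "\<And>a b. a \<in> N \<Longrightarrow> b \<in> N \<Longrightarrow> a \<oplus> b \<in> N"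
      "\<And>r a. r \<in> ring_part R 0 \<Longrightarrow> a \<in> N \<Longrightarrow> r \<otimes> a \<in> N" for N
  proof -
    have Nc: "a \<in> carrier R" if "a \<in> N" for a using that N(1) gr.part_carrier[of a 1] by auto
    define T where "T n = (if n = 1 then N else int_part R n)" for n :: int
    have T_sub: "T n \<subseteq> int_part R n" for n using N(1) by (simp add: T_def)
    have T_mult: "a \<otimes> b \<in> T (m + n)" if a: "a \<in> T m" and b: "b \<in> T n" for a b m n
    proof (cases "m + n = 1")
      case False
      then show ?thesis using part_mult[of a m b n] a b T_sub[of m] T_sub[of n] by (auto simp: T_def)
    next
      case True
      have ab: "a \<in> carrier R" "b \<in> carrier R" using a b T_sub gr.part_carrier by blast+
      consider "m < 0" | "n < 0" | "m = 0" "n = 1" | "m = 1" "n = 0" using True by linarith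
      then show ?thesis
      proof cases
        case 1
        then have "a = \<zero>" using a by (simp add: T_def int_part_def)
        then show ?thesis using True N(3) ab by (simp add: T_def)
      next
        case 2
        then have "b = \<zero>" using b by (simp add: T_def int_part_def)
        then show ?thesis using True N(3) ab by (simp add: T_def)
      next
        case 3
        then show ?thesis using N(5) a b by (simp add: T_def)
      next
        case 4
        then have "b \<otimes> a \<in> N" using N(5) a b by (simp add: T_def)
        then show ?thesis using True ab by (simp add: T_def m_comm)
      qed
    qed
    have "int_part R 1 \<subseteq> T 1"
    proof (rule multiplicative_family_full[OF X0(3)])
      show "ring_part R 0 \<union> X0 \<subseteq> carrier R" using X0(2) A_carrier by blast
    next
      fix h n assume h: "h \<in> ring_part R 0 \<union> X0"
      then have hc: "h \<in> carrier R" using X0(2) A_carrier by blast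
      show "component R (int_part R) h n \<in> T n"
      proof (cases "n = 1")
        case True
        show ?thesis
        proof (cases "h \<in> X0")
          case True
          then show ?thesis using N(2) \<open>n = 1\<close> by (auto simp: T_def X_def)
        next
          case False
          then have "h \<in> int_part R 0" using h by simp
          then show ?thesis using gr.component_homogeneous[of h 0] True N(3) by (simp add: T_def)
        qed
      next
        case False
        then show ?thesis using gr.component_part[OF hc] by (simp add: T_def)
      qed
    next
      fix n show "\<zero> \<in> T n" using N(3) gr.part_zero by (simp add: T_def)
    next
      fix n a b assume "a \<in> T n" "b \<in> T n"
      then show "a \<oplus> b \<in> T n" using N(4) gr.part_add by (simp add: T_def split: if_splits)
    next
      fix n a assume a: "a \<in> T n"
      show "\<ominus> a \<in> T n"
      proof (cases "n = 1")
        case True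
        then have "(\<ominus> \<one>) \<otimes> a \<in> N" using N(5)[OF minus_A[OF one_A]] a by (simp add: T_def)
        then show ?thesis using True a Nc by (simp add: T_def l_minus)
      next
        case False
        then show ?thesis using a gr.part_inv by (simp add: T_def)
      qed
    qed (use T_sub T_mult one_part in \<open>auto simp: T_def\<close>)
    then show ?thesis by (simp add: T_def)
  qed
  note * = this
  have "finite X" using X0(1) by (simp add: X_def)
  with X1 show ?thesis
  proof (intro exI[of _ X] conjI allI impI)
    fix N
    assume "N \<subseteq> ring_part R 1 \<and> X \<subseteq> N \<and> \<zero> \<in> N \<and> (\<forall>a \<in> N. \<forall>b \<in> N. a \<oplus> b \<in> N) \<and>
        (\<forall>r \<in> ring_part R 0. \<forall>a \<in> N. r \<otimes> a \<in> N)"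
    then show "ring_part R 1 \<subseteq> N" by (intro *) simp_all
  qed
qed

lemma local_unit:
  assumes y: "y \<in> \<nn>" and r: "r \<in> ring_part R 0"
  shows "\<exists>u \<in> ring_part R 0. u \<otimes> (\<one> \<ominus> r \<otimes> y) = \<one>"
proof -
  let ?N = "R\<lparr>carrier := ring_part R 0\<rparr>"
  have loc: "noetherian_local_ring ?N \<nn>" using local by (simp add: degree_zero_ring_def)
  interpret nn: maximalideal \<nn> ?N using loc by (simp add: noetherian_local_ring_def)
  have yA: "y \<in> ring_part R 0" using nn.Icarr[OF y] by simp
  have ry: "r \<otimes> y \<in> \<nn>" using nn.I_l_closed[OF y, of r] r by simp
  have ryA: "r \<otimes> y \<in> ring_part R 0" using nn.Icarr[OF ry] by simp
  have uA: "\<one> \<ominus> r \<otimes> y \<in> ring_part R 0"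
    unfolding a_minus_def using gr.part_add[of _ 0] gr.part_inv[of _ 0] ryA one_part by simp
  have "\<one> \<ominus> r \<otimes> y \<notin> \<nn>"
  proof
    assume "\<one> \<ominus> r \<otimes> y \<in> \<nn>"
    then have "(\<one> \<ominus> r \<otimes> y) \<oplus> r \<otimes> y \<in> \<nn>" using additive_subgroup.a_closed[OF nn.additive_subgroup_axioms _ ry] by simp
    moreover have "(\<one> \<ominus> r \<otimes> y) \<oplus> r \<otimes> y = \<one>" using A_carrier[OF ryA] by (intro diff_add_cancel) auto
    ultimately have "\<one>\<^bsub>?N\<^esub> \<in> \<nn>" by simp
    then show False using nn.one_imp_carrier nn.I_notcarr by simp
  qed
  then show ?thesis using noetherian_local_unit[OF loc, of "\<one> \<ominus> r \<otimes> y"] uA by simp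
qed

lemma exists_maximal_ideal_generators:
  "\<exists>Y. finite Y \<and> Y \<subseteq> \<nn> \<and> \<nn> \<subseteq> ring_part R 0 \<and>
     (\<forall>J. ideal J (R\<lparr>carrier := ring_part R 0\<rparr>) \<and> Y \<subseteq> J \<longrightarrow> \<nn> \<subseteq> J)"
proof -
  let ?N = "R\<lparr>carrier := ring_part R 0\<rparr>"
  have loc: "noetherian_local_ring ?N \<nn>" using local by (simp add: degree_zero_ring_def)
  interpret N: noetherian_ring ?N by (rule degree_zero_noetherian)
  interpret nn: maximalideal \<nn> ?N using loc by (simp add: noetherian_local_ring_def)
  obtain Y where Y: "Y \<subseteq> carrier ?N" "finite Y" "\<nn> = Idl\<^bsub>?N\<^esub> Y"
    using N.finetely_gen[OF nn.is_ideal] by blast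
  have "\<nn> \<subseteq> J" if "ideal J ?N" "Y \<subseteq> J" for J
    using N.genideal_minimal[OF that] Y(3) by blast
  moreover have "Y \<subseteq> \<nn>" using N.genideal_self[OF Y(1)] Y(3) by blast
  moreover have "\<nn> \<subseteq> ring_part R 0" using nn.a_subset by simp
  ultimately show ?thesis using Y(2) by blast
qed

end

section \<open>Passage from ring generators to the whole ring, and graded noetherianness\<close>

locale standard_graded_generators = standard_graded +
  fixes X :: "'a set"
  assumes finite_X: "finite X" and X_part: "X \<subseteq> ring_part R 1"
    and X_generate: "\<And>N. N \<subseteq> ring_part R 1 \<Longrightarrow> X \<subseteq> N \<Longrightarrow> \<zero> \<in> N \<Longrightarrow> (\<And>a b. a \<in> N \<Longrightarrow> b \<in> N \<Longrightarrow> a \<oplus> b \<in> N) \<Longrightarrow>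
        (\<And>r a. r \<in> ring_part R 0 \<Longrightarrow> a \<in> N \<Longrightarrow> r \<otimes> a \<in> N) \<Longrightarrow> ring_part R 1 \<subseteq> N"
begin

lemma X_carrier: "X \<subseteq> carrier R"
  using X_part gr.part_carrier[of _ 1] by auto

text \<open>By definition a graded family is closed only under the chosen operators. The elements of
  \<open>R\<^sub>n\<close> that map \<open>Z t\<close> into \<open>Z (t + n)\<close> for every
  \<open>t\<close> form a multiplicative family containing those operators, hence all of
  \<open>R\<^sub>n\<close>, because \<open>R\<close> is generated in degrees 0 and 1.\<close>

lemma family_part_closed:
  assumes G: "module R G" and Z: "graded_family (ring_part R 0) X G Z"
    and r: "r \<in> int_part R n" and z: "z \<in> Z t"
  shows "r \<odot>\<^bsub>G\<^esub> z \<in> Z (t + n)"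
proof -
  interpret G: module R G by fact
  note ZD = graded_familyD[OF Z]
  define T where "T n = {r \<in> int_part R n. \<forall>t. \<forall>z \<in> Z t. r \<odot>\<^bsub>G\<^esub> z \<in> Z (t + n)}" for n
  have Tc: "r \<in> T n \<Longrightarrow> r \<in> carrier R" for r n using gr.part_carrier by (auto simp: T_def)
  have T_zero: "\<zero> \<in> T n" for n using gr.part_zero ZD(1,2) by (auto simp: T_def)
  have T_add: "a \<oplus> b \<in> T n" if "a \<in> T n" "b \<in> T n" for a b n
    using that gr.part_add ZD(1,3) Tc[OF that(1)] Tc[OF that(2)] by (auto simp: T_def G.smult_l_distr)
  have T_mult: "a \<otimes> b \<in> T (m + n)" if a: "a \<in> T m" and b: "b \<in> T n" for a b m n
  proof -
    have "(a \<otimes> b) \<odot>\<^bsub>G\<^esub> z \<in> Z (t + (m + n))" if z: "z \<in> Z t" for z t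
    proof -
      have "b \<odot>\<^bsub>G\<^esub> z \<in> Z (t + n)" using b z by (simp add: T_def)
      then have "a \<odot>\<^bsub>G\<^esub> (b \<odot>\<^bsub>G\<^esub> z) \<in> Z (t + n + m)" using a by (simp add: T_def)
      then show ?thesis using Tc[OF a] Tc[OF b] ZD(1)[OF z] by (simp add: G.smult_assoc1 algebra_simps)
    qed
    then show ?thesis using part_mult[of a m b n] a b by (simp add: T_def)
  qed
  have T0: "ring_part R 0 \<subseteq> T 0" using ZD(4) by (auto simp: T_def)
  have T_inv: "\<ominus> a \<in> T n" if "a \<in> T n" for a n
    using T_mult[of "\<ominus> \<one>" 0 a n] T0 minus_A[OF one_A] that Tc[OF that] by (auto simp: l_minus)
  have T1: "ring_part R 1 \<subseteq> T 1"
  proof (rule X_generate)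
    show "T 1 \<subseteq> ring_part R 1" by (auto simp: T_def)
    show "X \<subseteq> T 1" using X_part ZD(5) by (auto simp: T_def)
    fix r a assume "r \<in> ring_part R 0" "a \<in> T 1"
    then show "r \<otimes> a \<in> T 1" using T_mult[of r 0 a 1] T0 by auto
  qed (use T_zero T_add in auto)
  have "int_part R n \<subseteq> T n"
  proof (rule multiplicative_family_full)
    show "generate_ring R (ring_part R 0 \<union> ring_part R 1) = carrier R"
      using standard by (simp add: fg_standard_graded_def)
    show "ring_part R 0 \<union> ring_part R 1 \<subseteq> carrier R" using gr.part_carrier[of _ 0] gr.part_carrier[of _ 1] by auto
  next
    fix h n assume "h \<in> ring_part R 0 \<union> ring_part R 1"
    then show "component R (int_part R) h n \<in> T n"
      using gr.component_homogeneous[of h 0] gr.component_homogeneous[of h 1] T0 T1 T_zero by auto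
  qed (use T_zero T_add T_inv T_mult T0 one_part in \<open>auto simp: T_def\<close>)
  then show ?thesis using r z by (auto simp: T_def)
qed

lemma ring_generated_by_one:
  assumes "graded_family (ring_part R 0) X (self_module R) K" "\<one> \<in> K 0"
  shows "int_part R t \<subseteq> K t"
proof
  fix r assume r: "r \<in> int_part R t"
  show "r \<in> K t"
    using family_part_closed[OF module_self_module assms(1) r assms(2)] gr.part_carrier[OF r] by simp
qed

lemma family_int_part: "graded_family (ring_part R 0) X (self_module R) (int_part R)"
proof (intro graded_familyI)
  fix t r a assume "r \<in> ring_part R 0" "a \<in> int_part R t"
  then show "r \<odot>\<^bsub>self_module R\<^esub> a \<in> int_part R t" using part_mult[of r 0 a t] by simp
next
  fix t r a assume "r \<in> X" "a \<in> int_part R t"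
  then show "r \<odot>\<^bsub>self_module R\<^esub> a \<in> int_part R (t + 1)"
    using part_mult[of r 1 a t] X_part by (auto simp: add.commute)
qed (use gr.part_carrier gr.part_zero gr.part_add in auto)

text \<open>The family generated by \<open>Y\<close> is not constructed. It is enough to find one
  family with the chain condition that contains \<open>Y\<close>:
  \<open>acc_finitely_generated\<close> supplies it over the degree-zero ring,
  \<open>acc_extend_operators\<close> adds \<open>X\<close>, and \<open>Z\<close> lies below
  it.\<close>

theorem acc_generated:
  assumes G: "module R G" and Y: "finite Y" "Y \<subseteq> UNIV \<times> carrier G"
    and gen: "\<And>K. graded_family (ring_part R 0) X G K \<Longrightarrow> (\<And>t y. (t, y) \<in> Y \<Longrightarrow> y \<in> K t) \<Longrightarrow> Z \<le> K"
  shows "acc (ring_part R 0) X G Z"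
proof -
  obtain S where S: "graded_family (ring_part R 0) {} G S" "acc (ring_part R 0) {} G S" "\<forall>(t, m) \<in> Y. m \<in> S t"
    using acc_finitely_generated[OF degree_zero_noetherian G Y] by blast
  obtain T where T: "graded_family (ring_part R 0) X G T" "S \<le> T" "acc (ring_part R 0) X G T"
    using acc_extend_operators[OF G finite_X X_carrier S(1,2)] by blast
  have "y \<in> T t" if "(t, y) \<in> Y" for t y using that S(3) T(2) unfolding le_fun_def by blast
  then have "Z \<le> T" using gen[OF T(1)] by blast
  then show ?thesis by (rule acc_subset[OF T(3)])
qed

lemma acc_ring: "acc (ring_part R 0) X (self_module R) (int_part R)"
proof (rule acc_generated[OF module_self_module, where Y = "{(0, \<one>)}"])
  fix K assume "graded_family (ring_part R 0) X (self_module R) K"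
    "\<And>t y. (t, y) \<in> {(0, \<one>)} \<Longrightarrow> y \<in> K t"
  then show "int_part R \<le> K" using ring_generated_by_one[of K] by (simp add: le_fun_def)
qed auto

end

section \<open>Relative injectivity in Baer's form\<close>

text \<open>The ambient module for graphs: a homomorphism from a graded ideal to \<open>G\<close>
  becomes a graded family of pairs, and closure of that family expresses linearity.\<close>

definition pair_module :: "('a, 'x) ring_scheme \<Rightarrow> ('a, 'c, 'y) module_scheme \<Rightarrow> ('a, 'a \<times> 'c) module" where
  "pair_module R G =
     \<lparr>carrier = carrier R \<times> carrier G, mult = undefined, one = undefined, zero = (\<zero>\<^bsub>R\<^esub>, \<zero>\<^bsub>G\<^esub>),
      add = (\<lambda>p q. (fst p \<oplus>\<^bsub>R\<^esub> fst q, snd p \<oplus>\<^bsub>G\<^esub> snd q)),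
      smult = (\<lambda>r p. (r \<otimes>\<^bsub>R\<^esub> fst p, r \<odot>\<^bsub>G\<^esub> snd p))\<rparr>"

lemma pair_module_simps [simp]:
  "carrier (pair_module R G) = carrier R \<times> carrier G" "zero (pair_module R G) = (\<zero>\<^bsub>R\<^esub>, \<zero>\<^bsub>G\<^esub>)"
  "p \<oplus>\<^bsub>pair_module R G\<^esub> q = (fst p \<oplus>\<^bsub>R\<^esub> fst q, snd p \<oplus>\<^bsub>G\<^esub> snd q)"
  "r \<odot>\<^bsub>pair_module R G\<^esub> p = (r \<otimes>\<^bsub>R\<^esub> fst p, r \<odot>\<^bsub>G\<^esub> snd p)"
  by (simp_all add: pair_module_def)

lemma module_pair_module:
  assumes "module R G" shows "module R (pair_module R G)"
proof -
  interpret G: module R G by fact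
  show ?thesis
  proof (rule moduleI)
    show "cring R" by (rule G.is_cring)
    show "abelian_group (pair_module R G)"
    proof (rule abelian_groupI)
      fix p assume "p \<in> carrier (pair_module R G)"
      then show "\<exists>q \<in> carrier (pair_module R G). q \<oplus>\<^bsub>pair_module R G\<^esub> p = \<zero>\<^bsub>pair_module R G\<^esub>"
        by (intro bexI[of _ "(\<ominus>\<^bsub>R\<^esub> fst p, \<ominus>\<^bsub>G\<^esub> snd p)"]) (auto simp: G.M.l_neg G.R.l_neg)
    qed (auto simp: G.M.a_ac G.R.a_ac)
  qed (auto simp: G.smult_l_distr G.smult_r_distr G.smult_assoc1 G.R.l_distr G.R.r_distr G.R.m_assoc)
qed

text \<open>
  \<open>F\<close> is the graph of a homomorphism of degree \<open>\<tau>\<close> from a graded ideal to \<open>W\<close>.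
\<close>

definition baer_injective ::
    "'a gring \<Rightarrow> 'a set \<Rightarrow> 'a set \<Rightarrow> ('a, 'c, 'y) module_scheme \<Rightarrow> (int \<Rightarrow> 'c set) \<Rightarrow> bool" where
  "baer_injective R A X G W \<longleftrightarrow>
     (\<forall>\<tau> F. graded_family A X (pair_module R G) F \<and> (\<forall>n. F n \<subseteq> int_part R n \<times> W (n + \<tau>)) \<and>
        (\<forall>n w. (\<zero>\<^bsub>R\<^esub>, w) \<in> F n \<longrightarrow> w = \<zero>\<^bsub>G\<^esub>) \<longrightarrow>
        (\<exists>e \<in> W \<tau>. \<forall>n. \<forall>(r, w) \<in> F n. w = r \<odot>\<^bsub>G\<^esub> e))"

lemma baer_injectiveD:
  assumes "baer_injective R A X G W" "graded_family A X (pair_module R G) F"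
    "\<And>n r w. (r, w) \<in> F n \<Longrightarrow> r \<in> int_part R n \<and> w \<in> W (n + \<tau>)"
    "\<And>n w. (\<zero>\<^bsub>R\<^esub>, w) \<in> F n \<Longrightarrow> w = \<zero>\<^bsub>G\<^esub>"
  obtains e where "e \<in> W \<tau>" "\<And>n r w. (r, w) \<in> F n \<Longrightarrow> w = r \<odot>\<^bsub>G\<^esub> e"
proof -
  have "\<forall>n. F n \<subseteq> int_part R n \<times> W (n + \<tau>)" using assms(3) by auto
  with assms have "\<exists>e \<in> W \<tau>. \<forall>n. \<forall>(r, w) \<in> F n. w = r \<odot>\<^bsub>G\<^esub> e"
    unfolding baer_injective_def by blast
  then show thesis using that by blast
qed

definition torsion_subfamily ::
    "('a, 'x) ring_scheme \<Rightarrow> ('a, 'c, 'y) module_scheme \<Rightarrow> 'a \<Rightarrow> (int \<Rightarrow> 'c set) \<Rightarrow> int \<Rightarrow> 'c set" where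
  "torsion_subfamily R G x W t = {w \<in> W t. \<exists>k :: nat. (x [^]\<^bsub>R\<^esub> k) \<odot>\<^bsub>G\<^esub> w = \<zero>\<^bsub>G\<^esub>}"

text \<open>The shift by \<open>\<tau>\<close> turns a homomorphism of degree \<open>\<tau>\<close>
  into one of degree 0, as \<open>graded_hom\<close> demands. The elements lie in the type of the
  ring, as the test modules of \<open>graded_injective\<close> do.\<close>

definition ideal_module :: "'a gring \<Rightarrow> (int \<Rightarrow> 'a set) \<Rightarrow> int \<Rightarrow> ('a, 'a) gmodule" where
  "ideal_module R a \<tau> =
     \<lparr>carrier = {r \<in> carrier R. \<forall>t. component R (int_part R) r t \<in> a t},
      mult = mult R, one = \<one>\<^bsub>R\<^esub>, zero = \<zero>\<^bsub>R\<^esub>, add = add R, smult = mult R,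
      mod_part = (\<lambda>t. a (t - \<tau>))\<rparr>"

lemma ideal_module_simps [simp]:
  "zero (ideal_module R a \<tau>) = \<zero>\<^bsub>R\<^esub>" "add (ideal_module R a \<tau>) = add R"
  "smult (ideal_module R a \<tau>) = mult R" "mod_part (ideal_module R a \<tau>) t = a (t - \<tau>)"
  "r \<in> carrier (ideal_module R a \<tau>) \<longleftrightarrow> r \<in> carrier R \<and> (\<forall>t. component R (int_part R) r t \<in> a t)"
  by (simp_all add: ideal_module_def)

context standard_graded_generators
begin

lemma generator_in_part: "is_generator (ring_part R 0) X (x, \<delta>) \<Longrightarrow> x \<in> int_part R (int \<delta>)"
  using X_part by (auto simp: is_generator_def)

lemma pow_in_part:
  assumes "x \<in> int_part R m" shows "x [^] (k::nat) \<in> int_part R (int k * m)"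
proof (induction k)
  case 0
  then show ?case using one_part by simp
next
  case (Suc k)
  then show ?case using part_mult[OF Suc assms] by (simp add: algebra_simps)
qed

lemma graded_module_ideal_module:
  assumes a: "graded_family (ring_part R 0) X (self_module R) a" and sub: "\<And>t. a t \<subseteq> int_part R t"
  shows "graded_module R (ideal_module R a \<tau>)"
proof -
  let ?J = "ideal_module R a \<tau>"
  note aD = graded_familyD[OF a, simplified]
  have a_closed: "r \<otimes> z \<in> a (t + n)" if "r \<in> int_part R n" "z \<in> a t" for r z n t
    using family_part_closed[OF module_self_module a that] by simp
  have a_inv: "\<ominus> z \<in> a t" if "z \<in> a t" for z t
    using family_minus[OF module_self_module a that] by simp
  have J_smult: "r \<otimes> u \<in> carrier ?J" if r: "r \<in> carrier R" and u: "u \<in> carrier ?J" for r u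
    using r
  proof (induction rule: gr.homogeneous_induct)
    case (homogeneous m r)
    have uc: "u \<in> carrier R" using u by simp
    have "component R (int_part R) (r \<otimes> u) t \<in> a t" for t
    proof -
      have "component R (int_part R) (r \<otimes> u) (t - m + m) = r \<otimes> component R (int_part R) u (t - m)"
        by (rule component_mult_part[OF homogeneous uc])
      moreover have "r \<otimes> component R (int_part R) u (t - m) \<in> a (t - m + m)"
      proof (rule a_closed[OF homogeneous])
        show "component R (int_part R) u (t - m) \<in> a (t - m)" using u by simp
      qed
      ultimately show ?thesis by simp
    qed
    then show ?case using uc gr.part_carrier[OF homogeneous] by simp
  next
    case (add r s)
    then show ?case using u aD(3) by (simp add: l_distr gr.component_add)
  qed
  have J_group: "abelian_group ?J"
  proof (rule abelian_groupI)
    fix u assume u: "u \<in> carrier ?J"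
    then show "\<exists>v \<in> carrier ?J. v \<oplus>\<^bsub>?J\<^esub> u = \<zero>\<^bsub>?J\<^esub>"
      using a_inv by (intro bexI[of _ "\<ominus> u"]) (auto simp: l_neg gr.component_inv)
  qed (use aD in \<open>auto simp: a_ac gr.component_add gr.component_zero\<close>)
  have J_module: "module R ?J"
  proof (rule moduleI)
    show "cring R" by (rule is_cring)
    fix r u assume "r \<in> carrier R" "u \<in> carrier ?J"
    then show "r \<odot>\<^bsub>?J\<^esub> u \<in> carrier ?J" unfolding ideal_module_simps(3) by (rule J_smult)
  qed (use J_group in \<open>auto simp: l_distr r_distr m_assoc\<close>)
  have shift: "direct_sum_of R (\<lambda>t. int_part R (t - \<tau>))"
  proof (rule gr.direct_sum_reindex[where \<sigma> = "\<lambda>n. n + \<tau>"])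
    show "inj (\<lambda>n. n + \<tau>)" by (simp add: inj_on_def)
    fix j assume "j \<notin> range (\<lambda>n. n + \<tau>)"
    moreover have "j = (j - \<tau>) + \<tau>" by simp
    ultimately show "int_part R (j - \<tau>) = {\<zero>}" by blast
  qed simp
  interpret sh: graded_group R "\<lambda>t. int_part R (t - \<tau>)" by unfold_locales (rule shift)
  have comp: "component R (\<lambda>t. int_part R (t - \<tau>)) r t = component R (int_part R) r (t - \<tau>)"
    if "r \<in> carrier R" for r t
  proof -
    have "component R (\<lambda>t. int_part R (t - \<tau>)) r ((\<lambda>n. n + \<tau>) (t - \<tau>)) = component R (int_part R) r (t - \<tau>)"
      by (rule component_hom[OF gr.graded_group_axioms sh.graded_group_axioms, where h = "\<lambda>r. r"])
        (use that in \<open>auto simp: inj_on_def\<close>)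
    then show ?thesis by simp
  qed
  have "direct_sum_of ?J (mod_part ?J)"
  proof (rule direct_sum_of_subgroup[OF sh.graded_group_axioms J_group])
    have "(\<forall>t. component R (int_part R) r t \<in> a t) \<longleftrightarrow> (\<forall>t. component R (int_part R) r (t - \<tau>) \<in> a (t - \<tau>))" for r
      by (metis add_diff_cancel_right')
    then show "carrier ?J = {r \<in> carrier R. \<forall>t. component R (\<lambda>t. int_part R (t - \<tau>)) r t \<in> mod_part ?J t}"
      using comp by (auto simp: ideal_module_def)
  qed (use sub aD a_inv in auto)
  moreover have "r \<odot>\<^bsub>?J\<^esub> u \<in> mod_part ?J (int n + t)" if "r \<in> ring_part R n" "u \<in> mod_part ?J t" for n t r u
    using a_closed[of r "int n" u "t - \<tau>"] that by (simp add: algebra_simps)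
  ultimately show ?thesis using J_module by (simp add: graded_module_def)
qed

text \<open>Injectivity is tested on the inclusion of the domain of \<open>F\<close> into
  \<open>R\<close>, both shifted by \<open>\<tau>\<close>; the value of the extension at
  \<open>\<one>\<close> is the element sought.\<close>

lemma graded_injective_baer:
  fixes E :: "('a, 'c) gmodule"
  assumes inj: "graded_injective R E"
  shows "baer_injective R (ring_part R 0) X E (mod_part E)"
  unfolding baer_injective_def
proof (intro allI impI, elim conjE)
  have gE: "graded_module R E" using inj by (simp add: graded_injective_def)
  have mE: "module R E" using gE by (simp add: graded_module_def)
  interpret E: module R E by (rule mE)
  interpret ge: graded_group E "mod_part E"
    using gE by unfold_locales (simp add: graded_module_def)
  fix \<tau> and F :: "int \<Rightarrow> ('a \<times> 'c) set"
  assume F: "graded_family (ring_part R 0) X (pair_module R E) F"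
    and F_sub: "\<forall>n. F n \<subseteq> int_part R n \<times> mod_part E (n + \<tau>)"
    and F_single: "\<forall>n w. (\<zero>, w) \<in> F n \<longrightarrow> w = \<zero>\<^bsub>E\<^esub>"
  note FD = graded_familyD[OF F, simplified]
  have F_mem: "r \<in> int_part R n" "w \<in> mod_part E (n + \<tau>)" if "(r, w) \<in> F n" for r w n
  proof -
    have "(r, w) \<in> int_part R n \<times> mod_part E (n + \<tau>)" using F_sub that by blast
    then show "r \<in> int_part R n" "w \<in> mod_part E (n + \<tau>)" by simp_all
  qed
  define a where "a n = fst ` F n" for n
  have a_sub: "a n \<subseteq> int_part R n" for n using F_mem by (auto simp: a_def)
  have a_fam: "graded_family (ring_part R 0) X (self_module R) a"
  proof (intro graded_familyI)
    fix t z assume "z \<in> a t" then show "z \<in> carrier (self_module R)" using a_sub gr.part_carrier by auto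
  next
    fix t show "\<zero>\<^bsub>self_module R\<^esub> \<in> a t" using FD(2)[of t] by (force simp: a_def)
  next
    fix t y z assume "y \<in> a t" "z \<in> a t"
    then obtain v w where "(y, v) \<in> F t" "(z, w) \<in> F t" by (auto simp: a_def)
    then show "y \<oplus>\<^bsub>self_module R\<^esub> z \<in> a t" using FD(3)[of "(y, v)" t "(z, w)"] by (force simp: a_def)
  next
    fix t r z assume r: "r \<in> ring_part R 0" and "z \<in> a t"
    then obtain w where "(z, w) \<in> F t" by (auto simp: a_def)
    then show "r \<odot>\<^bsub>self_module R\<^esub> z \<in> a t" using FD(4)[OF r, of "(z, w)" t] by (force simp: a_def)
  next
    fix t r z assume r: "r \<in> X" and "z \<in> a t"
    then obtain w where "(z, w) \<in> F t" by (auto simp: a_def)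
    then show "r \<odot>\<^bsub>self_module R\<^esub> z \<in> a (t + 1)" using FD(5)[OF r, of "(z, w)" t] by (force simp: a_def)
  qed
  let ?cR = "component R (int_part R)" and ?cE = "component E (mod_part E)"
  \<comment> \<open>The graph \<open>F\<close> relates homogeneous elements only. Comparing
    components extends it to all elements of the ideal, where it is shown to be linear, single
    valued and total.\<close>
  define rel where "rel r w \<longleftrightarrow> r \<in> carrier R \<and> w \<in> carrier E \<and> (\<forall>n. (?cR r n, ?cE w (n + \<tau>)) \<in> F n)" for r w
  have rel_add: "rel (r \<oplus> s) (v \<oplus>\<^bsub>E\<^esub> w)" if "rel r v" "rel s w" for r s v w
  proof -
    have "(?cR r n \<oplus> ?cR s n, ?cE v (n + \<tau>) \<oplus>\<^bsub>E\<^esub> ?cE w (n + \<tau>)) \<in> F n" for n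
      using FD(3)[of "(?cR r n, ?cE v (n + \<tau>))" n "(?cR s n, ?cE w (n + \<tau>))"] that by (simp add: rel_def)
    then show ?thesis using that by (simp add: rel_def gr.component_add ge.component_add)
  qed
  have rel_smult: "rel (s \<otimes> r) (s \<odot>\<^bsub>E\<^esub> w)" if s: "s \<in> carrier R" and rw: "rel r w" for s r w
    using s
  proof (induction rule: gr.homogeneous_induct)
    case (homogeneous m s)
    have c: "r \<in> carrier R" "w \<in> carrier E" "s \<in> carrier R" using rw gr.part_carrier[OF homogeneous] by (auto simp: rel_def)
    have "(?cR (s \<otimes> r) n, ?cE (s \<odot>\<^bsub>E\<^esub> w) (n + \<tau>)) \<in> F n" for n
    proof -
      have 1: "?cR (s \<otimes> r) (n - m + m) = s \<otimes> ?cR r (n - m)"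
        by (rule component_mult_part[OF homogeneous c(1)])
      have 2: "?cE (s \<odot>\<^bsub>E\<^esub> w) (n - m + \<tau> + m) = s \<odot>\<^bsub>E\<^esub> ?cE w (n - m + \<tau>)"
      proof (rule component_hom[OF ge.graded_group_axioms ge.graded_group_axioms, where \<sigma> = "\<lambda>n. n + m"])
        fix i u assume u: "u \<in> mod_part E i"
        show "s \<odot>\<^bsub>E\<^esub> u \<in> mod_part E (i + m)"
        proof (cases "m < 0")
          case True
          then show ?thesis using homogeneous ge.part_zero ge.part_carrier[OF u] by (simp add: int_part_def)
        next
          case False
          then have "s \<in> ring_part R (nat m)" using homogeneous by (simp add: int_part_def)
          then have "s \<odot>\<^bsub>E\<^esub> u \<in> mod_part E (int (nat m) + i)"
            using u gE unfolding graded_module_def by blast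
          then show ?thesis using False by (simp add: add.commute)
        qed
      qed (use c in \<open>auto simp: inj_on_def E.smult_r_distr\<close>)
      have "(s \<otimes> ?cR r (n - m), s \<odot>\<^bsub>E\<^esub> ?cE w (n - m + \<tau>)) \<in> F (n - m + m)"
        using family_part_closed[OF module_pair_module[OF mE] F homogeneous, of "(?cR r (n - m), ?cE w (n - m + \<tau>))" "n - m"] rw
        by (simp add: rel_def)
      then show ?thesis using 1 2 by (simp add: algebra_simps)
    qed
    then show ?case using c by (simp add: rel_def)
  next
    case (add s s')
    have c: "r \<in> carrier R" "w \<in> carrier E" using rw by (auto simp: rel_def)
    then show ?case using rel_add[OF add(3,4)] add(1,2) by (simp add: l_distr E.smult_l_distr)
  qed
  have rel_zero: "w = \<zero>\<^bsub>E\<^esub>" if "rel \<zero> w" for w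
  proof (rule ge.component_all_zero)
    show "w \<in> carrier E" using that by (simp add: rel_def)
    fix i
    have "(\<zero>, ?cE w (i - \<tau> + \<tau>)) \<in> F (i - \<tau>)" using that unfolding rel_def gr.component_zero by blast
    then show "?cE w i = \<zero>\<^bsub>E\<^esub>" using F_single by auto
  qed
  have rel_unique: "v = w" if "rel r v" "rel r w" for r v w
  proof -
    have c: "r \<in> carrier R" "v \<in> carrier E" "w \<in> carrier E" using that by (auto simp: rel_def)
    have "rel (r \<oplus> (\<ominus> \<one>) \<otimes> r) (v \<oplus>\<^bsub>E\<^esub> (\<ominus> \<one>) \<odot>\<^bsub>E\<^esub> w)"
      using rel_add[OF that(1) rel_smult[OF _ that(2), of "\<ominus> \<one>"]] by simp
    then have "rel \<zero> (v \<ominus>\<^bsub>E\<^esub> w)" using c by (simp add: l_minus r_neg E.smult_l_minus a_minus_def)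
    then show ?thesis using rel_zero E.M.diff_eq_zero_iff c by blast
  qed
  have rel_hom: "rel r w" if "(r, w) \<in> F n" for r w n
  proof -
    have m: "r \<in> int_part R n" "w \<in> mod_part E (n + \<tau>)" using F_mem that by auto
    then show ?thesis
      using that FD(2) gr.part_carrier ge.part_carrier
      by (simp add: rel_def gr.component_homogeneous ge.component_homogeneous)
  qed
  let ?J = "ideal_module R a \<tau>" and ?B = "ideal_module R (int_part R) \<tau>"
  have rel_total: "\<exists>w. rel r w" if "r \<in> carrier ?J" for r
  proof -
    have "r \<in> carrier R" "\<And>t. ?cR r t \<in> a t" using that by auto
    then show ?thesis
    proof (induction rule: gr.component_induct)
      case zero
      then show ?case using rel_hom[OF FD(2)] by blast
    next
      case (homogeneous i r)
      then obtain w where "(r, w) \<in> F i" by (auto simp: a_def)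
      then show ?case using rel_hom by blast
    next
      case (add r s)
      then show ?case using rel_add by blast
    qed
  qed
  define f where "f r = (THE w. rel r w)" for r
  have f_eq: "f r = w" if "rel r w" for r w
    unfolding f_def using that rel_unique by blast
  have rel_f: "rel r (f r)" if "r \<in> carrier ?J" for r using rel_total[OF that] f_eq by metis
  have F_J: "r \<in> carrier ?J" if "(r, w) \<in> F n" for r w n
  proof -
    have r: "r \<in> a n" "r \<in> int_part R n" using that a_sub by (force simp: a_def)+
    have "\<zero> \<in> a t" for t using graded_familyD(2)[OF a_fam] by simp
    then show ?thesis using r gr.part_carrier by (simp add: gr.component_homogeneous)
  qed
  have gJ: "graded_module R ?J" by (rule graded_module_ideal_module[OF a_fam a_sub])
  have gB: "graded_module R ?B" by (rule graded_module_ideal_module[OF family_int_part]) simp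
  have hom_id: "graded_hom R ?J ?B (\<lambda>r. r)"
    using a_sub gr.component_part by (auto simp: graded_hom_def)
  have hom_f: "graded_hom R ?J E f"
    unfolding graded_hom_def
  proof (intro conjI ballI allI)
    show "f \<in> carrier ?J \<rightarrow> carrier E" using rel_f by (auto simp: rel_def)
  next
    fix r s assume "r \<in> carrier ?J" "s \<in> carrier ?J"
    then show "f (r \<oplus>\<^bsub>?J\<^esub> s) = f r \<oplus>\<^bsub>E\<^esub> f s" using f_eq[OF rel_add[OF rel_f rel_f]] by simp
  next
    fix r s assume "r \<in> carrier R" "s \<in> carrier ?J"
    then show "f (r \<odot>\<^bsub>?J\<^esub> s) = r \<odot>\<^bsub>E\<^esub> f s" using f_eq[OF rel_smult[OF _ rel_f]] by simp
  next
    fix t show "f ` mod_part ?J t \<subseteq> mod_part E t"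
    proof
      fix w assume "w \<in> f ` mod_part ?J t"
      then obtain r v where "(r, v) \<in> F (t - \<tau>)" "w = f r" by (auto simp: a_def)
      moreover from this have "f r = v" using rel_hom f_eq by blast
      ultimately show "w \<in> mod_part E t" using F_mem(2)[of r v "t - \<tau>"] by simp
    qed
  qed
  have ext: "\<exists>g. graded_hom R B E g \<and> (\<forall>x \<in> carrier A. g (\<iota> x) = f x)"
    if "graded_module R A" "graded_module R B" "graded_hom R A B \<iota>" "inj_on \<iota> (carrier A)" "graded_hom R A E f"
    for A B :: "('a, 'a) gmodule" and \<iota> f
    using inj that unfolding graded_injective_def by blast
  from ext[OF gJ gB hom_id inj_on_id2 hom_f] obtain g where g: "graded_hom R ?B E g" "\<And>r. r \<in> carrier ?J \<Longrightarrow> g r = f r" by blast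
  have one_B: "\<one> \<in> carrier ?B" using gr.component_part by simp
  \<comment> \<open>In the shifted ring the unit has degree \<open>\<tau>\<close>, hence so has its
    image.\<close>
  have "g \<one> \<in> mod_part E \<tau>"
    using g(1) one_part unfolding graded_hom_def by (metis diff_self ideal_module_simps(4) image_subset_iff int_part_0)
  moreover have "w = r \<odot>\<^bsub>E\<^esub> g \<one>" if rw: "(r, w) \<in> F n" for n r w
  proof -
    have r: "r \<in> carrier R" using F_J[OF rw] by simp
    have "g (r \<odot>\<^bsub>?B\<^esub> \<one>) = r \<odot>\<^bsub>E\<^esub> g \<one>" using g(1) one_B r unfolding graded_hom_def by blast
    then show ?thesis using g(2)[OF F_J[OF rw]] f_eq[OF rel_hom[OF rw]] r by simp
  qed
  ultimately show "\<exists>e \<in> mod_part E \<tau>. \<forall>n. \<forall>(r, w) \<in> F n. w = r \<odot>\<^bsub>E\<^esub> e" by blast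
qed

end

context standard_graded_generators
begin

section \<open>Torsion parts of families injective in Baer's sense\<close>

lemma generator_pow_shift:
  assumes "module R G" "graded_family (ring_part R 0) X G Z"
    and "x \<in> int_part R (int \<delta>)" "z \<in> Z t"
  shows "(x [^] (k::nat)) \<odot>\<^bsub>G\<^esub> z \<in> Z (t + int k * int \<delta>)"
  using family_part_closed[OF assms(1,2) pow_in_part[OF assms(3)] assms(4)] .

text \<open>The operator sets are arbitrary because \<open>local_cohomology_part_iff\<close> applies
  this with the whole ring acting in degree 0.\<close>

lemma graded_family_torsion_subfamily:
  assumes G: "module R G" and W: "graded_family A' X' G W" and "A' \<subseteq> carrier R" "X' \<subseteq> carrier R"
    and x: "x \<in> carrier R"
  shows "graded_family A' X' G (torsion_subfamily R G x W)"
proof -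
  interpret G: module R G by (rule G)
  note WD = graded_familyD[OF W]
  have comm: "(x [^] (k::nat)) \<odot>\<^bsub>G\<^esub> (r \<odot>\<^bsub>G\<^esub> w) = r \<odot>\<^bsub>G\<^esub> ((x [^] k) \<odot>\<^bsub>G\<^esub> w)"
    if "r \<in> carrier R" "w \<in> carrier G" for r w k
    using that x by (simp add: G.smult_assoc1[symmetric] m_comm)
  have memI: "w \<in> torsion_subfamily R G x W t" if "w \<in> W t" "(x [^] (k::nat)) \<odot>\<^bsub>G\<^esub> w = \<zero>\<^bsub>G\<^esub>" for w t k
    using that by (auto simp: torsion_subfamily_def)
  show ?thesis
  proof (intro graded_familyI)
    fix t v w assume "v \<in> torsion_subfamily R G x W t" "w \<in> torsion_subfamily R G x W t"
    then obtain i j :: nat where v: "v \<in> W t" "(x [^] i) \<odot>\<^bsub>G\<^esub> v = \<zero>\<^bsub>G\<^esub>" and w: "w \<in> W t" "(x [^] j) \<odot>\<^bsub>G\<^esub> w = \<zero>\<^bsub>G\<^esub>"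
      by (auto simp: torsion_subfamily_def)
    have c: "v \<in> carrier G" "w \<in> carrier G" using v w WD(1) by auto
    have "(x [^] (i + j)) \<odot>\<^bsub>G\<^esub> (v \<oplus>\<^bsub>G\<^esub> w)
        = (x [^] j) \<odot>\<^bsub>G\<^esub> ((x [^] i) \<odot>\<^bsub>G\<^esub> v) \<oplus>\<^bsub>G\<^esub> (x [^] i) \<odot>\<^bsub>G\<^esub> ((x [^] j) \<odot>\<^bsub>G\<^esub> w)"
      using c x by (simp add: G.smult_r_distr G.smult_assoc1[symmetric] nat_pow_mult add.commute)
    then have "(x [^] (i + j)) \<odot>\<^bsub>G\<^esub> (v \<oplus>\<^bsub>G\<^esub> w) = \<zero>\<^bsub>G\<^esub>" using v w x by simp
    then show "v \<oplus>\<^bsub>G\<^esub> w \<in> torsion_subfamily R G x W t"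
      using WD(3)[OF v(1) w(1)] memI by blast
  next
    fix t r w assume r: "r \<in> A'" and "w \<in> torsion_subfamily R G x W t"
    then obtain k :: nat where w: "w \<in> W t" "(x [^] k) \<odot>\<^bsub>G\<^esub> w = \<zero>\<^bsub>G\<^esub>" by (auto simp: torsion_subfamily_def)
    have rc: "r \<in> carrier R" using r assms(3) by blast
    show "r \<odot>\<^bsub>G\<^esub> w \<in> torsion_subfamily R G x W t"
      using memI[OF WD(4)[OF r w(1)], of k] comm[OF rc WD(1)[OF w(1)]] w(2) rc by simp
  next
    fix t r w assume r: "r \<in> X'" and "w \<in> torsion_subfamily R G x W t"
    then obtain k :: nat where w: "w \<in> W t" "(x [^] k) \<odot>\<^bsub>G\<^esub> w = \<zero>\<^bsub>G\<^esub>" by (auto simp: torsion_subfamily_def)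
    have rc: "r \<in> carrier R" using r assms(4) by blast
    show "r \<odot>\<^bsub>G\<^esub> w \<in> torsion_subfamily R G x W (t + 1)"
      using memI[OF WD(5)[OF r w(1)], of k] comm[OF rc WD(1)[OF w(1)]] w(2) rc by simp
  next
    fix t w assume "w \<in> torsion_subfamily R G x W t"
    then show "w \<in> carrier G" using WD(1) by (auto simp: torsion_subfamily_def)
  next
    fix t show "\<zero>\<^bsub>G\<^esub> \<in> torsion_subfamily R G x W t" using memI[OF WD(2), of 0] by simp
  qed
qed

text \<open>The colon ideals of \<open>a\<close> by powers of \<open>x\<close> ascend, and
  \<open>acc_ring\<close> stops them in all degrees at once. For \<open>a = 0\<close> this bounds
  the annihilators of powers of \<open>x\<close>.\<close>

lemma colon_chain_stationary:
  assumes x: "x \<in> int_part R (int \<delta>)"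
    and a: "graded_family (ring_part R 0) X (self_module R) a"
  shows "\<exists>c :: nat. \<forall>j n r. r \<in> int_part R n \<longrightarrow> (x [^] j) \<otimes> r \<in> a (n + int j * int \<delta>) \<longrightarrow>
           (x [^] c) \<otimes> r \<in> a (n + int c * int \<delta>)"
proof -
  have xc: "x \<in> carrier R" using gr.part_carrier[OF x] .
  note aD = graded_familyD[OF a, simplified] and ID = graded_familyD[OF family_int_part, simplified]
  define C where "C j n = {r \<in> int_part R n. (x [^] j) \<otimes> r \<in> a (n + int j * int \<delta>)}" for j :: nat and n
  have x_shift: "x \<otimes> z \<in> a (t + int \<delta>)" if "z \<in> a t" for z t
    using family_part_closed[OF module_self_module a x that] by simp
  have fam: "graded_family (ring_part R 0) X (self_module R) (C j)" for j
  proof (intro graded_familyI)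
    fix t r assume "r \<in> C j t" then show "r \<in> carrier (self_module R)" using gr.part_carrier by (auto simp: C_def)
  next
    fix t show "\<zero>\<^bsub>self_module R\<^esub> \<in> C j t" using gr.part_zero aD(2) xc by (simp add: C_def)
  next
    fix t r s assume "r \<in> C j t" "s \<in> C j t"
    then show "r \<oplus>\<^bsub>self_module R\<^esub> s \<in> C j t"
      using aD(3) gr.part_add gr.part_carrier[of r t] gr.part_carrier[of s t] xc by (simp add: C_def r_distr)
  next
    fix t s r assume s: "s \<in> ring_part R 0" and r: "r \<in> C j t"
    have "(x [^] j) \<otimes> (s \<otimes> r) = s \<otimes> ((x [^] j) \<otimes> r)"
      using r gr.part_carrier[of r t] A_carrier[OF s] xc by (simp add: C_def m_lcomm)
    then show "s \<odot>\<^bsub>self_module R\<^esub> r \<in> C j t" using r ID(4)[OF s] aD(4)[OF s] by (simp add: C_def)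
  next
    fix t s r assume s: "s \<in> X" and r: "r \<in> C j t"
    have "(x [^] j) \<otimes> (s \<otimes> r) = s \<otimes> ((x [^] j) \<otimes> r)"
      using r gr.part_carrier[of r t] s X_carrier xc by (simp add: C_def m_lcomm subset_iff)
    moreover have "s \<otimes> ((x [^] j) \<otimes> r) \<in> a (t + int j * int \<delta> + 1)" using r aD(5)[OF s] by (simp add: C_def)
    moreover have "s \<otimes> r \<in> int_part R (t + 1)" using r ID(5)[OF s] by (simp add: C_def)
    moreover have "t + int j * int \<delta> + 1 = t + 1 + int j * int \<delta>" by simp
    ultimately show "s \<odot>\<^bsub>self_module R\<^esub> r \<in> C j (t + 1)" by (simp add: C_def)
  qed
  have step: "C j \<le> C (Suc j)" for j
  proof (rule le_funI, rule subsetI)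
    fix n r assume r: "r \<in> C j n"
    have "x \<otimes> ((x [^] j) \<otimes> r) \<in> a (n + int j * int \<delta> + int \<delta>)" using x_shift r by (simp add: C_def)
    moreover have "x \<otimes> ((x [^] j) \<otimes> r) = (x [^] Suc j) \<otimes> r"
      using r gr.part_carrier[of r n] xc by (simp add: C_def m_assoc[symmetric] m_comm)
    ultimately show "r \<in> C (Suc j) n" using r by (simp add: C_def algebra_simps)
  qed
  have "C j \<le> int_part R" for j by (auto simp: le_fun_def C_def)
  then obtain c where c: "\<And>j. j \<ge> c \<Longrightarrow> C j = C c" using accD[OF acc_ring, of C] fam step by metis
  have "C j n \<subseteq> C c n" for j n
  proof -
    have "C j \<le> C (max j c)" by (rule lift_Suc_mono_le[of C]) (use step in auto)
    then show ?thesis using c[of "max j c"] by (simp add: le_fun_def)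
  qed
  then show ?thesis unfolding C_def by blast
qed

text \<open>Injectivity of \<open>W\<close> alone yields an element of \<open>W\<close> which need
  not be torsion. The partial homomorphism is therefore first extended by zero to
  \<open>x\<^sup>m R\<close>, and this forces \<open>x\<^sup>m e = 0\<close>. That the extension is
  well defined is an Artin-Rees statement for a principal ideal, obtained from stationary
  colons.\<close>

lemma baer_injective_torsion_subfamily:
  assumes G: "module R G" and W: "graded_family (ring_part R 0) X G W"
    and inj: "baer_injective R (ring_part R 0) X G W" and x: "x \<in> int_part R (int \<delta>)"
  shows "baer_injective R (ring_part R 0) X G (torsion_subfamily R G x W)"
  unfolding baer_injective_def
proof (intro allI impI, elim conjE)
  interpret G: module R G by (rule G)
  have xc: "x \<in> carrier R" using gr.part_carrier[OF x] .
  note WD = graded_familyD[OF W]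
  have P: "module R (pair_module R G)" by (rule module_pair_module[OF G])
  fix \<tau> F
  assume F: "graded_family (ring_part R 0) X (pair_module R G) F"
    and F_sub: "\<forall>n. F n \<subseteq> int_part R n \<times> torsion_subfamily R G x W (n + \<tau>)"
    and F_single: "\<forall>n w. (\<zero>, w) \<in> F n \<longrightarrow> w = \<zero>\<^bsub>G\<^esub>"
  note FD = graded_familyD[OF F, simplified]
  have F_mem: "r \<in> int_part R n" "w \<in> torsion_subfamily R G x W (n + \<tau>)" if "(r, w) \<in> F n" for r w n
  proof -
    have "(r, w) \<in> int_part R n \<times> torsion_subfamily R G x W (n + \<tau>)" using F_sub that by blast
    then show "r \<in> int_part R n" "w \<in> torsion_subfamily R G x W (n + \<tau>)" by simp_all
  qed
  have F_c: "r \<in> carrier R" "w \<in> carrier G" if "(r, w) \<in> F n" for r w n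
    using FD(1)[OF that] by auto
  have F_pow: "((x [^] (k::nat)) \<otimes> r, (x [^] k) \<odot>\<^bsub>G\<^esub> w) \<in> F (n + int k * int \<delta>)" if "(r, w) \<in> F n" for r w n k
    using generator_pow_shift[OF P F x that, of k] by simp
  have F_unique: "v = w" if "(r, v) \<in> F n" "(r, w) \<in> F n" for r v w n
  proof -
    have c: "r \<in> carrier R" "v \<in> carrier G" "w \<in> carrier G" using F_c that by auto
    have "(r \<oplus> \<ominus> \<one> \<otimes> r, v \<oplus>\<^bsub>G\<^esub> (\<ominus> \<one>) \<odot>\<^bsub>G\<^esub> w) \<in> F n"
      using FD(3)[OF that(1) FD(4)[OF minus_A[OF one_A] that(2)]] by simp
    then have "(\<zero>, v \<ominus>\<^bsub>G\<^esub> w) \<in> F n" using c by (simp add: l_minus r_neg G.smult_l_minus a_minus_def)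
    then show ?thesis using F_single G.M.diff_eq_zero_iff c by blast
  qed
  \<comment> \<open>By the chain condition a single power of \<open>x\<close> kills all values of the partial homomorphism \<open>F\<close>.\<close>
  define K where "K j n = {r. \<exists>w. (r, w) \<in> F n \<and> (x [^] j) \<odot>\<^bsub>G\<^esub> w = \<zero>\<^bsub>G\<^esub>}" for j :: nat and n
  have K_fam: "graded_family (ring_part R 0) X (self_module R) (K j)" for j
  proof (intro graded_familyI)
    fix t r assume "r \<in> K j t" then show "r \<in> carrier (self_module R)" using F_c by (auto simp: K_def)
  next
    fix t show "\<zero>\<^bsub>self_module R\<^esub> \<in> K j t" using FD(2)[of t] xc by (auto simp: K_def)
  next
    fix t r s assume "r \<in> K j t" "s \<in> K j t"
    then obtain v w where vw: "(r, v) \<in> F t" "(x [^] j) \<odot>\<^bsub>G\<^esub> v = \<zero>\<^bsub>G\<^esub>" "(s, w) \<in> F t" "(x [^] j) \<odot>\<^bsub>G\<^esub> w = \<zero>\<^bsub>G\<^esub>"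
      by (auto simp: K_def)
    then have "(r \<oplus> s, v \<oplus>\<^bsub>G\<^esub> w) \<in> F t" "(x [^] j) \<odot>\<^bsub>G\<^esub> (v \<oplus>\<^bsub>G\<^esub> w) = \<zero>\<^bsub>G\<^esub>"
      using FD(3)[OF vw(1,3)] F_c[OF vw(1)] F_c[OF vw(3)] xc by (simp_all add: G.smult_r_distr)
    then show "r \<oplus>\<^bsub>self_module R\<^esub> s \<in> K j t" by (auto simp: K_def)
  next
    fix t s r assume s: "s \<in> ring_part R 0" and "r \<in> K j t"
    then obtain w where w: "(r, w) \<in> F t" "(x [^] j) \<odot>\<^bsub>G\<^esub> w = \<zero>\<^bsub>G\<^esub>" by (auto simp: K_def)
    have "(x [^] j) \<odot>\<^bsub>G\<^esub> (s \<odot>\<^bsub>G\<^esub> w) = s \<odot>\<^bsub>G\<^esub> ((x [^] j) \<odot>\<^bsub>G\<^esub> w)"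
      using F_c[OF w(1)] A_carrier[OF s] xc by (simp add: G.smult_assoc1[symmetric] m_comm)
    then show "s \<odot>\<^bsub>self_module R\<^esub> r \<in> K j t" using FD(4)[OF s w(1)] w(2) A_carrier[OF s] by (auto simp: K_def)
  next
    fix t s r assume s: "s \<in> X" and "r \<in> K j t"
    then obtain w where w: "(r, w) \<in> F t" "(x [^] j) \<odot>\<^bsub>G\<^esub> w = \<zero>\<^bsub>G\<^esub>" by (auto simp: K_def)
    have sc: "s \<in> carrier R" using s X_carrier by blast
    have "(x [^] j) \<odot>\<^bsub>G\<^esub> (s \<odot>\<^bsub>G\<^esub> w) = s \<odot>\<^bsub>G\<^esub> ((x [^] j) \<odot>\<^bsub>G\<^esub> w)"
      using F_c[OF w(1)] sc xc by (simp add: G.smult_assoc1[symmetric] m_comm)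
    then show "s \<odot>\<^bsub>self_module R\<^esub> r \<in> K j (t + 1)" using FD(5)[OF s w(1)] w(2) sc by (auto simp: K_def)
  qed
  have K_step: "K j \<le> K (Suc j)" for j
  proof (rule le_funI, rule subsetI)
    fix n r assume "r \<in> K j n"
    then obtain w where w: "(r, w) \<in> F n" "(x [^] j) \<odot>\<^bsub>G\<^esub> w = \<zero>\<^bsub>G\<^esub>" by (auto simp: K_def)
    have "(x [^] Suc j) \<odot>\<^bsub>G\<^esub> w = x \<odot>\<^bsub>G\<^esub> ((x [^] j) \<odot>\<^bsub>G\<^esub> w)"
      using F_c[OF w(1)] xc by (simp add: G.smult_assoc1[symmetric] m_comm)
    then show "r \<in> K (Suc j) n" using w xc by (auto simp: K_def)
  qed
  have "K j \<le> int_part R" for j using F_mem by (auto simp: le_fun_def K_def)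
  then obtain k where k: "\<And>j. j \<ge> k \<Longrightarrow> K j = K k" using accD[OF acc_ring, of K] K_fam K_step by metis
  have kill: "(x [^] k) \<odot>\<^bsub>G\<^esub> w = \<zero>\<^bsub>G\<^esub>" if rw: "(r, w) \<in> F n" for r w n
  proof -
    obtain j :: nat where "(x [^] j) \<odot>\<^bsub>G\<^esub> w = \<zero>\<^bsub>G\<^esub>" using F_mem(2)[OF rw] by (auto simp: torsion_subfamily_def)
    then have "r \<in> K j n" using rw by (auto simp: K_def)
    moreover have "K j \<le> K (max j k)" by (rule lift_Suc_mono_le[of K]) (use K_step in auto)
    ultimately have "r \<in> K k n" using k[of "max j k"] by (auto simp: le_fun_def)
    then show ?thesis using F_unique[OF rw] by (auto simp: K_def)
  qed
  \<comment> \<open>\<open>x\<^sup>m R \<inter> a \<subseteq> x\<^sup>k a\<close> for large \<open>m\<close>, where \<open>a\<close> is the domain of \<open>F\<close>: so \<open>F\<close> extends by zero to \<open>x\<^sup>m R\<close>.\<close>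
  define a where "a n = fst ` F n" for n
  have memI: "r \<in> a n" if "(r, w) \<in> F n" for r w n using that by (force simp: a_def)
  have a_fam: "graded_family (ring_part R 0) X (self_module R) a"
  proof (intro graded_familyI)
    fix t r assume "r \<in> a t" then show "r \<in> carrier (self_module R)" using F_c by (auto simp: a_def)
  next
    fix t show "\<zero>\<^bsub>self_module R\<^esub> \<in> a t" using memI[OF FD(2)] by simp
  next
    fix t r s assume "r \<in> a t" "s \<in> a t"
    then obtain v w where "(r, v) \<in> F t" "(s, w) \<in> F t" by (auto simp: a_def)
    from memI[OF FD(3)[OF this, simplified]] show "r \<oplus>\<^bsub>self_module R\<^esub> s \<in> a t" by simp
  next
    fix t s r assume s: "s \<in> ring_part R 0" and "r \<in> a t"
    then obtain w where "(r, w) \<in> F t" by (auto simp: a_def)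
    from memI[OF FD(4)[OF s this, simplified]] show "s \<odot>\<^bsub>self_module R\<^esub> r \<in> a t" by simp
  next
    fix t s r assume s: "s \<in> X" and "r \<in> a t"
    then obtain w where "(r, w) \<in> F t" by (auto simp: a_def)
    from memI[OF FD(5)[OF s this, simplified]] show "s \<odot>\<^bsub>self_module R\<^esub> r \<in> a (t + 1)" by simp
  qed
  obtain c :: nat where c: "\<And>j n r. r \<in> int_part R n \<Longrightarrow> (x [^] (j::nat)) \<otimes> r \<in> a (n + int j * int \<delta>) \<Longrightarrow>
      (x [^] c) \<otimes> r \<in> a (n + int c * int \<delta>)"
    using colon_chain_stationary[OF x a_fam] by blast
  \<comment> \<open>If \<open>x\<^sup>m s\<close> lies in \<open>a\<close>, then
    \<open>x\<^sup>c s\<close> already does by stationarity, and the remaining factor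
    \<open>x\<^sup>k\<close> kills its value under \<open>F\<close>.\<close>
  define m where "m = c + k"
  define y where "y = x [^] m"
  have y: "y \<in> int_part R (int m * int \<delta>)" unfolding y_def by (rule pow_in_part[OF x])
  have yc: "y \<in> carrier R" using gr.part_carrier[OF y] .
  define F' where "F' n = {(u \<oplus> y \<otimes> s, w) | u s w. (u, w) \<in> F n \<and> s \<in> int_part R (n - int m * int \<delta>)}" for n
  have memF': "(u \<oplus> y \<otimes> s, w) \<in> F' n" if "(u, w) \<in> F n" "s \<in> int_part R (n - int m * int \<delta>)" for u s w n
    using that unfolding F'_def by blast
  have F'_mem: "r \<in> int_part R n \<and> w \<in> W (n + \<tau>)" if rw: "(r, w) \<in> F' n" for r w n
  proof -
    obtain u s where us: "r = u \<oplus> y \<otimes> s" "(u, w) \<in> F n" "s \<in> int_part R (n - int m * int \<delta>)"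
      using rw unfolding F'_def by blast
    have "y \<otimes> s \<in> int_part R n" using part_mult[OF y us(3)] by simp
    then show ?thesis
      using us F_mem[OF us(2)] gr.part_add by (auto simp: torsion_subfamily_def)
  qed
  have F'_fam: "graded_family (ring_part R 0) X (pair_module R G) F'"
  proof (intro graded_familyI)
    fix t p assume "p \<in> F' t"
    then show "p \<in> carrier (pair_module R G)"
      using F'_mem[of "fst p" "snd p" t] gr.part_carrier WD(1) by (auto simp: mem_Times_iff)
  next
    fix t show "\<zero>\<^bsub>pair_module R G\<^esub> \<in> F' t" using memF'[OF FD(2) gr.part_zero] yc by simp
  next
    fix t p q assume "p \<in> F' t" "q \<in> F' t"
    then obtain u s v u' s' v' where p: "p = (u \<oplus> y \<otimes> s, v)" "(u, v) \<in> F t" "s \<in> int_part R (t - int m * int \<delta>)"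
      and q: "q = (u' \<oplus> y \<otimes> s', v')" "(u', v') \<in> F t" "s' \<in> int_part R (t - int m * int \<delta>)"
      unfolding F'_def by blast
    have "(u \<oplus> y \<otimes> s) \<oplus> (u' \<oplus> y \<otimes> s') = (u \<oplus> u') \<oplus> y \<otimes> (s \<oplus> s')"
      using F_c[OF p(2)] F_c[OF q(2)] gr.part_carrier[OF p(3)] gr.part_carrier[OF q(3)] yc
      by (simp add: r_distr a_ac)
    then show "p \<oplus>\<^bsub>pair_module R G\<^esub> q \<in> F' t"
      using memF'[OF FD(3)[OF p(2) q(2), simplified] gr.part_add[OF p(3) q(3)]] p(1) q(1) by simp
  next
    fix t r p assume r: "r \<in> ring_part R 0" and "p \<in> F' t"
    then obtain u s v where p: "p = (u \<oplus> y \<otimes> s, v)" "(u, v) \<in> F t" "s \<in> int_part R (t - int m * int \<delta>)"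
      unfolding F'_def by blast
    have "r \<otimes> (u \<oplus> y \<otimes> s) = r \<otimes> u \<oplus> y \<otimes> (r \<otimes> s)"
      using F_c[OF p(2)] gr.part_carrier[OF p(3)] yc A_carrier[OF r] by (simp add: r_distr m_lcomm)
    moreover have "r \<otimes> s \<in> int_part R (t - int m * int \<delta>)" using part_mult[of r 0 s] r p(3) by simp
    ultimately show "r \<odot>\<^bsub>pair_module R G\<^esub> p \<in> F' t"
      using memF'[OF FD(4)[OF r p(2), simplified]] p(1) by simp
  next
    fix t r p assume r: "r \<in> X" and "p \<in> F' t"
    then obtain u s v where p: "p = (u \<oplus> y \<otimes> s, v)" "(u, v) \<in> F t" "s \<in> int_part R (t - int m * int \<delta>)"
      unfolding F'_def by blast
    have rc: "r \<in> carrier R" "r \<in> int_part R 1" using r X_carrier X_part by auto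
    have "r \<otimes> (u \<oplus> y \<otimes> s) = r \<otimes> u \<oplus> y \<otimes> (r \<otimes> s)"
      using F_c[OF p(2)] gr.part_carrier[OF p(3)] yc rc by (simp add: r_distr m_lcomm)
    moreover have "r \<otimes> s \<in> int_part R (t + 1 - int m * int \<delta>)"
      using part_mult[OF rc(2) p(3)] by (simp add: algebra_simps)
    ultimately show "r \<odot>\<^bsub>pair_module R G\<^esub> p \<in> F' (t + 1)"
      using memF'[OF FD(5)[OF r p(2), simplified]] p(1) by simp
  qed
  have F'_single: "w = \<zero>\<^bsub>G\<^esub>" if zw: "(\<zero>, w) \<in> F' n" for w n
  proof -
    obtain u s where us: "\<zero> = u \<oplus> y \<otimes> s" "(u, w) \<in> F n" "s \<in> int_part R (n - int m * int \<delta>)"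
      using zw unfolding F'_def by blast
    have uc: "u \<in> carrier R" "w \<in> carrier G" "s \<in> carrier R" using F_c[OF us(2)] gr.part_carrier[OF us(3)] by auto
    have ys: "y \<otimes> s = \<ominus> u"
      using us(1) uc yc by (metis m_closed minus_equality a_comm minus_minus)
    have "\<ominus> u \<in> a n"
      using family_minus[OF module_self_module a_fam memI[OF us(2)]] by simp
    then have "(x [^] m) \<otimes> s \<in> a ((n - int m * int \<delta>) + int m * int \<delta>)" using ys by (simp add: y_def)
    from c[OF us(3) this] obtain v where v: "((x [^] c) \<otimes> s, v) \<in> F (n - int m * int \<delta> + int c * int \<delta>)"
      by (auto simp: a_def)
    have e: "n - int m * int \<delta> + int c * int \<delta> + int k * int \<delta> = n" by (simp add: m_def algebra_simps)
    have "(x [^] k) \<otimes> ((x [^] c) \<otimes> s) = y \<otimes> s"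
      using xc uc by (simp add: y_def m_def m_assoc[symmetric] nat_pow_mult add.commute)
    then have "(y \<otimes> s, \<zero>\<^bsub>G\<^esub>) \<in> F n" using F_pow[OF v, of k] kill[OF v] unfolding e by simp
    from FD(3)[OF us(2) this] have "(\<zero>, w) \<in> F n" using us(1) uc by simp
    then show ?thesis using F_single by blast
  qed
  obtain e where e: "e \<in> W \<tau>" "\<And>n r w. (r, w) \<in> F' n \<Longrightarrow> w = r \<odot>\<^bsub>G\<^esub> e"
  proof (rule baer_injectiveD[OF inj F'_fam])
    show "r \<in> int_part R n \<and> w \<in> W (n + \<tau>)" if "(r, w) \<in> F' n" for n r w by (rule F'_mem[OF that])
    show "w = \<zero>\<^bsub>G\<^esub>" if "(\<zero>, w) \<in> F' n" for n w by (rule F'_single[OF that])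
  qed blast
  have "\<one> \<in> int_part R (int m * int \<delta> - int m * int \<delta>)" using one_part by simp
  from memF'[OF FD(2) this] have "(y, \<zero>\<^bsub>G\<^esub>) \<in> F' (int m * int \<delta>)" using yc by simp
  from e(2)[OF this] have "(x [^] m) \<odot>\<^bsub>G\<^esub> e = \<zero>\<^bsub>G\<^esub>" by (simp add: y_def)
  then have "e \<in> torsion_subfamily R G x W \<tau>" using e(1) unfolding torsion_subfamily_def by blast
  moreover have "w = r \<odot>\<^bsub>G\<^esub> e" if rw: "(r, w) \<in> F n" for n r w
    using e(2)[of r w n] memF'[OF rw gr.part_zero] F_c[OF rw] yc by simp
  ultimately show "\<exists>e \<in> torsion_subfamily R G x W \<tau>. \<forall>n. \<forall>(r, w) \<in> F n. w = r \<odot>\<^bsub>G\<^esub> e" by blast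
qed

text \<open>The naive prescription \<open>x r \<mapsto> r w\<close> is ill defined when
  \<open>x\<close> has annihilators. At an exponent \<open>c\<close> where the annihilators of
  powers of \<open>x\<close> are stationary, \<open>(x [^] Suc c) r \<mapsto> (x [^] c) r w\<close>
  is well defined, and an extension gives an \<open>e\<close> for which \<open>x [^] c\<close> kills
  \<open>w - x e\<close>.\<close>

lemma baer_injective_divisible:
  assumes G: "module R G" and W: "graded_family (ring_part R 0) X G W"
    and inj: "baer_injective R (ring_part R 0) X G W" and x: "x \<in> int_part R (int \<delta>)" and w: "w \<in> W t"
  shows "\<exists>e \<in> W (t - int \<delta>). w \<ominus>\<^bsub>G\<^esub> x \<odot>\<^bsub>G\<^esub> e \<in> torsion_subfamily R G x W t"
proof -
  interpret G: module R G by (rule G)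
  have xc: "x \<in> carrier R" using gr.part_carrier[OF x] .
  note WD = graded_familyD[OF W]
  have wc: "w \<in> carrier G" using WD(1)[OF w] .
  have zero_fam: "graded_family (ring_part R 0) X (self_module R) (\<lambda>_. {\<zero>})"
    using A_carrier X_carrier by (intro graded_familyI) auto
  obtain c :: nat where c: "\<And>j n r. r \<in> int_part R n \<Longrightarrow> (x [^] (j::nat)) \<otimes> r = \<zero> \<Longrightarrow> (x [^] c) \<otimes> r = \<zero>"
    using colon_chain_stationary[OF x zero_fam] by auto
  define F where "F n = {((x [^] Suc c) \<otimes> r, (x [^] c) \<odot>\<^bsub>G\<^esub> (r \<odot>\<^bsub>G\<^esub> w)) | r. r \<in> int_part R (n - int (Suc c) * int \<delta>)}" for n
  have memF: "((x [^] Suc c) \<otimes> r, (x [^] c) \<odot>\<^bsub>G\<^esub> (r \<odot>\<^bsub>G\<^esub> w)) \<in> F n" if "r \<in> int_part R (n - int (Suc c) * int \<delta>)" for r n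
    using that unfolding F_def by blast
  have F_mem: "r \<in> int_part R n \<and> v \<in> W (n + (t - int \<delta>))" if "(r, v) \<in> F n" for r v n
  proof -
    obtain s where s: "r = (x [^] Suc c) \<otimes> s" "v = (x [^] c) \<odot>\<^bsub>G\<^esub> (s \<odot>\<^bsub>G\<^esub> w)"
      "s \<in> int_part R (n - int (Suc c) * int \<delta>)" using \<open>(r, v) \<in> F n\<close> unfolding F_def by blast
    have "r \<in> int_part R (int (Suc c) * int \<delta> + (n - int (Suc c) * int \<delta>))"
      unfolding s(1) by (rule part_mult[OF pow_in_part[OF x] s(3)])
    moreover have "v \<in> W (t + (n - int (Suc c) * int \<delta>) + int c * int \<delta>)"
      unfolding s(2) by (rule generator_pow_shift[OF G W x family_part_closed[OF G W s(3) w]])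
    moreover have e: "t + (n - int (Suc c) * int \<delta>) + int c * int \<delta> = n + (t - int \<delta>)" by (simp add: algebra_simps)
    ultimately show ?thesis unfolding e by simp
  qed
  have F_fam: "graded_family (ring_part R 0) X (pair_module R G) F"
  proof (intro graded_familyI)
    fix s p assume "p \<in> F s"
    then show "p \<in> carrier (pair_module R G)"
      using F_mem[of "fst p" "snd p" s] gr.part_carrier WD(1) by (auto simp: mem_Times_iff)
  next
    fix s show "\<zero>\<^bsub>pair_module R G\<^esub> \<in> F s" using memF[OF gr.part_zero] xc wc by simp
  next
    fix s p q assume "p \<in> F s" "q \<in> F s"
    then obtain u v where p: "p = ((x [^] Suc c) \<otimes> u, (x [^] c) \<odot>\<^bsub>G\<^esub> (u \<odot>\<^bsub>G\<^esub> w))" "u \<in> int_part R (s - int (Suc c) * int \<delta>)"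
      and q: "q = ((x [^] Suc c) \<otimes> v, (x [^] c) \<odot>\<^bsub>G\<^esub> (v \<odot>\<^bsub>G\<^esub> w))" "v \<in> int_part R (s - int (Suc c) * int \<delta>)"
      unfolding F_def by blast
    show "p \<oplus>\<^bsub>pair_module R G\<^esub> q \<in> F s"
      using memF[OF gr.part_add[OF p(2) q(2)]] gr.part_carrier[OF p(2)] gr.part_carrier[OF q(2)] xc wc
      unfolding p(1) q(1) by (simp add: r_distr G.smult_l_distr G.smult_r_distr)
  next
    fix s r p assume r: "r \<in> ring_part R 0" and "p \<in> F s"
    then obtain u where p: "p = ((x [^] Suc c) \<otimes> u, (x [^] c) \<odot>\<^bsub>G\<^esub> (u \<odot>\<^bsub>G\<^esub> w))" "u \<in> int_part R (s - int (Suc c) * int \<delta>)"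
      unfolding F_def by blast
    have ru: "r \<otimes> u \<in> int_part R (s - int (Suc c) * int \<delta>)" using part_mult[of r 0 u] r p(2) by simp
    have cu: "r \<in> carrier R" "u \<in> carrier R" using A_carrier[OF r] gr.part_carrier[OF p(2)] by auto
    have "r \<odot>\<^bsub>pair_module R G\<^esub> p = ((x [^] Suc c) \<otimes> (r \<otimes> u), (x [^] c) \<odot>\<^bsub>G\<^esub> ((r \<otimes> u) \<odot>\<^bsub>G\<^esub> w))"
      unfolding p(1) using cu xc wc by (simp add: G.smult_assoc1[symmetric] m_lcomm)
    then show "r \<odot>\<^bsub>pair_module R G\<^esub> p \<in> F s" using memF[OF ru] by simp
  next
    fix s r p assume r: "r \<in> X" and "p \<in> F s"
    then obtain u where p: "p = ((x [^] Suc c) \<otimes> u, (x [^] c) \<odot>\<^bsub>G\<^esub> (u \<odot>\<^bsub>G\<^esub> w))" "u \<in> int_part R (s - int (Suc c) * int \<delta>)"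
      unfolding F_def by blast
    have cu: "r \<in> carrier R" "u \<in> carrier R" "r \<in> int_part R 1" using r X_carrier X_part gr.part_carrier[OF p(2)] by auto
    have ru: "r \<otimes> u \<in> int_part R (s + 1 - int (Suc c) * int \<delta>)"
      using part_mult[OF cu(3) p(2)] by (simp add: algebra_simps)
    have "r \<odot>\<^bsub>pair_module R G\<^esub> p = ((x [^] Suc c) \<otimes> (r \<otimes> u), (x [^] c) \<odot>\<^bsub>G\<^esub> ((r \<otimes> u) \<odot>\<^bsub>G\<^esub> w))"
      unfolding p(1) using cu xc wc by (simp add: G.smult_assoc1[symmetric] m_lcomm)
    then show "r \<odot>\<^bsub>pair_module R G\<^esub> p \<in> F (s + 1)" using memF[OF ru] by simp
  qed
  have F_single: "v = \<zero>\<^bsub>G\<^esub>" if zv: "(\<zero>, v) \<in> F n" for v n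
  proof -
    obtain r where r: "\<zero> = (x [^] Suc c) \<otimes> r" "v = (x [^] c) \<odot>\<^bsub>G\<^esub> (r \<odot>\<^bsub>G\<^esub> w)" "r \<in> int_part R (n - int (Suc c) * int \<delta>)"
      using zv unfolding F_def by blast
    have "(x [^] c) \<otimes> r = \<zero>" using c[OF r(3) r(1)[symmetric]] .
    moreover have "v = ((x [^] c) \<otimes> r) \<odot>\<^bsub>G\<^esub> w"
      using r(2) gr.part_carrier[OF r(3)] xc wc by (simp add: G.smult_assoc1)
    ultimately show ?thesis using wc by simp
  qed
  obtain e where e: "e \<in> W (t - int \<delta>)" "\<And>n r v. (r, v) \<in> F n \<Longrightarrow> v = r \<odot>\<^bsub>G\<^esub> e"
  proof (rule baer_injectiveD[OF inj F_fam])
    show "r \<in> int_part R n \<and> v \<in> W (n + (t - int \<delta>))" if "(r, v) \<in> F n" for n r v by (rule F_mem[OF that])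
    show "v = \<zero>\<^bsub>G\<^esub>" if "(\<zero>, v) \<in> F n" for n v by (rule F_single[OF that])
  qed blast
  have ec: "e \<in> carrier G" using WD(1)[OF e(1)] .
  have "\<one> \<in> int_part R (int (Suc c) * int \<delta> - int (Suc c) * int \<delta>)" using one_part by simp
  from e(2)[OF memF[OF this]] have "(x [^] c) \<odot>\<^bsub>G\<^esub> w = (x [^] Suc c) \<odot>\<^bsub>G\<^esub> e" using xc wc by simp
  also have "\<dots> = (x [^] c) \<odot>\<^bsub>G\<^esub> (x \<odot>\<^bsub>G\<^esub> e)" using xc ec by (simp add: G.smult_assoc1)
  finally have eq: "(x [^] c) \<odot>\<^bsub>G\<^esub> w = (x [^] c) \<odot>\<^bsub>G\<^esub> (x \<odot>\<^bsub>G\<^esub> e)" .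
  have "(x [^] c) \<odot>\<^bsub>G\<^esub> (w \<ominus>\<^bsub>G\<^esub> x \<odot>\<^bsub>G\<^esub> e) = (x [^] c) \<odot>\<^bsub>G\<^esub> w \<ominus>\<^bsub>G\<^esub> (x [^] c) \<odot>\<^bsub>G\<^esub> (x \<odot>\<^bsub>G\<^esub> e)"
    using xc wc ec by (intro G.smult_diff) auto
  also have "\<dots> = \<zero>\<^bsub>G\<^esub>" unfolding eq using xc ec by (simp add: a_minus_def G.M.r_neg)
  finally have kill: "(x [^] c) \<odot>\<^bsub>G\<^esub> (w \<ominus>\<^bsub>G\<^esub> x \<odot>\<^bsub>G\<^esub> e) = \<zero>\<^bsub>G\<^esub>" .
  have "x \<odot>\<^bsub>G\<^esub> e \<in> W t" using family_part_closed[OF G W x e(1)] by simp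
  then have "w \<ominus>\<^bsub>G\<^esub> x \<odot>\<^bsub>G\<^esub> e \<in> W t" by (rule family_diff[OF G W w])
  then show ?thesis using e(1) kill unfolding torsion_subfamily_def by blast
qed

end

section \<open>The total complex of a resolution\<close>

text \<open>A direct sum and not a product: finite support lets a single power of \<open>x\<close>
  annihilate an element all of whose entries are torsion. Functions on \<open>nat\<close> are also
  what the cones interleave.\<close>

definition total_module :: "(nat \<Rightarrow> ('a, 'c) gmodule) \<Rightarrow> ('a, nat \<Rightarrow> 'c) module" where
  "total_module E =
     \<lparr>carrier = {f. (\<forall>i. f i \<in> carrier (E i)) \<and> finite {i. f i \<noteq> \<zero>\<^bsub>E i\<^esub>}},
      mult = undefined, one = undefined, zero = (\<lambda>i. \<zero>\<^bsub>E i\<^esub>),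
      add = (\<lambda>f g i. f i \<oplus>\<^bsub>E i\<^esub> g i), smult = (\<lambda>r f i. r \<odot>\<^bsub>E i\<^esub> f i)\<rparr>"

lemma total_module_simps [simp]:
  "f \<in> carrier (total_module E) \<longleftrightarrow> (\<forall>i. f i \<in> carrier (E i)) \<and> finite {i. f i \<noteq> \<zero>\<^bsub>E i\<^esub>}"
  "zero (total_module E) = (\<lambda>i. \<zero>\<^bsub>E i\<^esub>)"
  "f \<oplus>\<^bsub>total_module E\<^esub> g = (\<lambda>i. f i \<oplus>\<^bsub>E i\<^esub> g i)"
  "r \<odot>\<^bsub>total_module E\<^esub> f = (\<lambda>i. r \<odot>\<^bsub>E i\<^esub> f i)"
  by (simp_all add: total_module_def)

definition total_diff ::
    "(nat \<Rightarrow> ('a, 'c) gmodule) \<Rightarrow> (nat \<Rightarrow> 'c \<Rightarrow> 'c) \<Rightarrow> (nat \<Rightarrow> 'c) \<Rightarrow> nat \<Rightarrow> 'c" where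
  "total_diff E d f i = (case i of 0 \<Rightarrow> \<zero>\<^bsub>E 0\<^esub> | Suc j \<Rightarrow> d j (f j))"

lemma total_diff_simps [simp]:
  "total_diff E d f 0 = \<zero>\<^bsub>E 0\<^esub>" "total_diff E d f (Suc j) = d j (f j)"
  by (simp_all add: total_diff_def)

definition total_family ::
    "(nat \<Rightarrow> ('a, 'c) gmodule) \<Rightarrow> (nat \<Rightarrow> int \<Rightarrow> 'c set) \<Rightarrow> int \<Rightarrow> (nat \<Rightarrow> 'c) set" where
  "total_family E W t = {f. (\<forall>i. f i \<in> W i t) \<and> finite {i. f i \<noteq> \<zero>\<^bsub>E i\<^esub>}}"

definition torsion_list ::
    "('a, 'x) ring_scheme \<Rightarrow> ('a, 'c, 'y) module_scheme \<Rightarrow> 'a list \<Rightarrow> (int \<Rightarrow> 'c set) \<Rightarrow> int \<Rightarrow> 'c set" where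
  "torsion_list R G xs W = foldr (torsion_subfamily R G) xs W"

lemma torsion_list_simps [simp]:
  "torsion_list R G [] W = W"
  "torsion_list R G (x # xs) W = torsion_subfamily R G x (torsion_list R G xs W)"
  by (simp_all add: torsion_list_def)

lemma torsion_list_iff:
  "w \<in> torsion_list R G xs W t \<longleftrightarrow>
     w \<in> W t \<and> (\<forall>x \<in> set xs. \<exists>k :: nat. (x [^]\<^bsub>R\<^esub> k) \<odot>\<^bsub>G\<^esub> w = \<zero>\<^bsub>G\<^esub>)"
  by (induction xs) (auto simp: torsion_subfamily_def)

locale module_complex = cring R for R :: "'a gring" (structure) +
  fixes E :: "nat \<Rightarrow> ('a, 'c) gmodule" and d :: "nat \<Rightarrow> 'c \<Rightarrow> 'c"
  assumes module_E: "\<And>i. module R (E i)"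
    and d_closed: "\<And>i e. e \<in> carrier (E i) \<Longrightarrow> d i e \<in> carrier (E (Suc i))"
    and d_add: "\<And>i e e'. e \<in> carrier (E i) \<Longrightarrow> e' \<in> carrier (E i) \<Longrightarrow>
       d i (e \<oplus>\<^bsub>E i\<^esub> e') = d i e \<oplus>\<^bsub>E (Suc i)\<^esub> d i e'"
    and d_smult: "\<And>i r e. r \<in> carrier R \<Longrightarrow> e \<in> carrier (E i) \<Longrightarrow>
       d i (r \<odot>\<^bsub>E i\<^esub> e) = r \<odot>\<^bsub>E (Suc i)\<^esub> d i e"
    and d_d: "\<And>i e. e \<in> carrier (E i) \<Longrightarrow> d (Suc i) (d i e) = \<zero>\<^bsub>E (Suc (Suc i))\<^esub>"
begin

lemma d_zero: "d i \<zero>\<^bsub>E i\<^esub> = \<zero>\<^bsub>E (Suc i)\<^esub>"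
proof -
  interpret E: module R "E i" by (rule module_E)
  interpret E': module R "E (Suc i)" by (rule module_E)
  have "d i (\<zero> \<odot>\<^bsub>E i\<^esub> \<zero>\<^bsub>E i\<^esub>) = \<zero> \<odot>\<^bsub>E (Suc i)\<^esub> d i \<zero>\<^bsub>E i\<^esub>" by (rule d_smult) auto
  then show ?thesis using d_closed[of "\<zero>\<^bsub>E i\<^esub>" i] by simp
qed

lemma module_total_module: "module R (total_module E)"
proof -
  have [simp]: "r \<in> carrier R \<Longrightarrow> r \<odot>\<^bsub>E i\<^esub> \<zero>\<^bsub>E i\<^esub> = \<zero>\<^bsub>E i\<^esub>" for r i
    using module.smult_r_null[OF module_E] .
  have ab: "abelian_group (E i)" for i using module_E[of i] by (simp add: module_def)
  note mon = abelian_group.axioms(1)[OF ab]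
  have neg0: "\<ominus>\<^bsub>E i\<^esub> \<zero>\<^bsub>E i\<^esub> = \<zero>\<^bsub>E i\<^esub>" for i
    using abelian_monoid.zero_closed[OF mon] abelian_monoid.l_zero[OF mon]
    by (intro abelian_group.minus_equality[OF ab]) auto
  show ?thesis
  proof (rule moduleI)
    show "cring R" by (rule is_cring)
    show "abelian_group (total_module E)"
    proof (rule abelian_groupI)
      fix f g assume fg: "f \<in> carrier (total_module E)" "g \<in> carrier (total_module E)"
      have "finite {i. f i \<oplus>\<^bsub>E i\<^esub> g i \<noteq> \<zero>\<^bsub>E i\<^esub>}"
      proof (rule finite_subset)
        show "{i. f i \<oplus>\<^bsub>E i\<^esub> g i \<noteq> \<zero>\<^bsub>E i\<^esub>} \<subseteq> {i. f i \<noteq> \<zero>\<^bsub>E i\<^esub>} \<union> {i. g i \<noteq> \<zero>\<^bsub>E i\<^esub>}"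
        proof
          fix i assume i: "i \<in> {i. f i \<oplus>\<^bsub>E i\<^esub> g i \<noteq> \<zero>\<^bsub>E i\<^esub>}"
          have "\<zero>\<^bsub>E i\<^esub> \<oplus>\<^bsub>E i\<^esub> \<zero>\<^bsub>E i\<^esub> = \<zero>\<^bsub>E i\<^esub>"
            by (rule abelian_monoid.l_zero[OF mon abelian_monoid.zero_closed[OF mon]])
          then show "i \<in> {i. f i \<noteq> \<zero>\<^bsub>E i\<^esub>} \<union> {i. g i \<noteq> \<zero>\<^bsub>E i\<^esub>}" using i by auto
        qed
      qed (use fg in simp)
      then show "f \<oplus>\<^bsub>total_module E\<^esub> g \<in> carrier (total_module E)"
        using fg abelian_monoid.a_closed[OF mon] by simp
    next
      show "\<zero>\<^bsub>total_module E\<^esub> \<in> carrier (total_module E)" using abelian_monoid.zero_closed[OF mon] by simp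
    next
      fix f g h assume "f \<in> carrier (total_module E)" "g \<in> carrier (total_module E)" "h \<in> carrier (total_module E)"
      then show "(f \<oplus>\<^bsub>total_module E\<^esub> g) \<oplus>\<^bsub>total_module E\<^esub> h = f \<oplus>\<^bsub>total_module E\<^esub> (g \<oplus>\<^bsub>total_module E\<^esub> h)"
        using abelian_monoid.a_assoc[OF mon] by simp
    next
      fix f g assume "f \<in> carrier (total_module E)" "g \<in> carrier (total_module E)"
      then show "f \<oplus>\<^bsub>total_module E\<^esub> g = g \<oplus>\<^bsub>total_module E\<^esub> f"
        using abelian_monoid.a_comm[OF mon] by (simp add: fun_eq_iff)
    next
      fix f assume f: "f \<in> carrier (total_module E)"
      show "\<zero>\<^bsub>total_module E\<^esub> \<oplus>\<^bsub>total_module E\<^esub> f = f"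
        using f abelian_monoid.l_zero[OF mon] by simp
      have "finite {i. \<ominus>\<^bsub>E i\<^esub> f i \<noteq> \<zero>\<^bsub>E i\<^esub>}"
      proof (rule finite_subset)
        show "{i. \<ominus>\<^bsub>E i\<^esub> f i \<noteq> \<zero>\<^bsub>E i\<^esub>} \<subseteq> {i. f i \<noteq> \<zero>\<^bsub>E i\<^esub>}" using neg0 by auto
      qed (use f in simp)
      then show "\<exists>g \<in> carrier (total_module E). g \<oplus>\<^bsub>total_module E\<^esub> f = \<zero>\<^bsub>total_module E\<^esub>"
        using f abelian_group.l_neg[OF ab] abelian_group.a_inv_closed[OF ab]
        by (intro bexI[of _ "\<lambda>i. \<ominus>\<^bsub>E i\<^esub> f i"]) auto
    qed
  next
    fix r f assume r: "r \<in> carrier R" and f: "f \<in> carrier (total_module E)"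
    have "finite {i. r \<odot>\<^bsub>E i\<^esub> f i \<noteq> \<zero>\<^bsub>E i\<^esub>}"
    proof (rule finite_subset)
      show "{i. r \<odot>\<^bsub>E i\<^esub> f i \<noteq> \<zero>\<^bsub>E i\<^esub>} \<subseteq> {i. f i \<noteq> \<zero>\<^bsub>E i\<^esub>}" using r by auto
    qed (use f in simp)
    then show "r \<odot>\<^bsub>total_module E\<^esub> f \<in> carrier (total_module E)"
      using r f module.smult_closed[OF module_E] by simp
  qed (auto simp: module.smult_l_distr[OF module_E] module.smult_r_distr[OF module_E]
      module.smult_assoc1[OF module_E] module.smult_one[OF module_E])
qed

lemma total_module_a_inv:
  assumes f: "f \<in> carrier (total_module E)"
  shows "\<ominus>\<^bsub>total_module E\<^esub> f = (\<lambda>i. \<ominus>\<^bsub>E i\<^esub> f i)"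
proof -
  interpret T: module R "total_module E" by (rule module_total_module)
  have "\<ominus>\<^bsub>total_module E\<^esub> f = (\<ominus> \<one>) \<odot>\<^bsub>total_module E\<^esub> f"
    using f T.smult_l_minus[of \<one> f] T.smult_one[OF f] by simp
  also have "\<dots> = (\<lambda>i. \<ominus>\<^bsub>E i\<^esub> f i)"
  proof
    fix i
    interpret Ei: module R "E i" by (rule module_E)
    have "f i \<in> carrier (E i)" using f by simp
    then show "((\<ominus> \<one>) \<odot>\<^bsub>total_module E\<^esub> f) i = \<ominus>\<^bsub>E i\<^esub> f i" by (simp add: Ei.smult_l_minus)
  qed
  finally show ?thesis .
qed

lemma total_module_minus:
  "g \<in> carrier (total_module E) \<Longrightarrow> f \<ominus>\<^bsub>total_module E\<^esub> g = (\<lambda>i. f i \<ominus>\<^bsub>E i\<^esub> g i)"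
  by (simp add: a_minus_def total_module_a_inv)

lemma total_family_mono: "(\<And>i t. W' i t \<subseteq> W i t) \<Longrightarrow> total_family E W' \<le> total_family E W"
  unfolding total_family_def le_fun_def by blast

lemma differential_family_total:
  assumes A: "subring A R" and X: "X \<subseteq> carrier R"
    and W: "\<And>i. graded_family A X (E i) (W i)"
    and dW: "\<And>i t e. e \<in> W i t \<Longrightarrow> d i e \<in> W (Suc i) t"
  shows "differential_family R A (total_module E) X (total_diff E d) (total_family E W)"
proof (intro differential_family.intro differential_family_axioms.intro module_total_module X)
  interpret T: module R "total_module E" by (rule module_total_module)
  show "operators R A" by (intro operators.intro operators_axioms.intro is_cring A)
  have WD: "graded_family A X (E i) (W i)" for i by (rule W)
  have mem: "f \<in> total_family E W t \<longleftrightarrow> f \<in> carrier (total_module E) \<and> (\<forall>i. f i \<in> W i t)" for f t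
    using graded_familyD(1)[OF W] by (auto simp: total_family_def)
  show "graded_family A X (total_module E) (total_family E W)"
  proof (intro graded_familyI)
    fix t f assume "f \<in> total_family E W t" then show "f \<in> carrier (total_module E)" by (simp only: mem)
  next
    fix t show "\<zero>\<^bsub>total_module E\<^esub> \<in> total_family E W t"
      unfolding mem using T.M.zero_closed graded_familyD(2)[OF W] by simp
  next
    fix t f g assume "f \<in> total_family E W t" "g \<in> total_family E W t"
    then show "f \<oplus>\<^bsub>total_module E\<^esub> g \<in> total_family E W t"
      unfolding mem using T.M.a_closed[of f g] graded_familyD(3)[OF W] by simp
  next
    fix t r f assume r: "r \<in> A" and "f \<in> total_family E W t"
    then show "r \<odot>\<^bsub>total_module E\<^esub> f \<in> total_family E W t"
      unfolding mem using T.smult_closed[of r f] graded_familyD(4)[OF W r] subringE(1)[OF A] by auto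
  next
    fix t r f assume r: "r \<in> X" and "f \<in> total_family E W t"
    then show "r \<odot>\<^bsub>total_module E\<^esub> f \<in> total_family E W (t + 1)"
      unfolding mem using T.smult_closed[of r f] graded_familyD(5)[OF W r] X by auto
  qed
  have D_carrier: "total_diff E d f \<in> carrier (total_module E)" if f: "f \<in> carrier (total_module E)" for f
  proof -
    have "total_diff E d f i \<in> carrier (E i)" for i
      using f d_closed module.axioms(2)[OF module_E, THEN abelian_group.axioms(1), THEN abelian_monoid.zero_closed]
      by (cases i) auto
    moreover have "{i. total_diff E d f i \<noteq> \<zero>\<^bsub>E i\<^esub>} \<subseteq> Suc ` {i. f i \<noteq> \<zero>\<^bsub>E i\<^esub>}"
    proof
      fix i assume i: "i \<in> {i. total_diff E d f i \<noteq> \<zero>\<^bsub>E i\<^esub>}"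
      then obtain j where "i = Suc j" by (cases i) auto
      then show "i \<in> Suc ` {i. f i \<noteq> \<zero>\<^bsub>E i\<^esub>}" using i d_zero by auto
    qed
    then have "finite {i. total_diff E d f i \<noteq> \<zero>\<^bsub>E i\<^esub>}" using f finite_subset by fastforce
    ultimately show ?thesis by simp
  qed
  then show "\<And>a. a \<in> carrier (total_module E) \<Longrightarrow> total_diff E d a \<in> carrier (total_module E)" .
  show "total_diff E d f \<in> total_family E W t" if f: "f \<in> total_family E W t" for f t
  proof -
    have "total_diff E d f i \<in> W i t" for i
      using f dW graded_familyD(2)[OF W] by (cases i) (auto simp: mem)
    then show ?thesis using f D_carrier unfolding mem by blast
  qed
  show "total_diff E d (f \<oplus>\<^bsub>total_module E\<^esub> g) = total_diff E d f \<oplus>\<^bsub>total_module E\<^esub> total_diff E d g"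
    if "f \<in> carrier (total_module E)" "g \<in> carrier (total_module E)" for f g
  proof
    fix i
    interpret Ei: module R "E i" by (rule module_E)
    show "total_diff E d (f \<oplus>\<^bsub>total_module E\<^esub> g) i = (total_diff E d f \<oplus>\<^bsub>total_module E\<^esub> total_diff E d g) i"
      using that Ei.M.l_zero[OF Ei.M.zero_closed] by (cases i) (auto simp: d_add)
  qed
  show "total_diff E d (r \<odot>\<^bsub>total_module E\<^esub> f) = r \<odot>\<^bsub>total_module E\<^esub> total_diff E d f"
    if "r \<in> carrier R" "f \<in> carrier (total_module E)" for r f
  proof
    fix i show "total_diff E d (r \<odot>\<^bsub>total_module E\<^esub> f) i = (r \<odot>\<^bsub>total_module E\<^esub> total_diff E d f) i"
      using that module.smult_r_null[OF module_E] by (cases i) (auto simp: d_smult)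
  qed
  show "total_diff E d (total_diff E d f) = \<zero>\<^bsub>total_module E\<^esub>" if "f \<in> carrier (total_module E)" for f
  proof
    fix i
    show "total_diff E d (total_diff E d f) i = \<zero>\<^bsub>total_module E\<^esub> i"
    proof (cases i)
      case (Suc j)
      then show ?thesis using that d_zero d_d by (cases j) auto
    qed simp
  qed
qed

text \<open>Here \<open>t\<close> is the internal degree and \<open>i\<close> the cohomological
  index. The primitive is demanded in the same internal degree, and at index 0 there is no incoming
  map.\<close>

definition exact_at :: "(nat \<Rightarrow> int \<Rightarrow> 'c set) \<Rightarrow> int \<Rightarrow> nat \<Rightarrow> bool" where
  "exact_at W t i \<longleftrightarrow> (\<forall>z \<in> W i t. d i z = \<zero>\<^bsub>E (Suc i)\<^esub> \<longrightarrow>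
     (case i of 0 \<Rightarrow> z = \<zero>\<^bsub>E 0\<^esub> | Suc j \<Rightarrow> \<exists>w \<in> W j t. z = d j w))"

lemma acyclic_at_total:
  assumes zero: "\<And>i. \<zero>\<^bsub>E i\<^esub> \<in> W i t"
  shows "acyclic_at (total_module E) (total_diff E d) (total_family E W) t \<longleftrightarrow> (\<forall>i. exact_at W t i)"
proof
  assume L: "acyclic_at (total_module E) (total_diff E d) (total_family E W) t"
  show "\<forall>i. exact_at W t i"
    unfolding exact_at_def
  proof (intro allI ballI impI)
    fix i z assume z: "z \<in> W i t" "d i z = \<zero>\<^bsub>E (Suc i)\<^esub>"
    define f where "f j = (if j = i then z else \<zero>\<^bsub>E j\<^esub>)" for j
    have "finite {j. f j \<noteq> \<zero>\<^bsub>E j\<^esub>}" by (rule finite_subset[of _ "{i}"]) (auto simp: f_def)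
    then have "f \<in> total_family E W t" using z zero by (simp add: total_family_def f_def)
    moreover have "total_diff E d f = \<zero>\<^bsub>total_module E\<^esub>"
    proof
      fix j show "total_diff E d f j = \<zero>\<^bsub>total_module E\<^esub> j"
        using z d_zero by (cases j) (auto simp: f_def)
    qed
    ultimately obtain w where w: "w \<in> total_family E W t" "f = total_diff E d w"
      using L unfolding acyclic_at_def by blast
    have "z = total_diff E d w i" using fun_cong[OF w(2), of i] by (simp add: f_def)
    then show "case i of 0 \<Rightarrow> z = \<zero>\<^bsub>E 0\<^esub> | Suc j \<Rightarrow> \<exists>w \<in> W j t. z = d j w"
      using w(1) by (cases i) (auto simp: total_family_def)
  qed
next
  assume R: "\<forall>i. exact_at W t i"
  show "acyclic_at (total_module E) (total_diff E d) (total_family E W) t"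
    unfolding acyclic_at_def
  proof (intro ballI impI)
    fix f assume f: "f \<in> total_family E W t" "total_diff E d f = \<zero>\<^bsub>total_module E\<^esub>"
    have df: "d i (f i) = \<zero>\<^bsub>E (Suc i)\<^esub>" for i using fun_cong[OF f(2), of "Suc i"] by simp
    have f0: "f 0 = \<zero>\<^bsub>E 0\<^esub>" using R f df[of 0] by (fastforce simp: exact_at_def total_family_def)
    \<comment> \<open>Choosing 0 wherever the value to be bounded is 0 keeps the support of the
      primitive finite.\<close>
    have "\<exists>w \<in> W j t. f (Suc j) = d j w \<and> (f (Suc j) = \<zero>\<^bsub>E (Suc j)\<^esub> \<longrightarrow> w = \<zero>\<^bsub>E j\<^esub>)" for j
    proof (cases "f (Suc j) = \<zero>\<^bsub>E (Suc j)\<^esub>")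
      case True
      then show ?thesis using zero[of j] d_zero[of j] by (intro bexI[of _ "\<zero>\<^bsub>E j\<^esub>"]) auto
    next
      case False
      have "exact_at W t (Suc j)" using R by blast
      then show ?thesis using f(1) df[of "Suc j"] False by (auto simp: exact_at_def total_family_def)
    qed
    then obtain w where w: "\<And>j. w j \<in> W j t" "\<And>j. f (Suc j) = d j (w j)"
      "\<And>j. f (Suc j) = \<zero>\<^bsub>E (Suc j)\<^esub> \<Longrightarrow> w j = \<zero>\<^bsub>E j\<^esub>" by metis
    have "Suc ` {j. w j \<noteq> \<zero>\<^bsub>E j\<^esub>} \<subseteq> {i. f i \<noteq> \<zero>\<^bsub>E i\<^esub>}" using w(3) by auto
    moreover have "finite {i. f i \<noteq> \<zero>\<^bsub>E i\<^esub>}" using f(1) by (simp add: total_family_def)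
    ultimately have "finite {j. w j \<noteq> \<zero>\<^bsub>E j\<^esub>}" using finite_subset finite_imageD inj_Suc by metis
    then have "w \<in> total_family E W t" using w(1) by (simp add: total_family_def)
    moreover have "f = total_diff E d w"
    proof
      fix i show "f i = total_diff E d w i" using f0 w(2) by (cases i) auto
    qed
    ultimately show "\<exists>w \<in> total_family E W t. f = total_diff E d w" by blast
  qed
qed

lemma torsion_family_total:
  assumes x: "x \<in> carrier R" and W: "\<And>i t. W i t \<subseteq> carrier (E i)"
    and tors: "\<And>i t w. w \<in> W i t \<Longrightarrow> \<exists>k :: nat. (x [^] k) \<odot>\<^bsub>E i\<^esub> w = \<zero>\<^bsub>E i\<^esub>"
  shows "torsion_family R (total_module E) (total_family E W) x"
  unfolding torsion_family_def
proof (intro allI ballI)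
  fix t f assume f: "f \<in> total_family E W t"
  define S where "S = {i. f i \<noteq> \<zero>\<^bsub>E i\<^esub>}"
  have S: "finite S" using f by (simp add: S_def total_family_def)
  have "\<exists>k :: nat. (x [^] k) \<odot>\<^bsub>E i\<^esub> f i = \<zero>\<^bsub>E i\<^esub>" for i
    using tors[of "f i" i t] f by (simp add: total_family_def)
  then obtain k :: "nat \<Rightarrow> nat" where k: "\<And>i. (x [^] k i) \<odot>\<^bsub>E i\<^esub> f i = \<zero>\<^bsub>E i\<^esub>" by metis
  \<comment> \<open>Only finitely many entries are nonzero, so the sum of their exponents serves all
    of them.\<close>
  define m where "m = sum k S"
  have "(x [^] m) \<odot>\<^bsub>E i\<^esub> f i = \<zero>\<^bsub>E i\<^esub>" for i
  proof -
    interpret Ei: module R "E i" by (rule module_E)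
    have fi: "f i \<in> carrier (E i)" using f W by (auto simp: total_family_def)
    show ?thesis
    proof (cases "i \<in> S")
      case True
      then have "k i \<le> m" unfolding m_def using S by (simp add: member_le_sum)
      then have "x [^] m = x [^] (m - k i) \<otimes> x [^] k i" using x by (simp add: nat_pow_mult)
      then show ?thesis using fi k[of i] x by (simp add: Ei.smult_assoc1)
    next
      case False
      then show ?thesis using x by (simp add: S_def)
    qed
  qed
  then show "\<exists>k :: nat. (x [^] k) \<odot>\<^bsub>total_module E\<^esub> f = \<zero>\<^bsub>total_module E\<^esub>"
    by (intro exI[of _ m]) simp
qed

text \<open>Injectivity modulo torsion is automatic: if \<open>x f\<close> is torsion, so is
  \<open>f\<close>. Surjectivity is the divisibility hypothesis, applied entry by entry.\<close>

lemma quotient_bijective_total: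
  assumes x: "x \<in> carrier R" and W: "\<And>i t. W i t \<subseteq> carrier (E i)"
    and zero: "\<And>i t. \<zero>\<^bsub>E i\<^esub> \<in> W i t"
    and div: "\<And>i t w. w \<in> W i t \<Longrightarrow>
       \<exists>e \<in> W i (t - int \<delta>). w \<ominus>\<^bsub>E i\<^esub> x \<odot>\<^bsub>E i\<^esub> e \<in> torsion_subfamily R (E i) x (W i) t"
  shows "quotient_bijective (total_module E) (x, \<delta>)
     (total_family E (\<lambda>i. torsion_subfamily R (E i) x (W i))) (total_family E W)"
  unfolding quotient_bijective_def split
proof (intro conjI allI ballI impI)
  interpret T: module R "total_module E" by (rule module_total_module)
  fix t f assume f: "f \<in> total_family E W t"
  have fc: "f i \<in> carrier (E i)" for i using f W by (auto simp: total_family_def)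
  {
    assume xf: "x \<odot>\<^bsub>total_module E\<^esub> f \<in> total_family E (\<lambda>i. torsion_subfamily R (E i) x (W i)) (t + int \<delta>)"
    have "f i \<in> torsion_subfamily R (E i) x (W i) t" for i
    proof -
      interpret Ei: module R "E i" by (rule module_E)
      obtain k :: nat where "(x [^] k) \<odot>\<^bsub>E i\<^esub> (x \<odot>\<^bsub>E i\<^esub> f i) = \<zero>\<^bsub>E i\<^esub>"
        using xf by (auto simp: total_family_def torsion_subfamily_def)
      then have "(x [^] Suc k) \<odot>\<^bsub>E i\<^esub> f i = \<zero>\<^bsub>E i\<^esub>" using fc x by (simp add: Ei.smult_assoc1)
      then show ?thesis using f unfolding torsion_subfamily_def total_family_def by blast
    qed
    then show "f \<in> total_family E (\<lambda>i. torsion_subfamily R (E i) x (W i)) t"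
      using f by (simp add: total_family_def)
  }
  \<comment> \<open>The witness is taken to be 0 outside the support of \<open>f\<close>, since
    arbitrary choices there could have infinite support.\<close>
  have "\<exists>e \<in> W i (t - int \<delta>). f i \<ominus>\<^bsub>E i\<^esub> x \<odot>\<^bsub>E i\<^esub> e \<in> torsion_subfamily R (E i) x (W i) t \<and>
      (f i = \<zero>\<^bsub>E i\<^esub> \<longrightarrow> e = \<zero>\<^bsub>E i\<^esub>)" for i
  proof (cases "f i = \<zero>\<^bsub>E i\<^esub>")
    case True
    interpret Ei: module R "E i" by (rule module_E)
    have "(x [^] (0::nat)) \<odot>\<^bsub>E i\<^esub> \<zero>\<^bsub>E i\<^esub> = \<zero>\<^bsub>E i\<^esub>" by simp
    then have "\<zero>\<^bsub>E i\<^esub> \<in> torsion_subfamily R (E i) x (W i) t"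
      using zero unfolding torsion_subfamily_def by blast
    moreover have "f i \<ominus>\<^bsub>E i\<^esub> x \<odot>\<^bsub>E i\<^esub> \<zero>\<^bsub>E i\<^esub> = \<zero>\<^bsub>E i\<^esub>" using True x by (simp add: a_minus_def)
    ultimately show ?thesis using zero[of i "t - int \<delta>"] by (intro bexI[of _ "\<zero>\<^bsub>E i\<^esub>"]) auto
  next
    case False
    then show ?thesis using div[of "f i" i t] f by (auto simp: total_family_def)
  qed
  then obtain w where w: "\<And>i. w i \<in> W i (t - int \<delta>)"
    "\<And>i. f i \<ominus>\<^bsub>E i\<^esub> x \<odot>\<^bsub>E i\<^esub> w i \<in> torsion_subfamily R (E i) x (W i) t"
    "\<And>i. f i = \<zero>\<^bsub>E i\<^esub> \<Longrightarrow> w i = \<zero>\<^bsub>E i\<^esub>" by metis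
  have "finite {i. f i \<noteq> \<zero>\<^bsub>E i\<^esub>}" using f by (simp add: total_family_def)
  then have fin: "finite {i. w i \<noteq> \<zero>\<^bsub>E i\<^esub>}" by (rule rev_finite_subset) (use w(3) in auto)
  then have wT: "w \<in> total_family E W (t - int \<delta>)" using w(1) by (simp add: total_family_def)
  have wc: "w \<in> carrier (total_module E)" using w(1) W fin by auto
  have fT: "f \<in> carrier (total_module E)" using fc f by (simp add: total_family_def)
  have xw: "x \<odot>\<^bsub>total_module E\<^esub> w \<in> carrier (total_module E)" by (rule T.smult_closed[OF x wc])
  have "f \<ominus>\<^bsub>total_module E\<^esub> x \<odot>\<^bsub>total_module E\<^esub> w \<in> carrier (total_module E)"
    by (rule T.M.minus_closed[OF fT xw])
  then have "f \<ominus>\<^bsub>total_module E\<^esub> x \<odot>\<^bsub>total_module E\<^esub> w \<in> total_family E (\<lambda>i. torsion_subfamily R (E i) x (W i)) t"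
    using w(2) unfolding total_module_minus[OF xw] by (simp add: total_family_def)
  then show "\<exists>w \<in> total_family E W (t - int \<delta>). f \<ominus>\<^bsub>total_module E\<^esub> x \<odot>\<^bsub>total_module E\<^esub> w
      \<in> total_family E (\<lambda>i. torsion_subfamily R (E i) x (W i)) t"
    using wT by blast
qed

end

section \<open>The resolution, its torsion parts and the embedded copy of \<open>M\<close>\<close>

locale graded_resolution = standard_graded_generators R \<nn> X
  for R :: "'a gring" (structure) and \<nn> X +
  fixes M :: "('a, 'b) gmodule" and \<epsilon> :: "'b \<Rightarrow> 'c" and E :: "nat \<Rightarrow> ('a, 'c) gmodule" and d :: "nat \<Rightarrow> 'c \<Rightarrow> 'c"
  assumes graded_M: "graded_module R M" and fg_M: "fg_module R M"
    and resolution: "graded_injective_resolution R M \<epsilon> E d"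
begin

lemma injective_E: "graded_injective R (E i)"
  using resolution by (simp add: graded_injective_resolution_def)

lemma graded_E: "graded_module R (E i)"
  using injective_E by (simp add: graded_injective_def)

lemma graded_hom_d: "graded_hom R (E i) (E (Suc i)) (d i)"
  using resolution by (simp add: graded_injective_resolution_def)

lemma graded_hom_\<epsilon>: "graded_hom R M (E 0) \<epsilon>"
  using resolution by (simp add: graded_injective_resolution_def)

lemma \<epsilon>_image: "\<epsilon> ` carrier M = {x \<in> carrier (E 0). d 0 x = \<zero>\<^bsub>E 1\<^esub>}"
  using resolution by (simp add: graded_injective_resolution_def)

lemma d_image: "d i ` carrier (E i) = {x \<in> carrier (E (Suc i)). d (Suc i) x = \<zero>\<^bsub>E (Suc (Suc i))\<^esub>}"
  using resolution by (simp add: graded_injective_resolution_def)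

lemma inj_\<epsilon>: "inj_on \<epsilon> (carrier M)"
  using resolution by (simp add: graded_injective_resolution_def)

lemma d_part: "e \<in> mod_part (E i) t \<Longrightarrow> d i e \<in> mod_part (E (Suc i)) t"
  using graded_hom_d[of i] unfolding graded_hom_def by blast

sublocale module_complex R E d
proof (intro module_complex.intro module_complex_axioms.intro is_cring)
  show "module R (E i)" for i using graded_E by (simp add: graded_module_def)
  show "d i e \<in> carrier (E (Suc i))" if "e \<in> carrier (E i)" for i e
    using graded_hom_d[of i] that unfolding graded_hom_def by blast
  show "d i (e \<oplus>\<^bsub>E i\<^esub> e') = d i e \<oplus>\<^bsub>E (Suc i)\<^esub> d i e'" if "e \<in> carrier (E i)" "e' \<in> carrier (E i)" for i e e'
    using graded_hom_d[of i] that unfolding graded_hom_def by blast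
  show "d i (r \<odot>\<^bsub>E i\<^esub> e) = r \<odot>\<^bsub>E (Suc i)\<^esub> d i e" if "r \<in> carrier R" "e \<in> carrier (E i)" for i r e
    using graded_hom_d[of i] that unfolding graded_hom_def by blast
  show "d (Suc i) (d i e) = \<zero>\<^bsub>E (Suc (Suc i))\<^esub>" if "e \<in> carrier (E i)" for i e
    using d_image[of i] that by blast
qed

lemma graded_group_E: "graded_group (E i) (mod_part (E i))"
proof (intro graded_group.intro graded_group_axioms.intro)
  show "abelian_group (E i)" using module_E[of i] by (simp add: module_def)
  show "direct_sum_of (E i) (mod_part (E i))" using graded_E by (simp add: graded_module_def)
qed

lemma module_M: "module R M" using graded_M by (simp add: graded_module_def)

lemma graded_group_M: "graded_group M (mod_part M)"
proof (intro graded_group.intro graded_group_axioms.intro)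
  show "abelian_group M" using module_M by (simp add: module_def)
  show "direct_sum_of M (mod_part M)" using graded_M by (simp add: graded_module_def)
qed

lemma graded_family_mod_part:
  assumes N: "graded_module R N"
  shows "graded_family (ring_part R 0) X N (mod_part N)"
proof -
  interpret N: graded_group N "mod_part N"
    using N by (intro graded_group.intro graded_group_axioms.intro) (simp_all add: graded_module_def module_def)
  have smult: "a \<odot>\<^bsub>N\<^esub> x \<in> mod_part N (int n + t)" if "a \<in> ring_part R n" "x \<in> mod_part N t" for n a x t
    using N that unfolding graded_module_def by blast
  show ?thesis
  proof (intro graded_familyI)
    fix t r a assume "r \<in> ring_part R 0" "a \<in> mod_part N t"
    then show "r \<odot>\<^bsub>N\<^esub> a \<in> mod_part N t" using smult[of r 0 a t] by simp
  next
    fix t r a assume "r \<in> X" "a \<in> mod_part N t"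
    then show "r \<odot>\<^bsub>N\<^esub> a \<in> mod_part N (t + 1)" using smult[of r 1 a t] X_part by (auto simp: add.commute)
  qed (use N.part_carrier N.part_zero N.part_add in auto)
qed

definition torsion_parts :: "'a list \<Rightarrow> nat \<Rightarrow> int \<Rightarrow> 'c set" where
  "torsion_parts L i = torsion_list R (E i) L (mod_part (E i))"

lemma torsion_parts_iff:
  "w \<in> torsion_parts L i t \<longleftrightarrow>
     w \<in> mod_part (E i) t \<and> (\<forall>x \<in> set L. \<exists>k :: nat. (x [^] k) \<odot>\<^bsub>E i\<^esub> w = \<zero>\<^bsub>E i\<^esub>)"
  by (simp add: torsion_parts_def torsion_list_iff)

lemma torsion_parts_carrier: "torsion_parts L i t \<subseteq> carrier (E i)"
  using graded_group.part_carrier[OF graded_group_E] by (auto simp: torsion_parts_iff)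

text \<open>The two conclusions are carried together: injectivity of one torsion part gives that of
  the next, and it also provides the divisibility used in
  \<open>koszul_acyclic_torsion_parts\<close>.\<close>

lemma torsion_parts_family:
  assumes "\<forall>x \<in> set L. \<exists>\<delta>. x \<in> int_part R (int \<delta>)"
  shows "graded_family (ring_part R 0) X (E i) (torsion_parts L i) \<and>
     baer_injective R (ring_part R 0) X (E i) (torsion_parts L i)"
  using assms
proof (induction L)
  case Nil
  then show ?case
    using graded_family_mod_part[OF graded_E] graded_injective_baer[OF injective_E] by (simp add: torsion_parts_def)
next
  case (Cons x L)
  obtain \<delta> where x: "x \<in> int_part R (int \<delta>)" using Cons.prems by auto
  have IH: "graded_family (ring_part R 0) X (E i) (torsion_parts L i)"
    "baer_injective R (ring_part R 0) X (E i) (torsion_parts L i)" using Cons by auto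
  have e: "torsion_parts (x # L) i = torsion_subfamily R (E i) x (torsion_parts L i)"
    by (simp add: torsion_parts_def)
  have A: "ring_part R 0 \<subseteq> carrier R" using A_carrier by blast
  show ?case
    unfolding e using graded_family_torsion_subfamily[OF module_E IH(1) A X_carrier gr.part_carrier[OF x]]
      baer_injective_torsion_subfamily[OF module_E IH x] by blast
qed

lemma d_torsion_parts:
  assumes L: "set L \<subseteq> carrier R" and e: "e \<in> torsion_parts L i t"
  shows "d i e \<in> torsion_parts L (Suc i) t"
proof -
  have ec: "e \<in> carrier (E i)" using e torsion_parts_carrier by blast
  have "\<exists>k :: nat. (x [^] k) \<odot>\<^bsub>E (Suc i)\<^esub> d i e = \<zero>\<^bsub>E (Suc i)\<^esub>" if x: "x \<in> set L" for x
  proof -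
    obtain k :: nat where k: "(x [^] k) \<odot>\<^bsub>E i\<^esub> e = \<zero>\<^bsub>E i\<^esub>" using e x by (auto simp: torsion_parts_iff)
    have "(x [^] k) \<odot>\<^bsub>E (Suc i)\<^esub> d i e = d i ((x [^] k) \<odot>\<^bsub>E i\<^esub> e)"
      using L x ec by (simp add: d_smult subset_iff)
    then show ?thesis using k d_zero by auto
  qed
  then show ?thesis using e d_part by (simp add: torsion_parts_iff)
qed

abbreviation "\<Omega> \<equiv> total_module E"
abbreviation "\<D> \<equiv> total_diff E d"

lemma differential_family_torsion_parts:
  assumes "\<forall>x \<in> set L. \<exists>\<delta>. x \<in> int_part R (int \<delta>)"
  shows "differential_family R (ring_part R 0) \<Omega> X \<D> (total_family E (torsion_parts L))"
proof (rule differential_family_total[OF A_subring X_carrier])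
  have "set L \<subseteq> carrier R" using assms gr.part_carrier by blast
  then show "d i e \<in> torsion_parts L (Suc i) t" if "e \<in> torsion_parts L i t" for i t e
    using d_torsion_parts that by blast
qed (use torsion_parts_family[OF assms] in blast)

lemma generator_parts:
  assumes "\<forall>g \<in> set gs. is_generator (ring_part R 0) X g" "(x, \<delta>) \<in> set gs"
  shows "x \<in> int_part R (int \<delta>)"
  using assms generator_in_part by blast

text \<open>The entries of \<open>L\<close> are removed one at a time. An entry \<open>x\<close>
  acts bijectively on the quotient of two successive torsion parts and occurs in \<open>gs\<close>,
  so coning it off makes that quotient acyclic.\<close>

lemma koszul_acyclic_torsion_parts:
  assumes gs: "\<forall>g \<in> set gs. is_generator (ring_part R 0) X g"
    and L: "set L \<subseteq> fst ` set gs"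
  shows "koszul_acyclic gs \<Omega> \<D> (total_family E (torsion_parts L)) t0 \<longleftrightarrow>
     koszul_acyclic gs \<Omega> \<D> (total_family E (torsion_parts [])) t0"
  using L
proof (induction L)
  case (Cons x L)
  have parts: "\<forall>y \<in> set (x # L). \<exists>\<delta>. y \<in> int_part R (int \<delta>)"
    using generator_parts[OF gs] Cons.prems by fastforce
  then have parts_L: "\<forall>y \<in> set L. \<exists>\<delta>. y \<in> int_part R (int \<delta>)" by simp
  obtain \<delta> where x: "(x, \<delta>) \<in> set gs" using Cons.prems by auto
  have xp: "x \<in> int_part R (int \<delta>)" by (rule generator_parts[OF gs x])
  note fam = torsion_parts_family[OF parts_L]
  have e: "torsion_parts (x # L) = (\<lambda>i. torsion_subfamily R (E i) x (torsion_parts L i))"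
    by (simp add: torsion_parts_def fun_eq_iff)
  have le: "total_family E (torsion_parts (x # L)) \<le> total_family E (torsion_parts L)"
    by (rule total_family_mono) (auto simp: torsion_parts_iff)
  have bij: "quotient_bijective \<Omega> (x, \<delta>) (total_family E (torsion_parts (x # L))) (total_family E (torsion_parts L))"
    unfolding e
  proof (rule quotient_bijective_total[OF gr.part_carrier[OF xp] torsion_parts_carrier])
    show "\<zero>\<^bsub>E i\<^esub> \<in> torsion_parts L i t" for i t using graded_familyD(2) fam by blast
    fix i t w assume w: "w \<in> torsion_parts L i t"
    show "\<exists>e \<in> torsion_parts L i (t - int \<delta>). w \<ominus>\<^bsub>E i\<^esub> x \<odot>\<^bsub>E i\<^esub> e \<in> torsion_subfamily R (E i) x (torsion_parts L i) t"
      using baer_injective_divisible[OF module_E conjunct1[OF fam] conjunct2[OF fam] xp w] .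
  qed
  have "koszul_acyclic gs \<Omega> \<D> (total_family E (torsion_parts (x # L))) t0 \<longleftrightarrow>
      koszul_acyclic gs \<Omega> \<D> (total_family E (torsion_parts L)) t0"
    by (rule koszul_acyclic_quotient_bijective[OF differential_family_torsion_parts[OF parts_L]
          differential_family_torsion_parts[OF parts] le gs x bij])
  then show ?case using Cons by simp
qed simp

text \<open>Every element coned off acts with torsion on this family, so the Koszul complex detects
  its exactness up to the shift by the total degree.\<close>

lemma koszul_acyclic_iff_exact:
  assumes gs: "\<forall>g \<in> set gs. is_generator (ring_part R 0) X g"
    and L: "set L = fst ` set gs"
  shows "koszul_acyclic gs \<Omega> \<D> (total_family E (torsion_parts L)) (t0 + int (sum_list (map snd gs))) \<longleftrightarrow>
     (\<forall>t \<ge> t0. \<forall>i. exact_at (torsion_parts L) t i)"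
proof -
  have parts: "\<forall>y \<in> set L. \<exists>\<delta>. y \<in> int_part R (int \<delta>)"
    using generator_parts[OF gs] L by fastforce
  have tors: "\<forall>g \<in> set gs. is_generator (ring_part R 0) X g \<and>
      torsion_family R \<Omega> (total_family E (torsion_parts L)) (fst g)"
  proof
    fix g assume g: "g \<in> set gs"
    then have "fst g \<in> set L" using L by auto
    moreover from this obtain \<delta> where "fst g \<in> int_part R (int \<delta>)" using parts by blast
    then have "fst g \<in> carrier R" by (rule gr.part_carrier)
    ultimately have "torsion_family R \<Omega> (total_family E (torsion_parts L)) (fst g)"
      by (intro torsion_family_total torsion_parts_carrier) (auto simp: torsion_parts_iff)
    then show "is_generator (ring_part R 0) X g \<and>
        torsion_family R \<Omega> (total_family E (torsion_parts L)) (fst g)"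
      using gs g by blast
  qed
  have "\<zero>\<^bsub>E i\<^esub> \<in> torsion_parts L i t" for i t
    using graded_familyD(2) torsion_parts_family[OF parts] by blast
  then have "acyclic_at \<Omega> \<D> (total_family E (torsion_parts L)) t \<longleftrightarrow> (\<forall>i. exact_at (torsion_parts L) t i)" for t
    by (rule acyclic_at_total)
  then show ?thesis
    using koszul_acyclic_torsion[OF differential_family_torsion_parts[OF parts] tors] by simp
qed

text \<open>A copy of \<open>M\<close> inside the total complex, placed at index 0: the augmentation
  becomes an inclusion of families in one type, and the comparison lemmas for subcomplexes
  apply.\<close>

definition image_parts :: "nat \<Rightarrow> int \<Rightarrow> 'c set" where
  "image_parts i t = (if i = 0 then \<epsilon> ` mod_part M t else {\<zero>\<^bsub>E i\<^esub>})"

lemma \<epsilon>_closed: "m \<in> carrier M \<Longrightarrow> \<epsilon> m \<in> carrier (E 0)"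
  and \<epsilon>_add: "m \<in> carrier M \<Longrightarrow> m' \<in> carrier M \<Longrightarrow> \<epsilon> (m \<oplus>\<^bsub>M\<^esub> m') = \<epsilon> m \<oplus>\<^bsub>E 0\<^esub> \<epsilon> m'"
  and \<epsilon>_smult: "r \<in> carrier R \<Longrightarrow> m \<in> carrier M \<Longrightarrow> \<epsilon> (r \<odot>\<^bsub>M\<^esub> m) = r \<odot>\<^bsub>E 0\<^esub> \<epsilon> m"
  and \<epsilon>_part: "m \<in> mod_part M t \<Longrightarrow> \<epsilon> m \<in> mod_part (E 0) t"
  using graded_hom_\<epsilon> unfolding graded_hom_def by blast+

lemma \<epsilon>_zero: "\<epsilon> \<zero>\<^bsub>M\<^esub> = \<zero>\<^bsub>E 0\<^esub>"
proof -
  interpret M: module R M by (rule module_M)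
  interpret E0: module R "E 0" by (rule module_E)
  have "\<epsilon> (\<zero> \<odot>\<^bsub>M\<^esub> \<zero>\<^bsub>M\<^esub>) = \<zero> \<odot>\<^bsub>E 0\<^esub> \<epsilon> \<zero>\<^bsub>M\<^esub>" by (rule \<epsilon>_smult) auto
  then show ?thesis using \<epsilon>_closed[OF M.M.zero_closed] by simp
qed

lemma d_\<epsilon>: "m \<in> carrier M \<Longrightarrow> d 0 (\<epsilon> m) = \<zero>\<^bsub>E (Suc 0)\<^esub>"
  using \<epsilon>_image by auto

lemma M_part_carrier: "m \<in> mod_part M t \<Longrightarrow> m \<in> carrier M"
  using graded_group.part_carrier[OF graded_group_M] by blast

lemma E_zero_closed: "\<zero>\<^bsub>E i\<^esub> \<in> carrier (E i)"
  using module_E[of i] by (simp add: module_def abelian_group_def abelian_monoid.zero_closed)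

lemma E_zero_add: "\<zero>\<^bsub>E i\<^esub> \<oplus>\<^bsub>E i\<^esub> \<zero>\<^bsub>E i\<^esub> = \<zero>\<^bsub>E i\<^esub>"
  using module_E[of i] by (simp add: module_def abelian_group_def abelian_monoid.l_zero abelian_monoid.zero_closed)

lemma graded_family_image_parts: "graded_family (ring_part R 0) X (E i) (image_parts i)"
proof -
  interpret Ei: module R "E i" by (rule module_E)
  note MD = graded_familyD[OF graded_family_mod_part[OF graded_M]]
  show ?thesis
  proof (cases "i = 0")
    case True
    show ?thesis
      unfolding True
    proof (intro graded_familyI)
      fix t a assume "a \<in> image_parts 0 t"
      then show "a \<in> carrier (E 0)" using \<epsilon>_closed M_part_carrier by (auto simp: image_parts_def)
    next
      fix t show "\<zero>\<^bsub>E 0\<^esub> \<in> image_parts 0 t"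
        using MD(2)[of t] by (auto simp: image_parts_def \<epsilon>_zero[symmetric])
    next
      fix t a b assume "a \<in> image_parts 0 t" "b \<in> image_parts 0 t"
      then obtain m m' where m: "m \<in> mod_part M t" "a = \<epsilon> m" "m' \<in> mod_part M t" "b = \<epsilon> m'"
        by (auto simp: image_parts_def)
      then have "a \<oplus>\<^bsub>E 0\<^esub> b = \<epsilon> (m \<oplus>\<^bsub>M\<^esub> m')" using M_part_carrier by (simp add: \<epsilon>_add)
      then show "a \<oplus>\<^bsub>E 0\<^esub> b \<in> image_parts 0 t" using MD(3)[OF m(1,3)] by (simp add: image_parts_def)
    next
      fix t r a assume r: "r \<in> ring_part R 0" and "a \<in> image_parts 0 t"
      then obtain m where m: "m \<in> mod_part M t" "a = \<epsilon> m" by (auto simp: image_parts_def)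
      then have "r \<odot>\<^bsub>E 0\<^esub> a = \<epsilon> (r \<odot>\<^bsub>M\<^esub> m)" using M_part_carrier A_carrier[OF r] by (simp add: \<epsilon>_smult)
      then show "r \<odot>\<^bsub>E 0\<^esub> a \<in> image_parts 0 t" using MD(4)[OF r m(1)] by (simp add: image_parts_def)
    next
      fix t r a assume r: "r \<in> X" and "a \<in> image_parts 0 t"
      then obtain m where m: "m \<in> mod_part M t" "a = \<epsilon> m" by (auto simp: image_parts_def)
      have rc: "r \<in> carrier R" using r X_carrier by blast
      then have "r \<odot>\<^bsub>E 0\<^esub> a = \<epsilon> (r \<odot>\<^bsub>M\<^esub> m)" using m M_part_carrier by (simp add: \<epsilon>_smult)
      then show "r \<odot>\<^bsub>E 0\<^esub> a \<in> image_parts 0 (t + 1)" using MD(5)[OF r m(1)] by (simp add: image_parts_def)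
    qed
  next
    case False
    then show ?thesis
      using A_carrier X_carrier by (intro graded_familyI) (auto simp: image_parts_def)
  qed
qed

lemma differential_family_image_parts:
  "differential_family R (ring_part R 0) \<Omega> X \<D> (total_family E image_parts)"
proof (rule differential_family_total[OF A_subring X_carrier graded_family_image_parts])
  fix i t e assume "e \<in> image_parts i t"
  then show "d i e \<in> image_parts (Suc i) t"
    using d_\<epsilon> M_part_carrier d_zero by (auto simp: image_parts_def split: if_splits)
qed

lemma component_d:
  assumes "e \<in> carrier (E i)"
  shows "component (E (Suc i)) (mod_part (E (Suc i))) (d i e) t = d i (component (E i) (mod_part (E i)) e t)"
  using component_hom[OF graded_group_E[of i] graded_group_E[of "Suc i"], where \<sigma> = "\<lambda>t. t" and h = "d i"]
    assms d_closed d_add d_part by simp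

text \<open>The resolution is exact as a sequence of whole modules; replacing a preimage by its
  component of degree \<open>t\<close> gives exactness degree by degree.\<close>

lemma homogeneous_preimage_d:
  assumes e: "e \<in> carrier (E i)" and part: "d i e \<in> mod_part (E (Suc i)) t"
  shows "component (E i) (mod_part (E i)) e t \<in> mod_part (E i) t \<and> d i (component (E i) (mod_part (E i)) e t) = d i e"
  using component_d[OF e, of t] graded_group.component_homogeneous[OF graded_group_E part]
    graded_group.component_part[OF graded_group_E e] by simp

lemma homogeneous_preimage_\<epsilon>:
  assumes m: "m \<in> carrier M" and part: "\<epsilon> m \<in> mod_part (E 0) t"
  shows "m \<in> mod_part M t"
proof -
  interpret M: graded_group M "mod_part M" by (rule graded_group_M)
  have "component (E 0) (mod_part (E 0)) (\<epsilon> m) t = \<epsilon> (component M (mod_part M) m t)"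
    using component_hom[OF graded_group_M graded_group_E[of 0], where \<sigma> = "\<lambda>t. t" and h = \<epsilon>]
      m \<epsilon>_closed \<epsilon>_add \<epsilon>_part by simp
  then have "\<epsilon> (component M (mod_part M) m t) = \<epsilon> m"
    using graded_group.component_homogeneous[OF graded_group_E part] by simp
  then have "component M (mod_part M) m t = m"
    using inj_\<epsilon> m M.component_closed[OF m] by (auto dest: inj_onD)
  then show ?thesis using M.component_part[OF m, of t] by simp
qed

text \<open>This is exactness of the resolution. The copy of \<open>M\<close> vanishes at positive
  indices, so an element \<open>k\<close> whose differential lies in it has every
  \<open>d i (k i)\<close> zero; then \<open>k 0\<close> comes from \<open>M\<close> and every later
  entry is a boundary.\<close>

lemma quotient_acyclic_image_parts:
  "quotient_acyclic \<Omega> \<D> (total_family E image_parts) (total_family E (torsion_parts []))"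
  unfolding quotient_acyclic_def
proof (intro allI ballI impI)
  fix t k assume k: "k \<in> total_family E (torsion_parts []) t" "\<D> k \<in> total_family E image_parts t"
  have kp: "k i \<in> mod_part (E i) t" and kfin: "finite {i. k i \<noteq> \<zero>\<^bsub>E i\<^esub>}" for i
    using k(1) by (auto simp: total_family_def torsion_parts_iff)
  have kc: "k i \<in> carrier (E i)" for i using graded_group.part_carrier[OF graded_group_E kp] .
  have dk: "d i (k i) = \<zero>\<^bsub>E (Suc i)\<^esub>" for i
  proof -
    have "\<D> k (Suc i) \<in> image_parts (Suc i) t" using k(2) unfolding total_family_def by blast
    then show ?thesis by (simp add: image_parts_def)
  qed
  have k0: "k 0 \<in> \<epsilon> ` mod_part M t"
  proof -
    have "k 0 \<in> \<epsilon> ` carrier M" using \<epsilon>_image kc dk[of 0] by simp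
    then obtain m where m: "m \<in> carrier M" "k 0 = \<epsilon> m" by blast
    then show ?thesis using homogeneous_preimage_\<epsilon>[of m t] kp[of 0] by simp
  qed
  have "\<exists>w \<in> mod_part (E j) t. k (Suc j) = d j w \<and> (k (Suc j) = \<zero>\<^bsub>E (Suc j)\<^esub> \<longrightarrow> w = \<zero>\<^bsub>E j\<^esub>)" for j
  proof (cases "k (Suc j) = \<zero>\<^bsub>E (Suc j)\<^esub>")
    case True
    then show ?thesis
      using graded_group.part_zero[OF graded_group_E] d_zero[of j] by (intro bexI[of _ "\<zero>\<^bsub>E j\<^esub>"]) auto
  next
    case False
    have "k (Suc j) \<in> d j ` carrier (E j)" using d_image[of j] kc dk[of "Suc j"] by simp
    then obtain e where e: "e \<in> carrier (E j)" "k (Suc j) = d j e" by blast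
    then show ?thesis using homogeneous_preimage_d[OF e(1), of t] kp[of "Suc j"] False by metis
  qed
  then obtain w where w: "\<And>j. w j \<in> mod_part (E j) t" "\<And>j. k (Suc j) = d j (w j)"
    "\<And>j. k (Suc j) = \<zero>\<^bsub>E (Suc j)\<^esub> \<Longrightarrow> w j = \<zero>\<^bsub>E j\<^esub>" by metis
  have "Suc ` {j. w j \<noteq> \<zero>\<^bsub>E j\<^esub>} \<subseteq> {i. k i \<noteq> \<zero>\<^bsub>E i\<^esub>}" using w(3) by auto
  then have fin: "finite {j. w j \<noteq> \<zero>\<^bsub>E j\<^esub>}" using kfin finite_subset finite_imageD inj_Suc by metis
  have wT: "w \<in> total_family E (torsion_parts []) t"
    using w(1) fin by (simp add: total_family_def torsion_parts_iff)
  interpret DF: differential_family R "ring_part R 0" \<Omega> X \<D> "total_family E (torsion_parts [])"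
    by (rule differential_family_torsion_parts) simp
  have Dw: "\<D> w \<in> carrier \<Omega>" by (rule DF.D_closed[OF DF.S_carrier[OF wT]])
  have "k \<ominus>\<^bsub>\<Omega>\<^esub> \<D> w \<in> carrier \<Omega>"
    by (rule DF.M.minus_closed[OF DF.S_carrier[OF k(1)] Dw])
  moreover have "(k \<ominus>\<^bsub>\<Omega>\<^esub> \<D> w) i \<in> image_parts i t" for i
  proof -
    interpret Ei: module R "E i" by (rule module_E)
    show ?thesis
    proof (cases i)
      case 0
      interpret E0: module R "E 0" by (rule module_E)
      have "k 0 \<ominus>\<^bsub>E 0\<^esub> \<zero>\<^bsub>E 0\<^esub> = k 0" using kc[of 0] by (simp add: a_minus_def)
      then show ?thesis using k0 0 unfolding total_module_minus[OF Dw] by (simp add: image_parts_def)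
    next
      case (Suc j)
      have "k i \<ominus>\<^bsub>E i\<^esub> k i = \<zero>\<^bsub>E i\<^esub>" using kc[of i] by (simp add: a_minus_def Ei.M.r_neg)
      then show ?thesis using Suc w(2)[of j] unfolding total_module_minus[OF Dw] by (simp add: image_parts_def)
    qed
  qed
  ultimately have "k \<ominus>\<^bsub>\<Omega>\<^esub> \<D> w \<in> total_family E image_parts t" by (simp add: total_family_def)
  then show "\<exists>l \<in> total_family E (torsion_parts []) t. k \<ominus>\<^bsub>\<Omega>\<^esub> \<D> l \<in> total_family E image_parts t"
    using wT by blast
qed

lemma koszul_acyclic_image_parts:
  assumes gs: "\<forall>g \<in> set gs. is_generator (ring_part R 0) X g"
  shows "koszul_acyclic gs \<Omega> \<D> (total_family E image_parts) t0 \<longleftrightarrow>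
     koszul_acyclic gs \<Omega> \<D> (total_family E (torsion_parts [])) t0"
proof (rule koszul_acyclic_quotient_acyclic[OF _ differential_family_image_parts _ gs quotient_acyclic_image_parts])
  show "differential_family R (ring_part R 0) \<Omega> X \<D> (total_family E (torsion_parts []))"
    by (rule differential_family_torsion_parts) simp
  have "image_parts i t \<subseteq> torsion_parts [] i t" for i t
    using \<epsilon>_part graded_group.part_zero[OF graded_group_E] by (auto simp: image_parts_def torsion_parts_iff)
  then show "total_family E image_parts \<le> total_family E (torsion_parts [])" by (rule total_family_mono)
qed

text \<open>The elements all of whose components lie in \<open>U\<close> form a submodule, as one
  sees by splitting the scalar into homogeneous pieces. It contains \<open>Y\<close>, hence is all
  of \<open>M\<close>.\<close>

lemma graded_module_generated:
  assumes U: "graded_family (ring_part R 0) X M U" and Y: "Y \<subseteq> carrier M"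
    and gen: "\<And>N. submodule N R M \<Longrightarrow> Y \<subseteq> N \<Longrightarrow> N = carrier M"
    and YQ: "\<And>y t. y \<in> Y \<Longrightarrow> component M (mod_part M) y t \<in> U t"
  shows "mod_part M t \<subseteq> U t"
proof -
  interpret M: module R M by (rule module_M)
  interpret gM: graded_group M "mod_part M" by (rule graded_group_M)
  note QD = graded_familyD[OF U]
  define N where "N = {m \<in> carrier M. \<forall>t. component M (mod_part M) m t \<in> U t}"
  have "submodule N R M"
  proof (rule M.submoduleI)
    show "N \<subseteq> carrier M" by (auto simp: N_def)
    show "\<zero>\<^bsub>M\<^esub> \<in> N" using QD(2) by (simp add: N_def gM.component_zero)
  next
    fix m assume "m \<in> N"
    then show "\<ominus>\<^bsub>M\<^esub> m \<in> N" using family_minus[OF module_M U] by (simp add: N_def gM.component_inv)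
  next
    fix m m' assume "m \<in> N" "m' \<in> N"
    then show "m \<oplus>\<^bsub>M\<^esub> m' \<in> N" using QD(3) by (simp add: N_def gM.component_add)
  next
    fix r m assume r: "r \<in> carrier R" and m: "m \<in> N"
    have mc: "m \<in> carrier M" using m by (simp add: N_def)
    show "r \<odot>\<^bsub>M\<^esub> m \<in> N"
      using r
    proof (induction rule: gr.homogeneous_induct)
      case (homogeneous n r)
      have rc: "r \<in> carrier R" by (rule gr.part_carrier[OF homogeneous])
      have "component M (mod_part M) (r \<odot>\<^bsub>M\<^esub> m) t \<in> U t" for t
      proof -
        have "component M (mod_part M) (r \<odot>\<^bsub>M\<^esub> m) (t - n + n) = r \<odot>\<^bsub>M\<^esub> component M (mod_part M) m (t - n)"
        proof (rule component_hom[OF graded_group_M graded_group_M, where \<sigma> = "\<lambda>t. t + n"])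
          show "r \<odot>\<^bsub>M\<^esub> u \<in> mod_part M (i + n)" if "u \<in> mod_part M i" for u i
            using family_part_closed[OF module_M graded_family_mod_part[OF graded_M] homogeneous that] .
        qed (use rc mc in \<open>auto simp: inj_on_def M.smult_r_distr\<close>)
        moreover have "r \<odot>\<^bsub>M\<^esub> component M (mod_part M) m (t - n) \<in> U (t - n + n)"
        proof (rule family_part_closed[OF module_M U homogeneous])
          show "component M (mod_part M) m (t - n) \<in> U (t - n)" using m by (simp add: N_def)
        qed
        ultimately show ?thesis by simp
      qed
      then show ?case using rc mc by (simp add: N_def)
    next
      case (add r s)
      then show ?case using mc QD(3) by (simp add: N_def M.smult_l_distr gM.component_add)
    qed
  qed
  moreover have "Y \<subseteq> N" using Y YQ by (auto simp: N_def)
  ultimately have N: "N = carrier M" by (rule gen)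
  show ?thesis
  proof
    fix m assume m: "m \<in> mod_part M t"
    then have "m \<in> N" using N gM.part_carrier by simp
    then show "m \<in> U t" using gM.component_homogeneous[OF m] by (auto simp: N_def dest: spec[of _ t])
  qed
qed

lemma acc_image_parts: "acc (ring_part R 0) X \<Omega> (total_family E image_parts)"
proof -
  interpret M: module R M by (rule module_M)
  interpret gM: graded_group M "mod_part M" by (rule graded_group_M)
  interpret \<Omega>: module R \<Omega> by (rule module_total_module)
  obtain Y where Y: "finite Y" "Y \<subseteq> carrier M" "\<And>N. submodule N R M \<Longrightarrow> Y \<subseteq> N \<Longrightarrow> N = carrier M"
    using fg_M unfolding fg_module_def by blast
  let ?c = "component M (mod_part M)"
  define \<iota> where "\<iota> m i = (if i = 0 then \<epsilon> m else \<zero>\<^bsub>E i\<^esub>)" for m and i :: nat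
  have \<iota>_closed: "\<iota> m \<in> carrier \<Omega>" if "m \<in> carrier M" for m
  proof -
    have "finite {i. \<iota> m i \<noteq> \<zero>\<^bsub>E i\<^esub>}" by (rule finite_subset[of _ "{0}"]) (auto simp: \<iota>_def)
    then show ?thesis using \<epsilon>_closed[OF that] E_zero_closed by (simp add: \<iota>_def)
  qed
  have \<iota>_zero: "\<iota> \<zero>\<^bsub>M\<^esub> = \<zero>\<^bsub>\<Omega>\<^esub>" by (auto simp: \<iota>_def \<epsilon>_zero)
  have \<iota>_add: "\<iota> (m \<oplus>\<^bsub>M\<^esub> m') = \<iota> m \<oplus>\<^bsub>\<Omega>\<^esub> \<iota> m'" if "m \<in> carrier M" "m' \<in> carrier M" for m m'
    using that E_zero_add by (auto simp: \<iota>_def \<epsilon>_add)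
  have \<iota>_smult: "\<iota> (r \<odot>\<^bsub>M\<^esub> m) = r \<odot>\<^bsub>\<Omega>\<^esub> \<iota> m" if "r \<in> carrier R" "m \<in> carrier M" for r m
    using that module.smult_r_null[OF module_E] by (auto simp: \<iota>_def \<epsilon>_smult)
  \<comment> \<open>The generators given by \<open>fg_module\<close> need not be homogeneous; they
    are replaced by their finitely many nonzero components, tagged by degree.\<close>
  define P where "P = (\<Union>y \<in> Y. (\<lambda>t. (t, \<iota> (?c y t))) ` {t. ?c y t \<noteq> \<zero>\<^bsub>M\<^esub>})"
  show ?thesis
  proof (rule acc_generated[OF module_total_module, where Y = P])
    show "finite P" unfolding P_def using Y gM.finite_support by auto
    show "P \<subseteq> UNIV \<times> carrier \<Omega>" unfolding P_def using \<iota>_closed gM.component_closed Y(2) by blast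
  next
    fix K assume K: "graded_family (ring_part R 0) X \<Omega> K" and PK: "\<And>t y. (t, y) \<in> P \<Longrightarrow> y \<in> K t"
    note KD = graded_familyD[OF K]
    define U where "U t = {m \<in> carrier M. \<iota> m \<in> K t}" for t
    have "graded_family (ring_part R 0) X M U"
    proof (intro graded_familyI)
      fix t show "\<zero>\<^bsub>M\<^esub> \<in> U t" using KD(2) by (simp only: U_def \<iota>_zero mem_Collect_eq M.M.zero_closed simp_thms)
    next
      fix t m m' assume "m \<in> U t" "m' \<in> U t"
      then show "m \<oplus>\<^bsub>M\<^esub> m' \<in> U t" using KD(3)[of "\<iota> m" t "\<iota> m'"] \<iota>_add[of m m'] by (simp add: U_def)
    next
      fix t r m assume r: "r \<in> ring_part R 0" and "m \<in> U t"
      then show "r \<odot>\<^bsub>M\<^esub> m \<in> U t"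
        using KD(4)[OF r, of "\<iota> m" t] \<iota>_smult[of r m] A_carrier[OF r] by (simp add: U_def)
    next
      fix t r m assume r: "r \<in> X" and "m \<in> U t"
      then show "r \<odot>\<^bsub>M\<^esub> m \<in> U (t + 1)"
        using KD(5)[OF r, of "\<iota> m" t] \<iota>_smult[of r m] X_carrier by (auto simp: U_def)
    qed (simp add: U_def)
    then have "mod_part M t \<subseteq> U t" for t
    proof (rule graded_module_generated[OF _ Y(2,3)])
      fix y t assume y: "y \<in> Y"
      then have yc: "y \<in> carrier M" using Y(2) by blast
      show "?c y t \<in> U t"
      proof (cases "?c y t = \<zero>\<^bsub>M\<^esub>")
        case True
        then show ?thesis using KD(2) by (simp only: U_def \<iota>_zero mem_Collect_eq M.M.zero_closed simp_thms)
      next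
        case False
        then have "(t, \<iota> (?c y t)) \<in> P" using y by (auto simp: P_def)
        then show ?thesis using PK gM.component_closed[OF yc] by (simp add: U_def)
      qed
    qed
    moreover have "f \<in> \<iota> ` mod_part M t" if "f \<in> total_family E image_parts t" for f t
    proof -
      have f: "f i \<in> image_parts i t" for i using that by (simp add: total_family_def)
      obtain m where m: "m \<in> mod_part M t" "f 0 = \<epsilon> m" using f[of 0] by (auto simp: image_parts_def)
      have "f = \<iota> m"
      proof
        fix i show "f i = \<iota> m i" using f[of i] m(2) by (cases "i = 0") (auto simp: image_parts_def \<iota>_def)
      qed
      then show ?thesis using m(1) by blast
    qed
    ultimately show "total_family E image_parts \<le> K" unfolding le_fun_def U_def by blast
  qed
qed

context
  fixes xs ys :: "'a list"
  assumes xs: "set xs = X" and ys: "set ys \<subseteq> \<nn>" and \<nn>: "\<nn> \<subseteq> ring_part R 0"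
begin

theorem exact_in_high_degrees_iff:
  "(\<forall>t \<ge> t0. \<forall>i. exact_at (torsion_parts (xs @ ys)) t i) \<longleftrightarrow> (\<forall>t \<ge> t0. \<forall>i. exact_at (torsion_parts xs) t i)"
proof -
  define gx gy where "gx = map (\<lambda>x. (x, 1 :: nat)) xs" and "gy = map (\<lambda>y. (y, 0 :: nat)) ys"
  have gx: "\<forall>g \<in> set gx. is_generator (ring_part R 0) X g"
    using xs by (auto simp: gx_def is_generator_def)
  have gxy: "\<forall>g \<in> set (gx @ gy). is_generator (ring_part R 0) X g"
    using gx ys \<nn> by (auto simp: gy_def is_generator_def)
  have fx: "set xs = fst ` set gx" and fxy: "set (xs @ ys) = fst ` set (gx @ gy)"
    by (simp_all add: gx_def gy_def image_Un image_image)
  let ?r = "sum_list (map snd gx)"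
  \<comment> \<open>The entries of \<open>gy\<close> have degree 0, so both lists produce the same
    shift of the threshold.\<close>
  have sum: "sum_list (map snd (gx @ gy)) = ?r" by (simp add: gy_def comp_def)
  have "(\<forall>t \<ge> t0. \<forall>i. exact_at (torsion_parts (xs @ ys)) t i) \<longleftrightarrow>
      koszul_acyclic (gx @ gy) \<Omega> \<D> (total_family E (torsion_parts (xs @ ys))) (t0 + int ?r)"
    using koszul_acyclic_iff_exact[OF gxy fxy, of t0] unfolding sum by blast
  also have "\<dots> \<longleftrightarrow> koszul_acyclic (gx @ gy) \<Omega> \<D> (total_family E image_parts) (t0 + int ?r)"
    using koszul_acyclic_torsion_parts[OF gxy equalityD1[OF fxy]] koszul_acyclic_image_parts[OF gxy] by blast
  also have "\<dots> \<longleftrightarrow> koszul_acyclic gx \<Omega> \<D> (total_family E image_parts) (t0 + int ?r)"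
    unfolding gy_def
  proof (rule koszul_acyclic_append_local[OF differential_family_image_parts acc_image_parts gx])
    show "y \<in> ring_part R 0" if "y \<in> set ys" for y using that ys \<nn> by blast
    show "\<exists>u \<in> ring_part R 0. u \<otimes> (\<one> \<ominus> r \<otimes> y) = \<one>" if "y \<in> set ys" "r \<in> ring_part R 0" for y r
      using local_unit that ys by blast
  qed
  also have "\<dots> \<longleftrightarrow> koszul_acyclic gx \<Omega> \<D> (total_family E (torsion_parts xs)) (t0 + int ?r)"
    using koszul_acyclic_torsion_parts[OF gx equalityD1[OF fx]] koszul_acyclic_image_parts[OF gx] by blast
  also have "\<dots> \<longleftrightarrow> (\<forall>t \<ge> t0. \<forall>i. exact_at (torsion_parts xs) t i)"
    by (rule koszul_acyclic_iff_exact[OF gx fx])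
  finally show ?thesis .
qed

theorem exact_in_high_degrees: "\<exists>t0. \<forall>t \<ge> t0. \<forall>i. exact_at (torsion_parts xs) t i"
proof -
  define gx where "gx = map (\<lambda>x. (x, 1 :: nat)) xs"
  have gx: "\<forall>g \<in> set gx. is_generator (ring_part R 0) X g"
    using xs by (auto simp: gx_def is_generator_def)
  have fx: "set xs = fst ` set gx" by (simp add: gx_def image_image)
  let ?r = "sum_list (map snd gx)"
  have sub: "set xs \<subseteq> X" and rest: "\<forall>x \<in> X - set xs. nilpotent_on_cohomology R \<Omega> \<D> (total_family E image_parts) x"
    using xs by blast+
  have "\<exists>t0. koszul_acyclic gx \<Omega> \<D> (total_family E image_parts) t0"
    using koszul_acyclic_in_high_degrees[OF differential_family_image_parts acc_image_parts finite_X sub rest]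
    unfolding gx_def .
  then obtain t0 where "koszul_acyclic gx \<Omega> \<D> (total_family E image_parts) t0" by blast
  then have "koszul_acyclic gx \<Omega> \<D> (total_family E (torsion_parts xs)) t0"
    unfolding koszul_acyclic_image_parts[OF gx] koszul_acyclic_torsion_parts[OF gx equalityD1[OF fx]] .
  \<comment> \<open>The threshold is rewritten into the shifted form of
    \<open>koszul_acyclic_iff_exact\<close>; exactness then starts \<open>?r\<close> degrees
    lower.\<close>
  then have "koszul_acyclic gx \<Omega> \<D> (total_family E (torsion_parts xs)) ((t0 - int ?r) + int ?r)"
    by simp
  then have "\<forall>t \<ge> t0 - int ?r. \<forall>i. exact_at (torsion_parts xs) t i"
    unfolding koszul_acyclic_iff_exact[OF gx fx] .
  then show ?thesis by (rule exI)
qed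

end

end

section \<open>Local cohomology and the theorem\<close>

text \<open>The only consequence of \<open>I = (L)\<close> that matters for \<open>I\<close>-torsion in \<open>G\<close>.\<close>

definition ideal_generated_on :: "('a, 'x) ring_scheme \<Rightarrow> ('a, 'c, 'y) module_scheme \<Rightarrow> 'a set \<Rightarrow> 'a set \<Rightarrow> bool" where
  "ideal_generated_on R G L I \<longleftrightarrow> L \<subseteq> I \<and> I \<subseteq> carrier R \<and>
     (\<forall>V. V \<subseteq> carrier G \<and> \<zero>\<^bsub>G\<^esub> \<in> V \<and> (\<forall>v \<in> V. \<forall>w \<in> V. v \<oplus>\<^bsub>G\<^esub> w \<in> V) \<and>
        (\<forall>r \<in> carrier R. \<forall>v \<in> V. r \<odot>\<^bsub>G\<^esub> v \<in> V) \<longrightarrow>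
        (\<forall>v \<in> carrier G. (\<forall>x \<in> L. x \<odot>\<^bsub>G\<^esub> v \<in> V) \<longrightarrow> (\<forall>a \<in> I. a \<odot>\<^bsub>G\<^esub> v \<in> V)))"

text \<open>For the converse, \<open>iterated_colon_exponents\<close> combines the exponents of the
  finitely many generators and puts \<open>v\<close> into some \<open>V j\<close>, whose elements
  are killed by all products of \<open>j\<close> generators. Each \<open>V j\<close> is a submodule,
  so \<open>ideal_generated_on\<close> replaces generators by arbitrary elements of
  \<open>I\<close>, one factor of the ideal power at a time.\<close>

lemma (in cring) ideal_power_torsion_iff:
  assumes G: "module R G" and fin: "finite L" and I: "ideal_generated_on R G L I" and v: "v \<in> carrier G"
  shows "(\<exists>k :: nat. \<forall>a \<in> I [^]\<^bsub>ideals_set R\<^esub> k. a \<odot>\<^bsub>G\<^esub> v = \<zero>\<^bsub>G\<^esub>) \<longleftrightarrow>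
     (\<forall>x \<in> L. \<exists>k :: nat. (x [^] k) \<odot>\<^bsub>G\<^esub> v = \<zero>\<^bsub>G\<^esub>)"
proof
  interpret G: module R G by (rule G)
  have LI: "L \<subseteq> I" and Ic: "I \<subseteq> carrier R" using I by (auto simp: ideal_generated_on_def)
  \<comment> \<open>The zeroth power in the monoid of ideals is the whole ring, which fits
    \<open>V 0\<close> consisting of zero alone.\<close>
  have pow_0: "I [^]\<^bsub>ideals_set R\<^esub> (0::nat) = carrier R"
    and pow_Suc: "I [^]\<^bsub>ideals_set R\<^esub> Suc j = ideal_prod R (I [^]\<^bsub>ideals_set R\<^esub> j) I" for j
    by (simp_all add: nat_pow_def ideals_set_def)
  {
    assume "\<exists>k :: nat. \<forall>a \<in> I [^]\<^bsub>ideals_set R\<^esub> k. a \<odot>\<^bsub>G\<^esub> v = \<zero>\<^bsub>G\<^esub>"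
    then obtain k :: nat where k: "\<And>a. a \<in> I [^]\<^bsub>ideals_set R\<^esub> k \<Longrightarrow> a \<odot>\<^bsub>G\<^esub> v = \<zero>\<^bsub>G\<^esub>" by blast
    have "x [^] j \<in> I [^]\<^bsub>ideals_set R\<^esub> j" if "x \<in> L" for x and j :: nat
    proof (induction j)
      case 0
      show ?case unfolding pow_0 by simp
    next
      case (Suc j)
      then show ?case using that LI unfolding pow_Suc by (auto intro: ideal_prod.prod)
    qed
    then show "\<forall>x \<in> L. \<exists>k :: nat. (x [^] k) \<odot>\<^bsub>G\<^esub> v = \<zero>\<^bsub>G\<^esub>" using k by blast
  }
  assume "\<forall>x \<in> L. \<exists>k :: nat. (x [^] k) \<odot>\<^bsub>G\<^esub> v = \<zero>\<^bsub>G\<^esub>"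
  then obtain k :: "'a \<Rightarrow> nat" where k: "\<And>x. x \<in> L \<Longrightarrow> (x [^] k x) \<odot>\<^bsub>G\<^esub> v = \<zero>\<^bsub>G\<^esub>" by metis
  define V where "V = rec_nat {\<zero>\<^bsub>G\<^esub>} (\<lambda>_ V. {w \<in> carrier G. \<forall>x \<in> L. x \<odot>\<^bsub>G\<^esub> w \<in> V})"
  have V0: "V 0 = {\<zero>\<^bsub>G\<^esub>}" and VSuc: "V (Suc j) = {w \<in> carrier G. \<forall>x \<in> L. x \<odot>\<^bsub>G\<^esub> w \<in> V j}" for j
    by (simp_all add: V_def)
  have Lc: "x \<in> carrier R" if "x \<in> L" for x using that LI Ic by blast
  have pow: "((\<lambda>w. x \<odot>\<^bsub>G\<^esub> w) ^^ n) v = (x [^] n) \<odot>\<^bsub>G\<^esub> v" if "x \<in> L" for x n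
    using v Lc[OF that] by (induction n) (auto simp: G.smult_assoc1[symmetric] m_comm)
  have vV: "v \<in> V (Suc (sum k L))"
  proof (rule iterated_colon_exponents[OF fin, where U = "carrier G" and op = "\<lambda>x w. x \<odot>\<^bsub>G\<^esub> w"])
    show "x \<odot>\<^bsub>G\<^esub> (y \<odot>\<^bsub>G\<^esub> w) = y \<odot>\<^bsub>G\<^esub> (x \<odot>\<^bsub>G\<^esub> w)" if "x \<in> L" "y \<in> L" "w \<in> carrier G" for x y w
      using that Lc by (simp add: G.smult_assoc1[symmetric] m_comm)
    show "((\<lambda>w. x \<odot>\<^bsub>G\<^esub> w) ^^ k x) v \<in> V 0" if "x \<in> L" for x using pow k that by (simp add: V0)
  qed (use Lc v V0 VSuc in auto)
  have V_sub: "V j \<subseteq> carrier G \<and> \<zero>\<^bsub>G\<^esub> \<in> V j \<and> (\<forall>v \<in> V j. \<forall>w \<in> V j. v \<oplus>\<^bsub>G\<^esub> w \<in> V j) \<and>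
      (\<forall>r \<in> carrier R. \<forall>v \<in> V j. r \<odot>\<^bsub>G\<^esub> v \<in> V j)" for j
  proof (induction j)
    case (Suc j)
    have "x \<odot>\<^bsub>G\<^esub> (r \<odot>\<^bsub>G\<^esub> w) = r \<odot>\<^bsub>G\<^esub> (x \<odot>\<^bsub>G\<^esub> w)" if "x \<in> L" "r \<in> carrier R" "w \<in> carrier G" for x r w
      using that Lc by (simp add: G.smult_assoc1[symmetric] m_comm)
    then show ?case using Suc Lc unfolding VSuc by (auto simp: G.smult_r_distr)
  qed (simp add: V0)
  have pow_c: "I [^]\<^bsub>ideals_set R\<^esub> j \<subseteq> carrier R" for j :: nat
  proof (induction j)
    case (Suc j)
    show ?case
    proof
      fix a assume "a \<in> I [^]\<^bsub>ideals_set R\<^esub> Suc j"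
      then show "a \<in> carrier R" unfolding pow_Suc
        by (induction rule: ideal_prod.induct) (use Suc Ic in auto)
    qed
  qed (simp only: pow_0 subset_refl)
  have "a \<odot>\<^bsub>G\<^esub> w = \<zero>\<^bsub>G\<^esub>" if "w \<in> V j" "a \<in> I [^]\<^bsub>ideals_set R\<^esub> j" for j w a
    using that
  proof (induction j arbitrary: w a)
    case 0
    then show ?case unfolding V0 pow_0 by simp
  next
    case (Suc j)
    have w: "w \<in> carrier G" "\<And>x. x \<in> L \<Longrightarrow> x \<odot>\<^bsub>G\<^esub> w \<in> V j" using Suc.prems(1) unfolding VSuc by auto
    have wI: "b \<odot>\<^bsub>G\<^esub> w \<in> V j" if "b \<in> I" for b
      using I V_sub[of j] w that unfolding ideal_generated_on_def by blast
    have "a \<odot>\<^bsub>G\<^esub> w = \<zero>\<^bsub>G\<^esub> \<and> a \<in> carrier R" using Suc.prems(2) unfolding pow_Suc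
    proof (induction rule: ideal_prod.induct)
      case (prod a b)
      then have "a \<in> carrier R" "b \<in> carrier R" using pow_c Ic by auto
      then show ?case using Suc.IH[OF wI[OF prod(2)] prod(1)] w(1) by (simp add: G.smult_assoc1)
    next
      case (sum a b)
      then show ?case using w(1) by (simp add: G.smult_l_distr)
    qed
    then show ?case ..
  qed
  then show "\<exists>k :: nat. \<forall>a \<in> I [^]\<^bsub>ideals_set R\<^esub> k. a \<odot>\<^bsub>G\<^esub> v = \<zero>\<^bsub>G\<^esub>" using vV by blast
qed

lemma (in standard_graded_generators) irrelevant_ideal_generated:
  assumes G: "module R G"
  shows "ideal_generated_on R G X (irrelevant_ideal R)"
  unfolding ideal_generated_on_def
proof (intro conjI allI impI ballI)
  interpret G: module R G by (rule G)
  have part: "f n \<in> carrier R" if "f n \<in> ring_part R n" for f :: "nat \<Rightarrow> 'a" and n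
    using that gr.part_carrier[of "f n" "int n"] by simp
  show "X \<subseteq> irrelevant_ideal R"
  proof
    fix x assume x: "x \<in> X"
    then have "x = finsum R (\<lambda>_. x) {1 :: nat}" using X_carrier by auto
    then show "x \<in> irrelevant_ideal R"
      using x X_part unfolding irrelevant_ideal_def by blast
  qed
  show "irrelevant_ideal R \<subseteq> carrier R"
    using part by (auto simp: irrelevant_ideal_def intro!: finsum_closed)
  fix V v a
  assume V: "V \<subseteq> carrier G \<and> \<zero>\<^bsub>G\<^esub> \<in> V \<and> (\<forall>v \<in> V. \<forall>w \<in> V. v \<oplus>\<^bsub>G\<^esub> w \<in> V) \<and> (\<forall>r \<in> carrier R. \<forall>v \<in> V. r \<odot>\<^bsub>G\<^esub> v \<in> V)"
    and v: "v \<in> carrier G" and xv: "\<forall>x \<in> X. x \<odot>\<^bsub>G\<^esub> v \<in> V" and a: "a \<in> irrelevant_ideal R"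
  \<comment> \<open>No membership in \<open>V\<close> is asked in degrees below 1, so that
    \<open>\<one>\<close> belongs to \<open>K 0\<close>. A step by an element of \<open>X\<close>
    lands in \<open>V\<close> by the hypothesis on \<open>v\<close>, and
    \<open>ring_generated_by_one\<close> then covers all positive degrees.\<close>
  define K where "K t = {r \<in> int_part R t. t \<ge> 1 \<longrightarrow> r \<odot>\<^bsub>G\<^esub> v \<in> V}" for t
  have Kc: "r \<in> K t \<Longrightarrow> r \<in> carrier R" for r t using gr.part_carrier by (auto simp: K_def)
  note ID = graded_familyD[OF family_int_part, simplified]
  have "graded_family (ring_part R 0) X (self_module R) K"
  proof (intro graded_familyI)
    fix t r assume "r \<in> K t" then show "r \<in> carrier (self_module R)" using Kc by simp
  next
    fix t show "\<zero>\<^bsub>self_module R\<^esub> \<in> K t" using gr.part_zero V v by (simp add: K_def)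
  next
    fix t r s assume rs: "r \<in> K t" "s \<in> K t"
    then show "r \<oplus>\<^bsub>self_module R\<^esub> s \<in> K t"
      using gr.part_add V v Kc[OF rs(1)] Kc[OF rs(2)] by (simp add: K_def G.smult_l_distr)
  next
    fix t s r assume s: "s \<in> ring_part R 0" and r: "r \<in> K t"
    then show "s \<odot>\<^bsub>self_module R\<^esub> r \<in> K t"
      using ID(4)[OF s] V v Kc[OF r] A_carrier[OF s] by (simp add: K_def G.smult_assoc1)
  next
    fix t s r assume s: "s \<in> X" and r: "r \<in> K t"
    have c: "s \<in> carrier R" "r \<in> carrier R" using s X_carrier Kc[OF r] by auto
    have "(s \<otimes> r) \<odot>\<^bsub>G\<^esub> v \<in> V" if "t \<ge> 0"
    proof -
      have "(s \<otimes> r) \<odot>\<^bsub>G\<^esub> v = r \<odot>\<^bsub>G\<^esub> (s \<odot>\<^bsub>G\<^esub> v)"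
        using c v by (simp add: G.smult_assoc1[symmetric] m_comm)
      then show ?thesis using V xv s c by simp
    qed
    then show "s \<odot>\<^bsub>self_module R\<^esub> r \<in> K (t + 1)" using r ID(5)[OF s] by (simp add: K_def)
  qed
  moreover have "\<one> \<in> K 0" using one_part by (simp add: K_def)
  ultimately have full: "int_part R t \<subseteq> K t" for t by (rule ring_generated_by_one)
  obtain f F where f: "a = finsum R f F" "finite F" "F \<subseteq> {1 :: nat..}" "\<forall>n \<in> F. f n \<in> ring_part R n"
    using a unfolding irrelevant_ideal_def by blast
  have "finsum R f F \<odot>\<^bsub>G\<^esub> v \<in> V"
    using f(2-4)
  proof (induction F rule: finite_induct)
    case empty
    then show ?case using V v by simp
  next
    case (insert n F)
    have fn: "f n \<in> ring_part R n" and n: "n \<ge> 1" using insert by auto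
    have "f n \<in> K (int n)" using full[of "int n"] fn by auto
    then have "f n \<odot>\<^bsub>G\<^esub> v \<in> V" using n by (simp add: K_def)
    moreover have "f \<in> F \<rightarrow> carrier R" "f n \<in> carrier R" using insert part by auto
    moreover from this have "finsum R f F \<in> carrier R" by simp
    ultimately show ?case using insert V v by (simp add: G.smult_l_distr)
  qed
  then show "a \<odot>\<^bsub>G\<^esub> v \<in> V" using f(1) by simp
qed

lemma (in standard_graded_generators) maximal_ideal_generated:
  assumes G: "module R G" and Y: "Y \<subseteq> \<nn>" "\<nn> \<subseteq> ring_part R 0"
    and gen: "\<And>J. ideal J (R\<lparr>carrier := ring_part R 0\<rparr>) \<Longrightarrow> Y \<subseteq> J \<Longrightarrow> \<nn> \<subseteq> J"
  shows "ideal_generated_on R G (X \<union> Y) (\<nn> <+>\<^bsub>R\<^esub> irrelevant_ideal R)"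
  unfolding ideal_generated_on_def
proof (intro conjI allI impI ballI)
  interpret G: module R G by (rule G)
  let ?N = "R\<lparr>carrier := ring_part R 0\<rparr>"
  interpret N: cring ?N by (rule degree_zero_cring)
  interpret nn: maximalideal \<nn> ?N
    using local by (simp add: noetherian_local_ring_def degree_zero_ring_def)
  note irr = irrelevant_ideal_generated[OF G, unfolded ideal_generated_on_def]
  have zero_nn: "\<zero> \<in> \<nn>" using additive_subgroup.zero_closed[OF nn.additive_subgroup_axioms] by simp
  have zero_irr: "\<zero> \<in> irrelevant_ideal R" unfolding irrelevant_ideal_def by (force intro: exI[of _ "{}"])
  have nnc: "u \<in> carrier R" if "u \<in> \<nn>" for u using that Y(2) A_carrier by blast
  have irrc: "u \<in> carrier R" if "u \<in> irrelevant_ideal R" for u using that irr by blast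
  have memI: "u \<oplus> b \<in> \<nn> <+>\<^bsub>R\<^esub> irrelevant_ideal R" if "u \<in> \<nn>" "b \<in> irrelevant_ideal R" for u b
    using that by (auto simp: set_add_def set_mult_def)
  show "X \<union> Y \<subseteq> \<nn> <+>\<^bsub>R\<^esub> irrelevant_ideal R"
  proof
    fix x assume "x \<in> X \<union> Y"
    then show "x \<in> \<nn> <+>\<^bsub>R\<^esub> irrelevant_ideal R"
    proof
      assume "x \<in> X"
      then have x: "x \<in> irrelevant_ideal R" using irr by blast
      then show ?thesis using memI[OF zero_nn x] irrc[OF x] by simp
    next
      assume "x \<in> Y"
      then have x: "x \<in> \<nn>" using Y by blast
      then show ?thesis using memI[OF x zero_irr] nnc[OF x] by simp
    qed
  qed
  show "\<nn> <+>\<^bsub>R\<^esub> irrelevant_ideal R \<subseteq> carrier R"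
    using nnc irrc by (auto simp: set_add_def set_mult_def)
  fix V v a
  assume V: "V \<subseteq> carrier G \<and> \<zero>\<^bsub>G\<^esub> \<in> V \<and> (\<forall>v \<in> V. \<forall>w \<in> V. v \<oplus>\<^bsub>G\<^esub> w \<in> V) \<and> (\<forall>r \<in> carrier R. \<forall>v \<in> V. r \<odot>\<^bsub>G\<^esub> v \<in> V)"
    and v: "v \<in> carrier G" and xv: "\<forall>x \<in> X \<union> Y. x \<odot>\<^bsub>G\<^esub> v \<in> V" and a: "a \<in> \<nn> <+>\<^bsub>R\<^esub> irrelevant_ideal R"
  obtain u b where u: "u \<in> \<nn>" and b: "b \<in> irrelevant_ideal R" and ab: "a = u \<oplus> b"
    using a by (auto simp: set_add_def set_mult_def)
  have bv: "b \<odot>\<^bsub>G\<^esub> v \<in> V" using irr V v xv b by blast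
  \<comment> \<open>This is an ideal of the degree-zero ring containing \<open>Y\<close>, so
    \<open>gen\<close> extends the hypothesis from \<open>Y\<close> to all of
    \<open>\<nn>\<close>.\<close>
  define J where "J = {u \<in> ring_part R 0. u \<odot>\<^bsub>G\<^esub> v \<in> V}"
  have Jc: "w \<in> J \<Longrightarrow> w \<in> carrier R" for w using A_carrier by (auto simp: J_def)
  have J_mult: "r \<otimes> w \<in> J" if "r \<in> ring_part R 0" "w \<in> J" for r w
    using that V v Jc[OF that(2)] A_carrier[OF that(1)] subringE(6)[OF A_subring that(1), of w]
    by (simp add: J_def G.smult_assoc1)
  have "ideal J ?N"
  proof (rule idealI)
    show "ring ?N" by (rule N.ring_axioms)
    show "subgroup J (add_monoid ?N)"
    proof (rule N.add.subgroupI)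
      show "J \<subseteq> carrier ?N" by (auto simp: J_def)
      show "J \<noteq> {}" using zero_A V v by (auto simp: J_def intro!: exI[of _ \<zero>])
    next
      fix w assume w: "w \<in> J"
      have "\<ominus>\<^bsub>?N\<^esub> w = \<ominus> \<one> \<otimes> w"
      proof (rule N.minus_equality)
        show "\<ominus> \<one> \<otimes> w \<oplus>\<^bsub>?N\<^esub> w = \<zero>\<^bsub>?N\<^esub>" using Jc[OF w] by (simp add: l_minus l_neg)
        show "\<ominus> \<one> \<otimes> w \<in> carrier ?N" using J_mult[OF minus_A[OF one_A] w] by (simp add: J_def)
      qed (use w in \<open>simp add: J_def\<close>)
      then show "\<ominus>\<^bsub>?N\<^esub> w \<in> J" using J_mult[OF minus_A[OF one_A] w] by simp
    next
      fix w w' assume w: "w \<in> J" "w' \<in> J"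
      then show "w \<oplus>\<^bsub>?N\<^esub> w' \<in> J"
        using V v Jc[OF w(1)] Jc[OF w(2)] subringE(7)[OF A_subring, of w w'] by (simp add: J_def G.smult_l_distr)
    qed
  next
    fix w r assume "w \<in> J" "r \<in> carrier ?N"
    then show "r \<otimes>\<^bsub>?N\<^esub> w \<in> J" "w \<otimes>\<^bsub>?N\<^esub> r \<in> J"
      using J_mult[of r w] Jc[of w] A_carrier[of r] by (simp_all add: m_comm)
  qed
  moreover have "Y \<subseteq> J" using Y xv by (auto simp: J_def)
  ultimately have "\<nn> \<subseteq> J" by (rule gen)
  then have "u \<odot>\<^bsub>G\<^esub> v \<in> V" using u by (auto simp: J_def)
  then show "a \<odot>\<^bsub>G\<^esub> v \<in> V"
    unfolding ab using bv V v nnc[OF u] irrc[OF b] by (simp add: G.smult_l_distr)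
qed

section \<open>Local cohomology as failure of exactness\<close>

lemma torsion_part_simps:
  "carrier (torsion_part R I M) =
     {x \<in> carrier M. \<exists>k :: nat. \<forall>a \<in> I [^]\<^bsub>ideals_set R\<^esub> k. a \<odot>\<^bsub>M\<^esub> x = \<zero>\<^bsub>M\<^esub>}"
  "zero (torsion_part R I M) = \<zero>\<^bsub>M\<^esub>" "add (torsion_part R I M) = add M"
  "mod_part (torsion_part R I M) t = carrier (torsion_part R I M) \<inter> mod_part M t"
  by (simp_all add: torsion_part_def Let_def)

text \<open>The union is the coset of \<open>z\<close> in unfolded form, the shape in which it
  arises from \<open>quotient_gmodule\<close>.\<close>

lemma (in abelian_group) a_r_coset_eq_self_iff:
  assumes N: "N \<subseteq> carrier G" "\<zero> \<in> N" "\<And>a b. a \<in> N \<Longrightarrow> b \<in> N \<Longrightarrow> a \<oplus> b \<in> N" "\<And>a. a \<in> N \<Longrightarrow> \<ominus> a \<in> N"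
    and z: "z \<in> carrier G"
  shows "(\<Union>h \<in> N. {h \<oplus> z}) = N \<longleftrightarrow> z \<in> N"
proof
  assume "(\<Union>h \<in> N. {h \<oplus> z}) = N"
  then have "\<zero> \<oplus> z \<in> N" using N(2) by blast
  then show "z \<in> N" using z by simp
next
  assume zN: "z \<in> N"
  show "(\<Union>h \<in> N. {h \<oplus> z}) = N"
  proof (rule subset_antisym; rule subsetI)
    fix h assume h: "h \<in> N"
    have "h = (h \<oplus> \<ominus> z) \<oplus> z" using h N(1) z by (simp add: a_assoc l_neg subset_iff)
    moreover have "h \<oplus> \<ominus> z \<in> N" using N(3,4) h zN by blast
    ultimately show "h \<in> (\<Union>h \<in> N. {h \<oplus> z})" by blast
  qed (use N(3) zN in auto)
qed

context graded_resolution
begin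

text \<open>The coset of a homogeneous cocycle vanishes when the cocycle is the image of a torsion
  element, which may be inhomogeneous. The component of degree \<open>t\<close> of that element is
  again a primitive, and it is again torsion because powers of a homogeneous \<open>x\<close> merely
  shift components. Hence vanishing amounts to exactness inside degree \<open>t\<close>.\<close>

lemma local_cohomology_part_iff:
  assumes L: "\<forall>x \<in> set L. \<exists>\<delta>. x \<in> int_part R (int \<delta>)"
    and I: "\<And>i. ideal_generated_on R (E i) (set L) I"
  shows "mod_part (local_cohomology R I E d i) t \<noteq> {\<zero>\<^bsub>local_cohomology R I E d i\<^esub>} \<longleftrightarrow>
     \<not> exact_at (torsion_parts L) t i"
proof -
  have Lc: "set L \<subseteq> carrier R" using L gr.part_carrier by blast
  interpret Ei: module R "E i" by (rule module_E)
  define T where "T j = {v \<in> carrier (E j). \<forall>x \<in> set L. \<exists>k :: nat. (x [^] k) \<odot>\<^bsub>E j\<^esub> v = \<zero>\<^bsub>E j\<^esub>}" for j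
  have carrier_T: "carrier (torsion_part R I (E j)) = T j" for j
    using ideal_power_torsion_iff[OF module_E finite_set I] by (auto simp: torsion_part_simps T_def)
  have part_T: "T j \<inter> mod_part (E j) t = torsion_parts L j t" for j t
    using graded_group.part_carrier[OF graded_group_E] by (auto simp: T_def torsion_parts_iff)
  \<comment> \<open>A constant family with the whole ring acting in degree 0 says that
    \<open>T j\<close> is an ordinary submodule, and the closure lemma for torsion can be
    reused.\<close>
  have T_fam: "graded_family (carrier R) {} (E j) (\<lambda>_. T j)" for j
  proof -
    interpret Ej: module R "E j" by (rule module_E)
    have "graded_family (carrier R) {} (E j) (torsion_list R (E j) L' (\<lambda>_. carrier (E j)))"
      if "set L' \<subseteq> carrier R" for L'
      using that
    proof (induction L')
      case Nil
      then show ?case by (intro graded_familyI) auto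
    next
      case (Cons x L')
      then show ?case using graded_family_torsion_subfamily[OF module_E, of "carrier R" "{}" j _ x] by simp
    qed
    moreover have "torsion_list R (E j) L (\<lambda>_. carrier (E j)) = (\<lambda>_. T j)"
      by (auto simp: fun_eq_iff set_eq_iff torsion_list_iff T_def)
    ultimately show ?thesis using Lc by metis
  qed
  note TD = graded_familyD[OF T_fam]
  define N where "N = coboundaries (\<lambda>j. torsion_part R I (E j)) d i"
  have N_cases: "N = (case i of 0 \<Rightarrow> {\<zero>\<^bsub>E 0\<^esub>} | Suc j \<Rightarrow> d j ` T j)"
    by (simp add: N_def coboundaries_def torsion_part_simps(2) carrier_T split: nat.split)
  have N: "N \<subseteq> carrier (E i)" "\<zero>\<^bsub>E i\<^esub> \<in> N" "\<And>a b. a \<in> N \<Longrightarrow> b \<in> N \<Longrightarrow> a \<oplus>\<^bsub>E i\<^esub> b \<in> N"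
    "\<And>r a. r \<in> carrier R \<Longrightarrow> a \<in> N \<Longrightarrow> r \<odot>\<^bsub>E i\<^esub> a \<in> N"
  proof -
    have "N \<subseteq> carrier (E i) \<and> \<zero>\<^bsub>E i\<^esub> \<in> N \<and> (\<forall>a \<in> N. \<forall>b \<in> N. a \<oplus>\<^bsub>E i\<^esub> b \<in> N) \<and>
        (\<forall>r \<in> carrier R. \<forall>a \<in> N. r \<odot>\<^bsub>E i\<^esub> a \<in> N)"
    proof (cases i)
      case 0
      then show ?thesis using E_zero_closed E_zero_add module.smult_r_null[OF module_E] by (simp add: N_cases)
    next
      case (Suc j)
      have eN: "N = d j ` T j" by (simp add: N_cases Suc)
      have Tc: "w \<in> carrier (E j)" if "w \<in> T j" for w using that by (simp add: T_def)
      show ?thesis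
        unfolding eN Suc
      proof (intro conjI ballI)
        show "d j ` T j \<subseteq> carrier (E (Suc j))" using d_closed Tc by blast
        show "\<zero>\<^bsub>E (Suc j)\<^esub> \<in> d j ` T j" using TD(2) d_zero[of j] by (metis imageI)
      next
        fix a b assume "a \<in> d j ` T j" "b \<in> d j ` T j"
        then obtain v w where "v \<in> T j" "w \<in> T j" "a = d j v" "b = d j w" by blast
        then have "a \<oplus>\<^bsub>E (Suc j)\<^esub> b = d j (v \<oplus>\<^bsub>E j\<^esub> w)" "v \<oplus>\<^bsub>E j\<^esub> w \<in> T j"
          using d_add Tc TD(3) by auto
        then show "a \<oplus>\<^bsub>E (Suc j)\<^esub> b \<in> d j ` T j" by blast
      next
        fix r a assume r: "r \<in> carrier R" and "a \<in> d j ` T j"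
        then obtain v where "v \<in> T j" "a = d j v" by blast
        then have "r \<odot>\<^bsub>E (Suc j)\<^esub> a = d j (r \<odot>\<^bsub>E j\<^esub> v)" "r \<odot>\<^bsub>E j\<^esub> v \<in> T j"
          using r d_smult Tc TD(4) by auto
        then show "r \<odot>\<^bsub>E (Suc j)\<^esub> a \<in> d j ` T j" by blast
      qed
    qed
    then show "N \<subseteq> carrier (E i)" "\<zero>\<^bsub>E i\<^esub> \<in> N" "\<And>a b. a \<in> N \<Longrightarrow> b \<in> N \<Longrightarrow> a \<oplus>\<^bsub>E i\<^esub> b \<in> N"
      "\<And>r a. r \<in> carrier R \<Longrightarrow> a \<in> N \<Longrightarrow> r \<odot>\<^bsub>E i\<^esub> a \<in> N" by blast+
  qed
  have N_inv: "\<ominus>\<^bsub>E i\<^esub> a \<in> N" if "a \<in> N" for a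
  proof -
    have "\<ominus>\<^bsub>E i\<^esub> a = (\<ominus> \<one>) \<odot>\<^bsub>E i\<^esub> a" using that N(1) by (auto simp: Ei.smult_l_minus)
    then show ?thesis using N(4)[OF _ that, of "\<ominus> \<one>"] by simp
  qed
  let ?Z = "{z \<in> torsion_parts L i t. d i z = \<zero>\<^bsub>E (Suc i)\<^esub>}"
  have cosets: "mod_part (local_cohomology R I E d i) t = (\<lambda>z. \<Union>h \<in> N. {h \<oplus>\<^bsub>E i\<^esub> z}) ` ?Z"
    and zero: "\<zero>\<^bsub>local_cohomology R I E d i\<^esub> = N"
  proof -
    have "{z \<in> T i. d i z = \<zero>\<^bsub>E (Suc i)\<^esub>} \<inter> (T i \<inter> mod_part (E i) t) = ?Z"
      using part_T[of i t] by blast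
    then show "mod_part (local_cohomology R I E d i) t = (\<lambda>z. \<Union>h \<in> N. {h \<oplus>\<^bsub>E i\<^esub> z}) ` ?Z"
      by (simp add: local_cohomology_def cohomology_def quotient_gmodule_def cocycles_def Let_def
          torsion_part_simps(2-4) carrier_T a_r_coset_def' N_def[symmetric])
    show "\<zero>\<^bsub>local_cohomology R I E d i\<^esub> = N"
      by (simp add: local_cohomology_def cohomology_def quotient_gmodule_def N_def)
  qed
  have "\<zero>\<^bsub>E i\<^esub> \<in> T i \<inter> mod_part (E i) t"
    using TD(2)[of i] graded_group.part_zero[OF graded_group_E] by (intro IntI)
  \<comment> \<open>The set of cocycles is nonempty; otherwise its image under the coset map could
    not be a singleton.\<close>
  then have zero_Z: "\<zero>\<^bsub>E i\<^esub> \<in> ?Z" using d_zero[of i] unfolding part_T by simp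
  have image_singleton: "f ` Z = {n} \<longleftrightarrow> (\<forall>z \<in> Z. f z = n)" if "z \<in> Z" for f :: "'c \<Rightarrow> 'c set" and Z n z
    using that by blast
  have "mod_part (local_cohomology R I E d i) t = {N} \<longleftrightarrow> (\<forall>z \<in> ?Z. (\<Union>h \<in> N. {h \<oplus>\<^bsub>E i\<^esub> z}) = N)"
    unfolding cosets by (rule image_singleton[OF zero_Z])
  also have "\<dots> \<longleftrightarrow> (\<forall>z \<in> ?Z. z \<in> N)"
  proof (rule ball_cong[OF refl])
    fix z assume "z \<in> ?Z"
    then have "z \<in> carrier (E i)" using torsion_parts_carrier[of L i t] by blast
    then show "(\<Union>h \<in> N. {h \<oplus>\<^bsub>E i\<^esub> z}) = N \<longleftrightarrow> z \<in> N"
      using Ei.M.a_r_coset_eq_self_iff[OF N(1,2,3) N_inv] by simp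
  qed
  also have "\<dots> \<longleftrightarrow> exact_at (torsion_parts L) t i"
  proof (cases i)
    case 0
    then show ?thesis by (auto simp: exact_at_def N_cases)
  next
    case (Suc j)
    have "z \<in> d j ` T j \<longleftrightarrow> (\<exists>w \<in> torsion_parts L j t. z = d j w)" if z: "z \<in> torsion_parts L i t" for z
    proof
      assume "z \<in> d j ` T j"
      then obtain w where w: "w \<in> T j" "z = d j w" by blast
      have wc: "w \<in> carrier (E j)" using w(1) by (simp add: T_def)
      let ?w = "component (E j) (mod_part (E j)) w t"
      have "d j w \<in> mod_part (E (Suc j)) t" using z w(2) Suc by (simp add: torsion_parts_iff)
      note w' = homogeneous_preimage_d[OF wc this]
      interpret Ej: module R "E j" by (rule module_E)
      have "\<exists>k :: nat. (x [^] k) \<odot>\<^bsub>E j\<^esub> ?w = \<zero>\<^bsub>E j\<^esub>" if x: "x \<in> set L" for x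
      proof -
        obtain \<delta> where \<delta>: "x \<in> int_part R (int \<delta>)" using L x by blast
        obtain k :: nat where k: "(x [^] k) \<odot>\<^bsub>E j\<^esub> w = \<zero>\<^bsub>E j\<^esub>" using w(1) x by (auto simp: T_def)
        have xk: "x [^] k \<in> int_part R (int k * int \<delta>)" by (rule pow_in_part[OF \<delta>])
        have xkc: "x [^] k \<in> carrier R" by (rule gr.part_carrier[OF xk])
        have "component (E j) (mod_part (E j)) ((x [^] k) \<odot>\<^bsub>E j\<^esub> w) (t + int k * int \<delta>) = (x [^] k) \<odot>\<^bsub>E j\<^esub> ?w"
        proof (rule component_hom[OF graded_group_E graded_group_E, where \<sigma> = "\<lambda>t. t + int k * int \<delta>"])
          show "(x [^] k) \<odot>\<^bsub>E j\<^esub> u \<in> mod_part (E j) (s + int k * int \<delta>)" if "u \<in> mod_part (E j) s" for u s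
            by (rule family_part_closed[OF module_E graded_family_mod_part[OF graded_E] xk that])
        qed (use xkc wc in \<open>auto simp: inj_on_def Ej.smult_r_distr\<close>)
        then show ?thesis unfolding k graded_group.component_zero[OF graded_group_E] by metis
      qed
      then have "?w \<in> torsion_parts L j t" using w' by (simp add: torsion_parts_iff)
      then show "\<exists>w \<in> torsion_parts L j t. z = d j w" using w' w(2) by metis
    qed (use part_T[of j t] in blast)
    then show ?thesis by (auto simp: exact_at_def N_cases Suc)
  qed
  finally show ?thesis unfolding zero by blast
qed

end

text \<open>Integers bounded above have a largest element, which belongs to one of the sets; if all
  sets are empty, both suprema are \<open>-\<infinity>\<close>.\<close>

lemma Sup_int_attained:
  fixes S :: "nat \<Rightarrow> int set" and t0 :: int
  assumes bound: "\<And>t i. t \<ge> t0 \<Longrightarrow> t \<notin> S i"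
  shows "\<exists>i. Sup {ereal (real_of_int t) | t. t \<in> S i} = Sup {ereal (real_of_int t) | t. t \<in> (\<Union>i. S i)}"
proof (cases "(\<Union>i. S i) = {}")
  case False
  then obtain t where t: "t \<in> (\<Union>i. S i)" by blast
  \<comment> \<open>Cutting off below a known member \<open>t\<close> makes the set finite and does
    not change its maximum.\<close>
  define m where "m = Max ((\<Union>i. S i) \<inter> {t..t0})"
  have fin: "finite ((\<Union>i. S i) \<inter> {t..t0})" by simp
  have le: "s \<le> t0" if "s \<in> (\<Union>i. S i)" for s using bound[of s] that by (cases "t0 \<le> s") auto
  have mem: "s \<in> (\<Union>i. S i) \<inter> {t..t0}" if "s \<in> (\<Union>i. S i)" "t \<le> s" for s
    using that le by (simp only: Int_iff atLeastAtMost_iff)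
  have "m \<in> (\<Union>i. S i) \<inter> {t..t0}" unfolding m_def using mem[OF t order_refl] by (intro Max_in fin) blast
  then obtain i where i: "m \<in> S i" by blast
  have max: "s \<le> m" if s: "s \<in> (\<Union>i. S i)" for s
  proof (cases "s \<ge> t")
    case True
    then show ?thesis unfolding m_def using mem[OF s] by (intro Max_ge fin)
  next
    case False
    moreover have "t \<le> m" unfolding m_def using mem[OF t order_refl] by (intro Max_ge fin)
    ultimately show ?thesis by simp
  qed
  have Sup: "Sup {ereal (real_of_int t) | t. t \<in> B} = ereal (real_of_int m)"
    if "m \<in> B" "B \<subseteq> (\<Union>i. S i)" for B
  proof (rule Sup_eqI)
    fix v assume "v \<in> {ereal (real_of_int t) | t. t \<in> B}"
    then obtain t where "v = ereal (real_of_int t)" "t \<in> B" by blast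
    then show "v \<le> ereal (real_of_int m)" using max[of t] that(2) by auto
  qed (use that(1) in blast)
  have "Sup {ereal (real_of_int t) | t. t \<in> S i} = ereal (real_of_int m)"
    using i by (intro Sup) auto
  moreover have "Sup {ereal (real_of_int t) | t. t \<in> (\<Union>i. S i)} = ereal (real_of_int m)"
    using i by (intro Sup) auto
  ultimately show ?thesis by metis
qed auto

text \<open>Only rays of degrees are compared, and single sets \<open>S i\<close> and
  \<open>S' i\<close> need not be related. The equivalence bounds every member of one union by a
  member of the other, so the two suprema agree. Attainment is proved alongside because
  \<open>GREATEST\<close> is meaningful only when a maximum exists.\<close>

lemma maximum_of_tops:
  fixes S S' :: "nat \<Rightarrow> int set"
  assumes iff: "\<And>t0. (\<forall>t \<ge> t0. \<forall>i. t \<notin> S i) \<longleftrightarrow> (\<forall>t \<ge> t0. \<forall>i. t \<notin> S' i)"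
    and bound: "\<exists>t0. \<forall>t \<ge> t0. \<forall>i. t \<notin> S' i"
    and a: "\<And>i. a i = Sup {ereal (real_of_int t) | t. t \<in> S i}"
    and a': "\<And>i. a' i = Sup {ereal (real_of_int t) | t. t \<in> S' i}"
  shows "(\<exists>i. \<forall>j. a j \<le> a i) \<and> (\<exists>i. \<forall>j. a' j \<le> a' i) \<and>
    (GREATEST v. v \<in> range a) = (GREATEST v. v \<in> range a')"
proof -
  let ?V = "Sup {ereal (real_of_int t) | t. t \<in> (\<Union>i. S i)}"
  let ?V' = "Sup {ereal (real_of_int t) | t. t \<in> (\<Union>i. S' i)}"
  obtain t0 where t0: "\<And>t i. t \<ge> t0 \<Longrightarrow> t \<notin> S' i" using bound by blast
  then have t0': "\<And>t i. t \<ge> t0 \<Longrightarrow> t \<notin> S i" using iff by blast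
  obtain i where i: "a i = ?V" using Sup_int_attained[of t0 S, OF t0'] a by metis
  obtain i' where i': "a' i' = ?V'" using Sup_int_attained[of t0 S', OF t0] a' by metis
  have le: "a j \<le> ?V" for j unfolding a by (rule Sup_subset_mono) blast
  have le': "a' j \<le> ?V'" for j unfolding a' by (rule Sup_subset_mono) blast
  have "?V \<le> ?V'"
  proof (rule Sup_mono)
    fix v assume "v \<in> {ereal (real_of_int t) | t. t \<in> (\<Union>i. S i)}"
    then obtain t where t: "v = ereal (real_of_int t)" "t \<in> (\<Union>i. S i)" by blast
    then obtain s where "s \<ge> t" "s \<in> (\<Union>i. S' i)" using iff[of t] by blast
    then show "\<exists>w \<in> {ereal (real_of_int t) | t. t \<in> (\<Union>i. S' i)}. v \<le> w"
      using t(1) by (intro bexI[of _ "ereal (real_of_int s)"]) auto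
  qed
  moreover have "?V' \<le> ?V"
  proof (rule Sup_mono)
    fix v assume "v \<in> {ereal (real_of_int t) | t. t \<in> (\<Union>i. S' i)}"
    then obtain t where t: "v = ereal (real_of_int t)" "t \<in> (\<Union>i. S' i)" by blast
    then obtain s where "s \<ge> t" "s \<in> (\<Union>i. S i)" using iff[of t] by blast
    then show "\<exists>w \<in> {ereal (real_of_int t) | t. t \<in> (\<Union>i. S i)}. v \<le> w"
      using t(1) by (intro bexI[of _ "ereal (real_of_int s)"]) auto
  qed
  ultimately have VV: "?V = ?V'" by (rule antisym)
  have "(GREATEST v. v \<in> range a) = ?V"
    using i le by (intro Greatest_equality) (auto simp: image_iff intro: exI[of _ i])
  moreover have "(GREATEST v. v \<in> range a') = ?V'"
    using i' le' by (intro Greatest_equality) (auto simp: image_iff intro: exI[of _ i'])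
  moreover have "\<forall>j. a j \<le> a i" using i le by simp
  moreover have "\<forall>j. a' j \<le> a' i'" using i' le' by simp
  ultimately show ?thesis using VV by metis
qed

text \<open>The first two conjuncts assert that both maxima are attained, which
  \<open>GREATEST\<close> presupposes; the value is \<open>-\<infinity>\<close> when all the modules
  vanish. Both families of local cohomology modules are computed from the same resolution.\<close>

theorem theorem4p6:
  fixes R :: "'a gring" and \<nn> \<mm> :: "'a set" and M :: "('a, 'b) gmodule"
    and E :: "nat \<Rightarrow> ('a, 'c) gmodule" and d :: "nat \<Rightarrow> 'c \<Rightarrow> 'c" and \<epsilon> :: "'b \<Rightarrow> 'c"
  assumes "fg_standard_graded R"
    and "noetherian_local_ring (degree_zero_ring R) \<nn>"
    and "\<mm> = \<nn> <+>\<^bsub>R\<^esub> irrelevant_ideal R"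
    and "graded_module R M" and "fg_module R M"
    and "graded_injective_resolution R M \<epsilon> E d"
  shows "(\<exists>i. \<forall>j. a_invariant (local_cohomology R \<mm> E d j) \<le> a_invariant (local_cohomology R \<mm> E d i)) \<and>
    (\<exists>i. \<forall>j. a_invariant (local_cohomology R (irrelevant_ideal R) E d j)
              \<le> a_invariant (local_cohomology R (irrelevant_ideal R) E d i)) \<and>
    (GREATEST v. v \<in> range (\<lambda>i. a_invariant (local_cohomology R \<mm> E d i))) = a_star R E d"
proof -
  interpret standard_graded R \<nn> using assms(1,2) by (rule standard_graded.intro)
  obtain X where X: "finite X" "X \<subseteq> ring_part R 1"
    "\<forall>N. N \<subseteq> ring_part R 1 \<and> X \<subseteq> N \<and> \<zero>\<^bsub>R\<^esub> \<in> N \<and> (\<forall>a \<in> N. \<forall>b \<in> N. a \<oplus>\<^bsub>R\<^esub> b \<in> N) \<and>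
        (\<forall>r \<in> ring_part R 0. \<forall>a \<in> N. r \<otimes>\<^bsub>R\<^esub> a \<in> N) \<longrightarrow> ring_part R 1 \<subseteq> N"
    using exists_degree_one_generators by blast
  interpret graded_resolution R \<nn> X M \<epsilon> E d
    by unfold_locales (use X assms(4-6) in simp_all)
  obtain xs where xs: "set xs = X" using finite_list[OF X(1)] by blast
  obtain Y where Y: "finite Y" "Y \<subseteq> \<nn>" "\<nn> \<subseteq> ring_part R 0"
    "\<And>J. ideal J (R\<lparr>carrier := ring_part R 0\<rparr>) \<Longrightarrow> Y \<subseteq> J \<Longrightarrow> \<nn> \<subseteq> J"
    using exists_maximal_ideal_generators by metis
  obtain ys where ys: "set ys = Y" using finite_list[OF Y(1)] by blast
  have xs_part: "\<forall>x \<in> set xs. \<exists>\<delta>. x \<in> int_part R (int \<delta>)"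
    using X(2) xs by (intro ballI exI[of _ 1]) auto
  moreover have "\<forall>y \<in> set ys. \<exists>\<delta>. y \<in> int_part R (int \<delta>)"
    using Y(2,3) ys by (intro ballI exI[of _ 0]) auto
  ultimately have xys_part: "\<forall>x \<in> set (xs @ ys). \<exists>\<delta>. x \<in> int_part R (int \<delta>)" by auto
  have irr: "ideal_generated_on R (E i) (set xs) (irrelevant_ideal R)" for i
    using irrelevant_ideal_generated[OF module_E] by (simp add: xs)
  have max: "ideal_generated_on R (E i) (set (xs @ ys)) \<mm>" for i
    using maximal_ideal_generated[OF module_E Y(2-4)] by (simp add: xs ys assms(3))
  have ysn: "set ys \<subseteq> \<nn>" using ys Y(2) by simp
  show ?thesis
    unfolding a_star_def
  \<comment> \<open>The sets of degrees are those in which exactness of the torsion parts fails: for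
    \<open>xs @ ys\<close>, which generates \<open>\<mm>\<close>, and for \<open>xs\<close>, which
    generates the irrelevant ideal.\<close>
  proof (rule maximum_of_tops)
    show "(\<forall>t \<ge> t0. \<forall>i. t \<notin> {t. \<not> exact_at (torsion_parts (xs @ ys)) t i}) \<longleftrightarrow>
        (\<forall>t \<ge> t0. \<forall>i. t \<notin> {t. \<not> exact_at (torsion_parts xs) t i})" for t0
      using exact_in_high_degrees_iff[OF xs ysn Y(3)] by simp
    show "\<exists>t0. \<forall>t \<ge> t0. \<forall>i. t \<notin> {t. \<not> exact_at (torsion_parts xs) t i}"
      using exact_in_high_degrees[OF xs ysn Y(3)] by simp
    show "a_invariant (local_cohomology R \<mm> E d i) =
        Sup {ereal (real_of_int t) | t. t \<in> {t. \<not> exact_at (torsion_parts (xs @ ys)) t i}}" for i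
      unfolding a_invariant_def local_cohomology_part_iff[OF xys_part max] by simp
    show "a_invariant (local_cohomology R (irrelevant_ideal R) E d i) =
        Sup {ereal (real_of_int t) | t. t \<in> {t. \<not> exact_at (torsion_parts xs) t i}}" for i
      unfolding a_invariant_def local_cohomology_part_iff[OF xs_part irr] by simp
  qed
qed

end
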